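(* Let $T>0$, let $\Omega\subset\mathbb R^n$ be open, let $\omega\subset\Omega$ be open and non-empty, and let $0<T_1<T_2<T$. Suppose that $B\subset\Omega$ is open and connected, that $\omega\subset B$, and that the closure $\overline B$ is compact and contained in $\Omega$. Write $L=\partial_t-\Delta$. Then there are $C>0$ and $\kappa\in(0,1)$ such that for all $u$ in the space $$H^1(0,T;H^{-1}(\Omega))\cap L^2(0,T;H^1(\Omega))$$ it holds that $$\|u\|_{L^2(T_1,T_2;H^1(B))}\le C\left(\|u\|_{L^2((0,T)\times\omega)}+\|Lu\|_{L^2(0,T;H^{-1}(\Omega))}\right)^{\kappa}\left(\|u\|_{L^2((0,T)\times\Omega)}+\|Lu\|_{L^2(0,T;H^{-1}(\Omega))}\right)^{1-\kappa}.$$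
   Context: $H^{-1}(\Omega)$ denotes the dual of $H^1_0(\Omega)$. The Laplacian $\Delta$ acts in the spatial variable $x\in\Omega$ only, and $L u=\partial_t u-\Delta u$ is understood in the weak (distributional) sense; for $u$ in the stated space, $Lu\in L^2(0,T;H^{-1}(\Omega))$. *)

theory Defs
  imports "HOL-Analysis.Analysis"
begin

section \<open>Test functions\<close>

definition partial_deriv :: "'a::euclidean_space \<Rightarrow> ('a \<Rightarrow> real) \<Rightarrow> 'a \<Rightarrow> real" where
  "partial_deriv i f x = frechet_derivative f (at x) i"

text \<open>A function all of whose iterated partial derivatives are (totally) differentiable has
  continuous partial derivatives of every order, and conversely.\<close>

definition smooth :: "('a::euclidean_space \<Rightarrow> real) \<Rightarrow> bool" where
  "smooth f \<longleftrightarrow>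
     (\<forall>js. set js \<subseteq> Basis \<longrightarrow> (\<forall>x. foldr partial_deriv js f differentiable (at x)))"

definition test_functions :: "'a::euclidean_space set \<Rightarrow> ('a \<Rightarrow> real) set" where
  "test_functions S =
     {\<phi>. smooth \<phi> \<and> compact (closure {x. \<phi> x \<noteq> 0}) \<and> closure {x. \<phi> x \<noteq> 0} \<subseteq> S}"

section \<open>The spaces \<open>L\<^sup>2\<close>, \<open>H\<^sup>1\<close>, \<open>H\<^sup>1\<^sub>0\<close> and \<open>H\<^sup>-\<^sup>1\<close> of an open set\<close>

text \<open>Elements are represented by functions on the whole type, of which only the values on the
  open set matter. The spaces are not quotiented by equality almost everywhere, so that the
  norms below are seminorms.\<close>

definition L2 :: "'a::euclidean_space set \<Rightarrow> ('a \<Rightarrow> 'b::euclidean_space) set" where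
  "L2 S = {f. f \<in> borel_measurable (lebesgue_on S) \<and>
              integrable (lebesgue_on S) (\<lambda>x. (norm (f x))\<^sup>2)}"

definition L2_norm :: "'a::euclidean_space set \<Rightarrow> ('a \<Rightarrow> 'b::euclidean_space) \<Rightarrow> real" where
  "L2_norm S f = sqrt (\<integral>x. (norm (f x))\<^sup>2 \<partial>lebesgue_on S)"

definition is_weak_grad ::
    "'a::euclidean_space set \<Rightarrow> ('a \<Rightarrow> real) \<Rightarrow> ('a \<Rightarrow> 'a) \<Rightarrow> bool" where
  "is_weak_grad S f g \<longleftrightarrow>
     (\<forall>\<phi>\<in>test_functions S. \<forall>i\<in>Basis.
        (\<integral>x. f x * partial_deriv i \<phi> x \<partial>lebesgue_on S) =
        - (\<integral>x. (g x \<bullet> i) * \<phi> x \<partial>lebesgue_on S))"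

definition H1 :: "'a::euclidean_space set \<Rightarrow> ('a \<Rightarrow> real) set" where
  "H1 S = {f \<in> L2 S. \<exists>g\<in>L2 S. is_weak_grad S f g}"

text \<open>The weak gradient of an element of \<open>H1 S\<close> is unique up to a null subset of \<open>S\<close>; the choice
  of a representative does not affect any of the integrals in which it is used.\<close>

definition weak_grad :: "'a::euclidean_space set \<Rightarrow> ('a \<Rightarrow> real) \<Rightarrow> 'a \<Rightarrow> 'a" where
  "weak_grad S f = (SOME g. g \<in> L2 S \<and> is_weak_grad S f g)"

definition H1_norm :: "'a::euclidean_space set \<Rightarrow> ('a \<Rightarrow> real) \<Rightarrow> real" where
  "H1_norm S f = sqrt ((L2_norm S f)\<^sup>2 + (L2_norm S (weak_grad S f))\<^sup>2)"

definition H10 :: "'a::euclidean_space set \<Rightarrow> ('a \<Rightarrow> real) set" where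
  "H10 S = {f \<in> H1 S. \<exists>\<phi>. (\<forall>k. \<phi> k \<in> test_functions S) \<and>
                          (\<lambda>k::nat. H1_norm S (\<lambda>x. \<phi> k x - f x)) \<longlonglongrightarrow> 0}"

text \<open>Only the values of a functional on \<open>H10 S\<close> matter. Linearity and boundedness imply that
  these values depend only on the class of the argument modulo equality almost everywhere.\<close>

definition Hm1 :: "'a::euclidean_space set \<Rightarrow> (('a \<Rightarrow> real) \<Rightarrow> real) set" where
  "Hm1 S = {F. (\<forall>f\<in>H10 S. \<forall>g\<in>H10 S. F (\<lambda>x. f x + g x) = F f + F g) \<and>
               (\<forall>c. \<forall>f\<in>H10 S. F (\<lambda>x. c * f x) = c * F f) \<and>
               (\<exists>K. \<forall>f\<in>H10 S. \<bar>F f\<bar> \<le> K * H1_norm S f)}"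

definition Hm1_norm :: "'a::euclidean_space set \<Rightarrow> (('a \<Rightarrow> real) \<Rightarrow> real) \<Rightarrow> real" where
  "Hm1_norm S F = (SUP f\<in>{f \<in> H10 S. H1_norm S f \<le> 1}. \<bar>F f\<bar>)"

text \<open>The embedding of \<open>L\<^sup>2\<close> into \<open>H\<^sup>-\<^sup>1\<close>, and the Laplacian from \<open>H\<^sup>1\<close> to \<open>H\<^sup>-\<^sup>1\<close>.\<close>

definition to_Hm1 :: "'a::euclidean_space set \<Rightarrow> ('a \<Rightarrow> real) \<Rightarrow> ('a \<Rightarrow> real) \<Rightarrow> real" where
  "to_Hm1 S w v = (\<integral>x. w x * v x \<partial>lebesgue_on S)"

definition weak_laplacian ::
    "'a::euclidean_space set \<Rightarrow> ('a \<Rightarrow> real) \<Rightarrow> ('a \<Rightarrow> real) \<Rightarrow> real" where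
  "weak_laplacian S w v = - (\<integral>x. weak_grad S w x \<bullet> weak_grad S v x \<partial>lebesgue_on S)"

section \<open>Spaces of vector-valued functions of time\<close>

text \<open>Here \<open>V\<close> is a space of real-valued functions with seminorm \<open>N\<close>, and \<open>J\<close> is a time interval.
  Measurability is strong measurability: almost everywhere approximation in the norm of \<open>V\<close> by
  simple \<open>V\<close>-valued functions.\<close>

definition strongly_measurable ::
    "real set \<Rightarrow> ('b \<Rightarrow> real) set \<Rightarrow> (('b \<Rightarrow> real) \<Rightarrow> real) \<Rightarrow> (real \<Rightarrow> 'b \<Rightarrow> real) \<Rightarrow> bool" where
  "strongly_measurable J V N u \<longleftrightarrow>
     (\<exists>s. (\<forall>k::nat. simple_function (lebesgue_on J) (s k) \<and> s k ` J \<subseteq> V) \<and>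
          (AE t in lebesgue_on J. (\<lambda>k. N (\<lambda>x. s k t x - u t x)) \<longlonglongrightarrow> 0))"

definition time_L2 ::
    "real set \<Rightarrow> ('b \<Rightarrow> real) set \<Rightarrow> (('b \<Rightarrow> real) \<Rightarrow> real) \<Rightarrow> (real \<Rightarrow> 'b \<Rightarrow> real) set" where
  "time_L2 J V N = {u. (AE t in lebesgue_on J. u t \<in> V) \<and> strongly_measurable J V N u \<and>
                       integrable (lebesgue_on J) (\<lambda>t. (N (u t))\<^sup>2)}"

text \<open>With \<open>N = L2_norm S\<close> this is the norm of \<open>L\<^sup>2(J \<times> S)\<close>, under the isometric identification
  of that space with \<open>L\<^sup>2(J; L\<^sup>2(S))\<close>.\<close>

definition time_L2_norm ::
    "real set \<Rightarrow> (('b \<Rightarrow> real) \<Rightarrow> real) \<Rightarrow> (real \<Rightarrow> 'b \<Rightarrow> real) \<Rightarrow> real" where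
  "time_L2_norm J N u = sqrt (\<integral>t. (N (u t))\<^sup>2 \<partial>lebesgue_on J)"

text \<open>The identity defining the weak derivative of an \<open>H\<^sup>-\<^sup>1\<close>-valued function is an identity between
  two \<open>H\<^sup>-\<^sup>1\<close>-valued integrals; it is stated by evaluating both at every element of \<open>H\<^sup>1\<^sub>0\<close>.\<close>

definition is_time_deriv ::
    "real set \<Rightarrow> 'a::euclidean_space set \<Rightarrow>
     (real \<Rightarrow> ('a \<Rightarrow> real) \<Rightarrow> real) \<Rightarrow> (real \<Rightarrow> ('a \<Rightarrow> real) \<Rightarrow> real) \<Rightarrow> bool" where
  "is_time_deriv J S U G \<longleftrightarrow>
     (\<forall>\<phi>\<in>test_functions J. \<forall>v\<in>H10 S.
        (\<integral>t. U t v * deriv \<phi> t \<partial>lebesgue_on J) = - (\<integral>t. G t v * \<phi> t \<partial>lebesgue_on J))"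

definition time_deriv ::
    "real set \<Rightarrow> 'a::euclidean_space set \<Rightarrow>
     (real \<Rightarrow> ('a \<Rightarrow> real) \<Rightarrow> real) \<Rightarrow> real \<Rightarrow> ('a \<Rightarrow> real) \<Rightarrow> real" where
  "time_deriv J S U = (SOME G. G \<in> time_L2 J (Hm1 S) (Hm1_norm S) \<and> is_time_deriv J S U G)"

text \<open>The functions \<open>u\<close> of time and space that belong to \<open>H\<^sup>1(J; H\<^sup>-\<^sup>1(S))\<close> through the embedding
  \<open>to_Hm1\<close>.\<close>

definition time_H1_Hm1 ::
    "real set \<Rightarrow> 'a::euclidean_space set \<Rightarrow> (real \<Rightarrow> 'a \<Rightarrow> real) set" where
  "time_H1_Hm1 J S =
     {u. (\<lambda>t. to_Hm1 S (u t)) \<in> time_L2 J (Hm1 S) (Hm1_norm S) \<and>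
         (\<exists>G\<in>time_L2 J (Hm1 S) (Hm1_norm S). is_time_deriv J S (\<lambda>t. to_Hm1 S (u t)) G)}"

definition heat_op ::
    "real set \<Rightarrow> 'a::euclidean_space set \<Rightarrow> (real \<Rightarrow> 'a \<Rightarrow> real) \<Rightarrow> real \<Rightarrow> ('a \<Rightarrow> real) \<Rightarrow> real" where
  "heat_op J S u t v = time_deriv J S (\<lambda>t. to_Hm1 S (u t)) t v - weak_laplacian S (u t) v"

end

theory Submission
 imports Defs "HOL-Complex_Analysis.Complex_Analysis" "HOL-Probability.Distributions"
begin

text \<open>The Bochner space statement is reduced, by jointly measurable representatives and
 mollification in time, to square integrable functions on space-time whose pairing with the backward
 heat operator is bounded by the parabolic norm of the test function. There \<open>u\<close> splits into a caloric
 part \<open>v\<close> and a remainder: testing against a cutoff times the backward heat potential of \<open>f\<close> expresses the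
 pairing of \<open>u\<close> with \<open>f\<close> by \<open>Lu\<close>, controlled by the energy estimate for heat potentials, and by
 \<open>v\<close>, the convolution of \<open>u\<close> with the heat kernel away from its singularity. Hence \<open>v\<close> extends
 holomorphically along every spatial line with uniform bounds, and a two constants estimate along a
 chain of balls carries smallness from \<open>\<omega>\<close> to \<open>B\<close> at each time. The exponent survives integration in time
 by Jensen's inequality, and the gradient is reached by duality from Lipschitz bounds for \<open>v\<close>.\<close>

text \<open>The obstacle is that \<open>u\<close> has no pointwise meaning and \<open>Lu\<close> is
  only a functional, so every equation is tested with \<open>\<eta>\<close> times a backward
  potential of a test function, which is smooth and compactly supported and hence admissible.
  \<open>heat_dual\<close> of this product is \<open>- f\<close> plus terms that carry derivatives
  of \<open>\<eta>\<close>. Since \<open>\<eta>\<close> is 1 up to a distance \<open>d\<close> from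
  the closed cylinder over \<open>[T1, T2]\<close> and \<open>closure B\<close>, a point of that
  cylinder meets these terms only at distance \<open>d\<close> or so, where the heat kernel is
  smooth; here the strict inclusions of the time interval and of \<open>closure B\<close> are spent.
  For the gradient of \<open>u\<close> the source is a derivative of a test function
  \<open>h\<close>, and the energy must be bounded by the norm of \<open>h\<close> itself; hence
  sources in divergence form in the energy estimate. The exponent is the product of three effects:
  the passage from an L2 norm to a supremum on a small ball, one halving for each ball of the chain,
  and a last halving that also yields the Lipschitz bound. The step from ball to ball is a statement
  in one complex variable on each line through the centre.\<close>

abbreviation "pd \<equiv> partial_deriv"

notation test_functions ("\<D>")

lemmas integrable_bound = Bochner_Integration.integrable_bound
 and integral_nonneg = Bochner_Integration.integral_nonneg
 and integrable_sum = Bochner_Integration.integrable_sum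
 and integrable_add = Bochner_Integration.integrable_add
 and integral_sum = Bochner_Integration.integral_sum
 and integral_cong = Bochner_Integration.integral_cong
 and integral_add = Bochner_Integration.integral_add
 and integral_diff = Bochner_Integration.integral_diff
 and integrable_diff = Bochner_Integration.integrable_diff

section \<open>Smooth functions\<close>

lemma partial_deriv_eqI:
 assumes "(f has_derivative f') (at x)"
 shows "pd i f x = f' i"
 using assms frechet_derivative_at partial_deriv_def by metis

lemma sum_Basis_inner_left:
 assumes "i \<in> Basis"
 shows "(\<Sum>j\<in>Basis. (i \<bullet> j) * g j) = g i"
proof -
 have "(\<Sum>j\<in>Basis. (i \<bullet> j) * g j) = (\<Sum>j\<in>Basis. if j = i then g i else 0)"
  using assms by (intro sum.cong) (auto simp: inner_not_same_Basis)
 thus ?thesis using assms by simp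
qed

lemma smooth_differentiable: "smooth f \<Longrightarrow> f differentiable (at x)"
 unfolding smooth_def by (drule spec[of _ "[]"]) simp

lemma smooth_partial_deriv:
 assumes "smooth f" "i \<in> Basis"
 shows "smooth (pd i f)"
 unfolding smooth_def
proof (intro allI impI)
 fix js x assume "set js \<subseteq> (Basis :: 'a set)"
 hence "set (js @ [i]) \<subseteq> Basis" using assms by auto
 hence "foldr pd (js @ [i]) f differentiable (at x)"
  using assms(1) unfolding smooth_def by blast
 thus "foldr pd js (pd i f) differentiable (at x)" by simp
qed

text \<open>Since \<open>smooth\<close> speaks of all iterated derivatives, it suffices to exhibit
  an invariant: a set of differentiable functions closed under \<open>pd\<close>. Later smoothness
  proofs consist in choosing this set.\<close>

lemma smooth_coinduct:
 assumes "f \<in> S"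
  and "\<And>f x. f \<in> S \<Longrightarrow> f differentiable (at x)"
  and "\<And>f i. f \<in> S \<Longrightarrow> i \<in> Basis \<Longrightarrow> pd i f \<in> S"
 shows "smooth f"
proof -
 have "foldr pd js f \<in> S" if "set js \<subseteq> Basis" for js
  using that by (induction js) (use assms in auto)
 thus ?thesis unfolding smooth_def using assms(2) by blast
qed

lemma smooth_has_derivative:
 assumes "smooth f"
 shows "(f has_derivative (\<lambda>h. \<Sum>i\<in>Basis. (h \<bullet> i) * pd i f x)) (at x)"
proof -
 obtain f' where f': "(f has_derivative f') (at x)"
  using smooth_differentiable[OF assms] unfolding differentiable_def by blast
 interpret linear f' using f' has_derivative_linear by blast
 have "f' h = (\<Sum>i\<in>Basis. (h \<bullet> i) * pd i f x)" for h
 proof -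
  have "f' h = f' (\<Sum>i\<in>Basis. (h \<bullet> i) *\<^sub>R i)" by (simp add: euclidean_representation)
  also have "\<dots> = (\<Sum>i\<in>Basis. (h \<bullet> i) * f' i)" by (simp add: sum scale)
  finally show ?thesis using partial_deriv_eqI[OF f'] by simp
 qed
 hence "f' = (\<lambda>h. \<Sum>i\<in>Basis. (h \<bullet> i) * pd i f x)" by (rule ext)
 thus ?thesis using f' by metis
qed

lemma smooth_continuous: "smooth f \<Longrightarrow> continuous_on S f"
 using smooth_differentiable differentiable_imp_continuous_within
 by (metis continuous_at_imp_continuous_on)

lemma smooth_borel: "smooth f \<Longrightarrow> f \<in> borel_measurable borel"
 by (intro borel_measurable_continuous_onI smooth_continuous)

lemma has_partial_deriv:
 assumes "smooth f" "i \<in> Basis"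
 shows "((\<lambda>s. f (x + s *\<^sub>R i)) has_real_derivative pd i f (x + s *\<^sub>R i)) (at s)"
proof -
 have "((\<lambda>s. f (x + s *\<^sub>R i)) has_derivative
   (\<lambda>h. \<Sum>j\<in>Basis. ((h *\<^sub>R i) \<bullet> j) * pd j f (x + s *\<^sub>R i))) (at s)"
  by (rule has_derivative_compose[of "\<lambda>s. x + s *\<^sub>R i" "\<lambda>h. h *\<^sub>R i", OF _ smooth_has_derivative[OF assms(1)]])
    (auto intro!: derivative_eq_intros)
 moreover have "(\<Sum>j\<in>Basis. ((h *\<^sub>R i) \<bullet> j) * pd j f (x + s *\<^sub>R i))
   = pd i f (x + s *\<^sub>R i) * h" for h
 proof -
  have "(\<Sum>j\<in>Basis. ((h *\<^sub>R i) \<bullet> j) * pd j f (x + s *\<^sub>R i))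
    = (\<Sum>j\<in>Basis. if j = i then h * pd i f (x + s *\<^sub>R i) else 0)"
   by (rule sum.cong) (use assms(2) in \<open>auto simp: inner_not_same_Basis\<close>)
  thus ?thesis using assms(2) by simp
 qed
 ultimately have "((\<lambda>s. f (x + s *\<^sub>R i)) has_derivative
   (\<lambda>h. pd i f (x + s *\<^sub>R i) * h)) (at s)"
  by (simp only:)
 thus ?thesis unfolding has_field_derivative_def .
qed

text \<open>A set of differentiable functions generates an algebra of smooth functions as soon as the
 partial derivatives of the generators lie in that algebra.\<close>

inductive_set algebra_of :: "('a \<Rightarrow> real) set \<Rightarrow> ('a \<Rightarrow> real) set" for S where
 algebra_base: "f \<in> S \<Longrightarrow> f \<in> algebra_of S"
| algebra_add: "f \<in> algebra_of S \<Longrightarrow> g \<in> algebra_of S \<Longrightarrow> (\<lambda>x. f x + g x) \<in> algebra_of S"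
| algebra_mult: "f \<in> algebra_of S \<Longrightarrow> g \<in> algebra_of S \<Longrightarrow> (\<lambda>x. f x * g x) \<in> algebra_of S"

lemma partial_deriv_add:
 assumes "\<And>x. f differentiable (at x)" "\<And>x. g differentiable (at x)"
 shows "pd i (\<lambda>x. f x + g x) = (\<lambda>x. pd i f x + pd i g x)"
proof
 fix x
 show "pd i (\<lambda>x. f x + g x) x = pd i f x + pd i g x"
  using partial_deriv_eqI[OF has_derivative_add[OF assms[THEN iffD1[OF frechet_derivative_works]]]]
  unfolding partial_deriv_def by simp
qed

lemma partial_deriv_mult:
 assumes "\<And>x. f differentiable (at x)" "\<And>x. g differentiable (at x)"
 shows "pd i (\<lambda>x. f x * g x) =
  (\<lambda>x. pd i f x * g x + f x * pd i g x)"
proof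
 fix x
 show "pd i (\<lambda>x. f x * g x) x = pd i f x * g x + f x * pd i g x"
  using partial_deriv_eqI[OF has_derivative_mult[OF assms[THEN iffD1[OF frechet_derivative_works]]]]
  unfolding partial_deriv_def by (simp add: add.commute)
qed

lemma smooth_algebra:
 assumes "f \<in> algebra_of S"
  and d: "\<And>f x. f \<in> S \<Longrightarrow> f differentiable (at x)"
  and p: "\<And>f i. f \<in> S \<Longrightarrow> i \<in> Basis \<Longrightarrow> pd i f \<in> algebra_of S"
 shows "smooth f"
proof (rule smooth_coinduct[OF assms(1)])
 show d': "f differentiable (at x)" if "f \<in> algebra_of S" for f x
  using that by (induction rule: algebra_of.induct) (use d in auto)
 show "pd i f \<in> algebra_of S" if "f \<in> algebra_of S" "i \<in> Basis" for f i
  using that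
 proof (induction rule: algebra_of.induct)
  case (algebra_add f g)
  thus ?case
   by (subst partial_deriv_add) (use d' in \<open>auto intro: algebra_of.intros\<close>)
 next
  case (algebra_mult f g)
  thus ?case
   by (subst partial_deriv_mult) (use d' in \<open>auto intro: algebra_of.intros\<close>)
 qed (use p in auto)
qed

text \<open>The generators are taken to be all smooth functions; their derivatives are generators
  again, so the algebra argument needs no computation.\<close>

lemma smooth_add: "smooth f \<Longrightarrow> smooth g \<Longrightarrow> smooth (\<lambda>x. f x + g x)"
 by (rule smooth_algebra[of _ "{f. smooth f}"])
   (auto intro!: algebra_add intro: algebra_base smooth_differentiable smooth_partial_deriv)

lemma smooth_mult: "smooth f \<Longrightarrow> smooth g \<Longrightarrow> smooth (\<lambda>x. f x * g x)"
 by (rule smooth_algebra[of _ "{f. smooth f}"])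
   (auto intro!: algebra_mult intro: algebra_base smooth_differentiable smooth_partial_deriv)

lemma partial_deriv_const: "pd i (\<lambda>x. c) = (\<lambda>x. 0)"
 unfolding partial_deriv_def by simp

lemma smooth_const: "smooth (\<lambda>x. c)"
 by (rule smooth_coinduct[of _ "range (\<lambda>c x. c)"]) (auto simp: partial_deriv_const)

lemma partial_deriv_add_smooth:
 "smooth f \<Longrightarrow> smooth g \<Longrightarrow>
  pd i (\<lambda>x. f x + g x) = (\<lambda>x. pd i f x + pd i g x)"
 by (rule partial_deriv_add) (auto simp: smooth_differentiable)

lemma partial_deriv_mult_smooth:
 "smooth f \<Longrightarrow> smooth g \<Longrightarrow>
  pd i (\<lambda>x. f x * g x) = (\<lambda>x. pd i f x * g x + f x * pd i g x)"
 by (rule partial_deriv_mult) (auto simp: smooth_differentiable)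

lemma has_derivative_affine_comp:
 assumes "smooth f"
 shows "((\<lambda>x. f (a + c *\<^sub>R x)) has_derivative
  (\<lambda>h. \<Sum>i\<in>Basis. ((c *\<^sub>R h) \<bullet> i) * pd i f (a + c *\<^sub>R x))) (at x)"
 by (rule has_derivative_compose[of "\<lambda>x. a + c *\<^sub>R x" "\<lambda>h. c *\<^sub>R h", OF _ smooth_has_derivative[OF assms]])
   (auto intro!: derivative_eq_intros)

lemma partial_deriv_affine:
 assumes "smooth f" "i \<in> Basis"
 shows "pd i (\<lambda>x. f (a + c *\<^sub>R x)) = (\<lambda>x. c * pd i f (a + c *\<^sub>R x))"
proof
 fix x
 have "pd i (\<lambda>x. f (a + c *\<^sub>R x)) x
   = (\<Sum>j\<in>Basis. ((c *\<^sub>R i) \<bullet> j) * pd j f (a + c *\<^sub>R x))"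
  by (rule partial_deriv_eqI[OF has_derivative_affine_comp[OF assms(1)]])
 also have "\<dots> = (\<Sum>j\<in>Basis. if j = i then c * pd i f (a + c *\<^sub>R x) else 0)"
  by (rule sum.cong) (use assms(2) in \<open>auto simp: inner_not_same_Basis\<close>)
 finally show "pd i (\<lambda>x. f (a + c *\<^sub>R x)) x = c * pd i f (a + c *\<^sub>R x)"
  using assms(2) by simp
qed

lemma smooth_affine:
 assumes "smooth f"
 shows "smooth (\<lambda>x. f (a + c *\<^sub>R x))"
\<comment> \<open>The factor \<open>d\<close> makes the set closed under \<open>pd\<close>: each
  derivative of the composition brings out a factor \<open>c\<close>.\<close>
proof (rule smooth_coinduct[of _ "{\<lambda>x. d * f (a + c *\<^sub>R x) | d f. smooth f}"])
 show "(\<lambda>x. f (a + c *\<^sub>R x)) \<in> {\<lambda>x. d * f (a + c *\<^sub>R x) | d f. smooth f}"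
  using assms by (auto intro!: exI[of _ 1] exI[of _ f])
next
 fix g x assume "g \<in> {\<lambda>x. d * f (a + c *\<^sub>R x) | d f. smooth f}"
 then obtain d f where g: "g = (\<lambda>x. d * f (a + c *\<^sub>R x))" "smooth f" by blast
 have "(\<lambda>x. f (a + c *\<^sub>R x)) differentiable (at x)"
  using has_derivative_affine_comp[OF g(2)] differentiable_def by blast
 thus "g differentiable (at x)" unfolding g(1) by simp
next
 fix g i assume "g \<in> {\<lambda>x. d * f (a + c *\<^sub>R x) | d f. smooth f}" and i: "i \<in> (Basis :: 'a set)"
 then obtain d f where g: "g = (\<lambda>x. d * f (a + c *\<^sub>R x))" "smooth f" by blast
 have "(\<lambda>x. f (a + c *\<^sub>R x)) differentiable (at x)" for x
  using has_derivative_affine_comp[OF g(2)] differentiable_def by blast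
 hence "pd i g = (\<lambda>x. (d * c) * pd i f (a + c *\<^sub>R x))"
  unfolding g(1)
  by (subst partial_deriv_mult)
    (auto simp: partial_deriv_const partial_deriv_affine[OF g(2) i])
 thus "pd i g \<in> {\<lambda>x. d * f (a + c *\<^sub>R x) | d f. smooth f}"
  using smooth_partial_deriv[OF g(2) i] by blast
qed

lemma smooth_slice:
 fixes f :: "'a::euclidean_space \<times> 'b::euclidean_space \<Rightarrow> real"
 assumes "smooth f"
 shows "smooth (\<lambda>x. f (t, x))"
  and "i \<in> Basis \<Longrightarrow> pd i (\<lambda>x. f (t, x)) x = pd (0, i) f (t, x)"
proof -
 have d: "((\<lambda>x. f (t, x)) has_derivative
  (\<lambda>h. \<Sum>i\<in>Basis. ((0, h) \<bullet> i) * pd i f (t, x))) (at x)" if "smooth f" for f x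
  by (rule has_derivative_compose[of "\<lambda>x. (t, x)" "\<lambda>h. (0, h)", OF _ smooth_has_derivative[OF that]])
    (auto intro!: derivative_eq_intros)
 have p: "pd i (\<lambda>x. f (t, x)) = (\<lambda>x. pd (0, i) f (t, x))"
  if "smooth f" "i \<in> Basis" for f i
 proof
  fix x
  have "pd i (\<lambda>x. f (t, x)) x
    = (\<Sum>j\<in>Basis. ((0, i) \<bullet> j) * pd j f (t, x))"
   by (rule partial_deriv_eqI[OF d[OF that(1)]])
  also have "\<dots> = (\<Sum>j\<in>Basis. if j = (0::'a, i) then pd (0, i) f (t, x) else 0)"
   by (rule sum.cong) (use that(2) in \<open>auto simp: Basis_prod_def inner_not_same_Basis\<close>)
  finally show "pd i (\<lambda>x. f (t, x)) x = pd (0, i) f (t, x)"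
   using that(2) by (simp add: Basis_prod_def)
 qed
 show "i \<in> Basis \<Longrightarrow> pd i (\<lambda>x. f (t, x)) x = pd (0, i) f (t, x)"
  using p[OF assms] by simp
 show "smooth (\<lambda>x. f (t, x))"
 proof (rule smooth_coinduct[of _ "{\<lambda>x. f (t, x) | f. smooth f}"])
  show "(\<lambda>x. f (t, x)) \<in> {\<lambda>x. f (t, x) | f. smooth f}" using assms by blast
  show "g differentiable (at x)" if "g \<in> {\<lambda>x. f (t, x) | f. smooth f}" for g x
   using that d unfolding differentiable_def by blast
  show "pd i g \<in> {\<lambda>x. f (t, x) | f. smooth f}"
   if g: "g \<in> {\<lambda>x. f (t, x) | f. smooth f}" and i: "i \<in> Basis" for g i
  proof -
   obtain f where f: "g = (\<lambda>x. f (t, x))" "smooth f" using g by blast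
   have "smooth (pd (0, i) f)"
    using smooth_partial_deriv[OF f(2), of "(0, i)"] i by (simp add: Basis_prod_def)
   thus ?thesis using p[OF f(2) i] f(1) by blast
  qed
 qed
qed

section \<open>Test functions\<close>

lemma test_smooth: "f \<in> \<D> S \<Longrightarrow> smooth f"
 unfolding test_functions_def by auto

lemma test_mono: "f \<in> \<D> S \<Longrightarrow> S \<subseteq> S' \<Longrightarrow> f \<in> \<D> S'"
 unfolding test_functions_def by auto

lemma test_zero_outside: "f \<in> \<D> S \<Longrightarrow> x \<notin> S \<Longrightarrow> f x = 0"
 unfolding test_functions_def using closure_subset[of "{x. f x \<noteq> 0}"] by blast

text \<open>Any compact set outside which the function vanishes will do, which avoids computing the
  closure of the set of nonzeros.\<close>

lemma test_functionsI:
 assumes "smooth f" "compact K" "K \<subseteq> S" "\<And>x. x \<notin> K \<Longrightarrow> f x = 0"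
 shows "f \<in> \<D> S"
proof -
 have "closure {x. f x \<noteq> 0} \<subseteq> K"
  using assms by (intro closure_minimal compact_imp_closed) auto
 moreover have "compact (closure {x. f x \<noteq> 0})"
  using calculation assms(2) closed_closure
  by (meson bounded_subset compact_eq_bounded_closed)
 ultimately show ?thesis using assms unfolding test_functions_def by auto
qed

lemma test_functionsE:
 assumes "f \<in> \<D> S"
 obtains K where "compact K" "K \<subseteq> S" "\<And>x. x \<notin> K \<Longrightarrow> f x = 0"
 using assms closure_subset[of "{x. f x \<noteq> 0}"] unfolding test_functions_def by blast

lemma test_partial_deriv:
 assumes "f \<in> \<D> S" "i \<in> Basis"
 shows "pd i f \<in> \<D> S"
proof -
 obtain K where K: "compact K" "K \<subseteq> S" "\<And>x. x \<notin> K \<Longrightarrow> f x = 0"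
  using test_functionsE[OF assms(1)] by blast
 have "pd i f x = 0" if "x \<notin> K" for x
 proof -
  have "((\<lambda>_. 0) has_derivative (\<lambda>_. 0)) (at x)" by simp
  hence "(f has_derivative (\<lambda>_. 0)) (at x)"
   by (rule has_derivative_transform_within_open[of _ _ _ _ "- K"])
     (use K that in \<open>auto intro: open_Compl compact_imp_closed\<close>)
  thus ?thesis by (simp add: partial_deriv_eqI)
 qed
 thus ?thesis
  by (rule test_functionsI[OF smooth_partial_deriv[OF test_smooth[OF assms(1)] assms(2)] K(1,2)])
qed

lemma test_mult:
 assumes "f \<in> \<D> S" "smooth g"
 shows "(\<lambda>x. f x * g x) \<in> \<D> S"
 by (rule test_functionsE[OF assms(1)])
   (rule test_functionsI, auto intro: smooth_mult test_smooth assms)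

lemma test_mult2:
 assumes "f \<in> \<D> S" "smooth g"
 shows "(\<lambda>x. g x * f x) \<in> \<D> S"
 using test_mult[OF assms] by (simp add: mult.commute)

lemma test_add:
 assumes "f \<in> \<D> S" "g \<in> \<D> S"
 shows "(\<lambda>x. f x + g x) \<in> \<D> S"
proof -
 obtain K where K: "compact K" "K \<subseteq> S" "\<And>x. x \<notin> K \<Longrightarrow> f x = 0"
  using test_functionsE[OF assms(1)] by blast
 obtain L where L: "compact L" "L \<subseteq> S" "\<And>x. x \<notin> L \<Longrightarrow> g x = 0"
  using test_functionsE[OF assms(2)] by blast
 show ?thesis
  by (rule test_functionsI[of _ "K \<union> L"])
    (use K L assms in \<open>auto intro: smooth_add test_smooth\<close>)
qed

lemma test_zero: "(\<lambda>x. 0) \<in> \<D> S"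
 by (rule test_functionsI[of _ "{}"]) (auto simp: smooth_const)

lemma test_sum:
 "finite I \<Longrightarrow> (\<And>i. i \<in> I \<Longrightarrow> f i \<in> \<D> S) \<Longrightarrow>
  (\<lambda>x. \<Sum>i\<in>I. f i x) \<in> \<D> S"
 by (induction I rule: finite_induct) (auto intro: test_add test_zero)

lemma test_slice:
 assumes "f \<in> \<D> (A \<times> S)"
 shows "(\<lambda>x. f (t, x)) \<in> \<D> S"
proof -
 obtain K where K: "compact K" "K \<subseteq> A \<times> S" "\<And>x. x \<notin> K \<Longrightarrow> f x = 0"
  using test_functionsE[OF assms(1)] by blast
 show ?thesis
 proof (rule test_functionsI[of _ "snd ` K"])
  show "smooth (\<lambda>x. f (t, x))" using smooth_slice test_smooth assms by blast
  show "compact (snd ` K)" using K(1) by (intro compact_continuous_image continuous_intros)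
  show "snd ` K \<subseteq> S" using K(2) by auto
  show "f (t, x) = 0" if "x \<notin> snd ` K" for x using K(3) that by force
 qed
qed

lemma test_bounded:
 assumes "f \<in> \<D> S"
 obtains M where "M > 0" "\<And>x. \<bar>f x\<bar> \<le> M"
proof -
 obtain K where K: "compact K" "K \<subseteq> S" "\<And>x. x \<notin> K \<Longrightarrow> f x = 0"
  using test_functionsE[OF assms(1)] by blast
 have "bounded (f ` K)"
  using K(1) smooth_continuous[OF test_smooth[OF assms]]
  by (intro compact_imp_bounded compact_continuous_image)
 then obtain M where M: "M > 0" "\<And>x. x \<in> K \<Longrightarrow> \<bar>f x\<bar> \<le> M"
  by (auto simp: bounded_pos)
 thus ?thesis using K(3) that[of M] by (metis abs_zero less_imp_le)
qed

lemma test_lipschitz: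
 fixes f :: "'a::euclidean_space \<Rightarrow> real"
 assumes "f \<in> \<D> S"
 obtains L where "L > 0" "\<And>x y. \<bar>f x - f y\<bar> \<le> L * norm (x - y)"
proof -
 have "\<forall>i\<in>Basis. \<exists>M>0. \<forall>x. \<bar>pd i f x\<bar> \<le> M"
  using test_bounded[OF test_partial_deriv[OF assms]] by metis
 then obtain M where M: "\<And>i. i \<in> Basis \<Longrightarrow> M i > 0"
   "\<And>i x. i \<in> Basis \<Longrightarrow> \<bar>pd i f x\<bar> \<le> M i"
  by metis
 define L where "L = (\<Sum>i\<in>Basis. M i)"
 have "L > 0" unfolding L_def using M(1) by (intro sum_pos) auto
 moreover have "norm (f y - f x) \<le> L * norm (y - x)" for x y
 proof (rule differentiable_bound[of UNIV])
  show "(f has_derivative (\<lambda>h. \<Sum>i\<in>Basis. (h \<bullet> i) * pd i f z)) (at z within UNIV)"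
   for z using smooth_has_derivative[OF test_smooth[OF assms]] by simp
  show "onorm (\<lambda>h. \<Sum>i\<in>Basis. (h \<bullet> i) * pd i f z) \<le> L" for z
  proof (rule onorm_le)
   fix h :: 'a
   have "norm (\<Sum>i\<in>Basis. (h \<bullet> i) * pd i f z) \<le> (\<Sum>i\<in>Basis. norm h * M i)"
    by (rule sum_norm_le)
      (auto simp: abs_mult intro!: mult_mono M(2) Basis_le_norm)
   thus "norm (\<Sum>i\<in>Basis. (h \<bullet> i) * pd i f z) \<le> L * norm h"
    unfolding L_def by (simp add: sum_distrib_left mult.commute)
  qed
 qed auto
 ultimately show ?thesis using that[of L] by (metis norm_minus_commute real_norm_def)
qed

lemma test_translate:
 assumes "f \<in> \<D> UNIV"
 shows "(\<lambda>x. f (a + x)) \<in> \<D> UNIV"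
proof -
 obtain K where K: "compact K" "\<And>x. x \<notin> K \<Longrightarrow> f x = 0"
  using test_functionsE[OF assms(1)] by metis
 show ?thesis
 proof (rule test_functionsI[of _ "(\<lambda>x. x - a) ` K"])
  show "smooth (\<lambda>x. f (a + x))"
   using smooth_affine[OF test_smooth[OF assms], of a 1] by simp
  show "compact ((\<lambda>x. x - a) ` K)"
   using K(1) by (intro compact_continuous_image continuous_intros)
  show "f (a + x) = 0" if "x \<notin> (\<lambda>x. x - a) ` K" for x
   using K(2) that by (metis add_diff_cancel_left' image_eqI)
 qed auto
qed

section \<open>A smooth bump function\<close>

text \<open>The functions \<open>exp_inv_pow k\<close> are closed under differentiation up to linear combinations.\<close>

definition exp_inv_pow :: "nat \<Rightarrow> real \<Rightarrow> real" where
 "exp_inv_pow k t = (if t \<le> 0 then 0 else (1 / t) ^ k * exp (- (1 / t)))"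

text \<open>One term of the exponential series lies below the whole sum. This makes the bump flat at
  its edge, and later lets Gaussian decay beat negative powers of time.\<close>

lemma pow_exp_bound:
 fixes s :: real
 assumes "s \<ge> 0"
 shows "s ^ k * exp (- s) \<le> fact k"
proof -
 have "(\<Sum>n\<in>{k}. inverse (fact n) *\<^sub>R s ^ n) \<le> exp s"
  unfolding exp_def by (rule sum_le_suminf[OF summable_exp_generic]) (use assms in auto)
 hence "s ^ k \<le> fact k * exp s"
  by (simp add: field_simps)
 thus ?thesis by (simp add: exp_minus field_simps)
qed

lemma exp_inv_pow_deriv:
 "(exp_inv_pow k has_real_derivative - real k * exp_inv_pow (Suc k) t + exp_inv_pow (k + 2) t) (at t)"
proof -
 consider "t > 0" | "t < 0" | "t = 0" by linarith
 thus ?thesis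
 proof cases
  case 1
  have "((\<lambda>t. (1 / t) ^ k * exp (- (1 / t))) has_real_derivative
    (real k * (1 / t) ^ (k - 1) * (- 1 / t\<^sup>2)) * exp (- (1 / t))
    + (1 / t) ^ k * (exp (- (1 / t)) * (1 / t\<^sup>2))) (at t)"
   using 1 by (auto intro!: derivative_eq_intros simp: power2_eq_square)
  moreover have "real k * (1 / t) ^ (k - 1) * (- 1 / t\<^sup>2) * exp (- (1 / t))
    + (1 / t) ^ k * (exp (- (1 / t)) * (1 / t\<^sup>2))
    = - real k * exp_inv_pow (Suc k) t + exp_inv_pow (k + 2) t"
   using 1 unfolding exp_inv_pow_def
   by (cases k) (auto simp: power2_eq_square field_simps)
  ultimately have "((\<lambda>t. (1 / t) ^ k * exp (- (1 / t))) has_real_derivative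
    - real k * exp_inv_pow (Suc k) t + exp_inv_pow (k + 2) t) (at t)" by simp
  thus ?thesis
   by (rule has_field_derivative_transform_within_open[of _ _ _ "{0<..}"])
     (use 1 in \<open>auto simp: exp_inv_pow_def\<close>)
 next
  case 2
  have "((\<lambda>t. 0) has_real_derivative 0) (at t)" by simp
  hence "(exp_inv_pow k has_real_derivative 0) (at t)"
   by (rule has_field_derivative_transform_within_open[of _ _ _ "{..<0}"])
     (use 2 in \<open>auto simp: exp_inv_pow_def\<close>)
  thus ?thesis using 2 by (simp add: exp_inv_pow_def)
 next
  case 3
  \<comment> \<open>Two more powers of \<open>1 / h\<close> are borrowed from the exponential: one
    absorbs the difference quotient, the other leaves a factor \<open>h\<close> that tends to
    0.\<close>
  have b: "\<bar>exp_inv_pow k h / h\<bar> \<le> fact (k + 2) * \<bar>h\<bar>" for h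
  proof (cases "h > 0")
   case True
   have "exp_inv_pow k h / h = h * ((1 / h) ^ (k + 2) * exp (- (1 / h)))"
    using True by (simp add: exp_inv_pow_def)
   also have "\<dots> \<le> h * fact (k + 2)"
    using True by (intro mult_left_mono pow_exp_bound) auto
   finally show ?thesis using True by (simp add: exp_inv_pow_def mult.commute)
  next
   case False
   hence "exp_inv_pow k h = 0" by (simp add: exp_inv_pow_def)
   thus ?thesis by simp
  qed
  have "((\<lambda>h. exp_inv_pow k h / h) \<longlongrightarrow> 0) (at 0)"
  proof (rule Lim_null_comparison)
   show "\<forall>\<^sub>F h in at 0. norm (exp_inv_pow k h / h) \<le> fact (k + 2) * \<bar>h\<bar>"
    using b by (intro always_eventually) (simp only: real_norm_def, blast)
   show "((\<lambda>h. fact (k + 2) * \<bar>h\<bar>) \<longlongrightarrow> 0) (at (0::real))"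
    by (auto intro!: tendsto_eq_intros)
  qed
  thus ?thesis
   using 3 by (simp add: has_field_derivative_iff exp_inv_pow_def)
 qed
qed

definition bump :: "'a::euclidean_space \<Rightarrow> real" where
 "bump x = exp_inv_pow 0 (1 - x \<bullet> x)"

lemma smooth_bump: "smooth (bump :: 'a::euclidean_space \<Rightarrow> real)"
proof -
 \<comment> \<open>The derivative of a function of the first kind is a polynomial in coordinates,
   constants and two functions of the first kind, so the generated algebra contains the derivatives
   of its generators.\<close>
 define S :: "('a \<Rightarrow> real) set" where
  "S = range (\<lambda>k x. exp_inv_pow k (1 - x \<bullet> x)) \<union> range (\<lambda>i x. x \<bullet> i) \<union> range (\<lambda>c x. c)"
 have d: "((\<lambda>x::'a. exp_inv_pow k (1 - x \<bullet> x)) has_derivative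
   (\<lambda>h. (- 2 * (x \<bullet> h)) * (- real k * exp_inv_pow (Suc k) (1 - x \<bullet> x)
     + exp_inv_pow (k + 2) (1 - x \<bullet> x)))) (at x)" for k x
  by (rule has_derivative_compose[where f="\<lambda>x. 1 - x \<bullet> x" and f'="\<lambda>h. - 2 * (x \<bullet> h)",
     OF _ exp_inv_pow_deriv[unfolded has_field_derivative_def], THEN has_derivative_eq_rhs])
    (auto intro!: derivative_eq_intros simp: inner_commute mult.commute)
 have dl: "((\<lambda>x::'a. x \<bullet> i) has_derivative (\<lambda>h. h \<bullet> i)) (at x)" for x i
  by (auto intro!: derivative_eq_intros)
 have "bump \<in> algebra_of S"
  unfolding bump_def[abs_def] S_def by (rule algebra_base) auto
 thus ?thesis
 proof (rule smooth_algebra)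
  show "f differentiable (at x)" if f: "f \<in> S" for f :: "'a \<Rightarrow> real" and x
  proof -
   consider k where "f = (\<lambda>x. exp_inv_pow k (1 - x \<bullet> x))" | j where "f = (\<lambda>x. x \<bullet> j)"
    | c where "f = (\<lambda>x. c)"
    using f unfolding S_def by blast
   thus ?thesis
   proof cases
    case 3
    thus ?thesis by simp
   qed (use d dl in \<open>unfold differentiable_def, blast+\<close>)
  qed
  show "pd i f \<in> algebra_of S" if f: "f \<in> S" and "i \<in> Basis" for f i
  proof -
   have c: "(\<lambda>x. c) \<in> algebra_of S" for c
    by (rule algebra_base) (auto simp: S_def)
   have l: "(\<lambda>x. x \<bullet> i) \<in> algebra_of S" for i
    by (rule algebra_base) (auto simp: S_def)
   have e: "(\<lambda>x. exp_inv_pow k (1 - x \<bullet> x)) \<in> algebra_of S" for k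
    by (rule algebra_base) (auto simp: S_def)
   consider k where "f = (\<lambda>x. exp_inv_pow k (1 - x \<bullet> x))" | j where "f = (\<lambda>x. x \<bullet> j)"
    | c where "f = (\<lambda>x. c)"
    using f unfolding S_def by blast
   thus ?thesis
   proof cases
    case 1
    have "pd i f = (\<lambda>x. (- 2 * (x \<bullet> i)) * (- real k * exp_inv_pow (Suc k) (1 - x \<bullet> x)
     + exp_inv_pow (k + 2) (1 - x \<bullet> x)))"
     unfolding 1 using partial_deriv_eqI[OF d] by blast
    thus ?thesis by (simp only: algebra_mult algebra_add c l e)
   next
    case 2
    have "pd i f = (\<lambda>x. i \<bullet> j)"
     unfolding 2 using partial_deriv_eqI[OF dl] by blast
    thus ?thesis using c by simp
   next
    case 3
    thus ?thesis using c by (simp add: partial_deriv_const)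
   qed
  qed
 qed
qed

lemma bump_nonneg: "bump x \<ge> 0"
 unfolding bump_def exp_inv_pow_def by simp

lemma bump_pos_iff: "bump x > 0 \<longleftrightarrow> norm x < 1"
proof -
 have "bump x > 0 \<longleftrightarrow> x \<bullet> x < 1" unfolding bump_def exp_inv_pow_def by simp
 also have "\<dots> \<longleftrightarrow> (norm x)\<^sup>2 < 1" by (simp add: power2_norm_eq_inner)
 also have "\<dots> \<longleftrightarrow> norm x < 1" by (simp add: abs_square_less_1)
 finally show ?thesis .
qed

lemma bump_eq_0: "norm x \<ge> 1 \<Longrightarrow> bump x = 0"
 using bump_pos_iff[of x] bump_nonneg[of x] by linarith

lemma test_integrable:
 assumes "f \<in> \<D> S"
 shows "integrable lborel f"
proof -
 obtain K where K: "compact K" "K \<subseteq> S" "\<And>x. x \<notin> K \<Longrightarrow> f x = 0"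
  using test_functionsE[OF assms(1)] by blast
 have "set_integrable lborel K f"
  unfolding set_integrable_def
  using borel_integrable_compact[OF K(1) smooth_continuous[OF test_smooth[OF assms]]]
  by (simp add: scaleR_conv_of_real)
 moreover have "(\<lambda>x. indicator K x *\<^sub>R f x) = f"
  using K(3) by (force simp: indicator_def)
 ultimately show ?thesis unfolding set_integrable_def by simp
qed

lemma test_borel: "f \<in> \<D> S \<Longrightarrow> f \<in> borel_measurable borel"
 by (intro smooth_borel test_smooth)

section \<open>Averages of translates of a test function\<close>

text \<open>Mollified indicators, heat potentials and slice pairings are all weighted averages of
  translates of a test function. Differentiation falls on the test function alone, so the weight
  need only be integrable and the shift measurable; singular kernels are thereby allowed.\<close>

lemma average_translates:
 fixes f :: "'a::euclidean_space \<Rightarrow> real" and Y :: "'m \<Rightarrow> 'a"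
 assumes w: "integrable M w" and Y[measurable]: "Y \<in> borel_measurable M"
  and f: "f \<in> \<D> UNIV"
 shows "smooth (\<lambda>p. \<integral>q. w q * f (p + Y q) \<partial>M)"
  and "i \<in> Basis \<Longrightarrow> pd i (\<lambda>p. \<integral>q. w q * f (p + Y q) \<partial>M)
     = (\<lambda>p. \<integral>q. w q * pd i f (p + Y q) \<partial>M)"
  and average_translates_integrable: "integrable M (\<lambda>q. w q * f (p + Y q))"
proof -
 have wm[measurable]: "w \<in> borel_measurable M" using w by auto
 have int: "integrable M (\<lambda>q. w q * f (p + Y q))" if f: "f \<in> \<D> UNIV" for f :: "'a \<Rightarrow> real" and p
 proof -
  note [measurable] = test_borel[OF f]
  obtain B where B: "\<And>x. \<bar>f x\<bar> \<le> B" using test_bounded[OF f] by metis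
  show ?thesis
   by (rule integrable_bound[OF integrable_mult_left[OF w, of B]])
     (auto simp: abs_mult intro!: mult_left_mono order_trans[OF B])
 qed
 show "integrable M (\<lambda>q. w q * f (p + Y q))" by (rule int[OF f])
 have d: "((\<lambda>p. \<integral>q. w q * f (p + Y q) \<partial>M) has_derivative
   (\<lambda>h. \<Sum>i\<in>Basis. (h \<bullet> i) * (\<integral>q. w q * pd i f (p + Y q) \<partial>M))) (at p)"
  if f: "f \<in> \<D> UNIV" for f :: "'a \<Rightarrow> real" and p
 proof -
  note [measurable] = test_borel[OF f] test_borel[OF test_partial_deriv[OF f]]
  define f' where "f' x h = (\<Sum>i\<in>Basis. (h \<bullet> i) * pd i f x)" for x h
  obtain L where L: "L > 0" "\<And>x y. \<bar>f x - f y\<bar> \<le> L * norm (x - y)" using test_lipschitz[OF f] by metis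
  have "\<forall>i\<in>Basis. \<exists>M>0. \<forall>x. \<bar>pd i f x\<bar> \<le> M"
   using test_bounded[OF test_partial_deriv[OF f]] by metis
  then obtain b where b: "\<And>i. i \<in> Basis \<Longrightarrow> b i > 0"
    "\<And>i x. i \<in> Basis \<Longrightarrow> \<bar>pd i f x\<bar> \<le> b i"
   by metis
  define L' where "L' = (\<Sum>i\<in>Basis. b i)"
  have L': "\<bar>f' x h\<bar> \<le> L' * norm h" for x h
  proof -
   have "norm (f' x h) \<le> (\<Sum>i\<in>Basis. norm h * b i)"
    unfolding f'_def by (rule sum_norm_le)
      (auto simp: abs_mult intro!: mult_mono b(2) Basis_le_norm)
   thus ?thesis
    unfolding L'_def by (simp add: sum_distrib_left mult.commute)
  qed
  have L'0: "L' \<ge> 0" unfolding L'_def using b(1) by (intro sum_nonneg) (auto intro: less_imp_le)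
  have f'lin: "(\<integral>q. w q * f' (p + Y q) h \<partial>M)
    = (\<Sum>i\<in>Basis. (h \<bullet> i) * (\<integral>q. w q * pd i f (p + Y q) \<partial>M))" for h
  proof -
   have "(\<integral>q. w q * f' (p + Y q) h \<partial>M)
     = (\<integral>q. (\<Sum>i\<in>Basis. (h \<bullet> i) * (w q * pd i f (p + Y q))) \<partial>M)"
    unfolding f'_def by (simp add: sum_distrib_left mult.left_commute)
   also have "\<dots> = (\<Sum>i\<in>Basis. (\<integral>q. (h \<bullet> i) * (w q * pd i f (p + Y q)) \<partial>M))"
    by (rule integral_sum)
      (auto intro!: integrable_mult_right int test_partial_deriv f)
   finally show ?thesis by simp
  qed
  have intf': "integrable M (\<lambda>q. w q * f' (p + Y q) h)" for h
  proof -
   have "integrable M (\<lambda>q. (\<Sum>i\<in>Basis. (h \<bullet> i) * (w q * pd i f (p + Y q))))"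
    by (auto intro!: integrable_mult_right int test_partial_deriv f)
   thus ?thesis unfolding f'_def by (simp add: sum_distrib_left mult.left_commute)
  qed
  have "((\<lambda>h. norm ((\<integral>q. w q * f (p + h + Y q) \<partial>M) - (\<integral>q. w q * f (p + Y q) \<partial>M)
     - (\<integral>q. w q * f' (p + Y q) h \<partial>M)) / norm h) \<longlongrightarrow> 0) (at 0)"
   unfolding tendsto_at_iff_sequentially
  proof (intro allI impI)
   fix X :: "nat \<Rightarrow> 'a" assume X: "\<forall>i. X i \<in> UNIV - {0}" "X \<longlonglongrightarrow> 0"
   let ?D = "\<lambda>n q. w q * ((f (p + X n + Y q) - f (p + Y q) - f' (p + Y q) (X n)) / norm (X n))"
   \<comment> \<open>Uniformly in \<open>q\<close>, the difference quotient of \<open>f\<close> is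
     at most \<open>L\<close> and its linear part at most \<open>L'\<close>, which gives the
     dominating function.\<close>
   have lim: "(\<lambda>n. \<integral>q. ?D n q \<partial>M) \<longlonglongrightarrow> (\<integral>q. 0 \<partial>M)"
   proof (rule integral_dominated_convergence[where w="\<lambda>q. \<bar>w q\<bar> * (L + L')"])
    show "?D n \<in> borel_measurable M" for n unfolding f'_def by measurable
    show "integrable M (\<lambda>q. \<bar>w q\<bar> * (L + L'))" using w by auto
    show "AE q in M. (\<lambda>n. ?D n q) \<longlonglongrightarrow> 0"
    proof (rule AE_I2)
     fix q
     have "(f has_derivative f' (p + Y q)) (at (p + Y q))"
      unfolding f'_def[abs_def] by (rule smooth_has_derivative[OF test_smooth[OF f]])
     hence "((\<lambda>h. (f (p + Y q + h) - f (p + Y q) - f' (p + Y q) h) /\<^sub>R norm h) \<longlongrightarrow> 0) (at 0)"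
      unfolding has_derivative_at by (subst tendsto_norm_zero_iff[symmetric]) (simp add: abs_mult divide_inverse mult.commute)
     hence "((\<lambda>n. (f (p + Y q + X n) - f (p + Y q) - f' (p + Y q) (X n)) /\<^sub>R norm (X n)) \<longlonglongrightarrow> 0)"
      using X unfolding tendsto_at_iff_sequentially comp_def by blast
     hence "((\<lambda>n. w q * ((f (p + Y q + X n) - f (p + Y q) - f' (p + Y q) (X n)) /\<^sub>R norm (X n))) \<longlonglongrightarrow> w q * 0)"
      by (rule tendsto_mult_left)
     thus "(\<lambda>n. ?D n q) \<longlonglongrightarrow> 0" by (simp add: field_simps)
    qed
    show "AE q in M. norm (?D n q) \<le> \<bar>w q\<bar> * (L + L')" for n
    proof (rule AE_I2)
     fix q
     have "\<bar>f (p + X n + Y q) - f (p + Y q)\<bar> \<le> L * norm (X n)"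
      using L(2)[of "p + X n + Y q" "p + Y q"] by (simp add: algebra_simps)
     hence "\<bar>f (p + X n + Y q) - f (p + Y q) - f' (p + Y q) (X n)\<bar> \<le> (L + L') * norm (X n)"
      using L'[of "p + Y q" "X n"] by (simp add: algebra_simps)
     hence "\<bar>(f (p + X n + Y q) - f (p + Y q) - f' (p + Y q) (X n)) / norm (X n)\<bar> \<le> L + L'"
      using X(1) by (simp add: field_simps)
     thus "norm (?D n q) \<le> \<bar>w q\<bar> * (L + L')"
      unfolding real_norm_def abs_mult by (intro mult_left_mono) auto
    qed
   qed auto
   have D: "(\<integral>q. ?D n q \<partial>M) = ((\<integral>q. w q * f (p + X n + Y q) \<partial>M) - (\<integral>q. w q * f (p + Y q) \<partial>M)
     - (\<integral>q. w q * f' (p + Y q) (X n) \<partial>M)) / norm (X n)" (is "_ = ?E n") for n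
    using int[OF f] intf' by (simp add: right_diff_distrib)
   have "(\<lambda>n. norm (?E n)) \<longlonglongrightarrow> 0"
    using lim unfolding D by (rule tendsto_norm_zero[OF tendsto_eq_rhs]) simp
   thus "((\<lambda>h. norm ((\<integral>q. w q * f (p + h + Y q) \<partial>M) - (\<integral>q. w q * f (p + Y q) \<partial>M)
     - (\<integral>q. w q * f' (p + Y q) h \<partial>M)) / norm h) \<circ> X) \<longlonglongrightarrow> 0"
    by (simp add: comp_def)
  qed
  thus ?thesis
   unfolding has_derivative_at f'lin
   by (auto intro!: bounded_linear_sum bounded_linear_mult_const bounded_linear_inner_left)
 qed
 show "smooth (\<lambda>p. \<integral>q. w q * f (p + Y q) \<partial>M)"
 proof (rule smooth_coinduct[of _ "{\<lambda>p. \<integral>q. w q * f (p + Y q) \<partial>M | f. f \<in> \<D> UNIV}"])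
  show "(\<lambda>p. \<integral>q. w q * f (p + Y q) \<partial>M) \<in> {\<lambda>p. \<integral>q. w q * f (p + Y q) \<partial>M | f. f \<in> \<D> UNIV}"
   using f by blast
  show "g differentiable (at x)" if "g \<in> {\<lambda>p. \<integral>q. w q * f (p + Y q) \<partial>M | f. f \<in> \<D> UNIV}" for g x
   using that d unfolding differentiable_def by blast
  show "pd i g \<in> {\<lambda>p. \<integral>q. w q * f (p + Y q) \<partial>M | f. f \<in> \<D> UNIV}"
   if g: "g \<in> {\<lambda>p. \<integral>q. w q * f (p + Y q) \<partial>M | f. f \<in> \<D> UNIV}" and i: "i \<in> Basis" for g i
  proof -
   obtain f where f: "g = (\<lambda>p. \<integral>q. w q * f (p + Y q) \<partial>M)" "f \<in> \<D> UNIV" using g by blast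
   have "pd i g = (\<lambda>p. \<integral>q. w q * pd i f (p + Y q) \<partial>M)"
    unfolding f(1) by (rule ext) (simp only: partial_deriv_eqI[OF d[OF f(2)]] sum_Basis_inner_left[OF i])
   thus ?thesis using test_partial_deriv[OF f(2) i] by blast
  qed
 qed
 show "pd i (\<lambda>p. \<integral>q. w q * f (p + Y q) \<partial>M) = (\<lambda>p. \<integral>q. w q * pd i f (p + Y q) \<partial>M)"
  if i: "i \<in> Basis"
  by (rule ext) (simp only: partial_deriv_eqI[OF d[OF f]] sum_Basis_inner_left[OF i])
qed

section \<open>Square integrable functions\<close>

text \<open>Stated for an arbitrary measure, so that one set of lemmas serves both
  \<open>lborel\<close>, where the analysis takes place, and \<open>lebesgue_on S\<close>, in terms
  of which the spaces are defined.\<close>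

definition sqint :: "'m measure \<Rightarrow> ('m \<Rightarrow> real) \<Rightarrow> bool" where
 "sqint M f \<longleftrightarrow> f \<in> borel_measurable M \<and> integrable M (\<lambda>x. (f x)\<^sup>2)"

definition l2 :: "'m measure \<Rightarrow> ('m \<Rightarrow> real) \<Rightarrow> real" where
 "l2 M f = sqrt (\<integral>x. (f x)\<^sup>2 \<partial>M)"

lemma sqint_measurable: "sqint M f \<Longrightarrow> f \<in> borel_measurable M"
 unfolding sqint_def by simp

lemma sqint_sq: "sqint M f \<Longrightarrow> integrable M (\<lambda>x. (f x)\<^sup>2)"
 unfolding sqint_def by simp

lemma l2_nonneg: "l2 M f \<ge> 0"
 unfolding l2_def by (simp add: integral_nonneg)

lemma l2_sq: "(l2 M f)\<^sup>2 = (\<integral>x. (f x)\<^sup>2 \<partial>M)"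
 unfolding l2_def by (simp add: integral_nonneg)

lemma sqint_mult:
 assumes "sqint M f" "sqint M g"
 shows "integrable M (\<lambda>x. f x * g x)"
proof (rule integrable_bound)
 show "integrable M (\<lambda>x. (f x)\<^sup>2 + (g x)\<^sup>2)"
  using assms by (auto simp: sqint_def)
 show "(\<lambda>x. f x * g x) \<in> borel_measurable M"
  using assms by (auto simp: sqint_def)
 have "\<bar>a * b\<bar> \<le> a\<^sup>2 + b\<^sup>2" for a b :: real
 proof -
  have "0 \<le> (\<bar>a\<bar> - \<bar>b\<bar>)\<^sup>2" by simp
  hence "2 * (\<bar>a\<bar> * \<bar>b\<bar>) \<le> a\<^sup>2 + b\<^sup>2" by (simp add: power2_diff)
  moreover have "\<bar>a\<bar> * \<bar>b\<bar> \<ge> 0" by simp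
  ultimately show ?thesis unfolding abs_mult by linarith
 qed
 thus "AE x in M. norm (f x * g x) \<le> norm ((f x)\<^sup>2 + (g x)\<^sup>2)" by simp
qed

lemma sqint_add:
 assumes "sqint M f" "sqint M g"
 shows "sqint M (\<lambda>x. f x + g x)"
 using sqint_mult[OF assms] assms
 unfolding sqint_def by (auto simp: power2_sum mult.assoc)

lemma sqint_cmult: "sqint M f \<Longrightarrow> sqint M (\<lambda>x. c * f x)"
 unfolding sqint_def by (auto simp: power_mult_distrib)

lemma sqint_diff:
 assumes "sqint M f" "sqint M g"
 shows "sqint M (\<lambda>x. f x - g x)"
 using sqint_add[OF assms(1) sqint_cmult[OF assms(2), of "-1"]] by simp

lemma sqint_zero: "sqint M (\<lambda>x. 0)"
 unfolding sqint_def by simp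

lemma sqint_bounded_mult:
 assumes "sqint M f" "g \<in> borel_measurable M" "\<And>x. \<bar>g x\<bar> \<le> B"
 shows "sqint M (\<lambda>x. g x * f x)"
 unfolding sqint_def
proof
 show "(\<lambda>x. g x * f x) \<in> borel_measurable M" using assms by (auto simp: sqint_def)
 show "integrable M (\<lambda>x. (g x * f x)\<^sup>2)"
 proof (rule integrable_bound[OF integrable_mult_right[OF sqint_sq[OF assms(1)], of "B\<^sup>2"]])
  have "(g x)\<^sup>2 \<le> B\<^sup>2" for x
   using assms(3)[of x] abs_le_square_iff[of "g x" B] by auto
  thus "AE x in M. norm ((g x * f x)\<^sup>2) \<le> norm (B\<^sup>2 * (f x)\<^sup>2)"
   by (auto simp: power_mult_distrib intro!: mult_right_mono)
 qed (use assms in \<open>auto simp: sqint_def\<close>)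
qed

lemma Cauchy_Schwarz_l2:
 assumes "sqint M f" "sqint M g"
 shows "\<bar>\<integral>x. f x * g x \<partial>M\<bar> \<le> l2 M f * l2 M g"
proof -
 define a b c where "a = (\<integral>x. (f x)\<^sup>2 \<partial>M)" and "b = (\<integral>x. (g x)\<^sup>2 \<partial>M)" and "c = (\<integral>x. f x * g x \<partial>M)"
 have ab: "a \<ge> 0" "b \<ge> 0" unfolding a_def b_def by (auto intro: integral_nonneg)
 have q: "0 \<le> s\<^sup>2 * a + 2 * s * c + b" for s
 proof -
  have "0 \<le> (\<integral>x. (s * f x + g x)\<^sup>2 \<partial>M)" by (intro integral_nonneg) simp
  also have "(\<integral>x. (s * f x + g x)\<^sup>2 \<partial>M)
    = (\<integral>x. s\<^sup>2 * (f x)\<^sup>2 + 2 * s * (f x * g x) + (g x)\<^sup>2 \<partial>M)"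
   by (rule arg_cong[where f="integral\<^sup>L M"]) (auto simp: power2_sum power_mult_distrib)
  also have "\<dots> = s\<^sup>2 * a + 2 * s * c + b"
   unfolding a_def b_def c_def
   using sqint_mult[OF assms] assms[THEN sqint_sq] by simp
  finally show ?thesis .
 qed
 have "c\<^sup>2 \<le> a * b"
 proof (cases "a = 0")
  case True
  have "c = 0"
  proof (rule ccontr)
   assume "c \<noteq> 0"
   \<comment> \<open>For \<open>a = 0\<close> the quadratic is affine in \<open>s\<close>, and at
     this \<open>s\<close> it takes the value -1.\<close>
   thus False using q[of "- (b + 1) / (2 * c)"] True by (simp add: field_simps)
  qed
  thus ?thesis using ab by simp
 next
  case False
  thus ?thesis
   using q[of "- c / a"] ab by (simp add: field_simps power2_eq_square)
 qed
 hence "sqrt (c\<^sup>2) \<le> sqrt (a * b)" by (rule real_sqrt_le_mono)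
 thus ?thesis unfolding l2_def real_sqrt_mult a_def b_def c_def by simp
qed

lemma l2_triangle:
 assumes "sqint M f" "sqint M g"
 shows "l2 M (\<lambda>x. f x + g x) \<le> l2 M f + l2 M g"
proof (rule power2_le_imp_le)
 have "(l2 M (\<lambda>x. f x + g x))\<^sup>2 = (\<integral>x. (f x)\<^sup>2 + 2 * (f x * g x) + (g x)\<^sup>2 \<partial>M)"
  unfolding l2_sq by (rule arg_cong[where f="integral\<^sup>L M"]) (auto simp: power2_sum)
 also have "\<dots> = (l2 M f)\<^sup>2 + 2 * (\<integral>x. f x * g x \<partial>M) + (l2 M g)\<^sup>2"
  unfolding l2_sq using sqint_mult[OF assms] assms[THEN sqint_sq] by simp
 also have "\<dots> \<le> (l2 M f + l2 M g)\<^sup>2"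
  using Cauchy_Schwarz_l2[OF assms] by (simp add: power2_sum)
 finally show "(l2 M (\<lambda>x. f x + g x))\<^sup>2 \<le> (l2 M f + l2 M g)\<^sup>2" .
qed (simp add: l2_nonneg)

lemma l2_cmult: "l2 M (\<lambda>x. c * f x) = \<bar>c\<bar> * l2 M f"
 unfolding l2_def by (simp add: power_mult_distrib real_sqrt_mult)

lemma l2_triangle_diff:
 assumes "sqint M f" "sqint M g"
 shows "l2 M (\<lambda>x. f x - g x) \<le> l2 M f + l2 M g"
 using l2_triangle[OF assms(1) sqint_cmult[OF assms(2), of "-1"]] l2_cmult[of M "-1" g] by simp

lemma l2_mono:
 assumes "sqint M g" "f \<in> borel_measurable M" "AE x in M. \<bar>f x\<bar> \<le> \<bar>g x\<bar>"
 shows "l2 M f \<le> l2 M g" "sqint M f"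
proof -
 have *: "AE x in M. (f x)\<^sup>2 \<le> (g x)\<^sup>2"
  using assms(3) by eventually_elim (simp add: abs_le_square_iff)
 show f: "sqint M f"
  unfolding sqint_def using assms(2) *
  by (auto intro!: integrable_bound[OF sqint_sq[OF assms(1)]])
 show "l2 M f \<le> l2 M g"
  unfolding l2_def
  by (intro real_sqrt_le_mono integral_mono_AE sqint_sq f assms(1) *)
qed

lemma sqint_indicator:
 assumes "A \<in> sets M" "emeasure M A < \<infinity>"
 shows "sqint M (indicator A)"
 using assms by (simp add: sqint_def power2_eq_square indicator_inter_arith[symmetric])

lemma bounded_support_integrable:
 assumes A: "A \<in> sets M" "emeasure M A < \<infinity>" and f: "f \<in> borel_measurable M"
  and B: "\<And>x. \<bar>f x\<bar> \<le> B" "\<And>x. x \<notin> A \<Longrightarrow> f x = 0"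
 shows "integrable M f" "sqint M f"
proof -
 have le: "\<bar>f x\<bar> \<le> \<bar>B * indicator A x\<bar>" for x
  using B(1)[of x] B(2)[of x] by (cases "x \<in> A") auto
 show "integrable M f"
  by (rule integrable_bound[OF integrable_mult_right[OF integrable_real_indicator[OF A], of B] f]) (use le in simp)
 show "sqint M f"
  by (rule l2_mono(2)[OF sqint_cmult[OF sqint_indicator[OF A], of B] f]) (use le in simp)
qed

section \<open>Integration by parts\<close>

lemma lborel_integral_translate:
 fixes f :: "'a::euclidean_space \<Rightarrow> real"
 assumes [measurable]: "f \<in> borel_measurable borel"
 shows "(LBINT x. f (x + a)) = (LBINT x. f x)"
  and "integrable lborel f \<Longrightarrow> integrable lborel (\<lambda>x. f (x + a))"
proof -
 have "(LBINT x. f x) = (\<integral>x. f x \<partial>(distr lborel borel ((+) a)))"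
  by (simp add: lborel_distr_plus)
 also have "\<dots> = (LBINT x. f (x + a))"
  by (subst integral_distr) (auto simp: add.commute)
 finally show "(LBINT x. f (x + a)) = (LBINT x. f x)" by simp
 show "integrable lborel (\<lambda>x. f (x + a))" if "integrable lborel f"
 proof -
  have "integrable (distr lborel borel ((+) a)) f" using that by (simp add: lborel_distr_plus)
  thus ?thesis by (subst (asm) integrable_distr_eq) (auto simp: add.commute)
 qed
qed

text \<open>Translation invariance makes the integral of every difference quotient vanish; the mean
  value theorem bounds the quotients by \<open>L\<close>, so dominated convergence passes to the
  limit. Only differentiability along \<open>v\<close> is asked, which lets the lemma cover products
  with a Gaussian factor as well as functions of time alone.\<close>

lemma integral_directional_deriv_eq_0:
 fixes f f' :: "'a::euclidean_space \<Rightarrow> real"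
 assumes int: "integrable lborel f"
  and d: "\<And>x. ((\<lambda>s. f (x + s *\<^sub>R v)) has_real_derivative f' x) (at 0)"
  and L: "\<And>x. \<bar>f' x\<bar> \<le> L" and v: "norm v \<le> 1"
  and R: "\<And>x. norm x > R \<Longrightarrow> f x = 0"
 shows "(LBINT x. f' x) = 0" "integrable lborel f'"
proof -
 have [measurable]: "f \<in> borel_measurable borel" using int by auto
 define D where "D n x = (f (x + inverse (real (Suc n)) *\<^sub>R v) - f x) / inverse (real (Suc n))" for n x
 have d': "((\<lambda>s. f (x + s *\<^sub>R v)) has_real_derivative f' (x + s *\<^sub>R v)) (at s)" for x s
  using DERIV_shift[of "\<lambda>s. f (x + s *\<^sub>R v)" "f' (x + s *\<^sub>R v)" 0 s] d[of "x + s *\<^sub>R v"]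
  by (simp add: scaleR_add_left algebra_simps)
 have bd: "\<bar>f (x + s *\<^sub>R v) - f x\<bar> \<le> L * s" if "s > 0" for x s
 proof -
  have "\<exists>z>0. z < s \<and> f (x + s *\<^sub>R v) - f (x + 0 *\<^sub>R v) = (s - 0) * f' (x + z *\<^sub>R v)"
   by (rule MVT2[OF that]) (rule d')
  then obtain z where "f (x + s *\<^sub>R v) - f (x + 0 *\<^sub>R v) = (s - 0) * f' (x + z *\<^sub>R v)"
   by blast
  thus ?thesis using L[of "x + z *\<^sub>R v"] that by (simp add: abs_mult mult.commute)
 qed
 have L0: "L \<ge> 0" using L[of 0] by linarith
 \<comment> \<open>The increments have length at most 1, so all the quotients live within distance 1
   of the ball of radius \<open>R\<close>.\<close>
 have int': "integrable lborel (\<lambda>x. L * indicator (cball (0::'a) (\<bar>R\<bar> + 1)) x)"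
  using emeasure_lborel_cball_finite[of "0::'a" "\<bar>R\<bar> + 1"]
  by (intro integrable_mult_right integrable_real_indicator) (auto simp: top.not_eq_extremum)
 have lim: "(\<lambda>n. D n x) \<longlonglongrightarrow> f' x" for x
 proof -
  have "((\<lambda>s. (f (x + s *\<^sub>R v) - f x) / s) \<longlongrightarrow> f' x) (at 0)"
   using d[of x] unfolding has_field_derivative_iff by simp
  hence "((\<lambda>s. (f (x + s *\<^sub>R v) - f x) / s) \<circ> (\<lambda>n. inverse (real (Suc n)))) \<longlonglongrightarrow> f' x"
   unfolding tendsto_at_iff_sequentially using LIMSEQ_inverse_real_of_nat by auto
  thus ?thesis by (simp add: D_def comp_def)
 qed
 have f'm[measurable]: "f' \<in> borel_measurable borel"
  by (rule borel_measurable_LIMSEQ_real[OF lim]) (simp add: D_def)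
 have bound: "norm (D n x) \<le> L * indicator (cball 0 (\<bar>R\<bar> + 1)) x" for n x
 proof (cases "x \<in> cball 0 (\<bar>R\<bar> + 1)")
  case True
  have "\<bar>a\<bar> \<le> L * h \<Longrightarrow> h > 0 \<Longrightarrow> \<bar>a / h\<bar> \<le> L" for a h :: real
   by (simp add: pos_divide_le_eq)
  from this[OF bd] show ?thesis using True by (simp add: D_def)
 next
  case False
  have s: "0 < inverse (real (Suc n))" "inverse (real (Suc n)) \<le> 1" by (auto simp: field_simps)
  have "norm x \<le> norm (x + inverse (real (Suc n)) *\<^sub>R v) + norm (inverse (real (Suc n)) *\<^sub>R v)"
   by (metis add_diff_cancel_right' norm_triangle_ineq4)
  moreover have "norm (inverse (real (Suc n)) *\<^sub>R v) \<le> 1"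
   unfolding norm_scaleR using s v mult_mono[of "inverse (real (Suc n))" 1 "norm v" 1] by auto
  ultimately have "f (x + inverse (real (Suc n)) *\<^sub>R v) = 0" "f x = 0"
   using False R by (auto intro!: R)
  thus ?thesis using False by (simp add: D_def)
 qed
 show "integrable lborel f'"
  by (rule integrable_dominated_convergence[of f' lborel D, OF _ _ int'])
    (use lim bound in \<open>auto simp: D_def[abs_def]\<close>)
 have "(\<lambda>n. (LBINT x. D n x)) \<longlonglongrightarrow> (LBINT x. f' x)"
  by (rule integral_dominated_convergence[OF _ _ int'])
    (use lim bound in \<open>auto simp: D_def[abs_def]\<close>)
 moreover have "(LBINT x. D n x) = 0" for n
  unfolding D_def using lborel_integral_translate[of f] int by simp
 ultimately show "(LBINT x. f' x) = 0" by (simp add: LIMSEQ_const_iff)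
qed

lemma test_integral_partial_deriv:
 assumes f: "f \<in> \<D> S" and i: "i \<in> Basis"
 shows "(LBINT x. pd i f x) = 0"
proof -
 obtain K where K: "compact K" "K \<subseteq> S" "\<And>x. x \<notin> K \<Longrightarrow> f x = 0"
  using test_functionsE[OF f] by blast
 obtain R where R: "\<And>x. x \<in> K \<Longrightarrow> norm x \<le> R"
  using compact_imp_bounded[OF K(1)] unfolding bounded_iff by blast
 obtain L where L: "\<And>x. \<bar>pd i f x\<bar> \<le> L"
  using test_bounded[OF test_partial_deriv[OF f i]] by metis
 show ?thesis
 proof (rule integral_directional_deriv_eq_0[OF test_integrable[OF f] _ L])
  show "((\<lambda>s. f (x + s *\<^sub>R i)) has_real_derivative pd i f x) (at 0)" for x
   using has_partial_deriv[OF test_smooth[OF f] i, of x 0] by simp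
  show "f x = 0" if "R < norm x" for x using K(3) R that by force
 qed (use i in simp)
qed

lemma test_integral_by_parts:
 assumes f: "f \<in> \<D> S" and g: "smooth g" and i: "i \<in> Basis"
 shows "(LBINT x. pd i f x * g x) = - (LBINT x. f x * pd i g x)"
proof -
 have "(LBINT x. pd i (\<lambda>x. f x * g x) x) = 0"
  by (rule test_integral_partial_deriv[OF test_mult[OF f g] i])
 hence "(LBINT x. pd i f x * g x + f x * pd i g x) = 0"
  using partial_deriv_mult_smooth[OF test_smooth[OF f] g] by simp
 moreover have "integrable lborel (\<lambda>x. pd i f x * g x)" "integrable lborel (\<lambda>x. f x * pd i g x)"
  by (auto intro!: test_integrable test_mult[of _ S] test_partial_deriv f g i smooth_partial_deriv)
 ultimately show ?thesis by simp
qed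

lemma test_sqint:
 assumes "f \<in> \<D> S"
 shows "sqint lborel f"
 unfolding sqint_def power2_eq_square
 using test_borel[OF assms] test_integrable[OF test_mult[OF assms test_smooth[OF assms]]] by simp

section \<open>Mollifiers and smooth cutoffs\<close>

definition mollifier :: "real \<Rightarrow> 'a::euclidean_space \<Rightarrow> real" where
 "mollifier d x = bump ((1 / d) *\<^sub>R x) / (LBINT y. bump ((1 / d) *\<^sub>R (y::'a)))"

lemma
 assumes d: "d > 0"
 shows test_mollifier: "mollifier d \<in> \<D> (UNIV :: 'a::euclidean_space set)"
  and mollifier_nonneg: "mollifier d (x::'a) \<ge> 0"
  and mollifier_eq_0: "norm (x::'a) \<ge> d \<Longrightarrow> mollifier d x = 0"
  and mollifier_integral: "(LBINT x. mollifier d (x::'a)) = 1"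
  and mollifier_uminus: "mollifier d (- x) = mollifier d (x::'a)"
proof -
 let ?b = "\<lambda>x::'a. bump ((1 / d) *\<^sub>R x)"
 have z: "?b x = 0" if "norm x \<ge> d" for x
  using that d by (intro bump_eq_0) simp
 have t: "?b \<in> \<D> UNIV"
  by (rule test_functionsI[of _ "cball 0 d"])
    (use z smooth_affine[OF smooth_bump, of 0 "1 / d"] in auto)
 have "(LBINT x. ?b x) \<noteq> 0"
 proof
  assume "(LBINT x. ?b x) = 0"
  hence "AE x in lborel. ?b x = 0"
   using integral_nonneg_eq_0_iff_AE[OF test_integrable[OF t]] bump_nonneg by auto
  hence "AE x in lborel. x \<notin> ball (0::'a) d"
  proof eventually_elim
   case (elim x)
   thus ?case using bump_pos_iff[of "(1 / d) *\<^sub>R x"] d by (auto simp: field_simps)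
  qed
  hence "emeasure lborel (ball (0::'a) d) = 0"
   by (subst (asm) AE_iff_measurable[of "ball 0 d"]) auto
  thus False
   using content_ball_pos[OF d, of "0::'a"] by (simp add: measure_def)
 qed
 moreover have "(LBINT x. ?b x) \<ge> 0"
  by (intro integral_nonneg bump_nonneg)
 ultimately have c: "(LBINT x. ?b x) > 0" by linarith
 show "mollifier d \<in> \<D> (UNIV :: 'a::euclidean_space set)"
  using test_mult[OF t smooth_const[of "1 / (LBINT x. ?b x)"]]
  by (simp add: mollifier_def[abs_def])
 show "mollifier d (x::'a) \<ge> 0" using c by (simp add: mollifier_def bump_nonneg)
 show "mollifier d x = 0" if "norm (x::'a) \<ge> d" using z[OF that] by (simp add: mollifier_def)
 show "(LBINT x. mollifier d (x::'a)) = 1" using c by (simp add: mollifier_def)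
 show "mollifier d (- x) = mollifier d (x::'a)" by (simp add: mollifier_def bump_def)
qed

text \<open>The indicator of the \<open>2 * d\<close>-neighbourhood of \<open>K\<close> is mollified
  at width \<open>d\<close>, where \<open>3 * d = e\<close> is the room available in
  \<open>V\<close>. The result is 1 up to distance \<open>d\<close> from \<open>K\<close> and 0
  beyond \<open>3 * d\<close>. The plateau beyond \<open>K\<close> itself is what later keeps the
  heat kernels away from their singularity.\<close>

lemma smooth_cutoff:
 fixes K V :: "'a::euclidean_space set"
 assumes K: "compact K" and V: "open V" "K \<subseteq> V"
 obtains \<eta> d where "\<eta> \<in> \<D> V" "\<And>x. 0 \<le> \<eta> x" "\<And>x. \<eta> x \<le> 1" "d > 0"
  "\<And>x y. x \<in> K \<Longrightarrow> dist x y \<le> d \<Longrightarrow> \<eta> y = 1"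
proof -
 obtain e where e: "e > 0" "(\<Union>x\<in>K. cball x e) \<subseteq> V"
  using compact_subset_open_imp_cball_epsilon_subset[OF K V] by metis
 define d where "d = e / 3"
 have d: "d > 0" using e by (simp add: d_def)
 \<comment> \<open>Written as a Minkowski sum of two compact sets, hence compact; the next claim
   gives its metric description.\<close>
 define N where "N r = (\<Union>x\<in>K. \<Union>y\<in>cball 0 r. {x + y})" for r :: real
 have N: "y \<in> N r \<longleftrightarrow> (\<exists>x\<in>K. dist x y \<le> r)" for y r
 proof
  assume "y \<in> N r"
  then obtain x z where "x \<in> K" "norm z \<le> r" "y = x + z" by (auto simp: N_def)
  thus "\<exists>x\<in>K. dist x y \<le> r" by (auto simp: dist_norm intro!: bexI[of _ x])
 next
  assume "\<exists>x\<in>K. dist x y \<le> r"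
  then obtain x where "x \<in> K" "dist x y \<le> r" by blast
  hence "y = x + (y - x)" "y - x \<in> cball 0 r" by (auto simp: dist_norm norm_minus_commute)
  thus "y \<in> N r" using \<open>x \<in> K\<close> unfolding N_def by blast
 qed
 have Nc: "compact (N r)" for r
  unfolding N_def using compact_sums'[OF K compact_cball[of 0 r]] by simp
 let ?\<rho> = "mollifier d :: 'a \<Rightarrow> real"
 define \<eta> where "\<eta> x = (LBINT q. indicator (N (2 * d)) q * ?\<rho> (x + (- q)))" for x
 have Nm[measurable]: "N r \<in> sets borel" for r using Nc by (simp add: borel_closed compact_imp_closed)
 have iN: "integrable lborel (indicator (N (2 * d)) :: 'a \<Rightarrow> real)"
  using emeasure_compact_finite[OF Nc, of "2 * d"] by (intro integrable_real_indicator) (auto simp: top.not_eq_extremum)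
 have [measurable]: "?\<rho> \<in> borel_measurable borel" by (rule test_borel[OF test_mollifier[OF d]])
 have \<rho>i: "integrable lborel (\<lambda>q. ?\<rho> (x + (- q)))" "(LBINT q. ?\<rho> (x + (- q))) = 1" for x
 proof -
  have eq: "?\<rho> (x + (- q)) = ?\<rho> (q + (- x))" for q using mollifier_uminus[OF d, of "x - q"] by simp
  show "integrable lborel (\<lambda>q. ?\<rho> (x + (- q)))" unfolding eq
   by (rule lborel_integral_translate) (auto intro: test_integrable test_mollifier d)
  show "(LBINT q. ?\<rho> (x + (- q))) = 1" unfolding eq
   by (subst lborel_integral_translate) (auto simp: mollifier_integral d)
 qed
 have ci: "integrable lborel (\<lambda>q. indicator (N (2 * d)) q * ?\<rho> (x + (- q)))" for x
  by (rule average_translates_integrable[OF iN _ test_mollifier[OF d]]) simp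
 show thesis
 proof (rule that[of \<eta> d])
  have "smooth \<eta>" unfolding \<eta>_def
   by (rule average_translates(1)[OF iN _ test_mollifier[OF d]]) simp
  thus "\<eta> \<in> \<D> V"
  proof (rule test_functionsI)
   show "compact (N e)" by (rule Nc)
   show "N e \<subseteq> V" using e(2) N by fastforce
   show "\<eta> x = 0" if "x \<notin> N e" for x
   proof -
    have "indicator (N (2 * d)) q * ?\<rho> (x + (- q)) = 0" for q
    proof (cases "norm (x - q) \<ge> d")
     case False
     have "q \<notin> N (2 * d)"
     proof
      assume "q \<in> N (2 * d)"
      then obtain y where y: "y \<in> K" "dist y q \<le> 2 * d" using N by blast
      hence "dist y x \<le> e"
       using False dist_triangle[of y x q] by (simp add: d_def dist_norm norm_minus_commute)
      thus False using N that y by blast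
     qed
     thus ?thesis by simp
    qed (simp add: mollifier_eq_0[OF d])
    thus ?thesis unfolding \<eta>_def by (simp only: integral_zero)
   qed
  qed
  show "0 \<le> \<eta> x" for x
   unfolding \<eta>_def by (intro integral_nonneg) (simp add: mollifier_nonneg[OF d])
  have "\<eta> x \<le> (LBINT q. ?\<rho> (x + (- q)))" for x
   unfolding \<eta>_def
   by (rule integral_mono[OF ci \<rho>i(1)]) (auto simp: indicator_def mollifier_nonneg[OF d])
  thus "\<eta> x \<le> 1" for x using \<rho>i by simp
  show "d > 0" by (rule d)
  show "\<eta> y = 1" if x: "x \<in> K" "dist x y \<le> d" for x y
  proof -
   have "indicator (N (2 * d)) q * ?\<rho> (y + (- q)) = ?\<rho> (y + (- q))" for q
   proof (cases "norm (y - q) \<ge> d")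
    case False
    have "dist x q \<le> 2 * d"
     using False x(2) dist_triangle[of x q y] by (simp add: dist_norm)
    hence "q \<in> N (2 * d)" using N x by blast
    thus ?thesis by simp
   qed (simp add: mollifier_eq_0[OF d])
   thus ?thesis unfolding \<eta>_def using \<rho>i(2) by (simp only:)
  qed
 qed
qed

section \<open>Density of test functions and duality\<close>

definition test_approximable :: "'a::euclidean_space set \<Rightarrow> ('a \<Rightarrow> real) \<Rightarrow> bool" where
 "test_approximable S f \<longleftrightarrow> (\<forall>e>0. \<exists>\<phi>\<in>\<D> S. l2 lborel (\<lambda>x. f x - \<phi> x) < e)"

lemma test_approximable_limit:
 assumes f: "sqint lborel f" and g: "\<And>n. sqint lborel (g n)" "\<And>n. test_approximable S (g n)"
  and lim: "(\<lambda>n. l2 lborel (\<lambda>x. f x - g n x)) \<longlonglongrightarrow> 0"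
 shows "test_approximable S f"
 unfolding test_approximable_def
proof (intro allI impI)
 fix e :: real assume "e > 0"
 then obtain n where n: "l2 lborel (\<lambda>x. f x - g n x) < e / 2"
  using order_tendstoD(2)[OF lim, of "e / 2"] eventually_happens by fastforce
 obtain \<phi> where \<phi>: "\<phi> \<in> \<D> S" "l2 lborel (\<lambda>x. g n x - \<phi> x) < e / 2"
  using g(2)[of n] \<open>e > 0\<close> unfolding test_approximable_def by (metis half_gt_zero)
 have "l2 lborel (\<lambda>x. f x - \<phi> x) \<le> l2 lborel (\<lambda>x. f x - g n x) + l2 lborel (\<lambda>x. g n x - \<phi> x)"
  using l2_triangle[OF sqint_diff[OF f g(1)[of n]] sqint_diff[OF g(1)[of n] test_sqint[OF \<phi>(1)]]]
  by simp
 thus "\<exists>\<phi>\<in>\<D> S. l2 lborel (\<lambda>x. f x - \<phi> x) < e" using n \<phi> by force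
qed

lemma test_approximable_add:
 assumes "sqint lborel f" "sqint lborel g" "test_approximable S f" "test_approximable S g"
 shows "test_approximable S (\<lambda>x. f x + g x)"
 unfolding test_approximable_def
proof (intro allI impI)
 fix e :: real assume "e > 0"
 obtain \<phi> where \<phi>: "\<phi> \<in> \<D> S" "l2 lborel (\<lambda>x. f x - \<phi> x) < e / 2"
  using assms(3) \<open>e > 0\<close> unfolding test_approximable_def by (metis half_gt_zero)
 obtain \<psi> where \<psi>: "\<psi> \<in> \<D> S" "l2 lborel (\<lambda>x. g x - \<psi> x) < e / 2"
  using assms(4) \<open>e > 0\<close> unfolding test_approximable_def by (metis half_gt_zero)
 have "l2 lborel (\<lambda>x. (f x - \<phi> x) + (g x - \<psi> x)) \<le> l2 lborel (\<lambda>x. f x - \<phi> x) + l2 lborel (\<lambda>x. g x - \<psi> x)"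
  by (intro l2_triangle sqint_diff assms test_sqint[OF \<phi>(1)] test_sqint[OF \<psi>(1)])
 hence "l2 lborel (\<lambda>x. f x + g x - (\<phi> x + \<psi> x)) < e"
  using \<phi>(2) \<psi>(2) by (simp add: algebra_simps)
 thus "\<exists>\<phi>\<in>\<D> S. l2 lborel (\<lambda>x. f x + g x - \<phi> x) < e"
  by (intro bexI[OF _ test_add[OF \<phi>(1) \<psi>(1)]])
qed

lemma test_approximable_cmult:
 assumes "test_approximable S f"
 shows "test_approximable S (\<lambda>x. c * f x)"
 unfolding test_approximable_def
proof (intro allI impI)
 fix e :: real assume "e > 0"
 hence "e / (\<bar>c\<bar> + 1) > 0" by (simp add: divide_pos_pos)
 then obtain \<phi> where \<phi>: "\<phi> \<in> \<D> S" "l2 lborel (\<lambda>x. f x - \<phi> x) < e / (\<bar>c\<bar> + 1)"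
  using assms unfolding test_approximable_def by blast
 have "l2 lborel (\<lambda>x. c * f x - c * \<phi> x) = \<bar>c\<bar> * l2 lborel (\<lambda>x. f x - \<phi> x)"
  using l2_cmult[of lborel c "\<lambda>x. f x - \<phi> x"] by (simp add: right_diff_distrib)
 also have "\<dots> \<le> (\<bar>c\<bar> + 1) * l2 lborel (\<lambda>x. f x - \<phi> x)"
  by (intro mult_right_mono) (auto simp: l2_nonneg)
 also have "\<dots> < e" using \<phi>(2) by (simp add: field_simps)
 finally show "\<exists>\<phi>\<in>\<D> S. l2 lborel (\<lambda>x. c * f x - \<phi> x) < e"
  by (intro bexI[OF _ test_mult2[OF \<phi>(1) smooth_const[of c]]])
qed

lemma l2_dominated_convergence:
 assumes g: "sqint M g" and f: "f \<in> borel_measurable M" "\<And>n. h n \<in> borel_measurable M"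
  and lim: "\<And>x. (\<lambda>n. h n x) \<longlonglongrightarrow> f x" and bd: "\<And>n x. \<bar>f x - h n x\<bar> \<le> \<bar>g x\<bar>"
 shows "(\<lambda>n. l2 M (\<lambda>x. f x - h n x)) \<longlonglongrightarrow> 0"
proof -
 have "(\<lambda>n. \<integral>x. (f x - h n x)\<^sup>2 \<partial>M) \<longlonglongrightarrow> (\<integral>x. 0 \<partial>M)"
 proof (rule integral_dominated_convergence[where w="\<lambda>x. (g x)\<^sup>2"])
  show "AE x in M. (\<lambda>n. (f x - h n x)\<^sup>2) \<longlonglongrightarrow> 0"
   using lim by (intro AE_I2) (auto intro!: tendsto_eq_intros)
  show "AE x in M. norm ((f x - h n x)\<^sup>2) \<le> (g x)\<^sup>2" for n
   using bd by (intro AE_I2) (simp add: abs_le_square_iff[symmetric])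
 qed (use f g in \<open>auto simp: sqint_def\<close>)
 thus ?thesis unfolding l2_def using tendsto_real_sqrt by fastforce
qed

text \<open>Regularity of Lebesgue measure squeezes a bounded \<open>A\<close> between a compact
  \<open>T\<close> and an open \<open>V\<close>; a cutoff that is 1 on \<open>T\<close> and
  supported in \<open>V\<close> errs only on \<open>V - T\<close>. Unbounded sets of finite measure
  are reached by truncation to balls.\<close>

lemma test_approximable_indicator:
 fixes A S :: "'a::euclidean_space set"
 assumes S: "open S" and A[measurable]: "A \<in> sets borel" and AS: "A \<subseteq> S" and fin: "emeasure lborel A < \<infinity>"
 shows "test_approximable S (indicator A)"
proof -
 have bdd: "test_approximable S (indicator A)"
  if A[measurable]: "A \<in> sets borel" and AS: "A \<subseteq> S" and bA: "bounded A" for A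
  unfolding test_approximable_def
 proof (intro allI impI)
  fix e :: real assume e: "e > 0"
  \<comment> \<open>The error in \<open>l2\<close> is the square root of the measure of
    \<open>V - T\<close>, which consists of two pieces; thirds instead of halves leave room for a
    strict inequality.\<close>
  hence e2: "e\<^sup>2 / 3 > 0" by simp
  have AL: "A \<in> sets lebesgue" using A by simp
  obtain T where T: "closed T" "T \<subseteq> A" "A - T \<in> lmeasurable" "emeasure lebesgue (A - T) < ennreal (e\<^sup>2 / 3)"
   using sets_lebesgue_inner_closed[OF AL e2] by metis
  obtain V0 where V0: "open V0" "A \<subseteq> V0" "V0 - A \<in> lmeasurable" "emeasure lebesgue (V0 - A) < ennreal (e\<^sup>2 / 3)"
   using sets_lebesgue_outer_open[OF AL e2] by metis
  define V where "V = V0 \<inter> S"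
  have V: "open V" "A \<subseteq> V" "V \<subseteq> S" using V0 S AS by (auto simp: V_def)
  have cT: "compact T" using T bA by (meson bounded_subset compact_eq_bounded_closed)
  have "T \<subseteq> V" using T V by auto
  then obtain \<eta> d where \<eta>: "\<eta> \<in> \<D> V" "\<And>x. 0 \<le> \<eta> x" "\<And>x. \<eta> x \<le> 1" "(d::real) > 0"
   "\<And>x y. x \<in> T \<Longrightarrow> dist x y \<le> d \<Longrightarrow> \<eta> y = 1"
   using smooth_cutoff[OF cT V(1)] by metis
  have [measurable]: "T \<in> sets borel" "V \<in> sets borel" using T V by auto
  have mV: "emeasure lborel (V - T) < ennreal (e\<^sup>2)"
  proof -
   have "emeasure lborel (V - T) \<le> emeasure lborel ((V0 - A) \<union> (A - T))"
    using V0 by (intro emeasure_mono) (auto simp: V_def)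
   also have "\<dots> \<le> emeasure lborel (V0 - A) + emeasure lborel (A - T)"
    using V0 by (intro emeasure_subadditive) auto
   also have "\<dots> \<le> ennreal (e\<^sup>2 / 3) + ennreal (e\<^sup>2 / 3)"
    using V0 T by (intro add_mono) (auto simp: less_imp_le)
   also have "\<dots> = ennreal (e\<^sup>2 / 3 + e\<^sup>2 / 3)" by (subst ennreal_plus) auto
   also have "\<dots> < ennreal (e\<^sup>2)" using e by (intro ennreal_lessI) auto
   finally show ?thesis .
  qed
  have fV: "emeasure lborel (V - T) < \<infinity>" using less_trans[OF mV ennreal_less_top] by simp
  have "l2 lborel (\<lambda>x. indicator A x - \<eta> x) \<le> l2 lborel (indicator (V - T))"
  proof (rule l2_mono(1))
   show "sqint lborel (indicator (V - T) :: 'a \<Rightarrow> real)" using fV by (intro sqint_indicator) auto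
   show "(\<lambda>x. indicator A x - \<eta> x) \<in> borel_measurable lborel"
    using test_borel[OF \<eta>(1)] by simp
   have "\<bar>indicator A x - \<eta> x\<bar> \<le> \<bar>indicator (V - T) x\<bar>" for x
   proof -
    consider "x \<in> T" | "x \<in> V - T" | "x \<notin> V" by blast
    thus ?thesis
    proof cases
     case 1 thus ?thesis using \<eta>(5)[of x x] \<eta>(4) T by auto
    next
     case 2 thus ?thesis using \<eta>(2,3)[of x] by (auto simp: indicator_def)
    next
     case 3 hence "x \<notin> A" "\<eta> x = 0" using test_zero_outside[OF \<eta>(1)] V by blast+
     thus ?thesis by simp
    qed
   qed
   thus "AE x in lborel. \<bar>indicator A x - \<eta> x\<bar> \<le> \<bar>indicator (V - T) x\<bar>" by simp
  qed
  also have "\<dots> = sqrt (measure lborel (V - T))"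
   unfolding l2_def by (simp add: power2_eq_square indicator_inter_arith[symmetric])
  also have "\<dots> < sqrt (e\<^sup>2)"
  proof (rule real_sqrt_less_mono)
   have "emeasure lborel (V - T) = ennreal (measure lborel (V - T))"
    using fV by (intro emeasure_eq_ennreal_measure) auto
   thus "measure lborel (V - T) < e\<^sup>2"
    using mV by (simp add: ennreal_less_iff)
  qed
  finally show "\<exists>\<phi>\<in>\<D> S. l2 lborel (\<lambda>x. indicator A x - \<phi> x) < e"
   using test_mono[OF \<eta>(1) V(3)] e by (auto intro!: bexI[of _ \<eta>])
 qed
 have sqi: "sqint lborel (indicator B :: 'a \<Rightarrow> real)" if "B \<in> sets borel" "B \<subseteq> A" for B
  using that emeasure_mono[OF that(2), of lborel] fin A by (intro sqint_indicator) (auto simp: le_less_trans)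
 show ?thesis
 proof (rule test_approximable_limit[where g="\<lambda>n. indicator (A \<inter> cball 0 (real n))"])
  show "sqint lborel (indicator A :: 'a \<Rightarrow> real)" by (rule sqi) auto
  show "sqint lborel (indicator (A \<inter> cball 0 (real n)) :: 'a \<Rightarrow> real)" for n by (rule sqi) auto
  show "test_approximable S (indicator (A \<inter> cball 0 (real n)))" for n
   using AS by (intro bdd) (auto intro: bounded_subset[OF bounded_cball])
  show "(\<lambda>n. l2 lborel (\<lambda>x::'a. indicator A x - indicator (A \<inter> cball 0 (real n)) x)) \<longlonglongrightarrow> 0"
  proof (rule l2_dominated_convergence[of _ "indicator A"])
   fix x :: 'a
   obtain N where N: "norm x \<le> real N" using real_arch_simple by blast
   show "(\<lambda>n. indicator (A \<inter> cball 0 (real n)) x) \<longlonglongrightarrow> (indicator A x :: real)"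
    by (rule tendsto_eventually, rule eventually_sequentiallyI[of N]) (use N in \<open>auto simp: indicator_def\<close>)
  qed (auto simp: indicator_def intro: sqi)
 qed
qed

text \<open>The approximating simple functions are bounded by \<open>2 * \<bar>f\<bar>\<close>.
  Hence their nonzero level sets lie in \<open>S\<close> and have finite measure, and each indicator
  can be approximated inside \<open>S\<close>.\<close>

lemma test_functions_dense:
 fixes f :: "'a::euclidean_space \<Rightarrow> real"
 assumes S: "open S" and f: "sqint lborel f" and z: "\<And>x. x \<notin> S \<Longrightarrow> f x = 0"
 shows "test_approximable S f"
proof -
 have fm[measurable]: "f \<in> borel_measurable borel" using f by (simp add: sqint_def)
 obtain s where s: "\<And>i. simple_function lborel (s i)"
  "\<And>x. (\<lambda>i. s i x) \<longlonglongrightarrow> f x" "\<And>i x. dist (s i x) 0 \<le> 2 * dist (f x) 0"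
  using borel_measurable_implies_sequence_metric[of f lborel 0] by auto
 have sm[measurable]: "s i \<in> borel_measurable borel" for i
  using borel_measurable_simple_function[OF s(1)[of i]] by simp
 have f2: "sqint lborel (\<lambda>x. 2 * f x)" by (rule sqint_cmult[OF f])
 have s2: "sqint lborel (s i)" for i
  using s(3)[of i] by (intro l2_mono(2)[OF f2]) (auto simp: abs_mult)
 have sapp: "test_approximable S (s i)" for i
 proof -
  have fin: "finite (range (s i))" using s(1)[of i] by (simp add: simple_function_def)
  have single: "sqint lborel (\<lambda>x. y * indicator (s i -` {y}) x)
    \<and> test_approximable S (\<lambda>x. y * indicator (s i -` {y}) x)" for y
  proof (cases "y = 0")
   case True
   thus ?thesis
    using sqint_zero test_zero[of S]
    by (auto simp: test_approximable_def l2_def intro!: bexI[of _ "\<lambda>x. 0"])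
  next
   case False
   have mm[measurable]: "s i -` {y} \<in> sets borel"
    using measurable_sets[OF sm[of i], of "{y}"] by simp
   have sq: "sqint lborel (\<lambda>x. y * indicator (s i -` {y}) x)"
    by (rule l2_mono(2)[OF s2[of i]]) (auto simp: indicator_def)
   have "sqint lborel (\<lambda>x. (1 / y) * (y * indicator (s i -` {y}) x))"
    by (rule sqint_cmult[OF sq])
   hence "integrable lborel (indicator (s i -` {y}) :: 'a \<Rightarrow> real)"
    using False unfolding sqint_def by (simp add: power2_eq_square indicator_inter_arith[symmetric])
   hence "emeasure lborel (s i -` {y}) < \<infinity>" by (simp add: integrable_indicator_iff)
   moreover have "s i -` {y} \<subseteq> S"
   proof
    fix x assume x: "x \<in> s i -` {y}"
    show "x \<in> S"
    proof (rule ccontr)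
     assume "x \<notin> S"
     thus False using s(3)[of i x] z[of x] x False by simp
    qed
   qed
   ultimately show ?thesis
    using sq test_approximable_cmult[OF test_approximable_indicator[OF S mm]] by blast
  qed
  have "sqint lborel (\<lambda>x. \<Sum>y\<in>Y. y * indicator (s i -` {y}) x)
    \<and> test_approximable S (\<lambda>x. \<Sum>y\<in>Y. y * indicator (s i -` {y}) x)" if "finite Y" for Y
   using that
  proof (induction Y rule: finite_induct)
   case empty
   thus ?case
    using sqint_zero test_zero[of S]
    by (auto simp: test_approximable_def l2_def intro!: bexI[of _ "\<lambda>x. 0"])
  next
   case (insert y Y)
   thus ?case using single[of y]
    sqint_add[of lborel "\<lambda>x. y * indicator (s i -` {y}) x" "\<lambda>x. \<Sum>y\<in>Y. y * indicator (s i -` {y}) x"]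
    test_approximable_add[of "\<lambda>x. y * indicator (s i -` {y}) x" "\<lambda>x. \<Sum>y\<in>Y. y * indicator (s i -` {y}) x"]
    by (simp only: sum.insert[OF insert.hyps])
  qed
  moreover have "(\<lambda>x. \<Sum>y\<in>range (s i). y * indicator (s i -` {y}) x) = s i"
   using fin by (auto simp: indicator_def if_distrib[of "(*) _"] fun_eq_iff cong: if_cong)
  ultimately show ?thesis using fin by metis
 qed
 show ?thesis
 proof (rule test_approximable_limit[OF f s2 sapp])
  show "(\<lambda>n. l2 lborel (\<lambda>x. f x - s n x)) \<longlonglongrightarrow> 0"
  proof (rule l2_dominated_convergence[OF sqint_cmult[OF f, of 3] _ _ s(2)])
   show "\<bar>f x - s n x\<bar> \<le> \<bar>3 * f x\<bar>" for n x
    using s(3)[of n x] by (simp add: abs_mult)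
  qed auto
 qed
qed

text \<open>The test functions dense in L2 suffice to compute the norm. The bounds for the remainder
  and for the weak gradient, as well as the uniqueness of weak gradients, come through this lemma,
  because these objects are known only through their pairings.\<close>

lemma l2_le_by_duality:
 assumes S: "open S" and f: "sqint lborel f" and z: "\<And>x. x \<notin> S \<Longrightarrow> f x = 0"
  and C0: "C \<ge> 0"
  and C: "\<And>\<phi>. \<phi> \<in> \<D> S \<Longrightarrow> \<bar>LBINT x. f x * \<phi> x\<bar> \<le> C * l2 lborel \<phi>"
 shows "l2 lborel f \<le> C"
proof (rule field_le_epsilon)
 fix e :: real assume e: "e > 0"
 let ?n = "l2 lborel f"
 show "?n \<le> C + e"
 proof (cases "?n = 0")
  case False
  hence n: "?n > 0" using l2_nonneg[of lborel f] by linarith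
  \<comment> \<open>Chosen so that the approximation error \<open>(C + ?n) * d\<close> equals
    \<open>e * ?n\<close>, which becomes \<open>e\<close> after division by
    \<open>?n\<close>.\<close>
  define d where "d = e * ?n / (C + ?n)"
  have d: "d > 0" unfolding d_def using e n C0 by simp
  then obtain \<phi> where \<phi>: "\<phi> \<in> \<D> S" "l2 lborel (\<lambda>x. f x - \<phi> x) < d"
   using test_functions_dense[OF S f z] unfolding test_approximable_def by blast
  have sq: "sqint lborel \<phi>" by (rule test_sqint[OF \<phi>(1)])
  note sqd = sqint_diff[OF f sq]
  have "?n\<^sup>2 = (LBINT x. f x * \<phi> x + f x * (f x - \<phi> x))"
   unfolding l2_sq by (simp add: algebra_simps power2_eq_square)
  also have "\<dots> = (LBINT x. f x * \<phi> x) + (LBINT x. f x * (f x - \<phi> x))"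
   using sqint_mult[OF f sq] sqint_mult[OF f sqd] by simp
  also have "\<dots> \<le> C * l2 lborel \<phi> + ?n * l2 lborel (\<lambda>x. f x - \<phi> x)"
   using C[OF \<phi>(1)] Cauchy_Schwarz_l2[OF f sqd] by linarith
  also have "l2 lborel \<phi> \<le> ?n + l2 lborel (\<lambda>x. f x - \<phi> x)"
   using l2_triangle_diff[OF f sqd] by simp
  hence "C * l2 lborel \<phi> + ?n * l2 lborel (\<lambda>x. f x - \<phi> x) \<le> C * (?n + d) + ?n * d"
   using \<phi>(2) C0 n by (intro add_mono mult_left_mono) auto
  also have "\<dots> = C * ?n + (C + ?n) * d" by (simp add: algebra_simps)
  also have "(C + ?n) * d = e * ?n" using n C0 by (simp add: d_def)
  also have "C * ?n + e * ?n = (C + e) * ?n" by (simp add: algebra_simps)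
  finally show ?thesis using n by (simp add: power2_eq_square)
 qed (use e C0 in simp)
qed

section \<open>Gaussian weights\<close>

lemma Cauchy_Schwarz_weighted:
 fixes w f :: "'m \<Rightarrow> real"
 assumes w: "integrable M w" and wf2: "integrable M (\<lambda>q. \<bar>w q\<bar> * (f q)\<^sup>2)" and wf: "integrable M (\<lambda>q. w q * f q)"
  and [measurable]: "f \<in> borel_measurable M"
 shows "(\<integral>q. w q * f q \<partial>M)\<^sup>2 \<le> (\<integral>q. \<bar>w q\<bar> \<partial>M) * (\<integral>q. \<bar>w q\<bar> * (f q)\<^sup>2 \<partial>M)"
proof -
 have [measurable]: "w \<in> borel_measurable M" using w by auto
 let ?a = "\<lambda>q. sqrt \<bar>w q\<bar>" and ?b = "\<lambda>q. sqrt \<bar>w q\<bar> * \<bar>f q\<bar>"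
 have a: "sqint M ?a" using w by (simp add: sqint_def)
 have b: "sqint M ?b" using wf2 by (simp add: sqint_def power_mult_distrib)
 have "\<bar>\<integral>q. w q * f q \<partial>M\<bar> \<le> (\<integral>q. \<bar>w q * f q\<bar> \<partial>M)" by (rule integral_abs_bound)
 also have "(\<integral>q. \<bar>w q * f q\<bar> \<partial>M) = (\<integral>q. ?a q * ?b q \<partial>M)"
  by (rule arg_cong[where f="integral\<^sup>L M"]) (auto simp: abs_mult)
 also have "\<dots> \<le> \<bar>\<integral>q. ?a q * ?b q \<partial>M\<bar>" by simp
 also have "\<dots> \<le> l2 M ?a * l2 M ?b" by (rule Cauchy_Schwarz_l2[OF a b])
 finally have "\<bar>\<integral>q. w q * f q \<partial>M\<bar>\<^sup>2 \<le> (l2 M ?a * l2 M ?b)\<^sup>2" by (intro power_mono) auto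
 thus ?thesis by (simp add: power_mult_distrib l2_sq)
qed

lemma nn_integral_lborel_translate:
 assumes [measurable]: "f \<in> borel_measurable borel"
 shows "(\<integral>\<^sup>+x. f (x + a) \<partial>lborel) = (\<integral>\<^sup>+x. f x \<partial>lborel)"
proof -
 have "(\<integral>\<^sup>+x. f x \<partial>lborel) = (\<integral>\<^sup>+x. f x \<partial>(distr lborel borel ((+) a)))"
  by (simp add: lborel_distr_plus)
 also have "\<dots> = (\<integral>\<^sup>+x. f (x + a) \<partial>lborel)"
  by (subst nn_integral_distr) (auto simp: add.commute)
 finally show ?thesis by simp
qed

text \<open>Young's inequality with an integrable weight: weighted Cauchy-Schwarz at each point,
  then Tonelli and translation invariance. Working with nonnegative integrals yields finiteness and
  the bound at once. Applied to the heat potentials, it makes the L1 norms of their weights the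
  operator bounds on L2.\<close>

lemma average_translates_l2:
 assumes M: "sigma_finite_measure M" and w: "integrable M w" and Y[measurable]: "Y \<in> borel_measurable M"
  and f: "f \<in> \<D> UNIV"
 shows "sqint lborel (\<lambda>p. \<integral>q. w q * f (p + Y q) \<partial>M)"
  and "l2 lborel (\<lambda>p. \<integral>q. w q * f (p + Y q) \<partial>M) \<le> (\<integral>q. \<bar>w q\<bar> \<partial>M) * l2 lborel f"
proof -
 interpret M: sigma_finite_measure M by fact
 interpret pair_sigma_finite lborel M ..
 let ?z = "\<lambda>p. \<integral>q. w q * f (p + Y q) \<partial>M" and ?W = "\<integral>q. \<bar>w q\<bar> \<partial>M"
 have W0: "?W \<ge> 0" by (simp add: integral_nonneg)
 have [measurable]: "w \<in> borel_measurable M" using w by auto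
 note [measurable] = test_borel[OF f]
 have zm[measurable]: "?z \<in> borel_measurable borel"
  by (rule smooth_borel[OF average_translates(1)[OF w Y f]])
 have wf2: "integrable M (\<lambda>q. \<bar>w q\<bar> * (f (p + Y q))\<^sup>2)" for p
  unfolding power2_eq_square
  by (rule average_translates_integrable[OF _ Y test_mult[OF f test_smooth[OF f]]]) (use w in auto)
 have pt: "(?z p)\<^sup>2 \<le> ?W * (\<integral>q. \<bar>w q\<bar> * (f (p + Y q))\<^sup>2 \<partial>M)" for p
  by (rule Cauchy_Schwarz_weighted[OF w wf2 average_translates_integrable[OF w Y f]]) simp
 have "(\<integral>\<^sup>+p. ennreal ((?z p)\<^sup>2) \<partial>lborel) \<le> (\<integral>\<^sup>+p. ennreal ?W * (\<integral>\<^sup>+q. ennreal (\<bar>w q\<bar> * (f (p + Y q))\<^sup>2) \<partial>M) \<partial>lborel)"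
 proof (rule nn_integral_mono)
  fix p
  have "ennreal ((?z p)\<^sup>2) \<le> ennreal (?W * (\<integral>q. \<bar>w q\<bar> * (f (p + Y q))\<^sup>2 \<partial>M))"
   by (rule ennreal_leI[OF pt])
  also have "\<dots> = ennreal ?W * (\<integral>\<^sup>+q. ennreal (\<bar>w q\<bar> * (f (p + Y q))\<^sup>2) \<partial>M)"
   by (subst nn_integral_eq_integral[OF wf2]) (auto simp: ennreal_mult' W0)
  finally show "ennreal ((?z p)\<^sup>2) \<le> \<dots>" .
 qed
 also have "\<dots> = ennreal ?W * (\<integral>\<^sup>+p. (\<integral>\<^sup>+q. ennreal (\<bar>w q\<bar> * (f (p + Y q))\<^sup>2) \<partial>M) \<partial>lborel)"
  by (rule nn_integral_cmult) measurable
 also have "(\<integral>\<^sup>+p. (\<integral>\<^sup>+q. ennreal (\<bar>w q\<bar> * (f (p + Y q))\<^sup>2) \<partial>M) \<partial>lborel)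
   = (\<integral>\<^sup>+q. (\<integral>\<^sup>+p. ennreal (\<bar>w q\<bar> * (f (p + Y q))\<^sup>2) \<partial>lborel) \<partial>M)"
  by (rule Fubini'[symmetric]) measurable
 also have "\<dots> = (\<integral>\<^sup>+q. ennreal \<bar>w q\<bar> * ennreal (LBINT p. (f p)\<^sup>2) \<partial>M)"
 proof (rule nn_integral_cong)
  fix q
  have "(\<integral>\<^sup>+p. ennreal (\<bar>w q\<bar> * (f (p + Y q))\<^sup>2) \<partial>lborel) = (\<integral>\<^sup>+p. ennreal (\<bar>w q\<bar> * (f p)\<^sup>2) \<partial>lborel)"
   by (rule nn_integral_lborel_translate[of "\<lambda>p. ennreal (\<bar>w q\<bar> * (f p)\<^sup>2)"]) measurable
  also have "\<dots> = ennreal (LBINT p. \<bar>w q\<bar> * (f p)\<^sup>2)"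
   by (rule nn_integral_eq_integral)
     (auto intro!: integrable_mult_right sqint_sq[OF test_sqint[OF f]])
  also have "\<dots> = ennreal \<bar>w q\<bar> * ennreal (LBINT p. (f p)\<^sup>2)"
   by (simp add: ennreal_mult integral_nonneg)
  finally show "(\<integral>\<^sup>+p. ennreal (\<bar>w q\<bar> * (f (p + Y q))\<^sup>2) \<partial>lborel)
    = ennreal \<bar>w q\<bar> * ennreal (LBINT p. (f p)\<^sup>2)" .
 qed
 also have "\<dots> = ennreal ?W * ennreal (LBINT p. (f p)\<^sup>2)"
  by (subst nn_integral_multc) (auto simp: nn_integral_eq_integral w)
 also have "ennreal ?W * (ennreal ?W * ennreal (LBINT p. (f p)\<^sup>2)) = ennreal ((?W * l2 lborel f)\<^sup>2)"
 proof -
  have "(?W * l2 lborel f)\<^sup>2 = ?W * (?W * (LBINT p. (f p)\<^sup>2))"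
   by (simp only: power_mult_distrib l2_sq power2_eq_square[of ?W] mult.assoc)
  thus ?thesis by (simp only: ennreal_mult'[OF W0])
 qed
 finally have le: "(\<integral>\<^sup>+p. ennreal ((?z p)\<^sup>2) \<partial>lborel) \<le> ennreal ((?W * l2 lborel f)\<^sup>2)" .
 show sq: "sqint lborel ?z"
  unfolding sqint_def
  using le by (auto intro!: integrableI_bounded simp: le_less_trans[OF _ ennreal_less_top])
 have "(l2 lborel ?z)\<^sup>2 \<le> (?W * l2 lborel f)\<^sup>2"
  using le by (simp add: l2_sq nn_integral_eq_integral[OF sqint_sq[OF sq]])
 thus "l2 lborel ?z \<le> ?W * l2 lborel f"
  by (rule power2_le_imp_le) (simp add: W0 l2_nonneg)
qed

text \<open>The heat kernel of \<open>\<partial>_t - \<Delta>\<close> at time 1, hence the 4 in the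
  exponent. Dividing by the integral instead of an explicit power of 4 pi avoids evaluating that
  integral.\<close>

definition gauss :: "'a::euclidean_space \<Rightarrow> real" where
 "gauss x = exp (- (x \<bullet> x) / 4) / (\<integral>y. exp (- (y \<bullet> y) / 4) \<partial>(lborel :: 'a measure))"

text \<open>Half of the Gaussian rate, by a product over the coordinates. The other half of the
  exponent 1/4 is spent in \<open>coord_exp_le\<close> to absorb a linear factor, so this one
  majorant serves the Gaussian and its first moments.\<close>

lemma integrable_exp_inner:
 "integrable lborel (\<lambda>x::'a::euclidean_space. exp (- (x \<bullet> x) / 8))"
proof (rule integrableI_bounded)
 have "integrable lborel (\<lambda>t::real. exp (- t\<^sup>2 / 8))"
  using integrable_mult_right[OF integrable_normal_density[of 2 0], of "sqrt (2 * pi * 2\<^sup>2)"]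
  by (simp add: normal_density_def)
 hence fin1: "(\<integral>\<^sup>+t. ennreal (exp (- t\<^sup>2 / 8)) \<partial>(lborel :: real measure)) < \<infinity>"
  by (simp add: nn_integral_eq_integral)
 have "(\<integral>\<^sup>+x. ennreal (norm (exp (- ((x::'a) \<bullet> x) / 8))) \<partial>lborel)
   = (\<integral>\<^sup>+x. (\<Prod>b\<in>Basis. ennreal (exp (- ((x::'a) \<bullet> b)\<^sup>2 / 8))) \<partial>lborel)"
 proof (rule nn_integral_cong)
  fix x :: 'a
  have "- (x \<bullet> x) / 8 = (\<Sum>b\<in>Basis. - (x \<bullet> b)\<^sup>2 / 8)"
   by (subst euclidean_inner) (simp add: sum_divide_distrib sum_negf power2_eq_square)
  thus "ennreal (norm (exp (- (x \<bullet> x) / 8))) = (\<Prod>b\<in>Basis. ennreal (exp (- (x \<bullet> b)\<^sup>2 / 8)))"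
   by (simp only: exp_sum[OF finite_Basis]) (simp add: prod_ennreal abs_of_nonneg prod_nonneg)
 qed
 also have "\<dots> = (\<Prod>b\<in>(Basis::'a set). (\<integral>\<^sup>+t. ennreal (exp (- t\<^sup>2 / 8)) \<partial>lborel))"
  by (rule nn_integral_lborel_prod) auto
 also have "\<dots> < \<infinity>" using fin1 by (simp add: power_less_top_ennreal)
 finally show "(\<integral>\<^sup>+x. ennreal (norm (exp (- ((x::'a) \<bullet> x) / 8))) \<partial>lborel) < \<infinity>" .
qed simp

lemma coord_exp_le:
 shows "\<bar>x \<bullet> v\<bar> * exp (- (x \<bullet> x) / 4) \<le> (norm v * 4) * exp (- (x \<bullet> x) / 8)"
proof -
 have "norm x \<le> 4 * exp ((x \<bullet> x) / 8)"
 proof -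
  have "1 + (x \<bullet> x) / 8 \<le> exp ((x \<bullet> x) / 8)" by (rule exp_ge_add_one_self)
  moreover have "norm x \<le> 4 * (1 + (x \<bullet> x) / 8)"
   unfolding power2_norm_eq_inner[symmetric] using zero_le_power2[of "norm x - 1"] by (simp add: power2_diff)
  ultimately show ?thesis by argo
 qed
 hence "norm x * exp (- (x \<bullet> x) / 4) \<le> 4 * exp ((x \<bullet> x) / 8) * exp (- (x \<bullet> x) / 4)"
  by (intro mult_right_mono) auto
 also have "\<dots> = 4 * exp (- (x \<bullet> x) / 8)" by (simp add: exp_add[symmetric] mult.assoc)
 finally have "norm v * (norm x * exp (- (x \<bullet> x) / 4)) \<le> norm v * (4 * exp (- (x \<bullet> x) / 8))"
  by (intro mult_left_mono) auto
 moreover have "\<bar>x \<bullet> v\<bar> * exp (- (x \<bullet> x) / 4) \<le> norm v * (norm x * exp (- (x \<bullet> x) / 4))"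
  unfolding mult.assoc[symmetric] using Cauchy_Schwarz_ineq2[of x v]
  by (intro mult_right_mono) (auto simp: mult.commute)
 ultimately show ?thesis by (simp only: mult.assoc)
qed

lemma
 shows integrable_gauss: "integrable lborel (gauss :: 'a::euclidean_space \<Rightarrow> real)"
  and integrable_gauss_coord: "integrable lborel (\<lambda>x::'a. \<bar>x \<bullet> v\<bar> * gauss x)"
  and gauss_integral: "(LBINT x. gauss (x::'a)) = 1"
  and gauss_pos: "gauss (x::'a) > 0"
  and gauss_const_pos: "(\<integral>y. exp (- (y \<bullet> y) / 4) \<partial>(lborel :: 'a measure)) > 0"
proof -
 let ?e = "\<lambda>x::'a. exp (- (x \<bullet> x) / 4)"
 have i: "integrable lborel ?e"
  by (rule integrable_bound[OF integrable_exp_inner[where 'a='a]]) auto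
 have "(LBINT x. ?e x) \<noteq> 0"
 proof
  assume "(LBINT x. ?e x) = 0"
  hence "AE x in lborel. ?e x = 0" using integral_nonneg_eq_0_iff_AE[OF i] by auto
  hence "AE x in (lborel :: 'a measure). False" by simp
  hence "emeasure (lborel :: 'a measure) UNIV = 0"
   by (subst (asm) AE_iff_measurable[of UNIV]) auto
  thus False by (simp add: emeasure_lborel_UNIV)
 qed
 moreover have "(LBINT x. ?e x) \<ge> 0" by (intro integral_nonneg) simp
 ultimately show c: "(LBINT x. ?e x) > 0" by linarith
 show "integrable lborel (gauss :: 'a \<Rightarrow> real)"
  unfolding gauss_def[abs_def] using i by simp
 show "gauss x > 0" using c by (simp add: gauss_def)
 show "(LBINT x. gauss (x::'a)) = 1" unfolding gauss_def using c by simp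
 have "integrable lborel (\<lambda>x::'a. \<bar>x \<bullet> v\<bar> * ?e x)"
  using coord_exp_le[of _ v]
  by (intro integrable_bound[OF integrable_mult_right[OF integrable_exp_inner, of "norm v * 4"]]) auto
 thus "integrable lborel (\<lambda>x::'a. \<bar>x \<bullet> v\<bar> * gauss x)"
  unfolding gauss_def using integrable_divide by fastforce
qed

lemma gauss_borel[measurable]: "gauss \<in> borel_measurable borel"
 using integrable_gauss by auto

lemma gauss_has_derivative:
 "((\<lambda>s. gauss (x + s *\<^sub>R v)) has_real_derivative - ((x \<bullet> v) / 2) * gauss x) (at 0)"
proof -
 have "((\<lambda>s. exp (- ((x + s *\<^sub>R v) \<bullet> (x + s *\<^sub>R v)) / 4)) has_real_derivative
   - ((x \<bullet> v) / 2) * exp (- (x \<bullet> x) / 4)) (at 0)"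
 proof -
  have "((\<lambda>s. exp (- (x \<bullet> x + 2 * s * (x \<bullet> v) + s\<^sup>2 * (v \<bullet> v)) / 4)) has_real_derivative
   - ((x \<bullet> v) / 2) * exp (- (x \<bullet> x) / 4)) (at 0)"
   by (auto intro!: derivative_eq_intros)
  thus ?thesis by (simp add: inner_simps inner_commute power2_eq_square algebra_simps)
 qed
 thus ?thesis unfolding gauss_def by (rule DERIV_cdivide[THEN DERIV_cong]) simp
qed

lemma gauss_le: "gauss (x::'a::euclidean_space) \<le> gauss (0::'a)"
 using gauss_const_pos[where 'a='a] by (simp add: gauss_def divide_right_mono)

lemma integrable_lborel_prod_mult:
 fixes f :: "'b::euclidean_space \<Rightarrow> real" and g :: "'a::euclidean_space \<Rightarrow> real"
 assumes f: "integrable lborel f" and g: "integrable lborel g"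
 shows "integrable lborel (\<lambda>q. f (fst q) * g (snd q))"
proof -
 have [measurable]: "f \<in> borel_measurable borel" "g \<in> borel_measurable borel" using f g by auto
 have "integrable (lborel \<Otimes>\<^sub>M lborel) (\<lambda>q. f (fst q) * g (snd q))"
  by (rule lborel_pair.Fubini_integrable) (use f g in \<open>auto simp: abs_mult\<close>)
 thus ?thesis by (simp add: lborel_prod)
qed

lemma gauss_coord_le:
 fixes x v :: "'a::euclidean_space"
 shows "\<bar>x \<bullet> v\<bar> * gauss x \<le> 4 * norm v * gauss (0::'a)"
proof -
 have "exp (- (x \<bullet> x) / 8) \<le> 1" by simp
 hence "(norm v * 4) * exp (- (x \<bullet> x) / 8) \<le> (norm v * 4) * 1" by (intro mult_left_mono) auto
 hence "\<bar>x \<bullet> v\<bar> * exp (- (x \<bullet> x) / 4) \<le> norm v * 4" using coord_exp_le[of x v] by linarith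
 thus ?thesis
  using gauss_const_pos[where 'a='a] by (simp add: gauss_def divide_right_mono mult.commute)
qed

text \<open>This singularity is the price of moving one spatial derivative onto the heat kernel; its
  integrability at time 0 is what makes that move possible.\<close>

lemma integrable_inverse_sqrt:
 assumes T: "T > 0"
 shows "integrable lborel (\<lambda>t. indicator {0<..<T} t / sqrt t)"
proof -
 let ?g = "\<lambda>t. if t \<in> {0<..<T} then 1 / sqrt t else 0"
 have "((\<lambda>t. 1 / sqrt t) has_integral (2 * sqrt T - 2 * sqrt 0)) {0..T}"
  by (rule fundamental_theorem_of_calculus_interior)
    (use T in \<open>auto intro!: continuous_intros derivative_eq_intros simp: has_real_derivative_iff_has_vector_derivative[symmetric] field_simps\<close>)
 hence "((\<lambda>t. 1 / sqrt t) has_integral (2 * sqrt T)) {0<..<T}"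
  by (simp add: has_integral_Icc_iff_Ioo)
 hence "(?g has_integral (2 * sqrt T)) UNIV" by (subst has_integral_restrict_UNIV)
 hence "integral\<^sup>N lborel ?g = ennreal (2 * sqrt T)"
  by (intro nn_integral_has_integral_lborel) auto
 hence "integrable lborel ?g"
  by (intro integrableI_nonneg) auto
 moreover have "?g = (\<lambda>t. indicator {0<..<T} t / sqrt t)" by (auto simp: indicator_def)
 ultimately show ?thesis by simp
qed

section \<open>Heat potentials\<close>

lemma sum_Basis_real_prod:
 fixes g :: "real \<times> 'a::euclidean_space \<Rightarrow> real"
 shows "(\<Sum>j\<in>Basis. g j) = g (1, 0) + (\<Sum>i\<in>Basis. g (0, i))"
proof -
 have B: "(Basis :: (real \<times> 'a) set) = insert (1, 0) ((\<lambda>i. (0::real, i)) ` Basis)"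
  by (auto simp: Basis_prod_def)
 have "(\<Sum>j\<in>Basis. g j) = g (1, 0) + (\<Sum>j\<in>(\<lambda>i. (0::real, i)) ` Basis. g j)"
  unfolding B by (rule sum.insert) auto
 also have "(\<Sum>j\<in>(\<lambda>i. (0::real, i)) ` Basis. g j) = (\<Sum>i\<in>Basis. g (0, i))"
  by (subst sum.reindex) (auto simp: inj_on_def)
 finally show ?thesis .
qed

lemma Basis_real_prod[simp]: "(1, 0) \<in> (Basis :: (real \<times> 'a::euclidean_space) set)"
 "i \<in> Basis \<Longrightarrow> (0, i) \<in> (Basis :: (real \<times> 'a) set)"
 by (auto simp: Basis_prod_def)

text \<open>A general normed field is used because the lemma serves twice: for real time derivatives
  of Gaussian averages and for holomorphic dependence on a complex parameter. The integrable
  Lipschitz constant \<open>h\<close> dominates the difference quotients.\<close>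

lemma has_field_derivative_lebesgue_integral:
 fixes F :: "'b::{banach,real_normed_field,second_countable_topology} \<Rightarrow> 'm \<Rightarrow> 'b"
 assumes S: "open S" "z0 \<in> S" and d: "\<And>q. ((\<lambda>z. F z q) has_field_derivative F' q) (at z0)"
  and int: "\<And>z. z \<in> S \<Longrightarrow> integrable M (F z)"
  and lip: "\<And>z q. z \<in> S \<Longrightarrow> norm (F z q - F z0 q) \<le> h q * norm (z - z0)" and h: "integrable M h"
 shows "((\<lambda>z. \<integral>q. F z q \<partial>M) has_field_derivative (\<integral>q. F' q \<partial>M)) (at z0)"
 unfolding has_field_derivative_iff tendsto_at_iff_sequentially
proof (intro allI impI)
 fix X :: "nat \<Rightarrow> 'b" assume X: "\<forall>i. X i \<in> UNIV - {z0}" "X \<longlonglongrightarrow> z0"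
 obtain N where N: "\<And>n. n \<ge> N \<Longrightarrow> X n \<in> S"
  using topological_tendstoD[OF X(2) S] unfolding eventually_sequentially by blast
 let ?X = "\<lambda>n. X (n + N)"
 have Xn: "?X n \<in> S" "?X n \<noteq> z0" for n using N X(1) by auto
 let ?D = "\<lambda>n q. (F (?X n) q - F z0 q) / (?X n - z0)"
 have lim: "(\<lambda>n. ?D n q) \<longlonglongrightarrow> F' q" for q
  using d[of q] Xn LIMSEQ_ignore_initial_segment[OF X(2), of N]
  unfolding has_field_derivative_iff tendsto_at_iff_sequentially comp_def by simp
 have Dm: "?D n \<in> borel_measurable M" for n
  using int[OF Xn(1)] int[OF S(2)] by (auto intro!: borel_measurable_divide borel_measurable_diff)
 have "(\<lambda>n. \<integral>q. ?D n q \<partial>M) \<longlonglongrightarrow> (\<integral>q. F' q \<partial>M)"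
 proof (rule integral_dominated_convergence[OF borel_measurable_LIMSEQ_metric[OF Dm lim] Dm h])
  show "AE q in M. norm (?D n q) \<le> h q" for n
   using lip[OF Xn(1), of n] Xn(2)[of n] by (simp add: norm_divide pos_divide_le_eq)
 qed (simp add: lim)
 moreover have "(\<integral>q. ?D n q \<partial>M) = ((\<integral>q. F (?X n) q \<partial>M) - (\<integral>q. F z0 q \<partial>M)) / (?X n - z0)" for n
  using int[OF Xn(1)] int[OF S(2)] by simp
 ultimately have "(\<lambda>n. ((\<integral>q. F (?X n) q \<partial>M) - (\<integral>q. F z0 q \<partial>M)) / (?X n - z0)) \<longlonglongrightarrow> (\<integral>q. F' q \<partial>M)"
  by (simp only:)
 thus "((\<lambda>z. ((\<integral>q. F z q \<partial>M) - (\<integral>q. F z0 q \<partial>M)) / (z - z0)) \<circ> X) \<longlonglongrightarrow> (\<integral>q. F' q \<partial>M)"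
  unfolding comp_def by (rule LIMSEQ_offset)
qed

text \<open>Along \<open>i\<close> the Gaussian has logarithmic derivative
  \<open>- (x \<bullet> i) / 2\<close>, while the rescaled argument contributes
  \<open>sqrt t\<close>; their quotient is the factor on the right.\<close>

lemma gauss_integral_by_parts:
 fixes f :: "real \<times> 'a::euclidean_space \<Rightarrow> real"
 assumes f: "f \<in> \<D> UNIV" and t: "t > 0" and i: "i \<in> Basis"
 shows "(LBINT x. gauss x * pd (0, i) f (p + (t, sqrt t *\<^sub>R x)))
  = (LBINT x. ((x \<bullet> i) / (2 * sqrt t) * gauss x) * f (p + (t, sqrt t *\<^sub>R x)))"
proof -
 let ?Y = "\<lambda>x. (t, sqrt t *\<^sub>R x) :: real \<times> 'a"
 have Y: "?Y \<in> borel_measurable lborel" by simp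
 note f' = test_partial_deriv[OF f Basis_real_prod(2)[OF i]]
 have w: "integrable lborel (\<lambda>x::'a. (x \<bullet> i) * gauss x)"
  by (rule integrable_bound[OF integrable_gauss_coord[of i]]) (auto simp: abs_mult gauss_pos less_imp_le)
 have i1: "integrable lborel (\<lambda>x. gauss x * pd (0, i) f (p + ?Y x))"
  by (rule average_translates_integrable[OF integrable_gauss Y f'])
 have i2: "integrable lborel (\<lambda>x. ((x \<bullet> i) * gauss x) * f (p + ?Y x))"
  by (rule average_translates_integrable[OF w Y f])
 obtain B where B: "\<And>x. \<bar>f x\<bar> \<le> B" using test_bounded[OF f] by metis
 obtain B' where B': "\<And>x. \<bar>pd (0, i) f x\<bar> \<le> B'" using test_bounded[OF f'] by metis
 obtain K where K: "compact K" "\<And>x. x \<notin> K \<Longrightarrow> f x = 0" using test_functionsE[OF f] by metis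
 obtain R where R: "\<And>x. x \<in> K \<Longrightarrow> norm x \<le> R" using compact_imp_bounded[OF K(1)] unfolding bounded_iff by blast
 \<comment> \<open>The directional derivative of \<open>gauss x * f (p + ?Y x)\<close>, whose
   integral is 0.\<close>
 let ?G' = "\<lambda>x. - ((x \<bullet> i) / 2) * gauss x * f (p + ?Y x) + gauss x * (sqrt t * pd (0, i) f (p + ?Y x))"
 have "(LBINT x. ?G' x) = 0"
 proof (rule integral_directional_deriv_eq_0(1)[of "\<lambda>x. gauss x * f (p + ?Y x)" i])
  show "integrable lborel (\<lambda>x. gauss x * f (p + ?Y x))"
   by (rule average_translates_integrable[OF integrable_gauss Y f])
  show "((\<lambda>s. gauss (x + s *\<^sub>R i) * f (p + ?Y (x + s *\<^sub>R i))) has_real_derivative ?G' x) (at 0)" for x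
  proof -
   have "((\<lambda>s. f (p + ?Y x + (sqrt t * s) *\<^sub>R (0, i))) has_real_derivative
     pd (0, i) f (p + ?Y x + (sqrt t * 0) *\<^sub>R (0, i)) * sqrt t) (at 0)"
    by (rule DERIV_chain2[OF has_partial_deriv[OF test_smooth[OF f]]])
      (use i in \<open>auto intro!: derivative_eq_intros\<close>)
   moreover have "p + ?Y x + (sqrt t * s) *\<^sub>R (0, i) = p + ?Y (x + s *\<^sub>R i)" for s
    by (simp add: prod_eq_iff scaleR_add_right)
   moreover have "p + ?Y x + (sqrt t * 0) *\<^sub>R (0, i) = p + ?Y x"
    by (simp add: prod_eq_iff)
   ultimately have "((\<lambda>s. f (p + ?Y (x + s *\<^sub>R i))) has_real_derivative
     pd (0, i) f (p + ?Y x) * sqrt t) (at 0)" by (simp only:)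
   from DERIV_mult[OF gauss_has_derivative[of x i] this] show ?thesis
    by (simp add: algebra_simps)
  qed
  show "\<bar>?G' x\<bar> \<le> 2 * gauss (0::'a) * B + gauss (0::'a) * (sqrt t * B')" for x
  proof -
   have "\<bar>- ((x \<bullet> i) / 2) * gauss x * f (p + ?Y x)\<bar> = (\<bar>x \<bullet> i\<bar> * gauss x / 2) * \<bar>f (p + ?Y x)\<bar>"
    by (simp add: abs_mult gauss_pos less_imp_le)
   also have "\<dots> \<le> (2 * gauss (0::'a)) * B"
    using gauss_coord_le[of x i] i B by (intro mult_mono) (auto simp: gauss_pos less_imp_le)
   finally have "\<bar>- ((x \<bullet> i) / 2) * gauss x * f (p + ?Y x)\<bar> \<le> 2 * gauss (0::'a) * B" .
   moreover have "\<bar>gauss x * (sqrt t * pd (0, i) f (p + ?Y x))\<bar> \<le> gauss (0::'a) * (sqrt t * B')"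
    unfolding abs_mult using t B' gauss_le[of x] by (intro mult_mono) (auto simp: gauss_pos less_imp_le)
   ultimately show ?thesis by linarith
  qed
  show "norm i \<le> 1" using i by simp
  show "gauss x * f (p + ?Y x) = 0" if x: "norm x > (R + norm p) / sqrt t" for x
  proof -
   have "R + norm p < sqrt t * norm x" using x t by (simp add: field_simps)
   also have "\<dots> \<le> norm (?Y x)" using norm_snd_le[of "?Y x"] t by (simp add: norm_Pair)
   also have "\<dots> \<le> norm (p + ?Y x) + norm p" by (metis add_diff_cancel_left' norm_triangle_ineq4)
   finally have "R < norm (p + ?Y x)" by simp
   hence "p + ?Y x \<notin> K" using R[of "p + ?Y x"] by linarith
   thus ?thesis using K(2) by simp
  qed
 qed
 moreover have "(LBINT x. ?G' x) = - (1 / 2) * (LBINT x. ((x \<bullet> i) * gauss x) * f (p + ?Y x))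
   + sqrt t * (LBINT x. gauss x * pd (0, i) f (p + ?Y x))"
 proof -
  have "(LBINT x. ?G' x) = (LBINT x. - (1 / 2) * (((x \<bullet> i) * gauss x) * f (p + ?Y x))
    + sqrt t * (gauss x * pd (0, i) f (p + ?Y x)))"
   by (rule arg_cong[where f="integral\<^sup>L lborel"]) (auto simp: algebra_simps)
  also have "\<dots> = (LBINT x. - (1 / 2) * (((x \<bullet> i) * gauss x) * f (p + ?Y x)))
    + (LBINT x. sqrt t * (gauss x * pd (0, i) f (p + ?Y x)))"
   by (rule integral_add) (intro integrable_mult_right i1 i2)+
  finally show ?thesis by (simp only: integral_mult_right_zero)
 qed
 ultimately have "(LBINT x. gauss x * pd (0, i) f (p + ?Y x))
   = 1 / (2 * sqrt t) * (LBINT x. ((x \<bullet> i) * gauss x) * f (p + ?Y x))"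
  using t by (simp add: field_simps)
 also have "\<dots> = (LBINT x. ((x \<bullet> i) / (2 * sqrt t) * gauss x) * f (p + ?Y x))"
  by (subst integral_mult_right_zero[symmetric]) (rule arg_cong[where f="integral\<^sup>L lborel"], auto simp: field_simps)
 finally show ?thesis .
qed

lemma integral_add_sum:
 assumes "integrable M a" "\<And>i. i \<in> I \<Longrightarrow> integrable M (b i)"
 shows "(\<integral>x. a x + (\<Sum>i\<in>I. b i x) \<partial>M) = (\<integral>x. a x \<partial>M) + (\<Sum>i\<in>I. (\<integral>x. b i x \<partial>M))"
 using assms by (simp add: integral_sum)

text \<open>After the substitution \<open>y = sqrt t * x\<close> the spatial factor of the heat
  kernel becomes the fixed weight \<open>gauss\<close>, and its concentration at time 0 moves into
  this shift. The potential thereby becomes an average of translates.\<close>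

definition parabolic_shift :: "real \<times> 'a::euclidean_space \<Rightarrow> real \<times> 'a" where
 "parabolic_shift q = (fst q, sqrt (fst q) *\<^sub>R snd q)"

definition heat_weight :: "real \<Rightarrow> real \<times> 'a::euclidean_space \<Rightarrow> real" where
 "heat_weight T q = indicator {0<..<T} (fst q) * gauss (snd q)"

definition heat_weight_grad :: "real \<Rightarrow> 'a \<Rightarrow> real \<times> 'a::euclidean_space \<Rightarrow> real" where
 "heat_weight_grad T i q = indicator {0<..<T} (fst q) / sqrt (fst q) * ((snd q \<bullet> i) / 2 * gauss (snd q))"

text \<open>The source is evaluated at later times: this is the potential of the backward equation.
  It inverts \<open>heat_dual\<close> up to sign at points of nonnegative time, if the source
  vanishes from time \<open>T\<close> on.\<close>

definition heat_pot :: "real \<Rightarrow> (real \<times> 'a::euclidean_space \<Rightarrow> real) \<Rightarrow> real \<times> 'a \<Rightarrow> real" where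
 "heat_pot T f p = (LBINT q. heat_weight T q * f (p + parabolic_shift q))"

definition heat_pot_grad :: "real \<Rightarrow> 'a \<Rightarrow> (real \<times> 'a::euclidean_space \<Rightarrow> real) \<Rightarrow> real \<times> 'a \<Rightarrow> real" where
 "heat_pot_grad T i f p = (LBINT q. heat_weight_grad T i q * f (p + parabolic_shift q))"

lemma parabolic_shift_borel[measurable]: "parabolic_shift \<in> borel_measurable borel"
 unfolding parabolic_shift_def[abs_def] borel_prod[symmetric] by measurable

lemma integrable_heat_weight:
 "integrable lborel (heat_weight T :: real \<times> 'a::euclidean_space \<Rightarrow> real)"
 unfolding heat_weight_def[abs_def]
 by (rule integrable_lborel_prod_mult[OF _ integrable_gauss]) (cases "T > 0"; simp)

lemma integrable_heat_weight_grad: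
 assumes T: "T > 0"
 shows "integrable lborel (heat_weight_grad T i)"
proof -
 have "integrable lborel (\<lambda>x::'a. (x \<bullet> i) / 2 * gauss x)"
  by (rule integrable_bound[OF integrable_gauss_coord[of i]])
    (auto simp: abs_mult gauss_pos less_imp_le)
 thus ?thesis
  unfolding heat_weight_grad_def[abs_def]
  by (rule integrable_lborel_prod_mult[OF integrable_inverse_sqrt[OF T]])
qed

lemma lborel_integral_iterated:
 fixes F :: "'b::euclidean_space \<times> 'a::euclidean_space \<Rightarrow> real"
 assumes "integrable lborel F"
 shows "(LBINT q. F q) = (LBINT t. (LBINT x. F (t, x)))"
  and "integrable lborel (\<lambda>t. (LBINT x. F (t, x)))"
proof -
 have F: "integrable (lborel \<Otimes>\<^sub>M lborel) F" using assms by (simp add: lborel_prod)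
 show "(LBINT q. F q) = (LBINT t. (LBINT x. F (t, x)))"
  using lborel_pair.integral_fst'[OF F] by (simp add: lborel_prod)
 show "integrable lborel (\<lambda>t. (LBINT x. F (t, x)))"
  by (rule lborel_pair.integrable_fst'[OF F])
qed

lemma heat_pot_integrable:
 assumes "f \<in> \<D> UNIV"
 shows "integrable lborel (\<lambda>q. heat_weight T q * f (p + parabolic_shift q))"
 by (rule average_translates_integrable[OF integrable_heat_weight _ assms]) simp

lemma heat_pot_grad_integrable:
 assumes "f \<in> \<D> UNIV" "T > 0"
 shows "integrable lborel (\<lambda>q. heat_weight_grad T i q * f (p + parabolic_shift q))"
 by (rule average_translates_integrable[OF integrable_heat_weight_grad[OF assms(2)] _ assms(1)]) simp

text \<open>Integration by parts in each time slice. Together with the L2 bound for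
  \<open>heat_pot_grad\<close>, it bounds the potential of a derivative of \<open>f\<close> by the
  norm of \<open>f\<close> itself.\<close>

lemma heat_pot_partial_deriv:
 assumes f: "f \<in> \<D> UNIV" and T: "T > 0" and i: "i \<in> Basis"
 shows "heat_pot T (pd (0, i) f) p = heat_pot_grad T i f p"
proof -
 have "heat_pot T (pd (0, i) f) p
   = (LBINT t. (LBINT x. heat_weight T (t, x) * pd (0, i) f (p + parabolic_shift (t, x))))"
  unfolding heat_pot_def
  by (rule lborel_integral_iterated(1)[OF heat_pot_integrable[OF test_partial_deriv[OF f]]]) (use i in simp)
 also have "\<dots> = (LBINT t. (LBINT x. heat_weight_grad T i (t, x) * f (p + parabolic_shift (t, x))))"
 proof (rule integral_cong[OF refl])
  fix t :: real
  show "(LBINT x. heat_weight T (t, x) * pd (0, i) f (p + parabolic_shift (t, x)))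
   = (LBINT x. heat_weight_grad T i (t, x) * f (p + parabolic_shift (t, x)))"
  proof (cases "t \<in> {0<..<T}")
   case True
   thus ?thesis
    using gauss_integral_by_parts[OF f _ i, of t p]
    by (simp add: heat_weight_def heat_weight_grad_def parabolic_shift_def mult.assoc mult.commute mult.left_commute)
  qed (simp add: heat_weight_def heat_weight_grad_def)
 qed
 also have "\<dots> = heat_pot_grad T i f p"
  unfolding heat_pot_grad_def
  by (rule lborel_integral_iterated(1)[OF heat_pot_grad_integrable[OF f T], symmetric])
 finally show ?thesis .
qed

lemma smooth_heat_pot:
 assumes f: "f \<in> \<D> UNIV"
 shows "smooth (heat_pot T f)"
  and "j \<in> Basis \<Longrightarrow> pd j (heat_pot T f) = heat_pot T (pd j f)"
 unfolding heat_pot_def[abs_def]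
 by (rule average_translates[OF integrable_heat_weight _ f]; simp)+

lemma heat_pot_l2:
 fixes f :: "real \<times> 'a::euclidean_space \<Rightarrow> real"
 assumes f: "f \<in> \<D> UNIV"
 shows "sqint lborel (heat_pot T f)"
  and "l2 lborel (heat_pot T f) \<le> (LBINT q. \<bar>heat_weight T (q :: real \<times> 'a::euclidean_space)\<bar>) * l2 lborel f"
 unfolding heat_pot_def[abs_def]
 by (rule average_translates_l2[OF sigma_finite_lborel integrable_heat_weight _ f]; simp)+

lemma heat_pot_grad_l2:
 assumes f: "f \<in> \<D> UNIV" and T: "T > 0"
 shows "sqint lborel (heat_pot_grad T i f)"
  and "l2 lborel (heat_pot_grad T i f) \<le> (LBINT q. \<bar>heat_weight_grad T i q\<bar>) * l2 lborel f"
 unfolding heat_pot_grad_def[abs_def]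
 by (rule average_translates_l2[OF sigma_finite_lborel integrable_heat_weight_grad[OF T] _ f]; simp)+

text \<open>The operator \<open>\<partial>_t + \<Delta>\<close>, which is the formal adjoint of
  \<open>L\<close> with the opposite sign: \<open>Lu\<close> tested with \<open>\<psi>\<close> is
  minus the integral of \<open>u\<close> times \<open>heat_dual \<psi>\<close>.\<close>

definition heat_dual :: "(real \<times> 'a::euclidean_space \<Rightarrow> real) \<Rightarrow> real \<times> 'a \<Rightarrow> real" where
 "heat_dual f p = pd (1, 0) f p + (\<Sum>i\<in>Basis. pd (0, i) (pd (0, i) f) p)"

lemma test_heat_dual:
 assumes "f \<in> \<D> S"
 shows "heat_dual f \<in> \<D> S"
 unfolding heat_dual_def[abs_def]
 by (intro test_add test_sum test_partial_deriv assms finite_Basis Basis_real_prod)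

lemma curve_has_derivative:
 assumes f: "smooth f" and t: "t > 0"
 shows "((\<lambda>t. f (p + (t, sqrt t *\<^sub>R x))) has_real_derivative
  pd (1, 0) f (p + (t, sqrt t *\<^sub>R x))
   + (\<Sum>i\<in>Basis. (x \<bullet> i) / (2 * sqrt t) * pd (0, i) f (p + (t, sqrt t *\<^sub>R x)))) (at t)"
proof -
 let ?P = "\<lambda>j. pd j f (p + (t, sqrt t *\<^sub>R x))"
 have s: "((\<lambda>t. sqrt t) has_derivative (\<lambda>h. h / (2 * sqrt t))) (at t)"
  using DERIV_real_sqrt[OF t] unfolding has_field_derivative_def
  by (rule has_derivative_eq_rhs) (auto simp: field_simps)
 have "((\<lambda>t. p + (t, sqrt t *\<^sub>R x)) has_derivative (\<lambda>h. (h, (h / (2 * sqrt t)) *\<^sub>R x))) (at t)"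
  by (rule has_derivative_eq_rhs)
    (rule has_derivative_add has_derivative_const has_derivative_Pair has_derivative_ident has_derivative_scaleR s | simp)+
 from has_derivative_compose[OF this smooth_has_derivative[OF f]]
 have "((\<lambda>t. f (p + (t, sqrt t *\<^sub>R x))) has_derivative
   (\<lambda>h. \<Sum>j\<in>Basis. ((h, (h / (2 * sqrt t)) *\<^sub>R x) \<bullet> j) * ?P j)) (at t)" .
 moreover have "(\<Sum>j\<in>Basis. ((h, (h / (2 * sqrt t)) *\<^sub>R x) \<bullet> j) * ?P j)
   = (?P (1, 0) + (\<Sum>i\<in>Basis. (x \<bullet> i) / (2 * sqrt t) * ?P (0, i))) * h" for h
  unfolding sum_Basis_real_prod by (simp add: algebra_simps sum_distrib_left)
 ultimately show ?thesis unfolding has_field_derivative_def by (simp only:)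
qed

text \<open>\<open>I t\<close> is the Gaussian average of \<open>f\<close> at time \<open>t\<close>
  after \<open>p\<close>, \<open>J t\<close> that of \<open>heat_dual f\<close>. Differentiating
  \<open>I\<close> along the parabolas produces first derivatives weighted by
  \<open>(x \<bullet> i) / (2 * sqrt t)\<close>, which Gaussian integration by parts turns into the
  Laplacian; so \<open>I' = J\<close>. The integral of \<open>J\<close> over \<open>[0, T]\<close>
  is then \<open>I T - I 0 = - f p\<close>, since \<open>I T\<close> sees only times at which
  \<open>f\<close> vanishes.\<close>

lemma heat_pot_equation:
 fixes f :: "real \<times> 'a::euclidean_space \<Rightarrow> real"
 assumes f: "f \<in> \<D> UNIV" and T: "T > 0" and z: "\<And>t x. t \<ge> T \<Longrightarrow> f (t, x) = 0" and p: "fst p \<ge> 0"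
 shows "heat_dual (heat_pot T f) p = - f p"
proof -
 let ?Y = "\<lambda>t x. (t, sqrt t *\<^sub>R x) :: real \<times> 'a"
 define I where "I t = (LBINT x. gauss x * f (p + ?Y t x))" for t
 define J where "J t = (LBINT x. gauss x * heat_dual f (p + ?Y t x))" for t
 have Y[measurable]: "?Y t \<in> borel_measurable lborel" for t by simp
 note f1 = test_partial_deriv[OF f]
 have gi: "integrable lborel (\<lambda>x. gauss x * g (p + ?Y t x))" if "g \<in> \<D> UNIV" for g t
  by (rule average_translates_integrable[OF integrable_gauss Y that])
 obtain B where B: "B > 0" "\<And>x. \<bar>f x\<bar> \<le> B" using test_bounded[OF f] by metis
 have "\<forall>j\<in>Basis. \<exists>M>0. \<forall>x. \<bar>pd j f x\<bar> \<le> M"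
  using test_bounded[OF f1] by metis
 then obtain b where b: "\<And>j. j \<in> Basis \<Longrightarrow> b j > 0" "\<And>j x. j \<in> Basis \<Longrightarrow> \<bar>pd j f x\<bar> \<le> b j"
  by metis
 have dI: "(I has_real_derivative J t) (at t)" if t: "t > 0" for t
 proof -
  let ?F' = "\<lambda>t x. gauss x * (pd (1, 0) f (p + ?Y t x)
   + (\<Sum>i\<in>Basis. (x \<bullet> i) / (2 * sqrt t) * pd (0, i) f (p + ?Y t x)))"
  \<comment> \<open>Majorant of the time derivative for times above \<open>t / 2\<close>; hence
    \<open>sqrt (t / 2)\<close> in the denominators.\<close>
  let ?h = "\<lambda>x. gauss x * b (1, 0) + (\<Sum>i\<in>Basis. (\<bar>x \<bullet> i\<bar> * gauss x) * (b (0, i) / (2 * sqrt (t / 2))))"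
  have F'i1: "integrable lborel (\<lambda>x. ((x \<bullet> i) / (2 * sqrt t) * gauss x) * pd (0, i) f (p + ?Y t x))"
   if i: "i \<in> Basis" for i
  proof (rule average_translates_integrable[OF _ Y f1])
   show "integrable lborel (\<lambda>x. (x \<bullet> i) / (2 * sqrt t) * gauss x)"
    by (rule integrable_bound[OF integrable_divide[OF integrable_gauss_coord[of i], of "2 * sqrt t"]])
      (use t in \<open>auto simp: abs_mult gauss_pos less_imp_le\<close>)
  qed (use i in simp)
  have F'eq: "?F' t x = gauss x * pd (1, 0) f (p + ?Y t x)
    + (\<Sum>i\<in>Basis. ((x \<bullet> i) / (2 * sqrt t) * gauss x) * pd (0, i) f (p + ?Y t x))" for x
   by (simp add: distrib_left sum_distrib_left mult.assoc mult.left_commute)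
  have F'i: "integrable lborel (?F' t)"
   unfolding F'eq by (intro integrable_add integrable_sum F'i1 gi f1 Basis_real_prod)
  have "((\<lambda>t. (LBINT x. gauss x * f (p + ?Y t x))) has_real_derivative (LBINT x. ?F' t x)) (at t)"
  proof (rule has_field_derivative_lebesgue_integral[where h="?h" and S="{t / 2<..<2 * t}"])
   have der: "((\<lambda>s. gauss x * f (p + ?Y s x)) has_real_derivative ?F' s x) (at s)" if "s \<in> {t / 2<..<2 * t}" for s x
    by (rule DERIV_cmult[OF curve_has_derivative[OF test_smooth[OF f]]]) (use that t in auto)
   show "integrable lborel (\<lambda>x. gauss x * f (p + ?Y s x))" for s by (rule gi[OF f])
   have bd: "\<bar>?F' s x\<bar> \<le> ?h x" if s: "s \<in> {t / 2<..<2 * t}" for s x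
   proof -
    have s0: "s > 0" using s t by auto
    have "\<bar>pd (1, 0) f (p + ?Y s x)
     + (\<Sum>i\<in>Basis. (x \<bullet> i) / (2 * sqrt s) * pd (0, i) f (p + ?Y s x))\<bar>
     \<le> b (1, 0) + (\<Sum>i\<in>Basis. \<bar>x \<bullet> i\<bar> * (b (0, i) / (2 * sqrt (t / 2))))"
    proof (rule order_trans[OF abs_triangle_ineq], rule add_mono)
     have "\<bar>\<Sum>i\<in>Basis. (x \<bullet> i) / (2 * sqrt s) * pd (0, i) f (p + ?Y s x)\<bar>
       \<le> (\<Sum>i\<in>Basis. \<bar>(x \<bullet> i) / (2 * sqrt s) * pd (0, i) f (p + ?Y s x)\<bar>)"
      by (rule sum_abs)
     also have "\<dots> \<le> (\<Sum>i\<in>Basis. \<bar>x \<bullet> i\<bar> * (b (0, i) / (2 * sqrt (t / 2))))"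
     proof (rule sum_mono)
      fix i :: 'a assume i: "i \<in> Basis"
      have "\<bar>(x \<bullet> i) / (2 * sqrt s) * pd (0, i) f (p + ?Y s x)\<bar>
        = \<bar>x \<bullet> i\<bar> * (\<bar>pd (0, i) f (p + ?Y s x)\<bar> / (2 * sqrt s))"
       using s0 by (simp add: abs_mult)
      also have "\<dots> \<le> \<bar>x \<bullet> i\<bar> * (b (0, i) / (2 * sqrt (t / 2)))"
       using s t b[of "(0, i)"] i by (intro mult_left_mono frac_le) (auto intro: less_imp_le)
      finally show "\<bar>(x \<bullet> i) / (2 * sqrt s) * pd (0, i) f (p + ?Y s x)\<bar>
        \<le> \<bar>x \<bullet> i\<bar> * (b (0, i) / (2 * sqrt (t / 2)))" .
     qed
     finally show "\<bar>\<Sum>i\<in>Basis. (x \<bullet> i) / (2 * sqrt s) * pd (0, i) f (p + ?Y s x)\<bar>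
       \<le> (\<Sum>i\<in>Basis. \<bar>x \<bullet> i\<bar> * (b (0, i) / (2 * sqrt (t / 2))))" .
    qed (simp add: b)
    hence "gauss x * \<bar>pd (1, 0) f (p + ?Y s x)
     + (\<Sum>i\<in>Basis. (x \<bullet> i) / (2 * sqrt s) * pd (0, i) f (p + ?Y s x))\<bar>
     \<le> gauss x * (b (1, 0) + (\<Sum>i\<in>Basis. \<bar>x \<bullet> i\<bar> * (b (0, i) / (2 * sqrt (t / 2)))))"
     by (intro mult_left_mono) (auto simp: gauss_pos less_imp_le)
    moreover have "?h x = gauss x * (b (1, 0) + (\<Sum>i\<in>Basis. \<bar>x \<bullet> i\<bar> * (b (0, i) / (2 * sqrt (t / 2)))))"
     unfolding distrib_left sum_distrib_left by (intro arg_cong2[where f="(+)"] sum.cong refl) (simp only: mult.assoc mult.left_commute)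
    ultimately show ?thesis unfolding abs_mult using gauss_pos[of x] by (simp only: abs_of_pos)
   qed
   show "integrable lborel ?h"
    by (intro integrable_add integrable_sum integrable_mult_left integrable_gauss integrable_gauss_coord)
   show tt: "t \<in> {t / 2<..<2 * t}" using t by simp
   show "((\<lambda>s. gauss x * f (p + ?Y s x)) has_real_derivative ?F' t x) (at t)" for x by (rule der[OF tt])
   show "norm (gauss x * f (p + ?Y s x) - gauss x * f (p + ?Y t x)) \<le> ?h x * norm (s - t)" if "s \<in> {t / 2<..<2 * t}" for s x
    by (rule field_differentiable_bound[of "{t / 2<..<2 * t}" _ "\<lambda>s. ?F' s x"])
     (use has_field_derivative_at_within[OF der] bd that tt in auto)
  qed simp
  moreover have "(LBINT x. ?F' t x) = J t"
  proof -
   have "(LBINT x. ?F' t x) = (LBINT x. gauss x * pd (1, 0) f (p + ?Y t x))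
    + (LBINT x. (\<Sum>i\<in>Basis. ((x \<bullet> i) / (2 * sqrt t) * gauss x) * pd (0, i) f (p + ?Y t x)))"
    unfolding F'eq by (intro integral_add integrable_sum F'i1 gi f1 Basis_real_prod)
   also have "(LBINT x. (\<Sum>i\<in>Basis. ((x \<bullet> i) / (2 * sqrt t) * gauss x) * pd (0, i) f (p + ?Y t x)))
     = (\<Sum>i\<in>Basis. (LBINT x. ((x \<bullet> i) / (2 * sqrt t) * gauss x) * pd (0, i) f (p + ?Y t x)))"
    by (intro integral_sum F'i1)
   also have "\<dots> = (\<Sum>i\<in>Basis. (LBINT x. gauss x * pd (0, i) (pd (0, i) f) (p + ?Y t x)))"
    by (intro sum.cong refl gauss_integral_by_parts[symmetric] f1 t Basis_real_prod)
   also have "(LBINT x. gauss x * pd (1, 0) f (p + ?Y t x)) + \<dots> =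
     (LBINT x. gauss x * pd (1, 0) f (p + ?Y t x)
      + (\<Sum>i\<in>Basis. gauss x * pd (0, i) (pd (0, i) f) (p + ?Y t x)))"
    by (rule integral_add_sum[symmetric]) (auto intro!: gi f1 test_partial_deriv f)
   also have "\<dots> = J t"
    unfolding J_def heat_dual_def by (simp add: distrib_left sum_distrib_left)
   finally show ?thesis .
  qed
  ultimately show ?thesis unfolding I_def by simp
 qed
 \<comment> \<open>The parabolas are not differentiable at time 0, so the fundamental theorem is
   used with mere continuity at the end points.\<close>
 have cI: "continuous_on {0..T} I"
  unfolding continuous_on_sequentially
 proof (intro allI ballI impI, elim conjE)
  fix X t assume X: "\<forall>n. X n \<in> {0..T}" "X \<longlonglongrightarrow> t"
  have "(\<lambda>n. I (X n)) \<longlonglongrightarrow> I t"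
   unfolding I_def
  proof (rule integral_dominated_convergence[where w="\<lambda>x. gauss x * B"])
   show "AE x in lborel. (\<lambda>n. gauss x * f (p + ?Y (X n) x)) \<longlonglongrightarrow> gauss x * f (p + ?Y t x)"
   proof (rule AE_I2)
    fix x
    have "isCont f (p + ?Y t x)"
     using smooth_differentiable[OF test_smooth[OF f]] differentiable_imp_continuous_within by blast
    moreover have "(\<lambda>n. p + ?Y (X n) x) \<longlonglongrightarrow> p + ?Y t x" by (intro tendsto_intros X)
    ultimately have "(\<lambda>n. f (p + ?Y (X n) x)) \<longlonglongrightarrow> f (p + ?Y t x)" by (rule isCont_tendsto_compose)
    thus "(\<lambda>n. gauss x * f (p + ?Y (X n) x)) \<longlonglongrightarrow> gauss x * f (p + ?Y t x)" by (rule tendsto_mult_left)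
   qed
   show "AE x in lborel. norm (gauss x * f (p + ?Y (X n) x)) \<le> gauss x * B" for n
    using B(2) by (auto simp: abs_mult gauss_pos less_imp_le intro!: mult_left_mono)
   show "integrable lborel (\<lambda>x::'a. gauss x * B)" by (intro integrable_mult_left integrable_gauss)
  qed (use gi[OF f] in \<open>auto intro: borel_measurable_integrable\<close>)
  thus "(I \<circ> X) \<longlonglongrightarrow> I t" by (simp add: comp_def)
 qed
 have "(J has_integral (I T - I 0)) {0..T}"
  using fundamental_theorem_of_calculus_interior[OF less_imp_le[OF T] cI, of J] dI
  by (simp add: has_real_derivative_iff_has_vector_derivative)
 moreover have "I T = 0"
 proof -
  have "p + ?Y T x = (fst p + T, snd p + sqrt T *\<^sub>R x)" for x by (simp add: prod_eq_iff)
  hence "f (p + ?Y T x) = 0" for x using z p by simp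
  thus ?thesis by (simp add: I_def)
 qed
 moreover have "I 0 = f p"
  unfolding I_def by (simp add: gauss_integral zero_prod_def[symmetric])
 ultimately have "(J has_integral (- f p)) {0<..<T}" by (simp add: has_integral_Icc_iff_Ioo)
 hence J1: "((\<lambda>t. if t \<in> {0<..<T} then J t else 0) has_integral (- f p)) UNIV"
  by (subst has_integral_restrict_UNIV)
 note hi = heat_pot_integrable[OF test_heat_dual[OF f], of T p]
 have J2: "(LBINT x. heat_weight T (t, x) * heat_dual f (p + parabolic_shift (t, x)))
   = (if t \<in> {0<..<T} then J t else 0)" for t
  by (auto simp: heat_weight_def J_def parabolic_shift_def)
 have "(LBINT q. heat_weight T q * heat_dual f (p + parabolic_shift q)) = (LBINT t. (if t \<in> {0<..<T} then J t else 0))"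
  unfolding lborel_integral_iterated(1)[OF hi] J2 ..
 also have "\<dots> = - f p"
  using has_integral_unique[OF has_integral_integral_lborel[OF lborel_integral_iterated(2)[OF hi], unfolded J2] J1] .
 finally have "heat_pot T (heat_dual f) p = - f p" by (simp add: heat_pot_def)
 moreover have "heat_dual (heat_pot T f) p = heat_pot T (heat_dual f) p"
 proof -
  have "heat_dual (heat_pot T f) p = heat_pot T (pd (1, 0) f) p
    + (\<Sum>i\<in>Basis. heat_pot T (pd (0, i) (pd (0, i) f)) p)"
   unfolding heat_dual_def using f by (simp add: smooth_heat_pot test_partial_deriv)
  also have "\<dots> = (LBINT q. heat_weight T q * pd (1, 0) f (p + parabolic_shift q)
    + (\<Sum>i\<in>Basis. heat_weight T q * pd (0, i) (pd (0, i) f) (p + parabolic_shift q)))"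
   unfolding heat_pot_def
   by (rule integral_add_sum[symmetric]) (auto intro!: heat_pot_integrable test_partial_deriv f)
  also have "\<dots> = heat_pot T (heat_dual f) p"
   unfolding heat_pot_def heat_dual_def by (simp add: distrib_left sum_distrib_left)
  finally show ?thesis .
 qed
 ultimately show ?thesis by simp
qed

section \<open>The energy estimate for heat potentials\<close>

text \<open>The norm of a test function in L2 in time with values in H1. It contains no time
  derivative and is the norm dual to the one in which \<open>Lu\<close> is measured.\<close>

definition parabolic_norm :: "(real \<times> 'a::euclidean_space \<Rightarrow> real) \<Rightarrow> real" where
 "parabolic_norm \<psi> = sqrt ((l2 lborel \<psi>)\<^sup>2 + (\<Sum>i\<in>Basis. (l2 lborel (pd (0, i) \<psi>))\<^sup>2))"

text \<open>The variables are values at one point: \<open>e\<close>, \<open>et\<close>,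
  \<open>ej\<close> of the cutoff and its derivatives, \<open>z\<close>, \<open>zt\<close>,
  \<open>zj\<close>, \<open>zjj\<close> of the solution, \<open>g + hi\<close> of the source with
  \<open>hi\<close> the \<open>i\<close>-th derivative of \<open>h\<close>. The bracket on the right
  is the expanded form of half the time derivative of \<open>e^2 z^2\<close>, plus the divergence of
  \<open>e^2 z grad z\<close>, plus the \<open>i\<close>-th derivative of \<open>e^2 z h\<close>; it
  will integrate to 0. What remains is Young's inequality.\<close>

lemma caccioppoli_pointwise:
 assumes I: "finite I" "i \<in> I" and E: "\<bar>e\<bar> \<le> E" "\<bar>et\<bar> \<le> E" "\<And>j. j \<in> I \<Longrightarrow> \<bar>ej j\<bar> \<le> E"
  and eq: "e \<noteq> 0 \<Longrightarrow> zt + (\<Sum>j\<in>I. zjj j) = - (g + hi)"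
 shows "1 / 2 * (\<Sum>j\<in>I. (e * zj j)\<^sup>2) \<le>
   (e * et * z\<^sup>2 + e\<^sup>2 * z * zt
    + (\<Sum>j\<in>I. 2 * e * ej j * z * zj j + e\<^sup>2 * (zj j)\<^sup>2 + e\<^sup>2 * z * zjj j)
    + (2 * e * ej i * z * h + e\<^sup>2 * zj i * h + e\<^sup>2 * z * hi))
   + (E\<^sup>2 * (4 * real (card I) + 4)) * (z\<^sup>2 + g\<^sup>2 + h\<^sup>2)"
proof -
 have E0: "E \<ge> 0" using E by linarith
 have sq: "a\<^sup>2 \<le> E\<^sup>2" if "\<bar>a\<bar> \<le> E" for a
  using that E0 by (simp add: abs_le_square_iff[symmetric])
 have pr: "\<bar>a * b\<bar> \<le> E\<^sup>2" if "\<bar>a\<bar> \<le> E" "\<bar>b\<bar> \<le> E" for a b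
  unfolding abs_mult power2_eq_square using that E0 by (intro mult_mono) auto
 have amgm: "2 * a * b \<ge> - (a\<^sup>2) - b\<^sup>2" for a b :: real
  using zero_le_power2[of "a + b"] by (simp add: power2_sum)
 \<comment> \<open>The equation is known only where \<open>e\<close> does not vanish; elsewhere all
   these terms carry the factor \<open>e\<close> squared.\<close>
 have eqm: "e\<^sup>2 * z * zt + (\<Sum>j\<in>I. e\<^sup>2 * z * zjj j) + e\<^sup>2 * z * hi = - (e\<^sup>2 * z * g)"
 proof (cases "e = 0")
  case False
  have "e\<^sup>2 * z * zt + (\<Sum>j\<in>I. e\<^sup>2 * z * zjj j) + e\<^sup>2 * z * hi = e\<^sup>2 * z * ((zt + (\<Sum>j\<in>I. zjj j)) + hi)"
   by (simp add: distrib_left sum_distrib_left mult.assoc)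
  thus ?thesis using eq[OF False] by (simp add: algebra_simps)
 qed simp
 let ?S = "\<Sum>j\<in>I. (e * zj j)\<^sup>2" and ?W = "z\<^sup>2 + g\<^sup>2 + h\<^sup>2"
 have t1: "e * et * z\<^sup>2 \<ge> - (E\<^sup>2 * ?W)"
 proof -
  have "- (E\<^sup>2) \<le> e * et" using pr[OF E(1,2)] by linarith
  hence "- (E\<^sup>2) * z\<^sup>2 \<le> e * et * z\<^sup>2" by (intro mult_right_mono) auto
  moreover have "E\<^sup>2 * z\<^sup>2 \<le> E\<^sup>2 * ?W" by (intro mult_left_mono) auto
  ultimately show ?thesis by linarith
 qed
 have t2: "- (e\<^sup>2 * z * g) \<ge> - (E\<^sup>2 * ?W)"
 proof -
  have "2 * \<bar>z * g\<bar> \<le> z\<^sup>2 + g\<^sup>2"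
   using zero_le_power2[of "\<bar>z\<bar> - \<bar>g\<bar>"] by (simp add: power2_diff abs_mult)
  hence "\<bar>z * g\<bar> \<le> ?W" using abs_ge_zero[of "z * g"] zero_le_power2[of h] by linarith
  hence "e\<^sup>2 * \<bar>z * g\<bar> \<le> E\<^sup>2 * ?W" using sq[OF E(1)] by (intro mult_mono) auto
  moreover have "e\<^sup>2 * (z * g) \<le> e\<^sup>2 * \<bar>z * g\<bar>" by (intro mult_left_mono) auto
  ultimately show ?thesis by (simp add: mult.assoc)
 qed
 \<comment> \<open>Young's inequality weighted to give up a quarter of the gradient sum;
   \<open>t5\<close> gives up another quarter, and half of the sum survives on the left of the
   claim.\<close>
 have t3: "(\<Sum>j\<in>I. 2 * e * ej j * z * zj j) \<ge> - (1 / 4) * ?S - real (card I) * (4 * E\<^sup>2 * ?W)"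
 proof -
  have "(\<Sum>j\<in>I. - (1 / 4) * (e * zj j)\<^sup>2 - 4 * E\<^sup>2 * ?W) \<le> (\<Sum>j\<in>I. 2 * e * ej j * z * zj j)"
  proof (rule sum_mono)
   fix j assume j: "j \<in> I"
   have "2 * (e * zj j / 2) * (2 * ej j * z) \<ge> - ((e * zj j / 2)\<^sup>2) - (2 * ej j * z)\<^sup>2" by (rule amgm)
   moreover have "(2 * ej j * z)\<^sup>2 \<le> 4 * E\<^sup>2 * ?W"
   proof -
    have "(ej j)\<^sup>2 * z\<^sup>2 \<le> E\<^sup>2 * ?W" using sq[OF E(3)[OF j]] by (intro mult_mono) auto
    thus ?thesis by (simp add: power_mult_distrib)
   qed
   ultimately show "- (1 / 4) * (e * zj j)\<^sup>2 - 4 * E\<^sup>2 * ?W \<le> 2 * e * ej j * z * zj j"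
    by (simp add: power_divide algebra_simps)
  qed
  thus ?thesis by (simp add: sum_subtractf sum_divide_distrib[symmetric] sum_negf)
 qed
 have t4: "2 * e * ej i * z * h \<ge> - (E\<^sup>2 * ?W)"
 proof -
  have "2 * \<bar>z * h\<bar> \<le> z\<^sup>2 + h\<^sup>2"
   using zero_le_power2[of "\<bar>z\<bar> - \<bar>h\<bar>"] by (simp add: power2_diff abs_mult)
  hence "2 * \<bar>z * h\<bar> \<le> ?W" using zero_le_power2[of g] by linarith
  hence "\<bar>e * ej i\<bar> * (2 * \<bar>z * h\<bar>) \<le> E\<^sup>2 * ?W"
   using pr[OF E(1) E(3)[OF I(2)]] by (intro mult_mono) auto
  moreover have "\<bar>2 * e * ej i * z * h\<bar> = \<bar>e * ej i\<bar> * (2 * \<bar>z * h\<bar>)" by (simp add: abs_mult)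
  ultimately show ?thesis by linarith
 qed
 have t5: "e\<^sup>2 * zj i * h \<ge> - (1 / 4) * ?S - E\<^sup>2 * ?W"
 proof -
  have "2 * (e * zj i / 2) * (e * h) \<ge> - ((e * zj i / 2)\<^sup>2) - (e * h)\<^sup>2" by (rule amgm)
  moreover have "(e * h)\<^sup>2 \<le> E\<^sup>2 * ?W"
   unfolding power_mult_distrib using sq[OF E(1)] by (intro mult_mono) auto
  moreover have "(e * zj i)\<^sup>2 \<le> ?S" using I by (intro member_le_sum) auto
  moreover have "2 * (e * zj i / 2) * (e * h) = e\<^sup>2 * zj i * h" by (simp add: power2_eq_square)
  moreover have "(e * zj i / 2)\<^sup>2 = 1 / 4 * (e * zj i)\<^sup>2" by (simp add: power_divide)
  ultimately show ?thesis by linarith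
 qed
 have s: "(\<Sum>j\<in>I. 2 * e * ej j * z * zj j + e\<^sup>2 * (zj j)\<^sup>2 + e\<^sup>2 * z * zjj j)
   = (\<Sum>j\<in>I. 2 * e * ej j * z * zj j) + ?S + (\<Sum>j\<in>I. e\<^sup>2 * z * zjj j)"
  by (simp add: sum.distrib power_mult_distrib)
 have c: "(E\<^sup>2 * (4 * real (card I) + 4)) * ?W = real (card I) * (4 * E\<^sup>2 * ?W) + 4 * (E\<^sup>2 * ?W)"
  by (simp add: algebra_simps)
 show ?thesis using t1 t2 t3 t4 t5 eqm unfolding s c by linarith
qed

text \<open>The constant depends on \<open>\<eta>\<close> alone. The source is split as
  \<open>g\<close> plus a derivative of \<open>h\<close> so that no derivative of \<open>h\<close>
  enters the bound; the term with that derivative is completed to an exact derivative whose integral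
  vanishes by compact support.\<close>

lemma caccioppoli:
 fixes \<eta> :: "real \<times> 'a::euclidean_space \<Rightarrow> real"
 assumes \<eta>: "\<eta> \<in> \<D> V"
 obtains C where "C \<ge> 0"
  "\<And>z g h i. smooth z \<Longrightarrow> sqint lborel z \<Longrightarrow> g \<in> \<D> UNIV \<Longrightarrow> h \<in> \<D> UNIV
   \<Longrightarrow> i \<in> Basis \<Longrightarrow> (\<And>p. \<eta> p \<noteq> 0 \<Longrightarrow> heat_dual z p = - (g p + pd (0, i) h p))
   \<Longrightarrow> (parabolic_norm (\<lambda>p. \<eta> p * z p))\<^sup>2 \<le> C * ((l2 lborel z)\<^sup>2 + (l2 lborel g)\<^sup>2 + (l2 lborel h)\<^sup>2)"
proof -
 define n where "n = real (card (Basis :: 'a set))"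
 obtain b0 where b0: "b0 > 0" "\<And>p. \<bar>\<eta> p\<bar> \<le> b0" using test_bounded[OF \<eta>] by metis
 have "\<forall>j\<in>Basis. \<exists>M>0. \<forall>x. \<bar>pd j \<eta> x\<bar> \<le> M"
  using test_bounded[OF test_partial_deriv[OF \<eta>]] by metis
 then obtain b where b: "\<And>j. j \<in> Basis \<Longrightarrow> b j > 0" "\<And>j x. j \<in> Basis \<Longrightarrow> \<bar>pd j \<eta> x\<bar> \<le> b j"
  by metis
 define E where "E = b0 + (\<Sum>j\<in>Basis. b j)"
 have bE: "b j \<le> E" if "j \<in> Basis" for j
  unfolding E_def using member_le_sum[OF that, of b] b(1) b0(1) by (auto simp: less_imp_le intro: order_trans)
 have E: "\<bar>\<eta> p\<bar> \<le> E" "j \<in> Basis \<Longrightarrow> \<bar>pd j \<eta> p\<bar> \<le> E" for p j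
 proof -
  have "(\<Sum>j\<in>Basis. b j) \<ge> 0" by (intro sum_nonneg) (use b(1) in \<open>auto intro: less_imp_le\<close>)
  thus "\<bar>\<eta> p\<bar> \<le> E" using b0(2)[of p] by (simp add: E_def)
  show "j \<in> Basis \<Longrightarrow> \<bar>pd j \<eta> p\<bar> \<le> E" using b(2)[of j p] bE[of j] by linarith
 qed
 have E0: "E \<ge> 0" using E(1)[of 0] by linarith
 define K where "K = E\<^sup>2 * (4 * n + 4)"
 have K0: "K \<ge> 0" unfolding K_def n_def by simp
 \<comment> \<open>The summands account for \<open>\<eta> z\<close> itself, for the derivatives that
   fall on \<open>\<eta>\<close> in \<open>n\<close> directions, and for twice the gradient bound
   \<open>2 * (K * ?W)\<close>.\<close>
 define C where "C = E\<^sup>2 + 2 * n * E\<^sup>2 + 4 * K"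
 show thesis
 proof (rule that[of C])
  show "C \<ge> 0" unfolding C_def n_def using K0 by simp
  fix z g h :: "real \<times> 'a \<Rightarrow> real" and i :: 'a
  assume z: "smooth z" "sqint lborel z" and g: "g \<in> \<D> UNIV" and h: "h \<in> \<D> UNIV"
   and i: "i \<in> Basis" and eq: "\<And>p. \<eta> p \<noteq> 0 \<Longrightarrow> heat_dual z p = - (g p + pd (0, i) h p)"
  let ?x = "\<lambda>j. pd (0::real, j :: 'a)" and ?t = "pd (1::real, 0 :: 'a)"
  have s\<eta>: "smooth \<eta>" by (rule test_smooth[OF \<eta>])
  have sz: "smooth (?x j z)" if "j \<in> Basis" for j by (intro smooth_partial_deriv z Basis_real_prod that)
  have sh: "smooth h" by (rule test_smooth[OF h])
  let ?A = "\<lambda>p. (\<eta> p * \<eta> p) * (z p * z p)" and ?B = "\<lambda>j p. (\<eta> p * \<eta> p) * (z p * ?x j z p)"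
   and ?D = "\<lambda>p. (\<eta> p * \<eta> p) * (z p * h p)"
  have tA: "?A \<in> \<D> V" by (intro test_mult test_mult \<eta> s\<eta> smooth_mult z)
  have tB: "?B j \<in> \<D> V" if "j \<in> Basis" for j by (intro test_mult test_mult \<eta> s\<eta> smooth_mult z sz that)
  have tD: "?D \<in> \<D> V" by (intro test_mult test_mult \<eta> s\<eta> smooth_mult z sh)
  have dA: "?t ?A p = 2 * (\<eta> p * ?t \<eta> p * (z p)\<^sup>2 + (\<eta> p)\<^sup>2 * z p * ?t z p)" for p
   by (simp add: partial_deriv_mult_smooth smooth_mult s\<eta> z power2_eq_square algebra_simps)
  have dB: "?x j (?B j) p = 2 * \<eta> p * ?x j \<eta> p * z p * ?x j z p + (\<eta> p)\<^sup>2 * (?x j z p)\<^sup>2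
    + (\<eta> p)\<^sup>2 * z p * ?x j (?x j z) p" if "j \<in> Basis" for j p
   by (simp add: partial_deriv_mult_smooth smooth_mult s\<eta> z sz that power2_eq_square algebra_simps)
  have dD: "?x i ?D p = 2 * \<eta> p * ?x i \<eta> p * z p * h p + (\<eta> p)\<^sup>2 * ?x i z p * h p
    + (\<eta> p)\<^sup>2 * z p * ?x i h p" for p
   by (simp add: partial_deriv_mult_smooth smooth_mult s\<eta> z sh power2_eq_square algebra_simps)
  let ?Q = "\<lambda>p. 1 / 2 * ?t ?A p + (\<Sum>j\<in>Basis. ?x j (?B j) p) + ?x i ?D p"
  have ti: "integrable lborel (pd j f)" "(LBINT p. pd j f p) = 0"
   if "f \<in> \<D> V" "j \<in> Basis" for f :: "real \<times> 'a \<Rightarrow> real" and j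
   using test_integrable[OF test_partial_deriv[OF that]] test_integral_partial_deriv[OF that] by auto
  have Qi: "integrable lborel ?Q"
   by (intro integrable_add integrable_sum integrable_mult_right ti tA tB tD Basis_real_prod i)
  have Q0: "(LBINT p. ?Q p) = 0"
  proof -
   have "(LBINT p. ?Q p) = (LBINT p. 1 / 2 * ?t ?A p + (\<Sum>j\<in>Basis. ?x j (?B j) p)) + (LBINT p. ?x i ?D p)"
    by (intro integral_add integrable_add integrable_sum
      integrable_mult_right ti tA tB tD Basis_real_prod i)
   also have "(LBINT p. 1 / 2 * ?t ?A p + (\<Sum>j\<in>Basis. ?x j (?B j) p))
     = (LBINT p. 1 / 2 * ?t ?A p) + (\<Sum>j\<in>Basis. (LBINT p. ?x j (?B j) p))"
    by (intro integral_add_sum integrable_mult_right ti tA tB Basis_real_prod)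
   also have "(LBINT p. 1 / 2 * ?t ?A p) = 0"
    unfolding integral_mult_right_zero using ti(2)[OF tA] by simp
   also have "(\<Sum>j\<in>Basis. (LBINT p. ?x j (?B j) p)) = 0"
    by (intro sum.neutral ballI ti(2) tB Basis_real_prod)
   also have "(LBINT p. ?x i ?D p) = 0" by (intro ti(2) tD Basis_real_prod i)
   finally show ?thesis by simp
  qed
  have t\<eta>z: "(\<lambda>p. \<eta> p * ?x j z p) \<in> \<D> V" if "j \<in> Basis" for j by (intro test_mult \<eta> sz that)
  have si: "integrable lborel (\<lambda>p. (\<eta> p * ?x j z p)\<^sup>2)" if "j \<in> Basis" for j
   by (rule sqint_sq[OF test_sqint[OF t\<eta>z[OF that]]])
  let ?W = "(l2 lborel z)\<^sup>2 + (l2 lborel g)\<^sup>2 + (l2 lborel h)\<^sup>2"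
  note sqi = sqint_sq[OF z(2)] sqint_sq[OF test_sqint[OF g]] sqint_sq[OF test_sqint[OF h]]
  have Wi: "integrable lborel (\<lambda>p. K * ((z p)\<^sup>2 + (g p)\<^sup>2 + (h p)\<^sup>2))"
   using sqi by auto
  have "(LBINT p. 1 / 2 * (\<Sum>j\<in>Basis. (\<eta> p * ?x j z p)\<^sup>2))
    \<le> (LBINT p. ?Q p + K * ((z p)\<^sup>2 + (g p)\<^sup>2 + (h p)\<^sup>2))"
  proof (rule integral_mono)
   show "integrable lborel (\<lambda>p. 1 / 2 * (\<Sum>j\<in>Basis. (\<eta> p * ?x j z p)\<^sup>2))"
    by (intro integrable_mult_right integrable_sum si)
   show "integrable lborel (\<lambda>p. ?Q p + K * ((z p)\<^sup>2 + (g p)\<^sup>2 + (h p)\<^sup>2))"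
    by (intro integrable_add Qi Wi)
   fix p
   have "?Q p = (\<eta> p * ?t \<eta> p * (z p)\<^sup>2 + (\<eta> p)\<^sup>2 * z p * ?t z p)
     + (\<Sum>j\<in>Basis. 2 * \<eta> p * ?x j \<eta> p * z p * ?x j z p + (\<eta> p)\<^sup>2 * (?x j z p)\<^sup>2
      + (\<eta> p)\<^sup>2 * z p * ?x j (?x j z) p)
     + (2 * \<eta> p * ?x i \<eta> p * z p * h p + (\<eta> p)\<^sup>2 * ?x i z p * h p + (\<eta> p)\<^sup>2 * z p * ?x i h p)"
    unfolding dA dD by (simp add: dB)
   thus "1 / 2 * (\<Sum>j\<in>Basis. (\<eta> p * ?x j z p)\<^sup>2) \<le> ?Q p + K * ((z p)\<^sup>2 + (g p)\<^sup>2 + (h p)\<^sup>2)"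
    using caccioppoli_pointwise[of "Basis :: 'a set" i "\<eta> p" E "?t \<eta> p" "\<lambda>j. ?x j \<eta> p" "?t z p"
      "\<lambda>j. ?x j (?x j z) p" "g p" "?x i h p" "\<lambda>j. ?x j z p" "z p" "h p"]
     i E eq[of p] unfolding heat_dual_def K_def n_def by simp
  qed
  also have "\<dots> = (LBINT p. ?Q p) + (LBINT p. K * ((z p)\<^sup>2 + (g p)\<^sup>2 + (h p)\<^sup>2))"
   by (rule integral_add[OF Qi Wi])
  also have "\<dots> = K * ?W" unfolding Q0 l2_sq using sqi by simp
  also have "(LBINT p. 1 / 2 * (\<Sum>j\<in>Basis. (\<eta> p * ?x j z p)\<^sup>2))
    = 1 / 2 * (\<Sum>j\<in>Basis. (LBINT p. (\<eta> p * ?x j z p)\<^sup>2))"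
   unfolding integral_mult_right_zero by (subst integral_sum) (use si in auto)
  finally have grad: "(\<Sum>j\<in>Basis. (l2 lborel (\<lambda>p. \<eta> p * ?x j z p))\<^sup>2) \<le> 2 * (K * ?W)"
   unfolding l2_sq by simp
  have bm: "l2 lborel (\<lambda>p. f p * z p) \<le> E * l2 lborel z" "sqint lborel (\<lambda>p. f p * z p)"
   if "\<And>p. \<bar>f p\<bar> \<le> E" "smooth f" for f
  proof -
   have "f \<in> borel_measurable lborel" using smooth_borel[OF that(2)] by simp
   thus "sqint lborel (\<lambda>p. f p * z p)"
    using that(1) by (intro sqint_bounded_mult[OF z(2)])
   have "l2 lborel (\<lambda>p. f p * z p) \<le> l2 lborel (\<lambda>p. E * z p)"
   proof (rule l2_mono(1)[OF sqint_cmult[OF z(2)]])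
    show "(\<lambda>p. f p * z p) \<in> borel_measurable lborel"
     using smooth_borel[OF that(2)] smooth_borel[OF z(1)] by simp
    show "AE p in lborel. \<bar>f p * z p\<bar> \<le> \<bar>E * z p\<bar>"
     using that(1) E0 by (intro AE_I2) (simp add: abs_mult mult_right_mono)
   qed
   thus "l2 lborel (\<lambda>p. f p * z p) \<le> E * l2 lborel z" using E0 by (simp add: l2_cmult)
  qed
  have p1: "(l2 lborel (\<lambda>p. \<eta> p * z p))\<^sup>2 \<le> E\<^sup>2 * ?W"
  proof -
   have "(l2 lborel (\<lambda>p. \<eta> p * z p))\<^sup>2 \<le> (E * l2 lborel z)\<^sup>2"
    by (intro power_mono bm E s\<eta> l2_nonneg)
   also have "\<dots> \<le> E\<^sup>2 * ?W" unfolding power_mult_distrib by (intro mult_left_mono) auto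
   finally show ?thesis .
  qed
  have p2: "(l2 lborel (?x j (\<lambda>p. \<eta> p * z p)))\<^sup>2 \<le> 2 * (E\<^sup>2 * ?W) + 2 * (l2 lborel (\<lambda>p. \<eta> p * ?x j z p))\<^sup>2"
   if j: "j \<in> Basis" for j
  proof -
   have "?x j (\<lambda>p. \<eta> p * z p) = (\<lambda>p. ?x j \<eta> p * z p + \<eta> p * ?x j z p)"
    by (rule partial_deriv_mult_smooth[OF s\<eta> z(1)])
   hence "l2 lborel (?x j (\<lambda>p. \<eta> p * z p)) \<le> l2 lborel (\<lambda>p. ?x j \<eta> p * z p) + l2 lborel (\<lambda>p. \<eta> p * ?x j z p)"
    by (simp add: l2_triangle bm(2) E j smooth_partial_deriv s\<eta> test_sqint[OF t\<eta>z[OF j]])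
   also have "\<dots> \<le> E * l2 lborel z + l2 lborel (\<lambda>p. \<eta> p * ?x j z p)"
    by (intro add_right_mono bm(1) E Basis_real_prod j smooth_partial_deriv s\<eta>)
   finally have "(l2 lborel (?x j (\<lambda>p. \<eta> p * z p)))\<^sup>2 \<le> (E * l2 lborel z + l2 lborel (\<lambda>p. \<eta> p * ?x j z p))\<^sup>2"
    by (intro power_mono l2_nonneg)
   also have "\<dots> \<le> 2 * (E * l2 lborel z)\<^sup>2 + 2 * (l2 lborel (\<lambda>p. \<eta> p * ?x j z p))\<^sup>2"
    using zero_le_power2[of "E * l2 lborel z - l2 lborel (\<lambda>p. \<eta> p * ?x j z p)"]
    by (simp add: power2_sum power2_diff)
   also have "(E * l2 lborel z)\<^sup>2 \<le> E\<^sup>2 * ?W" unfolding power_mult_distrib by (intro mult_left_mono) auto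
   finally show ?thesis by simp
  qed
  have "(\<Sum>j\<in>Basis. (l2 lborel (?x j (\<lambda>p. \<eta> p * z p)))\<^sup>2)
    \<le> (\<Sum>j\<in>(Basis::'a set). 2 * (E\<^sup>2 * ?W) + 2 * (l2 lborel (\<lambda>p. \<eta> p * ?x j z p))\<^sup>2)"
   by (rule sum_mono[OF p2])
  also have "\<dots> = 2 * n * (E\<^sup>2 * ?W) + 2 * (\<Sum>j\<in>(Basis::'a set). (l2 lborel (\<lambda>p. \<eta> p * ?x j z p))\<^sup>2)"
   by (simp add: sum.distrib n_def sum_distrib_left)
  finally have "(\<Sum>j\<in>Basis. (l2 lborel (?x j (\<lambda>p. \<eta> p * z p)))\<^sup>2) \<le> 2 * n * (E\<^sup>2 * ?W) + 4 * (K * ?W)"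
   using grad by linarith
  moreover have "(parabolic_norm (\<lambda>p. \<eta> p * z p))\<^sup>2
    = (l2 lborel (\<lambda>p. \<eta> p * z p))\<^sup>2 + (\<Sum>j\<in>Basis. (l2 lborel (?x j (\<lambda>p. \<eta> p * z p)))\<^sup>2)"
   unfolding parabolic_norm_def by (rule real_sqrt_pow2) (intro add_nonneg_nonneg sum_nonneg zero_le_power2)
  ultimately show "(parabolic_norm (\<lambda>p. \<eta> p * z p))\<^sup>2 \<le> C * ?W"
   using p1 unfolding C_def by (simp add: algebra_simps)
 qed
qed

text \<open>The Caccioppoli inequality is used once with \<open>h = 0\<close> and once with
  \<open>g = 0\<close>; the L2 norm of the potential on its right-hand side is controlled by the L1
  norm of the weight. In the second case the bound by \<open>h\<close>, not by its derivative, is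
  what duality for the gradient requires. The cutoff lives at positive times, where the potential
  satisfies its equation.\<close>

lemma heat_pot_energy:
 fixes \<eta> :: "real \<times> 'a::euclidean_space \<Rightarrow> real"
 assumes \<eta>: "\<eta> \<in> \<D> ({0<..} \<times> UNIV)" and T: "T > 0"
 obtains C where "C \<ge> 0"
  "\<And>f. f \<in> \<D> ({..<T} \<times> UNIV) \<Longrightarrow>
   parabolic_norm (\<lambda>p. \<eta> p * heat_pot T f p) \<le> C * l2 lborel f"
  "\<And>h i. h \<in> \<D> ({..<T} \<times> UNIV) \<Longrightarrow> i \<in> Basis \<Longrightarrow>
   parabolic_norm (\<lambda>p. \<eta> p * heat_pot T (pd (0, i) h) p) \<le> C * l2 lborel h"
proof -
 obtain C0 where C0: "C0 \<ge> 0"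
  "\<And>z g h i. smooth z \<Longrightarrow> sqint lborel z \<Longrightarrow> g \<in> \<D> UNIV \<Longrightarrow> h \<in> \<D> UNIV
   \<Longrightarrow> i \<in> Basis \<Longrightarrow> (\<And>p. \<eta> p \<noteq> 0 \<Longrightarrow> heat_dual z p = - (g p + pd (0, i) h p))
   \<Longrightarrow> (parabolic_norm (\<lambda>p. \<eta> p * z p))\<^sup>2 \<le> C0 * ((l2 lborel z)\<^sup>2 + (l2 lborel g)\<^sup>2 + (l2 lborel h)\<^sup>2)"
 proof (rule caccioppoli[OF \<eta>], goal_cases)
  case (1 C)
  show ?case by (rule 1(1)[OF 1(2)]) (rule 1(3))
 qed
 define W where "W = (LBINT q. \<bar>heat_weight T (q :: real \<times> 'a)\<bar>) + (\<Sum>i\<in>(Basis :: 'a set). (LBINT q. \<bar>heat_weight_grad T i q\<bar>))"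
 have W1: "(LBINT q. \<bar>heat_weight T (q :: real \<times> 'a)\<bar>) \<le> W"
  unfolding W_def by (simp add: sum_nonneg integral_nonneg)
 have W2: "(LBINT q. \<bar>heat_weight_grad T i q\<bar>) \<le> W" if "i \<in> (Basis :: 'a set)" for i
 proof -
  have "(LBINT q. \<bar>heat_weight_grad T i q\<bar>) \<le> (\<Sum>i\<in>(Basis :: 'a set). (LBINT q. \<bar>heat_weight_grad T i q\<bar>))"
   by (rule member_le_sum[OF that]) (auto intro: integral_nonneg)
  thus ?thesis unfolding W_def by (simp add: add_increasing integral_nonneg)
 qed
 have W0: "W \<ge> 0"
  by (rule order_trans[OF _ W1]) (auto intro: integral_nonneg)
 define C where "C = sqrt (C0 * (W\<^sup>2 + 1))"
 have pos: "fst p \<ge> 0" if "\<eta> p \<noteq> 0" for p using test_zero_outside[OF \<eta>, of p] that by (cases p) force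
 have fin: "parabolic_norm (\<lambda>p. \<eta> p * z p) \<le> C * a"
  if "(parabolic_norm (\<lambda>p. \<eta> p * z p))\<^sup>2 \<le> C0 * ((l2 lborel z)\<^sup>2 + a\<^sup>2)" "l2 lborel z \<le> W * a" "a \<ge> 0" for z a
 proof -
  have "(l2 lborel z)\<^sup>2 \<le> (W * a)\<^sup>2" using that(2) by (intro power_mono l2_nonneg)
  hence "C0 * ((l2 lborel z)\<^sup>2 + a\<^sup>2) \<le> C0 * ((W * a)\<^sup>2 + a\<^sup>2)" using C0(1) by (intro mult_left_mono) auto
  also have "\<dots> = (C * a)\<^sup>2"
   unfolding C_def power_mult_distrib using C0(1) by (simp add: algebra_simps)
  finally have "(parabolic_norm (\<lambda>p. \<eta> p * z p))\<^sup>2 \<le> (C * a)\<^sup>2" using that(1) by linarith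
  thus ?thesis by (rule power2_le_imp_le) (use C0(1) that(3) in \<open>simp add: C_def\<close>)
 qed
 show thesis
 proof (rule that[of C])
  show "C \<ge> 0" unfolding C_def using C0(1) by simp
  show "parabolic_norm (\<lambda>p. \<eta> p * heat_pot T f p) \<le> C * l2 lborel f"
   if f: "f \<in> \<D> ({..<T} \<times> UNIV)" for f
  proof (rule fin)
   have f': "f \<in> \<D> UNIV" using test_mono[OF f] by blast
   obtain i :: 'a where i: "i \<in> Basis" using nonempty_Basis by blast
   have "heat_dual (heat_pot T f) p = - (f p + pd (0, i) (\<lambda>p. 0) p)" if "\<eta> p \<noteq> 0" for p
    using heat_pot_equation[OF f' T _ pos[OF that]] test_zero_outside[OF f] by (simp add: partial_deriv_const)
   from C0(2)[OF smooth_heat_pot(1)[OF f'] heat_pot_l2(1)[OF f'] f' test_zero i this]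
   show "(parabolic_norm (\<lambda>p. \<eta> p * heat_pot T f p))\<^sup>2 \<le> C0 * ((l2 lborel (heat_pot T f))\<^sup>2 + (l2 lborel f)\<^sup>2)"
    by (simp add: l2_def)
   show "l2 lborel (heat_pot T f) \<le> W * l2 lborel f"
    using heat_pot_l2(2)[OF f', of T] mult_right_mono[OF W1 l2_nonneg, of lborel f] by linarith
  qed (rule l2_nonneg)
  show "parabolic_norm (\<lambda>p. \<eta> p * heat_pot T (pd (0, i) h) p) \<le> C * l2 lborel h"
   if h: "h \<in> \<D> ({..<T} \<times> UNIV)" and i: "i \<in> Basis" for h i
  proof (rule fin)
   have h': "h \<in> \<D> UNIV" using test_mono[OF h] by blast
   let ?f = "pd (0, i) h"
   have f: "?f \<in> \<D> ({..<T} \<times> UNIV)" using test_partial_deriv[OF h] i by simp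
   have f': "?f \<in> \<D> UNIV" using test_mono[OF f] by blast
   have eq: "heat_pot T ?f = heat_pot_grad T i h"
    using heat_pot_partial_deriv[OF h' T i] by blast
   have "heat_dual (heat_pot T ?f) p = - (0 + ?f p)" if "\<eta> p \<noteq> 0" for p
    using heat_pot_equation[OF f' T _ pos[OF that]] test_zero_outside[OF f] by simp
   from C0(2)[OF smooth_heat_pot(1)[OF f'] heat_pot_l2(1)[OF f'] test_zero h' i this]
   show "(parabolic_norm (\<lambda>p. \<eta> p * heat_pot T ?f p))\<^sup>2 \<le> C0 * ((l2 lborel (heat_pot T ?f))\<^sup>2 + (l2 lborel h)\<^sup>2)"
    by (simp add: l2_def)
   show "l2 lborel (heat_pot T ?f) \<le> W * l2 lborel h"
    unfolding eq using heat_pot_grad_l2(2)[OF h' T, of i] mult_right_mono[OF W2[OF i] l2_nonneg, of lborel h] by linarith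
  qed (rule l2_nonneg)
 qed
qed

section \<open>The caloric part of a solution\<close>

lemma lborel_integral_scale:
 fixes g :: "'a::euclidean_space \<Rightarrow> real"
 assumes c: "c > 0" and [measurable]: "g \<in> borel_measurable borel"
 shows "(LBINT x. g (c *\<^sub>R x)) = (1 / c) ^ DIM('a) * (LBINT x. g x)"
  and "integrable lborel g \<Longrightarrow> integrable lborel (\<lambda>x. g (c *\<^sub>R x))"
proof -
 have eq: "lborel = density (distr lborel borel (\<lambda>x::'a. c *\<^sub>R x)) (\<lambda>_. \<bar>c\<bar> ^ DIM('a))"
  using lborel_affine[of c "0::'a"] c by simp
 have "(LBINT x. g x) = (LBINT x. \<bar>c\<bar> ^ DIM('a) * g (c *\<^sub>R x))"
  by (subst eq) (simp add: integral_density integral_distr)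
 thus "(LBINT x. g (c *\<^sub>R x)) = (1 / c) ^ DIM('a) * (LBINT x. g x)"
  using c by (simp add: field_simps)
 show "integrable lborel (\<lambda>x. g (c *\<^sub>R x))" if "integrable lborel g"
 proof -
  have "integrable (density (distr lborel borel (\<lambda>x::'a. c *\<^sub>R x)) (\<lambda>_. \<bar>c\<bar> ^ DIM('a))) g"
   using that eq by simp
  hence "integrable lborel (\<lambda>x. \<bar>c\<bar> ^ DIM('a) * g (c *\<^sub>R x))"
   by (subst (asm) integrable_density) (auto simp: integrable_distr_eq)
  hence "integrable lborel (\<lambda>x. (1 / c ^ DIM('a)) * (\<bar>c\<bar> ^ DIM('a) * g (c *\<^sub>R x)))"
   by (rule integrable_mult_right)
  thus ?thesis using c by simp
 qed
qed

text \<open>The density of the weight \<open>a (fst q) * m (snd q)\<close> after transport by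
  \<open>parabolic_shift\<close>. With \<open>m = gauss\<close> the second factor is the heat kernel
  at time \<open>fst q\<close>.\<close>

definition parabolic_kernel :: "(real \<Rightarrow> real) \<Rightarrow> ('a::euclidean_space \<Rightarrow> real) \<Rightarrow> real \<times> 'a \<Rightarrow> real" where
 "parabolic_kernel a m q = a (fst q) * ((1 / sqrt (fst q)) ^ DIM('a) * m ((1 / sqrt (fst q)) *\<^sub>R snd q))"

text \<open>The substitution \<open>y = sqrt t * x\<close> in every slice; that \<open>a\<close>
  vanishes up to time 0 disposes of the slices in which this scaling degenerates.\<close>

lemma parabolic_kernel_transfer:
 fixes m :: "'a::euclidean_space \<Rightarrow> real" and F :: "real \<times> 'a \<Rightarrow> real"
 assumes a: "integrable lborel a" "\<And>t. t \<le> 0 \<Longrightarrow> a t = 0" and m: "integrable lborel m"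
 shows "integrable lborel (parabolic_kernel a m)"
  and "F \<in> borel_measurable borel \<Longrightarrow> (\<And>q. \<bar>F q\<bar> \<le> B) \<Longrightarrow>
   (LBINT q. (a (fst q) * m (snd q)) * F (parabolic_shift q)) = (LBINT q. parabolic_kernel a m q * F q)"
proof -
 have am[measurable]: "a \<in> borel_measurable borel" "m \<in> borel_measurable borel" using a m by auto
 have km[measurable]: "parabolic_kernel a m \<in> borel_measurable borel"
  unfolding parabolic_kernel_def[abs_def] borel_prod[symmetric] by measurable
 have sc: "(LBINT y. (1 / sqrt t) ^ DIM('a) * (m ((1 / sqrt t) *\<^sub>R y) * G y)) = (LBINT x. m x * G (sqrt t *\<^sub>R x))"
  if "t > 0" and [measurable]: "G \<in> borel_measurable borel" for t and G :: "'a \<Rightarrow> real"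
  using lborel_integral_scale(1)[of "sqrt t" "\<lambda>y. m ((1 / sqrt t) *\<^sub>R y) * G y"] that by simp
 have scn: "(LBINT y. \<bar>(1 / sqrt t) ^ DIM('a) * m ((1 / sqrt t) *\<^sub>R y)\<bar>) = (LBINT x. \<bar>m x\<bar>)" if "t > 0" for t
  using lborel_integral_scale(1)[of "sqrt t" "\<lambda>y. \<bar>m ((1 / sqrt t) *\<^sub>R y)\<bar>"] that by (simp add: abs_mult)
 have mi: "integrable lborel (\<lambda>y. (1 / sqrt t) ^ DIM('a) * m ((1 / sqrt t) *\<^sub>R y))" if "t > 0" for t
  using lborel_integral_scale(2)[of "1 / sqrt t" m] that m by auto
 show ki: "integrable lborel (parabolic_kernel a m)"
 proof -
  have "integrable (lborel \<Otimes>\<^sub>M lborel) (parabolic_kernel a m)"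
  proof (rule lborel_pair.Fubini_integrable)
   show "parabolic_kernel a m \<in> borel_measurable (lborel \<Otimes>\<^sub>M lborel)" by (simp add: lborel_prod)
   have "(\<lambda>t. (LBINT y. norm (parabolic_kernel a m (t, y)))) = (\<lambda>t. \<bar>a t\<bar> * (LBINT x. \<bar>m x\<bar>))"
   proof
    fix t
    show "(LBINT y. norm (parabolic_kernel a m (t, y))) = \<bar>a t\<bar> * (LBINT x. \<bar>m x\<bar>)"
     using scn[of t] a(2)[of t] by (cases "t > 0") (simp_all add: parabolic_kernel_def abs_mult)
   qed
   thus "integrable lborel (\<lambda>t. (LBINT y. norm (parabolic_kernel a m (t, y))))" using a(1) by simp
   show "AE t in lborel. integrable lborel (\<lambda>y. parabolic_kernel a m (t, y))"
   proof (rule AE_I2)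
    fix t
    show "integrable lborel (\<lambda>y. parabolic_kernel a m (t, y))"
     using mi[of t] a(2)[of t] by (cases "t > 0") (simp_all add: parabolic_kernel_def)
   qed
  qed
  thus ?thesis by (simp add: lborel_prod)
 qed
 show "(LBINT q. (a (fst q) * m (snd q)) * F (parabolic_shift q)) = (LBINT q. parabolic_kernel a m q * F q)"
  if F[measurable]: "F \<in> borel_measurable borel" and B: "\<And>q. \<bar>F q\<bar> \<le> B"
 proof -
  have F2: "(\<lambda>y. F (t, y)) \<in> borel_measurable borel" for t
   by (rule measurable_compose[OF _ F]) simp
  have bi: "integrable lborel (\<lambda>q. w q * H q)" if "integrable lborel w" "H \<in> borel_measurable borel" "\<And>q. \<bar>H q\<bar> \<le> B"
   for w H :: "real \<times> 'a \<Rightarrow> real"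
   by (rule integrable_bound[OF integrable_mult_left[OF that(1), of B]])
     (use that borel_measurable_integrable[OF that(1)] in \<open>auto simp: abs_mult intro!: mult_left_mono order_trans[OF that(3)]\<close>)
  have i1: "integrable lborel (\<lambda>q. (a (fst q) * m (snd q)) * F (parabolic_shift q))"
   by (rule bi[OF integrable_lborel_prod_mult[OF a(1) m]]) (use B in auto)
  have i2: "integrable lborel (\<lambda>q. parabolic_kernel a m q * F q)" by (rule bi[OF ki F B])
  show ?thesis
   unfolding lborel_integral_iterated(1)[OF i1] lborel_integral_iterated(1)[OF i2]
  proof (rule integral_cong[OF refl])
   fix t
   show "(LBINT x. (a (fst (t, x)) * m (snd (t, x))) * F (parabolic_shift (t, x)))
     = (LBINT x. parabolic_kernel a m (t, x) * F (t, x))"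
   proof (cases "t > 0")
    case True
    thus ?thesis
     using sc[OF True F2[of t]] by (simp add: parabolic_kernel_def parabolic_shift_def mult.assoc)
   qed (use a(2)[of t] in \<open>simp add: parabolic_kernel_def\<close>)
  qed
 qed
qed

text \<open>Fubini: the potential operator acting on \<open>f\<close> is transposed to a convolution
  acting on \<open>a\<close>. In this way the commutator terms become the pairing of
  \<open>f\<close> with one function that is independent of \<open>f\<close>.\<close>

lemma convolution_duality:
 fixes a K f :: "'a::euclidean_space \<Rightarrow> real"
 assumes a: "integrable lborel a" and K: "integrable lborel K" and f[measurable]: "f \<in> borel_measurable borel"
  and B: "\<And>p. \<bar>f p\<bar> \<le> B"
 shows "(LBINT p. a p * (LBINT q. K q * f (p + q))) = (LBINT p'. (LBINT p. a p * K (p' - p)) * f p')"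
  and "integrable lborel (\<lambda>p'. (LBINT p. a p * K (p' - p)) * f p')"
  and "integrable lborel (\<lambda>p. a p * (LBINT q. K q * f (p + q)))"
proof -
 have [measurable]: "a \<in> borel_measurable borel" "K \<in> borel_measurable borel" using a K by auto
 have tr: "(LBINT q. K q * f (p + q)) = (LBINT p'. K (p' - p) * f p')" for p
  using lborel_integral_translate(1)[of "\<lambda>p'. K (p' - p) * f p'" p] by (simp add: add.commute)
 have Ki: "integrable lborel (\<lambda>p'. K (p' - p))" for p
  using lborel_integral_translate(2)[of K "- p"] K by simp
 have Kn: "(LBINT p'. \<bar>K (p' - p)\<bar>) = (LBINT q. \<bar>K q\<bar>)" for p
  using lborel_integral_translate(1)[of "\<lambda>q. \<bar>K q\<bar>" "- p"] by simp
 have "integrable (lborel \<Otimes>\<^sub>M lborel) (\<lambda>(p, p'). a p * K (p' - p))"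
 proof (rule lborel_pair.Fubini_integrable)
  show "(\<lambda>(p, p'). a p * K (p' - p)) \<in> borel_measurable (lborel \<Otimes>\<^sub>M lborel)" by measurable
  show "integrable lborel (\<lambda>p. (LBINT p'. norm (case (p, p') of (p, p') \<Rightarrow> a p * K (p' - p))))"
   using a by (simp add: abs_mult Kn)
  show "AE p in lborel. integrable lborel (\<lambda>p'. case (p, p') of (p, p') \<Rightarrow> a p * K (p' - p))"
   using Ki by (intro AE_I2) simp
 qed
 hence int: "integrable (lborel \<Otimes>\<^sub>M lborel) (case_prod (\<lambda>p p'. a p * K (p' - p) * f p'))"
 proof (rule integrable_bound[OF integrable_mult_left[where c=B]])
  show "case_prod (\<lambda>p p'. a p * K (p' - p) * f p') \<in> borel_measurable (lborel \<Otimes>\<^sub>M lborel)" by measurable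
  show "AE x in lborel \<Otimes>\<^sub>M lborel. norm (case_prod (\<lambda>p p'. a p * K (p' - p) * f p') x) \<le> norm ((case x of (p, p') \<Rightarrow> a p * K (p' - p)) * B)"
   using B by (intro AE_I2) (auto simp: abs_mult intro!: mult_left_mono order_trans[OF B])
 qed
 show "(LBINT p. a p * (LBINT q. K q * f (p + q))) = (LBINT p'. (LBINT p. a p * K (p' - p)) * f p')"
  using lborel_pair.Fubini_integral[OF int] by (simp add: tr mult.assoc flip: integral_mult_right_zero integral_mult_left_zero)
 show "integrable lborel (\<lambda>p'. (LBINT p. a p * K (p' - p)) * f p')"
  using lborel_pair.integrable_snd[OF int] by simp
 show "integrable lborel (\<lambda>p. a p * (LBINT q. K q * f (p + q)))"
  using lborel_pair.integrable_fst[OF int] by (simp add: tr mult.assoc)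
qed

definition heat_kernel :: "real \<Rightarrow> real \<times> 'a::euclidean_space \<Rightarrow> real" where
 "heat_kernel T = parabolic_kernel (indicator {0<..<T}) gauss"

definition heat_kernel_grad :: "real \<Rightarrow> 'a \<Rightarrow> real \<times> 'a::euclidean_space \<Rightarrow> real" where
 "heat_kernel_grad T i = parabolic_kernel (\<lambda>t. indicator {0<..<T} t / sqrt t) (\<lambda>x. (x \<bullet> i) / 2 * gauss x)"

lemma integrable_gauss_half_coord: "integrable lborel (\<lambda>x::'a::euclidean_space. (x \<bullet> i) / 2 * gauss x)"
 by (rule integrable_bound[OF integrable_gauss_coord[of i]])
   (auto simp: abs_mult gauss_pos less_imp_le)

lemma heat_kernel_integrable:
 "integrable lborel (heat_kernel T :: real \<times> 'a::euclidean_space \<Rightarrow> real)"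
 "T > 0 \<Longrightarrow> integrable lborel (heat_kernel_grad T i)"
 unfolding heat_kernel_def heat_kernel_grad_def
 using integrable_gauss integrable_gauss_half_coord[of i] integrable_inverse_sqrt[of T]
 by (auto intro!: parabolic_kernel_transfer(1)) (cases "T > 0"; simp)

lemma heat_pot_kernel:
 assumes f: "f \<in> \<D> UNIV" and T: "T > 0"
 shows "heat_pot T f p = (LBINT q. heat_kernel T q * f (p + q))"
  and "heat_pot_grad T i f p = (LBINT q. heat_kernel_grad T i q * f (p + q))"
proof -
 obtain B where B: "\<And>x. \<bar>f x\<bar> \<le> B" using test_bounded[OF f] by metis
 note [measurable] = test_borel[OF f]
 have m: "(\<lambda>q. f (p + q)) \<in> borel_measurable borel" by measurable
 show "heat_pot T f p = (LBINT q. heat_kernel T q * f (p + q))"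
  unfolding heat_pot_def heat_weight_def heat_kernel_def
  by (rule parabolic_kernel_transfer(2)[OF _ _ integrable_gauss m B]) (use T in auto)
 show "heat_pot_grad T i f p = (LBINT q. heat_kernel_grad T i q * f (p + q))"
  unfolding heat_pot_grad_def heat_weight_grad_def heat_kernel_grad_def
  by (rule parabolic_kernel_transfer(2)[OF integrable_inverse_sqrt[OF T] _ integrable_gauss_half_coord m B]) auto
qed

text \<open>Since \<open>\<eta>\<close> is constant near the region of interest, the kernels in the following definition are
 only evaluated away from their singularity.\<close>

definition caloric_part ::
  "(real \<times> 'a::euclidean_space \<Rightarrow> real) \<Rightarrow> real \<Rightarrow> (real \<times> 'a \<Rightarrow> real) \<Rightarrow> real \<times> 'a \<Rightarrow> real" where
 "caloric_part \<eta> T U p' = (LBINT p. (U p * heat_dual \<eta> p) * heat_kernel T (p' - p))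
   + (\<Sum>i\<in>Basis. (LBINT p. (U p * (2 * pd (0, i) \<eta> p)) * heat_kernel_grad T i (p' - p)))"

lemma heat_dual_mult:
 assumes "smooth f" "smooth g"
 shows "heat_dual (\<lambda>p. f p * g p) p = f p * heat_dual g p + g p * heat_dual f p
  + (\<Sum>i\<in>Basis. 2 * pd (0, i) f p * pd (0, i) g p)"
proof -
 have "pd (0, i) (pd (0, i) (\<lambda>p. f p * g p)) p
   = f p * pd (0, i) (pd (0, i) g) p + g p * pd (0, i) (pd (0, i) f) p
    + 2 * pd (0, i) f p * pd (0, i) g p" if "i \<in> Basis" for i
  using assms that
  by (simp add: partial_deriv_mult_smooth partial_deriv_add_smooth smooth_mult smooth_partial_deriv algebra_simps)
 thus ?thesis
  unfolding heat_dual_def using assms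
  by (simp add: partial_deriv_mult_smooth sum.distrib sum_distrib_left algebra_simps)
qed

text \<open>Applying \<open>heat_dual\<close> to \<open>\<eta>\<close> times the potential of
  \<open>f\<close> gives \<open>- f\<close>, because \<open>\<eta> f = f\<close>, plus commutator
  terms with derivatives of \<open>\<eta>\<close>. Paired with \<open>U\<close> and transposed by
  \<open>convolution_duality\<close>, the commutator terms are exactly \<open>caloric_part\<close>
  paired with \<open>f\<close>.\<close>

lemma caloric_part_pairing:
 assumes \<eta>: "\<eta> \<in> \<D> ({0<..} \<times> UNIV)" and T: "T > 0" and U: "sqint lborel U"
  and f: "f \<in> \<D> ({..<T} \<times> UNIV)" and \<eta>f: "\<And>p. \<eta> p * f p = f p"
 shows "(LBINT p. U p * f p) = - (LBINT p. U p * heat_dual (\<lambda>p. \<eta> p * heat_pot T f p) p)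
   + (LBINT p. caloric_part \<eta> T U p * f p)"
  and "integrable lborel (\<lambda>p. caloric_part \<eta> T U p * f p)"
proof -
 have f': "f \<in> \<D> UNIV" using test_mono[OF f] by blast
 obtain B where B: "\<And>x. \<bar>f x\<bar> \<le> B" using test_bounded[OF f] by metis
 have fm: "f \<in> borel_measurable borel" by (rule test_borel[OF f])
 have pos: "fst p \<ge> 0" if "\<eta> p \<noteq> 0" for p using test_zero_outside[OF \<eta>, of p] that by (cases p) force
 note s\<eta> = test_smooth[OF \<eta>] and sz = smooth_heat_pot(1)[OF f', of T]
 define a where "a i p = U p * (2 * pd (0, i) \<eta> p)" for i p
 have ai: "integrable lborel (a i)" if "i \<in> Basis" for i
  unfolding a_def[abs_def]
  by (intro sqint_mult[OF U] sqint_cmult test_sqint[OF test_partial_deriv[OF \<eta>]] Basis_real_prod that)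
 have a0: "integrable lborel (\<lambda>p. U p * heat_dual \<eta> p)"
  by (rule sqint_mult[OF U test_sqint[OF test_heat_dual[OF \<eta>]]])
 have hp: "heat_dual (\<lambda>p. \<eta> p * heat_pot T f p) p = - f p + heat_pot T f p * heat_dual \<eta> p
   + (\<Sum>i\<in>Basis. 2 * pd (0, i) \<eta> p * heat_pot_grad T i f p)" for p
 proof -
  have "\<eta> p * heat_dual (heat_pot T f) p = - f p"
  proof (cases "\<eta> p = 0")
   case False
   have "heat_dual (heat_pot T f) p = - f p"
    using heat_pot_equation[OF f' T _ pos[OF False]] test_zero_outside[OF f] by simp
   thus ?thesis using \<eta>f[of p] by simp
  qed (use \<eta>f[of p] in simp)
  thus ?thesis
   unfolding heat_dual_mult[OF s\<eta> sz]
   by (simp add: smooth_heat_pot(2)[OF f'] heat_pot_partial_deriv[OF f' T])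
 qed
 have e0: "(LBINT p. (U p * heat_dual \<eta> p) * heat_pot T f p)
    = (LBINT p'. (LBINT p. (U p * heat_dual \<eta> p) * heat_kernel T (p' - p)) * f p')"
  and i0: "integrable lborel (\<lambda>p'. (LBINT p. (U p * heat_dual \<eta> p) * heat_kernel T (p' - p)) * f p')"
  and j0: "integrable lborel (\<lambda>p. (U p * heat_dual \<eta> p) * heat_pot T f p)"
  using convolution_duality[OF a0 heat_kernel_integrable(1)[of T] fm B] by (simp_all add: heat_pot_kernel(1)[OF f' T])
 have ei: "(LBINT p. a i p * heat_pot_grad T i f p)
    = (LBINT p'. (LBINT p. a i p * heat_kernel_grad T i (p' - p)) * f p')"
  and ii: "integrable lborel (\<lambda>p'. (LBINT p. a i p * heat_kernel_grad T i (p' - p)) * f p')"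
  and ji: "integrable lborel (\<lambda>p. a i p * heat_pot_grad T i f p)" if "i \<in> Basis" for i
  using convolution_duality[OF ai[OF that] heat_kernel_integrable(2)[OF T, of i] fm B]
  by (simp_all add: heat_pot_kernel(2)[OF f' T])
 have v: "caloric_part \<eta> T U p' * f p' = (LBINT p. (U p * heat_dual \<eta> p) * heat_kernel T (p' - p)) * f p'
   + (\<Sum>i\<in>Basis. (LBINT p. a i p * heat_kernel_grad T i (p' - p)) * f p')" for p'
  unfolding caloric_part_def a_def by (simp add: distrib_right sum_distrib_right)
 show "integrable lborel (\<lambda>p. caloric_part \<eta> T U p * f p)"
  unfolding v by (intro integrable_add integrable_sum i0 ii)
 have "(LBINT p. caloric_part \<eta> T U p * f p)
   = (LBINT p. (U p * heat_dual \<eta> p) * heat_pot T f p) + (\<Sum>i\<in>Basis. (LBINT p. a i p * heat_pot_grad T i f p))"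
  unfolding v by (subst integral_add_sum) (simp_all add: i0 ii e0 ei)
 also have "\<dots> = (LBINT p. (U p * heat_dual \<eta> p) * heat_pot T f p + (\<Sum>i\<in>Basis. a i p * heat_pot_grad T i f p))"
  by (rule integral_add_sum[symmetric]) (auto simp: j0 ji)
 also have "\<dots> = (LBINT p. U p * heat_dual (\<lambda>p. \<eta> p * heat_pot T f p) p + U p * f p)"
  by (rule arg_cong[where f="integral\<^sup>L lborel"])
    (auto simp: hp a_def algebra_simps sum_distrib_left fun_eq_iff)
 also have "\<dots> = (LBINT p. U p * heat_dual (\<lambda>p. \<eta> p * heat_pot T f p) p) + (LBINT p. U p * f p)"
  by (intro integral_add sqint_mult[OF U] test_sqint[OF test_heat_dual[OF test_mult[OF \<eta> sz]]]
    test_sqint[OF f])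
 finally show "(LBINT p. U p * f p) = - (LBINT p. U p * heat_dual (\<lambda>p. \<eta> p * heat_pot T f p) p)
   + (LBINT p. caloric_part \<eta> T U p * f p)" by simp
qed

lemma caloric_part_borel:
 assumes [measurable]: "U \<in> borel_measurable borel" and \<eta>: "\<eta> \<in> \<D> V" and T: "T > 0"
 shows "caloric_part \<eta> T U \<in> borel_measurable borel"
proof -
 note [measurable] = test_borel[OF test_heat_dual[OF \<eta>]] borel_measurable_integrable[OF heat_kernel_integrable(1)[of T], simplified]
  borel_measurable_integrable[OF heat_kernel_integrable(2)[OF T], simplified]
 have [measurable]: "i \<in> Basis \<Longrightarrow> pd (0, i) \<eta> \<in> borel_measurable borel" for i
  by (intro test_borel[OF test_partial_deriv[OF \<eta>]]) simp
 show ?thesis unfolding caloric_part_def[abs_def] by measurable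
qed

section \<open>Holomorphic extension of the caloric part\<close>

text \<open>Cauchy's inequality turns the majorant of \<open>F\<close> into a majorant of its
  derivative on a smaller disc, hence into the Lipschitz constant required for differentiation under
  the integral.\<close>

lemma holomorphic_lebesgue_integral:
 assumes hol: "\<And>q. (\<lambda>z. F z q) holomorphic_on ball 0 R"
  and meas: "\<And>z. F z \<in> borel_measurable M"
  and bd: "\<And>z q. z \<in> ball 0 R \<Longrightarrow> norm (F z q) \<le> h q" and h: "integrable M h"
 shows "(\<lambda>z. \<integral>q. F z q \<partial>M) holomorphic_on ball 0 R"
proof -
 have int: "integrable M (F z)" if "z \<in> ball 0 R" for z
  by (rule integrable_bound[OF h meas]) (use bd[OF that] in \<open>auto intro: order_trans[OF _ abs_ge_self]\<close>)
 have "\<exists>D. ((\<lambda>z. \<integral>q. F z q \<partial>M) has_field_derivative D) (at z0)" if z0: "z0 \<in> ball 0 R" for z0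
 proof -
  obtain r0 where r0: "r0 > 0" "cball z0 r0 \<subseteq> ball 0 R"
   using open_contains_cball[of "ball (0::complex) R"] z0 open_ball by blast
  \<comment> \<open>Discs of radius \<open>r\<close> about points of \<open>ball z0 r\<close> stay
    in \<open>cball z0 r0\<close>.\<close>
  define r where "r = r0 / 2"
  have r: "r > 0" using r0 by (simp add: r_def)
  let ?F' = "\<lambda>q. deriv (\<lambda>z. F z q) z0"
  have der: "((\<lambda>z. F z q) has_field_derivative deriv (\<lambda>z. F z q) w) (at w)" if "w \<in> ball 0 R" for w q
   using holomorphic_derivI[OF hol open_ball that] .
  have dbd: "norm (deriv (\<lambda>z. F z q) w) \<le> h q / r" if w: "w \<in> ball z0 r" for w q
  proof -
   have sub: "cball w r \<subseteq> ball 0 R"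
   proof
    fix y assume "y \<in> cball w r"
    hence "dist z0 y \<le> r0" using w dist_triangle[of z0 y w] by (simp add: r_def dist_commute)
    thus "y \<in> ball 0 R" using r0(2) by auto
   qed
   have "norm ((deriv ^^ 1) (\<lambda>z. F z q) w) \<le> fact 1 * h q / r ^ 1"
   proof (rule Cauchy_inequality)
    show "(\<lambda>z. F z q) holomorphic_on ball w r"
     by (rule holomorphic_on_subset[OF hol]) (use sub ball_subset_cball in blast)
    show "continuous_on (cball w r) (\<lambda>z. F z q)"
     by (rule continuous_on_subset[OF holomorphic_on_imp_continuous_on[OF hol] sub])
    show "norm (F x q) \<le> h q" if "norm (w - x) = r" for x
     by (rule bd) (use sub that in \<open>auto simp: dist_norm\<close>)
   qed (rule r)
   thus ?thesis by simp
  qed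
  have lip: "norm (F w q - F z0 q) \<le> h q / r * norm (w - z0)" if "w \<in> ball z0 r" for w q
  proof (rule field_differentiable_bound[of "ball z0 r" "\<lambda>z. F z q" "deriv (\<lambda>z. F z q)"])
   show "((\<lambda>z. F z q) has_field_derivative deriv (\<lambda>z. F z q) x) (at x within ball z0 r)" if "x \<in> ball z0 r" for x
    by (rule has_field_derivative_at_within[OF der]) (use that r0 in \<open>auto simp: r_def subset_eq\<close>)
  qed (use that r dbd in auto)
  have "((\<lambda>z. \<integral>q. F z q \<partial>M) has_field_derivative (\<integral>q. ?F' q \<partial>M)) (at z0)"
   by (rule has_field_derivative_lebesgue_integral[where S="ball z0 r" and h="\<lambda>q. h q / r"])
    (use r r0 der[OF z0] int lip h in \<open>auto simp: r_def subset_eq\<close>)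
  thus ?thesis by blast
 qed
 thus ?thesis
  by (subst holomorphic_on_open) (auto)
qed

text \<open>Agreement is demanded at every real \<open>s\<close>, although the extension is
  holomorphic and bounded only on the disc; the explicit integral formulas provide this, and no side
  condition on \<open>s\<close> is carried along.\<close>

definition extends_holomorphically :: "real \<Rightarrow> real \<Rightarrow> (real \<Rightarrow> real) \<Rightarrow> bool" where
 "extends_holomorphically R M f \<longleftrightarrow> (\<exists>G. G holomorphic_on ball 0 R \<and>
   (\<forall>z\<in>ball 0 R. norm (G z) \<le> M) \<and> (\<forall>s. G (of_real s) = of_real (f s)))"

lemma extends_holomorphically_add:
 assumes "extends_holomorphically R M f" "extends_holomorphically R N g"
 shows "extends_holomorphically R (M + N) (\<lambda>s. f s + g s)"
proof -
 obtain F G where "F holomorphic_on ball 0 R" "G holomorphic_on ball 0 R"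
  "\<And>z. z \<in> ball 0 R \<Longrightarrow> norm (F z) \<le> M" "\<And>z. z \<in> ball 0 R \<Longrightarrow> norm (G z) \<le> N"
  "\<And>s. F (of_real s) = of_real (f s)" "\<And>s. G (of_real s) = of_real (g s)"
  using assms unfolding extends_holomorphically_def by blast
 thus ?thesis
  unfolding extends_holomorphically_def
  by (intro exI[of _ "\<lambda>z. F z + G z"]) (auto intro!: holomorphic_intros norm_triangle_mono)
qed

lemma extends_holomorphically_sum:
 assumes "finite I" "\<And>i. i \<in> I \<Longrightarrow> extends_holomorphically R (M i) (f i)"
 shows "extends_holomorphically R (\<Sum>i\<in>I. M i) (\<lambda>s. \<Sum>i\<in>I. f i s)"
 using assms
proof (induction I rule: finite_induct)
 case empty
 show ?case unfolding extends_holomorphically_def by (intro exI[of _ "\<lambda>z. 0"]) auto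
qed (simp add: extends_holomorphically_add)

text \<open>Moving a point by the complex multiple \<open>z\<close> of \<open>e\<close> replaces the
  squared distance by \<open>\<rho>\<close>, whose real part is the squared norm of
  \<open>w + Re z e\<close> minus the square of \<open>Im z\<close>. If \<open>w\<close> is far,
  this is at least \<open>d^2 / 8\<close>, as (3/8)^2 - (1/8)^2 = 1/8, and Gaussian decay beats the
  powers of \<open>1 / t\<close>. If \<open>t\<close> is far from 0, the powers are bounded and the
  exponential is at most \<open>exp (d / 128)\<close>. The factor with \<open>c0\<close> and
  \<open>i\<close> covers the heat kernel and its gradient together.\<close>

lemma complex_gauss_bound:
 fixes w e i :: "'a::euclidean_space" and z :: complex
 assumes d: "d > 0" and t: "t > 0" and far: "norm w > d / 2 \<or> t > d / 2" and e: "norm e = 1" and z: "norm z < d / 8"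
  and w: "norm w \<le> D" and i: "norm i \<le> 1" and c0: "\<bar>c0\<bar> \<le> 1"
 shows "norm (of_real ((1 / sqrt t) ^ n) * exp (- (of_real (w \<bullet> w) + 2 * z * of_real (w \<bullet> e) + z\<^sup>2) / of_real (4 * t))
   * (of_real c0 + (of_real (w \<bullet> i) + z * of_real (e \<bullet> i)) / of_real (2 * t)))
  \<le> (1 + D + d) * (fact (n + 1) * exp (d\<^sup>2 / 32) / (d\<^sup>2 / 32) ^ (n + 1) + (1 + 2 / d) ^ (n + 1) * exp (d / 128))"
proof -
 define u where "u = 1 / t"
 have u: "u > 0" using t by (simp add: u_def)
 define a b where "a = Re z" and "b = Im z"
 have ab: "\<bar>a\<bar> < d / 8" "\<bar>b\<bar> < d / 8"
  using z abs_Re_le_cmod[of z] abs_Im_le_cmod[of z] unfolding a_def b_def by linarith+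
 have ee: "e \<bullet> e = 1" using e by (simp add: norm_eq_1)
 define \<rho> where "\<rho> = of_real (w \<bullet> w) + 2 * z * of_real (w \<bullet> e) + z\<^sup>2"
 have Re\<rho>: "Re \<rho> = (norm (w + a *\<^sub>R e))\<^sup>2 - b\<^sup>2"
  unfolding \<rho>_def a_def b_def power2_norm_eq_inner
  by (simp add: inner_simps ee inner_commute power2_eq_square algebra_simps)
 have b2: "b\<^sup>2 \<le> (d / 8)\<^sup>2" using ab(2) by (metis abs_ge_zero less_imp_le power2_abs power_mono)
 have nexp: "norm (exp (- \<rho> / of_real (4 * t))) = exp (- (Re \<rho> * u / 4))"
  by (simp add: norm_exp_eq_Re u_def)
 let ?M1 = "fact (n + 1) * exp (d\<^sup>2 / 32) / (d\<^sup>2 / 32) ^ (n + 1)" and ?M2 = "(1 + 2 / d) ^ (n + 1) * exp (d / 128)"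
 have M0: "?M1 \<ge> 0" "?M2 \<ge> 0" using d by auto
 have main: "(1 + u) ^ (n + 1) * norm (exp (- \<rho> / of_real (4 * t))) \<le> ?M1 + ?M2"
  using far
 proof
  assume far: "norm w > d / 2"
  have "norm w \<le> norm (w + a *\<^sub>R e) + norm (a *\<^sub>R e)" by (metis add_diff_cancel_right' norm_triangle_ineq4)
  hence "norm (w + a *\<^sub>R e) \<ge> 3 * d / 8" using far ab(1) e by simp
  hence "(norm (w + a *\<^sub>R e))\<^sup>2 \<ge> (3 * d / 8)\<^sup>2" using d by (intro power_mono) auto
  hence "Re \<rho> \<ge> d\<^sup>2 / 8" unfolding Re\<rho> using b2 by (simp add: power_divide power_mult_distrib)
  hence "Re \<rho> * u / 4 \<ge> d\<^sup>2 / 8 * u / 4" using u by (intro divide_right_mono mult_right_mono) auto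
  hence "norm (exp (- \<rho> / of_real (4 * t))) \<le> exp (- (d\<^sup>2 / 32 * u))" unfolding nexp by simp
  hence "(1 + u) ^ (n + 1) * norm (exp (- \<rho> / of_real (4 * t))) \<le> (1 + u) ^ (n + 1) * exp (- (d\<^sup>2 / 32 * u))"
   using u by (intro mult_left_mono) auto
  also have "\<dots> \<le> ?M1"
  proof -
   let ?c = "d\<^sup>2 / 32"
   have c: "?c > 0" using d by simp
   have "(?c * (1 + u)) ^ (n + 1) * exp (- (?c * (1 + u))) \<le> fact (n + 1)"
    using c u by (intro pow_exp_bound mult_nonneg_nonneg) auto
   hence "?c ^ (n + 1) * ((1 + u) ^ (n + 1) * exp (- (?c * u))) * exp (- ?c) \<le> fact (n + 1)"
    unfolding power_mult_distrib by (simp add: distrib_left exp_add[symmetric] mult.assoc add.commute)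
   hence "?c ^ (n + 1) * ((1 + u) ^ (n + 1) * exp (- (?c * u))) \<le> fact (n + 1) * exp ?c"
    by (simp add: exp_minus field_simps)
   thus ?thesis using zero_less_power[OF c, of "n + 1"] by (simp only: pos_le_divide_eq mult.commute)
  qed
  finally show ?thesis using M0 by linarith
 next
  assume far: "t > d / 2"
  have u2: "u \<le> 2 / d" using far d t by (simp add: u_def field_simps)
  have "Re \<rho> \<ge> - ((d / 8)\<^sup>2)" unfolding Re\<rho> using b2 zero_le_power2[of "norm (w + a *\<^sub>R e)"] by linarith
  hence "- Re \<rho> * u \<le> (d / 8)\<^sup>2 * (2 / d)" using u u2 by (intro mult_mono) auto
  moreover have "(d / 8)\<^sup>2 * (2 / d) = d / 32" using d by (simp add: power2_eq_square)
  ultimately have "- (Re \<rho> * u / 4) \<le> d / 128" by linarith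
  hence "norm (exp (- \<rho> / of_real (4 * t))) \<le> exp (d / 128)" unfolding nexp by simp
  moreover have "(1 + u) ^ (n + 1) \<le> (1 + 2 / d) ^ (n + 1)" using u u2 by (intro power_mono) auto
  ultimately have "(1 + u) ^ (n + 1) * norm (exp (- \<rho> / of_real (4 * t))) \<le> ?M2"
   using u d by (intro mult_mono) auto
  thus ?thesis using M0 by linarith
 qed
 \<comment> \<open>Powers of \<open>1 / sqrt t\<close> are replaced by powers of
   \<open>1 + u\<close>, so that small and large times need no separate treatment.\<close>
 have p1: "(1 / sqrt t) ^ n \<le> (1 + u) ^ n"
 proof (rule power_mono)
  have "1 / sqrt t = sqrt u" by (simp add: u_def real_sqrt_divide)
  also have "\<dots> \<le> 1 + u" using u by (intro real_le_lsqrt) (auto simp: power2_eq_square algebra_simps)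
  finally show "1 / sqrt t \<le> 1 + u" .
 qed (use t in simp)
 have D0: "D \<ge> 0" using w norm_ge_zero[of w] by linarith
 have p2: "norm (of_real c0 + (of_real (w \<bullet> i) + z * of_real (e \<bullet> i)) / of_real (2 * t)) \<le> (1 + D + d) * (1 + u)"
 proof -
  have wi: "\<bar>w \<bullet> i\<bar> \<le> D"
   using Cauchy_Schwarz_ineq2[of w i] w i mult_mono[OF w i] D0 by auto
  have ei: "\<bar>e \<bullet> i\<bar> \<le> 1"
   using Cauchy_Schwarz_ineq2[of e i] i e by auto
  have zei: "norm (z * of_real (e \<bullet> i)) \<le> d"
   unfolding norm_mult using mult_mono[of "norm z" d "\<bar>e \<bullet> i\<bar>" 1] z ei d by simp
  have "norm (of_real c0 + (of_real (w \<bullet> i) + z * of_real (e \<bullet> i)) / of_real (2 * t))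
    \<le> \<bar>c0\<bar> + (\<bar>w \<bullet> i\<bar> + norm (z * of_real (e \<bullet> i))) / (2 * t)"
   by (rule order_trans[OF norm_triangle_ineq])
     (use t norm_triangle_ineq[of "of_real (w \<bullet> i)" "z * of_real (e \<bullet> i)"] in \<open>simp add: norm_divide divide_right_mono\<close>)
  also have "\<dots> \<le> 1 + (D + d) / t"
  proof -
   have "(\<bar>w \<bullet> i\<bar> + norm (z * of_real (e \<bullet> i))) / (2 * t) \<le> (D + d) / t"
    using t wi zei D0 d by (intro frac_le) auto
   thus ?thesis using c0 by linarith
  qed
  also have "\<dots> = 1 + (D + d) * u" by (simp add: u_def)
  also have "\<dots> \<le> (1 + D + d) * (1 + u)" using D0 d u by (simp add: algebra_simps)
  finally show ?thesis .
 qed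
 have "norm (of_real ((1 / sqrt t) ^ n) * exp (- \<rho> / of_real (4 * t))
   * (of_real c0 + (of_real (w \<bullet> i) + z * of_real (e \<bullet> i)) / of_real (2 * t)))
   = (1 / sqrt t) ^ n * norm (exp (- \<rho> / of_real (4 * t)))
   * norm (of_real c0 + (of_real (w \<bullet> i) + z * of_real (e \<bullet> i)) / of_real (2 * t))"
  unfolding norm_mult norm_of_real using t by (simp add: abs_of_nonneg)
 also have "\<dots> \<le> (1 + u) ^ n * norm (exp (- \<rho> / of_real (4 * t))) * ((1 + D + d) * (1 + u))"
  using p1 p2 u by (intro mult_mono mult_nonneg_nonneg) auto
 also have "\<dots> = (1 + D + d) * ((1 + u) ^ (n + 1) * norm (exp (- \<rho> / of_real (4 * t))))" by simp
 also have "\<dots> \<le> (1 + D + d) * (?M1 + ?M2)" using main D0 d by (intro mult_left_mono) auto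
 finally show ?thesis unfolding \<rho>_def .
qed

text \<open>The two kernels of the caloric part are \<open>heat_kernel T\<close> times a factor of the following form.\<close>

lemma heat_kernel_analytic:
 fixes b :: "real \<times> 'a::euclidean_space \<Rightarrow> real" and c0 :: real and i :: 'a
 assumes b: "b \<in> \<D> V" and d: "d > 0" and D: "bounded D"
  and far: "\<And>p q. p \<in> D \<Longrightarrow> dist p q \<le> d \<Longrightarrow> b q = 0" and c0: "\<bar>c0\<bar> \<le> 1" and i: "norm i \<le> 1"
 obtains C where "C \<ge> 0"
  "\<And>U t x e. sqint lborel U \<Longrightarrow> (t, x) \<in> D \<Longrightarrow> norm e = 1 \<Longrightarrow>
   extends_holomorphically (d / 8) (C * l2 lborel U)
    (\<lambda>s. (LBINT p. (U p * b p) * (heat_kernel T ((t, x + s *\<^sub>R e) - p)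
      * (c0 + ((x + s *\<^sub>R e - snd p) \<bullet> i) / (2 * (t - fst p))))))"
proof -
 obtain K where K: "compact K" "\<And>p. p \<notin> K \<Longrightarrow> b p = 0" using test_functionsE[OF b] by metis
 obtain RK where RK: "\<And>p. p \<in> K \<Longrightarrow> norm p \<le> RK" using compact_imp_bounded[OF K(1)] unfolding bounded_iff by blast
 obtain RD where RD: "\<And>p. p \<in> D \<Longrightarrow> norm p \<le> RD" using D unfolding bounded_iff by blast
 define c where "c = (\<integral>y. exp (- (y \<bullet> y) / 4) \<partial>(lborel :: 'a measure))"
 have c: "c > 0" unfolding c_def by (rule gauss_const_pos)
 define n where "n = DIM('a)"
 define C1 where "C1 = (1 + (RK + RD) + d) * (fact (n + 1) * exp (d\<^sup>2 / 32) / (d\<^sup>2 / 32) ^ (n + 1) + (1 + 2 / d) ^ (n + 1) * exp (d / 128)) / c"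
 have bsq: "sqint lborel b" by (rule test_sqint[OF b])
 note bm[measurable] = test_borel[OF b]
 show thesis
 proof (rule that[of "\<bar>C1\<bar> * l2 lborel b"])
  show "\<bar>C1\<bar> * l2 lborel b \<ge> 0" by (simp add: l2_nonneg)
  fix U :: "real \<times> 'a \<Rightarrow> real" and t x e
  assume U: "sqint lborel U" and tx: "(t, x) \<in> D" and e: "norm (e::'a) = 1"
  have Um[measurable]: "U \<in> borel_measurable borel" using U by (simp add: sqint_def)
  \<comment> \<open>The integrand on the line through \<open>x\<close> in direction \<open>e\<close>
    at the complex parameter \<open>z\<close>; the condition on \<open>t - fst p\<close> is the time
    window of the kernel.\<close>
  define F :: "complex \<Rightarrow> real \<times> 'a \<Rightarrow> complex" where
   "F z p = of_real (U p * b p) * (if 0 < t - fst p \<and> t - fst p < T then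
     of_real ((1 / sqrt (t - fst p)) ^ n)
     * exp (- (of_real ((x - snd p) \<bullet> (x - snd p)) + 2 * z * of_real ((x - snd p) \<bullet> e) + z\<^sup>2) / of_real (4 * (t - fst p)))
     * (of_real c0 + (of_real ((x - snd p) \<bullet> i) + z * of_real (e \<bullet> i)) / of_real (2 * (t - fst p))) / of_real c else 0)" for z p
  have Fh: "(\<lambda>z. F z p) holomorphic_on ball 0 (d / 8)" for p
  proof (cases "0 < t - fst p \<and> t - fst p < T")
   case True
   hence "complex_of_real (4 * (t - fst p)) \<noteq> 0" "complex_of_real (2 * (t - fst p)) \<noteq> 0"
    unfolding of_real_eq_0_iff by simp_all
   thus ?thesis unfolding F_def using True c by (simp only: simp_thms if_True) (intro holomorphic_intros, auto)
  next
   case False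
   thus ?thesis unfolding F_def by (simp only: if_False) simp
  qed
  have Fm: "F z \<in> borel_measurable lborel" for z
  proof -
   have [measurable]: "U \<in> borel_measurable (borel \<Otimes>\<^sub>M borel)" "b \<in> borel_measurable (borel \<Otimes>\<^sub>M borel)"
    using Um bm by (simp_all add: borel_prod)
   have "F z \<in> borel_measurable (borel \<Otimes>\<^sub>M borel)" unfolding F_def[abs_def] by measurable
   thus ?thesis by (simp add: borel_prod)
  qed
  have Fb: "norm (F z p) \<le> \<bar>C1\<bar> * \<bar>U p * b p\<bar>" if z: "z \<in> ball 0 (d / 8)" for z p
  proof (cases "b p = 0 \<or> \<not> (0 < t - fst p \<and> t - fst p < T)")
   case False
   hence bp: "b p \<noteq> 0" and tp: "0 < t - fst p" "t - fst p < T" by auto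
   have dd: "dist (t, x) p > d" using far[OF tx, of p] bp by force
   \<comment> \<open>Space-time distance above \<open>d\<close> means more than \<open>d / 2\<close>
     in space or in time, the two cases of \<open>complex_gauss_bound\<close>.\<close>
   have "dist (t, x) p \<le> \<bar>t - fst p\<bar> + norm (x - snd p)"
    unfolding dist_prod_def dist_norm by (rule order_trans[OF sqrt_sum_squares_le_sum_abs]) simp
   hence far': "norm (x - snd p) > d / 2 \<or> t - fst p > d / 2" using dd tp by linarith
   have "norm (x - snd p) \<le> RK + RD"
   proof -
    have "norm (x - snd p) \<le> norm x + norm (snd p)" by (rule norm_triangle_ineq4)
    also have "\<dots> \<le> norm (t, x) + norm p" using norm_snd_le[of x t] norm_snd_le[of "snd p" "fst p"] by simp
    also have "\<dots> \<le> RK + RD" using RK[of p] RD[OF tx] K(2)[of p] bp by force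
    finally show ?thesis .
   qed
   note bnd = complex_gauss_bound[OF d tp(1) far' e _ this i c0, of z n]
   have "norm (F z p) \<le> \<bar>U p * b p\<bar> * C1"
    unfolding F_def norm_mult norm_of_real C1_def using z tp c bnd
    by (simp add: norm_divide norm_mult mult_left_mono divide_right_mono)
   also have "\<dots> \<le> \<bar>C1\<bar> * \<bar>U p * b p\<bar>" by (simp add: mult.commute mult_right_mono)
   finally show ?thesis .
  qed (auto simp: F_def)
  have hi: "integrable lborel (\<lambda>p. \<bar>C1\<bar> * \<bar>U p * b p\<bar>)"
   using sqint_mult[OF U bsq] by simp
  define G where "G z = (LBINT p. F z p)" for z
  show "extends_holomorphically (d / 8) (\<bar>C1\<bar> * l2 lborel b * l2 lborel U)
    (\<lambda>s. (LBINT p. (U p * b p) * (heat_kernel T ((t, x + s *\<^sub>R e) - p)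
      * (c0 + ((x + s *\<^sub>R e - snd p) \<bullet> i) / (2 * (t - fst p))))))"
   unfolding extends_holomorphically_def
  proof (intro exI[of _ G] conjI ballI allI)
   show "G holomorphic_on ball 0 (d / 8)"
    unfolding G_def by (rule holomorphic_lebesgue_integral[OF Fh Fm Fb hi])
   show "norm (G z) \<le> \<bar>C1\<bar> * l2 lborel b * l2 lborel U" if z: "z \<in> ball 0 (d / 8)" for z
   proof -
    have "norm (G z) \<le> (LBINT p. \<bar>C1\<bar> * \<bar>U p * b p\<bar>)"
     unfolding G_def using Fb[OF z] by (intro Bochner_Integration.integral_norm_bound_integral hi)
      (auto intro!: integrable_bound[OF hi Fm] simp: abs_mult)
    also have "\<dots> = \<bar>C1\<bar> * (LBINT p. \<bar>U p\<bar> * \<bar>b p\<bar>)" by (simp add: abs_mult)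
    also have "(LBINT p. \<bar>U p\<bar> * \<bar>b p\<bar>) \<le> l2 lborel (\<lambda>p. \<bar>U p\<bar>) * l2 lborel (\<lambda>p. \<bar>b p\<bar>)"
     using Cauchy_Schwarz_l2[of lborel "\<lambda>p. \<bar>U p\<bar>" "\<lambda>p. \<bar>b p\<bar>"] U bsq by (simp add: sqint_def)
    also have "\<dots> = l2 lborel b * l2 lborel U" by (simp add: l2_def mult.commute)
    finally show ?thesis by (simp add: mult_left_mono mult.assoc)
   qed
   fix s :: real
   have "F (of_real s) p = of_real ((U p * b p) * (heat_kernel T ((t, x + s *\<^sub>R e) - p)
      * (c0 + ((x + s *\<^sub>R e - snd p) \<bullet> i) / (2 * (t - fst p)))))" for p
   proof (cases "0 < t - fst p \<and> t - fst p < T")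
    case True
    let ?\<tau> = "t - fst p" and ?w = "x - snd p"
    have sub: "(t, x + s *\<^sub>R e) - p = (?\<tau>, ?w + s *\<^sub>R e)" by (simp add: prod_eq_iff)
    have ee: "e \<bullet> e = 1" using e by (simp add: norm_eq_1)
    have sq: "((1 / sqrt ?\<tau>) *\<^sub>R (?w + s *\<^sub>R e)) \<bullet> ((1 / sqrt ?\<tau>) *\<^sub>R (?w + s *\<^sub>R e))
      = (?w \<bullet> ?w + 2 * s * (?w \<bullet> e) + s\<^sup>2) / ?\<tau>"
    proof -
     have "((1 / sqrt ?\<tau>) *\<^sub>R (?w + s *\<^sub>R e)) \<bullet> ((1 / sqrt ?\<tau>) *\<^sub>R (?w + s *\<^sub>R e))
       = (1 / sqrt ?\<tau> * (1 / sqrt ?\<tau>)) * ((?w + s *\<^sub>R e) \<bullet> (?w + s *\<^sub>R e))" by simp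
     also have "1 / sqrt ?\<tau> * (1 / sqrt ?\<tau>) = 1 / ?\<tau>" using True by simp
     also have "(?w + s *\<^sub>R e) \<bullet> (?w + s *\<^sub>R e) = ?w \<bullet> ?w + 2 * s * (?w \<bullet> e) + s\<^sup>2"
      unfolding inner_add_left inner_add_right inner_scaleR_left inner_scaleR_right ee
      by (simp add: inner_commute[of e] power2_eq_square algebra_simps)
     finally show ?thesis by simp
    qed
    have hk: "heat_kernel T ((t, x + s *\<^sub>R e) - p) = (1 / sqrt ?\<tau>) ^ n
      * (exp (- (?w \<bullet> ?w + 2 * s * (?w \<bullet> e) + s\<^sup>2) / (4 * ?\<tau>)) / c)"
    proof -
     have "- (X / ?\<tau>) / 4 = - X / (4 * ?\<tau>)" for X by (simp add: mult.commute)
     thus ?thesis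
      unfolding sub heat_kernel_def parabolic_kernel_def gauss_def fst_conv snd_conv sq c_def[symmetric] n_def[symmetric]
      using True by (simp only: indicator_simps greaterThanLessThan_iff simp_thms mult_1)
    qed
    have wi: "(x + s *\<^sub>R e - snd p) \<bullet> i = ?w \<bullet> i + s * (e \<bullet> i)" by (simp add: inner_simps)
    have arg: "- (of_real (?w \<bullet> ?w) + 2 * of_real s * of_real (?w \<bullet> e) + (of_real s)\<^sup>2) / of_real (4 * ?\<tau>)
      = complex_of_real (- (?w \<bullet> ?w + 2 * s * (?w \<bullet> e) + s\<^sup>2) / (4 * ?\<tau>))" by simp
    define E where "E = exp (- (?w \<bullet> ?w + 2 * s * (?w \<bullet> e) + s\<^sup>2) / (4 * ?\<tau>))"
    show ?thesis
     unfolding hk wi F_def arg exp_of_real E_def[symmetric] using True by simp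
   next
    case False
    have "(t, x + s *\<^sub>R e) - p = (t - fst p, x - snd p + s *\<^sub>R e)" by (simp add: prod_eq_iff)
    hence "heat_kernel T ((t, x + s *\<^sub>R e) - p) = 0"
     unfolding heat_kernel_def parabolic_kernel_def using False by auto
    thus ?thesis unfolding F_def using False by (simp only: if_False) simp
   qed
   hence "F (of_real s) = (\<lambda>p. of_real ((U p * b p) * (heat_kernel T ((t, x + s *\<^sub>R e) - p)
      * (c0 + ((x + s *\<^sub>R e - snd p) \<bullet> i) / (2 * (t - fst p))))))"
    by (rule ext)
   thus "G (of_real s) = of_real (LBINT p. (U p * b p) * (heat_kernel T ((t, x + s *\<^sub>R e) - p)
      * (c0 + ((x + s *\<^sub>R e - snd p) \<bullet> i) / (2 * (t - fst p)))))"
    unfolding G_def by (simp only: integral_complex_of_real)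
  qed
 qed
qed

lemma heat_kernel_grad_eq:
 "heat_kernel_grad T i q = heat_kernel T q * ((snd q \<bullet> i) / (2 * fst q))"
proof (cases "fst q > 0")
 case True
 have "1 / sqrt (fst q) * (k * ((1 / sqrt (fst q) * a) / 2 * g)) = k * g * (a / (2 * fst q))" for a k g :: real
  using True by (simp add: field_simps)
 thus ?thesis
  using True unfolding heat_kernel_grad_def heat_kernel_def parabolic_kernel_def by (simp add: indicator_def)
qed (auto simp: heat_kernel_grad_def heat_kernel_def parabolic_kernel_def)

text \<open>Every term of the caloric part carries a derivative of \<open>\<eta>\<close>, and these
  vanish on the open ball of radius \<open>d\<close> about a point of \<open>D\<close>, hence on the
  closed ball of radius \<open>d / 2\<close>. Radius and constant are uniform in \<open>U\<close>,
  in the point and in the direction.\<close>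

lemma caloric_part_analytic:
 fixes \<eta> :: "real \<times> 'a::euclidean_space \<Rightarrow> real"
 assumes \<eta>: "\<eta> \<in> \<D> V" and d: "d > 0" and D: "bounded D"
  and one: "\<And>p q. p \<in> D \<Longrightarrow> dist p q \<le> d \<Longrightarrow> \<eta> q = 1"
 obtains R C where "R > 0" "C \<ge> 0"
  "\<And>U t x e. sqint lborel U \<Longrightarrow> (t, x) \<in> D \<Longrightarrow> norm e = 1 \<Longrightarrow>
   extends_holomorphically R (C * l2 lborel U) (\<lambda>s. caloric_part \<eta> T U (t, x + s *\<^sub>R e))"
proof -
 define d' where "d' = d / 2"
 have d': "d' > 0" using d by (simp add: d'_def)
 have z: "pd j f q = 0" if "dist p q < d" "\<And>q. dist p q < d \<Longrightarrow> f q = a" for p q j a and f :: "real \<times> 'a \<Rightarrow> real"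
 proof -
  have "((\<lambda>_. a) has_derivative (\<lambda>_. 0)) (at q)" by simp
  hence "(f has_derivative (\<lambda>_. 0)) (at q)"
   by (rule has_derivative_transform_within_open[of _ _ _ _ "ball p d"]) (use that in auto)
  thus ?thesis by (simp add: partial_deriv_eqI)
 qed
 have z1: "pd j \<eta> q = 0" if p: "p \<in> D" "dist p q < d" for p q j
  by (rule z[OF p(2), of _ 1]) (use one[OF p(1)] in auto)
 have z2: "pd k (pd j \<eta>) q = 0" if p: "p \<in> D" "dist p q < d" for p q j k
  by (rule z[OF p(2) z1[OF p(1)]])
 have dd: "dist p q < d" if "dist p q \<le> d'" for p q :: "real \<times> 'a" using that d by (simp add: d'_def)
 have zA: "heat_dual \<eta> q = 0" if "p \<in> D" "dist p q \<le> d'" for p q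
  unfolding heat_dual_def using z1[OF that(1) dd[OF that(2)]] z2[OF that(1) dd[OF that(2)]] by simp
 have zi: "2 * pd (0, i) \<eta> q = 0" if "p \<in> D" "dist p q \<le> d'" for p q i
  using z1[OF that(1) dd[OF that(2)]] by simp
 let ?I = "\<lambda>U b c0 i t x e s. (LBINT p. (U p * b p) * (heat_kernel T ((t, x + s *\<^sub>R e) - p)
      * (c0 + ((x + s *\<^sub>R e - snd p) \<bullet> i) / (2 * (t - fst p)))))"
 obtain C0 where C0: "C0 \<ge> 0" "\<And>U t x e. sqint lborel U \<Longrightarrow> (t, x) \<in> D \<Longrightarrow> norm e = 1 \<Longrightarrow>
   extends_holomorphically (d' / 8) (C0 * l2 lborel U) (?I U (heat_dual \<eta>) 1 0 t x e)"
  by (rule heat_kernel_analytic[OF test_heat_dual[OF \<eta>] d' D zA, where ?c0.0=1 and i=0 and T=T]) auto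
 define Q where "Q i C \<longleftrightarrow> (\<forall>U t x e. sqint lborel U \<longrightarrow> (t, x) \<in> D \<longrightarrow> norm e = 1 \<longrightarrow>
   extends_holomorphically (d' / 8) (C * l2 lborel U) (?I U (\<lambda>p. 2 * pd (0, i) \<eta> p) 0 i t x e))" for i C
 have "\<exists>C\<ge>0. Q i C" if i: "i \<in> Basis" for i
 proof -
  have "(\<lambda>p. 2 * pd (0, i) \<eta> p) \<in> \<D> V"
   using test_mult2[OF test_partial_deriv[OF \<eta>] smooth_const[of 2]] i by simp
  thus ?thesis unfolding Q_def
   by (rule heat_kernel_analytic[OF _ d' D zi, where ?c0.0=0 and i=i and T=T]) (use i in auto)
 qed
 then obtain Ci where Ci0: "\<And>i. i \<in> Basis \<Longrightarrow> Ci i \<ge> 0" and Ci': "\<And>i. i \<in> Basis \<Longrightarrow> Q i (Ci i)"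
  by metis
 note Ci = Ci'[unfolded Q_def, rule_format]
 show thesis
 proof (rule that[of "d' / 8" "C0 + (\<Sum>i\<in>Basis. Ci i)"])
  show "d' / 8 > 0" using d' by simp
  show "C0 + (\<Sum>i\<in>Basis. Ci i) \<ge> 0" using C0 Ci0 by (simp add: sum_nonneg)
  fix U :: "real \<times> 'a \<Rightarrow> real" and t x e
  assume a: "sqint lborel U" "(t, x) \<in> D" "norm (e::'a) = 1"
  have "extends_holomorphically (d' / 8) (C0 * l2 lborel U + (\<Sum>i\<in>Basis. Ci i * l2 lborel U))
   (\<lambda>s. ?I U (heat_dual \<eta>) 1 0 t x e s + (\<Sum>i\<in>Basis. ?I U (\<lambda>p. 2 * pd (0, i) \<eta> p) 0 i t x e s))"
   by (intro extends_holomorphically_add extends_holomorphically_sum finite_Basis C0(2) Ci a)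
  thus "extends_holomorphically (d' / 8) ((C0 + (\<Sum>i\<in>Basis. Ci i)) * l2 lborel U)
    (\<lambda>s. caloric_part \<eta> T U (t, x + s *\<^sub>R e))"
   unfolding caloric_part_def heat_kernel_grad_eq by (simp add: distrib_right sum_distrib_right)
 qed
qed

section \<open>Propagation of smallness\<close>

text \<open>The Joukowski map takes the unit circle to the segment and an annulus around it to a
 neighbourhood of the segment. The integer \<open>q\<close> balances the two boundary bounds for
 \<open>G (J \<zeta>) / \<zeta> ^ q\<close>.\<close>

lemma two_constants_pos:
 assumes hol: "G holomorphic_on ball 0 R" and M: "\<And>z. z \<in> ball 0 R \<Longrightarrow> norm (G z) \<le> M"
  and r: "r > 0" "16 * r \<le> R" and e: "0 < \<epsilon>" "\<epsilon> \<le> M"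
  and small: "\<And>s. \<bar>s\<bar> \<le> r \<Longrightarrow> norm (G (of_real s)) \<le> \<epsilon>" and z: "norm z \<le> 2 * r"
 shows "norm (G z) \<le> 25 * sqrt (\<epsilon> * M)"
proof -
 define J where "J \<zeta> = of_real (r / 2) * (\<zeta> + 1 / \<zeta>)" for \<zeta> :: complex
 \<comment> \<open>Up to radius 25 the map is bounded by \<open>13 * r\<close>, which is below
   \<open>16 * r\<close>; this is the origin of the ratio between \<open>R\<close> and
   \<open>r\<close>.\<close>
 have JR: "J \<zeta> \<in> ball 0 R" if "1 \<le> norm \<zeta>" "norm \<zeta> \<le> 25" for \<zeta>
 proof -
  have "norm (\<zeta> + 1 / \<zeta>) \<le> norm \<zeta> + norm (1 / \<zeta>)" by (rule norm_triangle_ineq)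
  also have "\<dots> \<le> 25 + 1" using that by (intro add_mono) (auto simp: norm_divide divide_le_eq)
  finally have "norm (J \<zeta>) \<le> r / 2 * 26"
   unfolding J_def norm_mult using r by (simp add: mult_left_mono)
  thus ?thesis using r by simp
 qed
 \<comment> \<open>With \<open>c = z / r\<close>, the preimages are the roots \<open>c + w\<close>
   and \<open>c - w\<close> of a quadratic, with product 1. The one outside the unit disc is taken,
   and its norm is at most 2 * 2 + 1 = 5.\<close>
 obtain \<zeta> where \<zeta>: "J \<zeta> = z" "1 \<le> norm \<zeta>" "norm \<zeta> \<le> 5"
 proof -
  define c where "c = z / of_real r"
  have nc: "norm c \<le> 2" using z r by (simp add: c_def norm_divide divide_le_eq)
  define w where "w = csqrt (c\<^sup>2 - 1)"
  have w2: "w\<^sup>2 = c\<^sup>2 - 1" by (simp add: w_def)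
  have pr: "(c + w) * (c - w) = 1" using w2 by (simp add: power2_eq_square algebra_simps)
  define \<zeta> where "\<zeta> = (if norm (c + w) \<ge> 1 then c + w else c - w)"
  have inv: "\<zeta> \<noteq> 0" "\<zeta> + 1 / \<zeta> = 2 * c" "norm \<zeta> \<ge> 1"
  proof -
   show "\<zeta> \<noteq> 0" using pr by (auto simp: \<zeta>_def)
   have "c + w \<noteq> 0" "c - w \<noteq> 0" using pr by auto
   hence "1 / (c + w) = c - w" "1 / (c - w) = c + w" using pr by (auto simp: field_simps)
   thus "\<zeta> + 1 / \<zeta> = 2 * c" by (simp add: \<zeta>_def)
   show "norm \<zeta> \<ge> 1"
   proof (cases "norm (c + w) \<ge> 1")
    case False
    have "norm (c + w) * norm (c - w) = 1" using pr by (metis norm_mult norm_one)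
    moreover have "norm (c + w) * norm (c - w) \<le> 1 * norm (c - w)" using False by (intro mult_right_mono) auto
    ultimately show ?thesis using False by (simp add: \<zeta>_def)
   qed (simp add: \<zeta>_def)
  qed
  have "norm \<zeta> \<le> norm (2 * c) + norm (1 / \<zeta>)"
   using inv(2) norm_triangle_ineq4[of "2 * c" "1 / \<zeta>"] by (metis add_diff_cancel_right')
  also have "\<dots> \<le> 4 + 1" using nc inv(3) by (intro add_mono) (auto simp: norm_mult norm_divide divide_le_eq)
  finally have "norm \<zeta> \<le> 5" by simp
  moreover have "J \<zeta> = z" unfolding J_def inv(2) c_def using r by simp
  ultimately show ?thesis using that inv(3) by blast
 qed
 have Me: "M / \<epsilon> \<ge> 1" using e by simp
 \<comment> \<open>The largest integer with \<open>25 ^ q \<le> M / \<epsilon>\<close>; rounding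
   costs the factor 25. The radius 25 is the square of the bound 5 for \<open>norm \<zeta>\<close>,
   so \<open>5 ^ q\<close> is at most the square root of \<open>M / \<epsilon>\<close> and the
   exponent is one half.\<close>
 define q where "q = nat \<lfloor>log 25 (M / \<epsilon>)\<rfloor>"
 have q: "25 ^ q \<le> M / \<epsilon>" "M / \<epsilon> \<le> 25 ^ (q + 1)"
 proof -
  have l0: "log 25 (M / \<epsilon>) \<ge> 0" using Me by simp
  have "real q \<le> log 25 (M / \<epsilon>)" unfolding q_def using l0 by simp
  hence "25 powr real q \<le> M / \<epsilon>" using Me by (subst (asm) le_log_iff) auto
  thus "25 ^ q \<le> M / \<epsilon>" by (simp add: powr_realpow)
  have "log 25 (M / \<epsilon>) \<le> real (q + 1)" unfolding q_def using l0 by linarith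
  hence "M / \<epsilon> \<le> 25 powr real (q + 1)" using Me by (subst (asm) log_le_iff) auto
  thus "M / \<epsilon> \<le> 25 ^ (q + 1)" by (simp only: powr_realpow zero_less_numeral)
 qed
 define S where "S = cball (0::complex) 25 - ball 0 1"
 have S0: "x \<noteq> 0" if "x \<in> S" for x using that by (auto simp: S_def)
 have cS: "closed S" unfolding S_def by (intro closed_Diff) auto
 have holJ: "J holomorphic_on (- {0})" unfolding J_def by (intro holomorphic_intros) auto
 have hS: "(\<lambda>x. G (J x) / x ^ q) holomorphic_on S"
 proof (intro holomorphic_on_divide holomorphic_on_power holomorphic_on_ident)
  have "G \<circ> J holomorphic_on S"
  proof (rule holomorphic_on_compose_gen[OF _ hol])
   show "J holomorphic_on S" by (rule holomorphic_on_subset[OF holJ]) (use S0 in auto)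
   show "J ` S \<subseteq> ball 0 R" using JR by (auto simp: S_def)
  qed
  thus "(\<lambda>x. G (J x)) holomorphic_on S" by (simp add: comp_def)
 qed (use S0 in auto)
 have "norm (G (J \<zeta>) / \<zeta> ^ q) \<le> 25 * \<epsilon>"
 proof (rule maximum_modulus_frontier[of "\<lambda>x. G (J x) / x ^ q" S])
  show "(\<lambda>x. G (J x) / x ^ q) holomorphic_on interior S"
   by (rule holomorphic_on_subset[OF hS interior_subset])
  show "continuous_on (closure S) (\<lambda>x. G (J x) / x ^ q)"
   using holomorphic_on_imp_continuous_on[OF hS] cS by simp
  show "bounded S" unfolding S_def by (rule bounded_subset[OF bounded_cball]) auto
  show "\<zeta> \<in> S" using \<zeta> by (simp add: S_def)
  fix x assume x: "x \<in> frontier S"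
  have xS: "x \<in> S" using x cS frontier_subset_closed by blast
  have "x \<notin> ball 0 25 - cball 0 1"
  proof
   assume "x \<in> ball 0 25 - cball 0 1"
   moreover have "open (ball (0::complex) 25 - cball 0 1)" by (intro open_Diff) auto
   moreover have "ball (0::complex) 25 - cball 0 1 \<subseteq> S" by (auto simp: S_def)
   ultimately have "x \<in> interior S" using interior_maximal by blast
   thus False using x by (simp add: frontier_def)
  qed
  then consider "norm x = 1" | "norm x = 25" using xS by (force simp: S_def)
  thus "norm (G (J x) / x ^ q) \<le> 25 * \<epsilon>"
  proof cases
   case 1
   \<comment> \<open>On the unit circle \<open>1 / x\<close> is the conjugate of \<open>x\<close>,
     so \<open>J x\<close> is the real number \<open>r * Re x\<close> in the segment where
     \<open>G\<close> is small.\<close>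
   have "x * cnj x = 1" using complex_norm_square[of x] 1 by simp
   hence "1 / x = cnj x" using S0[OF xS] by (simp add: divide_eq_eq mult.commute)
   hence "J x = of_real (r * Re x)" unfolding J_def by (simp add: complex_add_cnj)
   moreover have "\<bar>r * Re x\<bar> \<le> r" using abs_Re_le_cmod[of x] 1 r by (simp add: abs_mult)
   ultimately have "norm (G (J x)) \<le> \<epsilon>" using small by metis
   thus ?thesis using 1 e by (simp add: norm_divide norm_power)
  next
   case 2
   have "norm (G (J x)) \<le> M" by (rule M[OF JR]) (use 2 in auto)
   also have "M \<le> 25 * \<epsilon> * 25 ^ q" using q(2) e by (simp add: field_simps)
   finally show ?thesis using 2 by (simp add: norm_divide norm_power divide_le_eq)
  qed
 qed
 moreover have "norm \<zeta> ^ q > 0" using \<zeta>(2) by (intro zero_less_power) linarith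
 ultimately have "norm (G z) \<le> 25 * \<epsilon> * norm \<zeta> ^ q"
  using \<zeta>(1) by (simp add: norm_divide norm_power pos_divide_le_eq)
 also have "\<dots> \<le> 25 * \<epsilon> * 5 ^ q" using \<zeta> e by (intro mult_left_mono power_mono) auto
 also have "\<dots> \<le> 25 * \<epsilon> * sqrt (M / \<epsilon>)"
 proof -
  have "(25::real) ^ q = (5 ^ q)\<^sup>2" by (simp add: power2_eq_square power_mult_distrib[symmetric])
  hence "(5 ^ q :: real) = sqrt (25 ^ q)" by simp
  also have "\<dots> \<le> sqrt (M / \<epsilon>)" using q(1) by simp
  finally show ?thesis using e by simp
 qed
 also have "\<dots> = 25 * sqrt (\<epsilon> * M)"
 proof -
  have "\<epsilon> * sqrt (M / \<epsilon>) = sqrt (\<epsilon>\<^sup>2 * (M / \<epsilon>))" using e by (simp only: real_sqrt_mult) simp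
  also have "\<epsilon>\<^sup>2 * (M / \<epsilon>) = \<epsilon> * M" using e by (simp add: power2_eq_square)
  finally show ?thesis by simp
 qed
 finally show ?thesis .
qed

text \<open>For \<open>\<epsilon> \<ge> M\<close> the bound \<open>M\<close> itself is below the
  geometric mean; \<open>\<epsilon> = 0\<close> is the limit of positive values.\<close>

lemma two_constants:
 assumes hol: "G holomorphic_on ball 0 R" and M: "\<And>z. z \<in> ball 0 R \<Longrightarrow> norm (G z) \<le> M"
  and r: "r > 0" "16 * r \<le> R" and e: "0 \<le> \<epsilon>"
  and small: "\<And>s. \<bar>s\<bar> \<le> r \<Longrightarrow> norm (G (of_real s)) \<le> \<epsilon>" and z: "norm z \<le> 2 * r"
 shows "norm (G z) \<le> 25 * sqrt (\<epsilon> * M)"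
proof -
 have zR: "z \<in> ball 0 R" using z r by simp
 have M0: "M \<ge> 0" using M[OF zR] norm_ge_zero[of "G z"] by linarith
 consider "M = 0" | "M > 0" "\<epsilon> \<ge> M" | "M > 0" "\<epsilon> > 0" "\<epsilon> < M" | "M > 0" "\<epsilon> = 0" using M0 e by linarith
 thus ?thesis
 proof cases
  case 1 thus ?thesis using M[OF zR] by simp
 next
  case 2
  have "M * M \<le> \<epsilon> * M" using 2 by simp
  hence "sqrt (M * M) \<le> sqrt (\<epsilon> * M)" by (rule real_sqrt_le_mono)
  hence "M \<le> sqrt (\<epsilon> * M)" using 2 by simp
  thus ?thesis using M[OF zR] 2 by linarith
 next
  case 3 thus ?thesis using two_constants_pos[OF hol M r _ _ small z] by simp
 next
  case 4
  have "norm (G z) \<le> 25 * sqrt (\<delta> * M)" if "\<delta> > 0" "\<delta> < M" for \<delta>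
   by (rule two_constants_pos[OF hol M r that(1) less_imp_le[OF that(2)] _ z])
     (use small 4 that in \<open>auto intro: order_trans\<close>)
  hence ev: "\<forall>\<^sub>F \<delta> in at_right 0. norm (G z) \<le> 25 * sqrt (\<delta> * M)"
   using 4 by (auto simp: eventually_at_right intro!: exI[of _ M])
  have "((\<lambda>\<delta>. 25 * sqrt (\<delta> * M)) \<longlongrightarrow> 25 * sqrt (0 * M)) (at_right 0)"
   by (intro tendsto_intros)
  from tendsto_lowerbound[OF this ev] show ?thesis using 4 by simp
 qed
qed

text \<open>Holomorphic extension on every line through a point of \<open>B\<close>, with common
  radius and bound; the lines may leave \<open>B\<close>. One-variable complex analysis thus does
  the work of real analyticity in several variables.\<close>

definition line_analytic :: "'a::euclidean_space set \<Rightarrow> real \<Rightarrow> real \<Rightarrow> ('a \<Rightarrow> real) \<Rightarrow> bool" where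
 "line_analytic B R M f \<longleftrightarrow>
   (\<forall>x\<in>B. \<forall>e. norm e = 1 \<longrightarrow> extends_holomorphically R M (\<lambda>s. f (x + s *\<^sub>R e)))"

lemma line_analyticE:
 assumes "line_analytic B R M f" "x \<in> B"
 obtains e G where "norm e = 1" "y = x + norm (y - x) *\<^sub>R e" "G holomorphic_on ball 0 R"
  "\<And>z. z \<in> ball 0 R \<Longrightarrow> norm (G z) \<le> M" "\<And>s. G (of_real s) = of_real (f (x + s *\<^sub>R e))"
proof -
 obtain e where e: "norm e = 1" "y = x + norm (y - x) *\<^sub>R e"
 proof (cases "y = x")
  case True
  obtain b :: 'a where "b \<in> Basis" using nonempty_Basis by blast
  thus ?thesis using that[of b] True by simp
 next
  case False
  thus ?thesis using that[of "(y - x) /\<^sub>R norm (y - x)"] by simp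
 qed
 hence "extends_holomorphically R M (\<lambda>s. f (x + s *\<^sub>R e))" using assms unfolding line_analytic_def by blast
 thus ?thesis unfolding extends_holomorphically_def using that e by blast
qed

lemma line_analytic_bound:
 assumes "line_analytic B R M f" "x \<in> B" "norm (y - x) < R"
 shows "\<bar>f y\<bar> \<le> M"
proof -
 obtain e G where G: "norm e = 1" "y = x + norm (y - x) *\<^sub>R e" "G holomorphic_on ball 0 R"
  "\<And>z. z \<in> ball 0 R \<Longrightarrow> norm (G z) \<le> M" "\<And>s. G (of_real s) = of_real (f (x + s *\<^sub>R e))"
  using line_analyticE[OF assms(1,2), of y] by blast
 have "norm (G (of_real (norm (y - x)))) \<le> M" using G(4) assms(3) by simp
 thus ?thesis unfolding G(5) using G(2) by simp
qed

text \<open>On the line through \<open>x\<close> and \<open>y\<close> the extension is small on the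
  real segment of length \<open>2 * r\<close>, hence on the complex disc of radius
  \<open>2 * r\<close>: the ball of smallness doubles while \<open>\<epsilon>\<close> becomes the
  geometric mean with \<open>M\<close>. Cauchy's inequality on discs of radius \<open>r\<close>
  turns the same bound into a Lipschitz estimate.\<close>

lemma line_analytic_step:
 assumes f: "line_analytic B R M f" and x: "x \<in> B" and r: "r > 0" "16 * r \<le> R" and e: "\<epsilon> \<ge> 0"
  and small: "\<And>y. norm (y - x) \<le> r \<Longrightarrow> \<bar>f y\<bar> \<le> \<epsilon>"
 shows "norm (y - x) \<le> 2 * r \<Longrightarrow> \<bar>f y\<bar> \<le> 25 * sqrt (\<epsilon> * M)"
  and "norm (y - x) \<le> r \<Longrightarrow> \<bar>f y - f x\<bar> \<le> 25 * sqrt (\<epsilon> * M) / r * norm (y - x)"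
proof -
 obtain e G where G: "norm e = 1" "y = x + norm (y - x) *\<^sub>R e" "G holomorphic_on ball 0 R"
  "\<And>z. z \<in> ball 0 R \<Longrightarrow> norm (G z) \<le> M" "\<And>s. G (of_real s) = of_real (f (x + s *\<^sub>R e))"
  using line_analyticE[OF f x, of y] by blast
 have sm: "norm (G (of_real s)) \<le> \<epsilon>" if "\<bar>s\<bar> \<le> r" for s
  unfolding G(5) norm_of_real using that G(1) by (intro small) simp
 have tc: "norm (G z) \<le> 25 * sqrt (\<epsilon> * M)" if "norm z \<le> 2 * r" for z
  by (rule two_constants[OF G(3,4) r e sm that])
 show "\<bar>f y\<bar> \<le> 25 * sqrt (\<epsilon> * M)" if "norm (y - x) \<le> 2 * r"
  using tc[of "of_real (norm (y - x))"] that G(2) unfolding G(5) by simp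
 show "\<bar>f y - f x\<bar> \<le> 25 * sqrt (\<epsilon> * M) / r * norm (y - x)" if yx: "norm (y - x) \<le> r"
 proof -
  have "norm (G (of_real (norm (y - x))) - G 0) \<le> 25 * sqrt (\<epsilon> * M) / r * norm (of_real (norm (y - x)) - 0 :: complex)"
  proof (rule field_differentiable_bound[of "cball 0 r" G "deriv G"])
   show "(G has_field_derivative deriv G z) (at z within cball 0 r)" if "z \<in> cball 0 r" for z
    by (rule has_field_derivative_at_within[OF holomorphic_derivI[OF G(3)]]) (use that r in auto)
   show "norm (deriv G z) \<le> 25 * sqrt (\<epsilon> * M) / r" if "z \<in> cball 0 r" for z
   proof -
    have sub: "cball z r \<subseteq> cball 0 (2 * r)"
    proof
     fix y assume "y \<in> cball z r"
     thus "y \<in> cball 0 (2 * r)" using that dist_triangle[of 0 y z] by simp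
    qed
    have sub': "cball 0 (2 * r) \<subseteq> ball (0::complex) R" using r by auto
    have "norm ((deriv ^^ 1) G z) \<le> fact 1 * (25 * sqrt (\<epsilon> * M)) / r ^ 1"
    proof (rule Cauchy_inequality)
     show "G holomorphic_on ball z r"
      by (rule holomorphic_on_subset[OF G(3)]) (use sub sub' ball_subset_cball in blast)
     show "continuous_on (cball z r) G"
      by (rule continuous_on_subset[OF holomorphic_on_imp_continuous_on[OF G(3)]]) (use sub sub' in blast)
     show "norm (G w) \<le> 25 * sqrt (\<epsilon> * M)" if "norm (z - w) = r" for w
      by (rule tc) (use that sub in \<open>auto simp: dist_norm subset_eq\<close>)
    qed (rule r)
    thus ?thesis by simp
   qed
  qed (use yx r in auto)
  moreover have "G 0 = of_real (f x)" using G(5)[of 0] by simp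
  moreover have "G (of_real (norm (y - x))) = of_real (f y)" using G(5)[of "norm (y - x)"] G(2) by simp
  ultimately show ?thesis by (simp flip: of_real_diff)
 qed
qed

text \<open>The constant 625 is the fixed point of \<open>c \<mapsto> 25 * sqrt c\<close>. Along a
  chain of balls the constant therefore stays put and only the exponent is halved.\<close>

lemma sqrt_powr_step:
 assumes "\<epsilon> \<ge> 0" "M > 0"
 shows "25 * sqrt ((625 * \<epsilon> powr \<kappa> * M powr (1 - \<kappa>)) * M) = 625 * \<epsilon> powr (\<kappa> / 2) * M powr (1 - \<kappa> / 2)"
proof -
 have "sqrt ((625 * \<epsilon> powr \<kappa> * M powr (1 - \<kappa>)) * M) = sqrt (25\<^sup>2 * (\<epsilon> powr \<kappa> * (M powr (1 - \<kappa>) * M powr 1)))"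
  using assms by simp
 also have "M powr (1 - \<kappa>) * M powr 1 = M powr (2 - \<kappa>)" by (subst powr_add[symmetric]) simp
 also have "sqrt (25\<^sup>2 * (\<epsilon> powr \<kappa> * M powr (2 - \<kappa>))) = 25 * (sqrt (\<epsilon> powr \<kappa>) * sqrt (M powr (2 - \<kappa>)))"
  by (simp add: real_sqrt_mult)
 also have "sqrt (\<epsilon> powr \<kappa>) = \<epsilon> powr (\<kappa> / 2)" by (simp add: powr_half_sqrt[symmetric] powr_powr)
 also have "sqrt (M powr (2 - \<kappa>)) = M powr (1 - \<kappa> / 2)" by (simp add: powr_half_sqrt[symmetric] powr_powr diff_divide_distrib)
 finally show ?thesis by simp
qed

text \<open>For \<open>\<epsilon> \<le> M\<close> a smaller exponent gives a weaker bound, so chains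
  of different lengths can be replaced by one common length.\<close>

lemma powr_interpolation_mono:
 fixes \<epsilon> M :: real
 assumes "0 \<le> \<epsilon>" "\<epsilon> \<le> M" "M > 0" "\<kappa>' \<le> \<kappa>"
 shows "\<epsilon> powr \<kappa> * M powr (1 - \<kappa>) \<le> \<epsilon> powr \<kappa>' * M powr (1 - \<kappa>')"
proof (cases "\<epsilon> = 0")
 case False
 hence e: "\<epsilon> > 0" using assms by simp
 have eq: "\<epsilon> powr k * M powr (1 - k) = M * (\<epsilon> / M) powr k" for k
  using e assms by (simp add: powr_diff powr_divide)
 have "(\<epsilon> / M) powr \<kappa> \<le> (\<epsilon> / M) powr \<kappa>'" using e assms by (intro powr_mono') auto
 thus ?thesis unfolding eq using assms by simp
qed simp

text \<open>\<open>good x k\<close> says that smallness reaches the ball about \<open>x\<close>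
  after \<open>k\<close> halvings, for all functions at once. A step has the fixed length
  \<open>r\<close>, so the points of \<open>B\<close> that are reached form a set both open and
  closed in \<open>B\<close>. A finite cover of \<open>closure B\<close> by balls with centres in
  \<open>B\<close> bounds the number of steps uniformly.\<close>

lemma chain_of_balls:
 assumes B: "open B" "connected B" "compact (closure B)" and x0: "x0 \<in> B" and r: "r > 0" "16 * r \<le> R"
 obtains \<kappa> where "0 < \<kappa>" "\<kappa> < 1"
  "\<And>f M \<epsilon> x y. line_analytic B R M f \<Longrightarrow> M > 0 \<Longrightarrow> 0 \<le> \<epsilon> \<Longrightarrow> \<epsilon> \<le> M \<Longrightarrow>
   (\<And>y. norm (y - x0) \<le> r \<Longrightarrow> \<bar>f y\<bar> \<le> \<epsilon>) \<Longrightarrow> x \<in> B \<Longrightarrow> norm (y - x) \<le> r \<Longrightarrow>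
   \<bar>f y\<bar> \<le> 625 * \<epsilon> powr \<kappa> * M powr (1 - \<kappa>)"
proof -
 let ?k = "\<lambda>k::nat. (1 / 2) ^ k :: real"
 define good where "good x k \<longleftrightarrow> (\<forall>f M \<epsilon>. line_analytic B R M f \<longrightarrow> M > 0 \<longrightarrow> 0 \<le> \<epsilon> \<longrightarrow>
   (\<forall>y. norm (y - x0) \<le> r \<longrightarrow> \<bar>f y\<bar> \<le> \<epsilon>) \<longrightarrow>
   (\<forall>y. norm (y - x) \<le> r \<longrightarrow> \<bar>f y\<bar> \<le> 625 * \<epsilon> powr (?k k) * M powr (1 - ?k k)))" for x k
 have step: "good x' (Suc k)" if g: "good x k" and x: "x \<in> B" and xx: "norm (x' - x) \<le> r" for x x' k
  unfolding good_def
 proof (intro allI impI)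
  fix f M \<epsilon> y
  assume f: "line_analytic B R M f" and M: "M > 0" and e: "0 \<le> (\<epsilon>::real)"
   and s: "\<forall>y. norm (y - x0) \<le> r \<longrightarrow> \<bar>f y\<bar> \<le> \<epsilon>" and y: "norm (y - x') \<le> r"
  have "norm (y - x) \<le> 2 * r"
   using norm_triangle_ineq[of "y - x'" "x' - x"] y xx by simp
  hence "\<bar>f y\<bar> \<le> 25 * sqrt ((625 * \<epsilon> powr ?k k * M powr (1 - ?k k)) * M)"
   by (intro line_analytic_step(1)[OF f x r]) (use g f M e s in \<open>auto simp: good_def\<close>)
  thus "\<bar>f y\<bar> \<le> 625 * \<epsilon> powr ?k (Suc k) * M powr (1 - ?k (Suc k))"
   unfolding sqrt_powr_step[OF e M] by simp
 qed
 define A where "A = {x \<in> B. \<exists>k. good x k}"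
 have "A = B"
 proof -
  have near: "x' \<in> A" if "x \<in> A" "x' \<in> B" "norm (x' - x) \<le> r" for x x'
   using that step unfolding A_def by blast
  have o1: "openin (top_of_set B) A"
   unfolding openin_euclidean_subtopology_iff
  proof (intro conjI ballI)
   fix x assume "x \<in> A"
   thus "\<exists>e>0. \<forall>x'\<in>B. dist x' x < e \<longrightarrow> x' \<in> A"
    using near r(1) by (intro exI[of _ r]) (auto simp: dist_norm)
  qed (auto simp: A_def)
  have o2: "openin (top_of_set B) (B - A)"
   unfolding openin_euclidean_subtopology_iff
  proof (intro conjI ballI)
   fix x assume "x \<in> B - A"
   thus "\<exists>e>0. \<forall>x'\<in>B. dist x' x < e \<longrightarrow> x' \<in> B - A"
    using near r(1) by (intro exI[of _ r]) (auto simp: dist_norm norm_minus_commute)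
  qed auto
  have "closedin (top_of_set B) A"
   unfolding closedin_def using o2 by (auto simp: A_def)
  moreover have "x0 \<in> A"
  proof -
   have "good x0 0" unfolding good_def by (auto intro: order_trans)
   thus ?thesis using x0 by (auto simp: A_def)
  qed
  ultimately show ?thesis using B(2) o1 connected_clopen by blast
 qed
 have "closure B \<subseteq> (\<Union>x\<in>B. ball x r)"
 proof
  fix x assume "x \<in> closure B"
  then obtain y where "y \<in> B" "dist y x < r" using closure_approachable r(1) by metis
  thus "x \<in> (\<Union>x\<in>B. ball x r)" by auto
 qed
 then obtain F where F: "F \<subseteq> B" "finite F" "closure B \<subseteq> (\<Union>x\<in>F. ball x r)"
  using compactE_image[OF B(3), of B "\<lambda>x. ball x r"] by (metis open_ball)
 have "\<forall>x\<in>F. \<exists>k. good x k" using F \<open>A = B\<close> by (auto simp: A_def)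
 then obtain k where k: "\<And>x. x \<in> F \<Longrightarrow> good x (k x)" by metis
 \<comment> \<open>An upper bound for all step counts; the \<open>Suc\<close> is the last step from
   a centre of the cover to \<open>x\<close>, and it also makes the exponent smaller than 1.\<close>
 define K where "K = Suc (\<Sum>x\<in>F. k x)"
 have K: "Suc (k x) \<le> K" if "x \<in> F" for x unfolding K_def using member_le_sum[OF that, of k] F(2) by simp
 show thesis
 proof (rule that[of "?k K"])
  show "0 < ?k K" by simp
  have "?k K \<le> ?k 1" by (intro power_decreasing) (auto simp: K_def)
  thus "?k K < 1" by simp
  fix f M \<epsilon> x y
  assume f: "line_analytic B R M f" and M: "M > 0" and e: "0 \<le> (\<epsilon>::real)" "\<epsilon> \<le> M"
   and s: "\<And>y. norm (y - x0) \<le> r \<Longrightarrow> \<bar>f y\<bar> \<le> \<epsilon>" and x: "x \<in> B" and y: "norm (y - x) \<le> r"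
  obtain x' where x': "x' \<in> F" "norm (x - x') \<le> r"
   using F(3) x closure_subset[of B] by (fastforce simp: dist_norm norm_minus_commute)
  have "good x (Suc (k x'))" by (rule step[OF k[OF x'(1)] _ x'(2)]) (use x' F in auto)
  hence "\<bar>f y\<bar> \<le> 625 * \<epsilon> powr (?k (Suc (k x'))) * M powr (1 - ?k (Suc (k x')))"
   unfolding good_def using f M e(1) s y by blast
  also have "\<dots> = 625 * (\<epsilon> powr (?k (Suc (k x'))) * M powr (1 - ?k (Suc (k x'))))" by simp
  also have "\<dots> \<le> 625 * (\<epsilon> powr (?k K) * M powr (1 - ?k K))"
   by (intro mult_left_mono powr_interpolation_mono e M power_decreasing K x') auto
  finally show "\<bar>f y\<bar> \<le> 625 * \<epsilon> powr (?k K) * M powr (1 - ?k K)" by simp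
 qed
qed

text \<open>If \<open>b = \<bar>f y\<bar>\<close>, the Lipschitz constant \<open>25 * M / r\<close>
  keeps \<open>\<bar>f\<bar>\<close> above \<open>b / 2\<close> on a ball of radius proportional to
  \<open>b / M\<close>. Its mass in the L2 norm \<open>a\<close> gives
  \<open>c * b ^ (n + 2) \<le> a\<^sup>2 * M ^ n\<close>, and a root of order \<open>n + 2\<close>
  yields the exponent.\<close>

lemma l2_to_sup:
 fixes f :: "'a::euclidean_space \<Rightarrow> real"
 assumes f: "line_analytic B R M f" and M: "M > 0" and r: "r > 0" "16 * r \<le> R"
  and w: "cball x0 (2 * r) \<subseteq> \<omega>" "\<omega> \<subseteq> B" and fw: "sqint lborel (\<lambda>x. indicator \<omega> x * f x)"
  and y: "norm (y - x0) \<le> r"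
 shows "\<bar>f y\<bar> \<le> (4 / (measure lborel (ball (0::'a) 1) * (r / 50) ^ DIM('a))) powr (1 / (DIM('a) + 2))
   * l2 lborel (\<lambda>x. indicator \<omega> x * f x) powr (2 / (DIM('a) + 2)) * M powr (1 - 2 / (DIM('a) + 2))"
proof -
 define b where "b = \<bar>f y\<bar>"
 define a where "a = l2 lborel (\<lambda>x. indicator \<omega> x * f x)"
 define n where "n = DIM('a)"
 define c where "c = measure lborel (ball (0::'a) 1) * (r / 50) ^ n / 4"
 have c: "c > 0" unfolding c_def using content_ball_pos[of 1 "0::'a"] r by simp
 have yw: "y \<in> \<omega>" using w y r by (auto simp: dist_norm norm_minus_commute subset_eq)
 hence yB: "y \<in> B" using w by auto
 have bM: "b \<le> M" unfolding b_def by (rule line_analytic_bound[OF f yB]) (use r in simp)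
 have b0: "b \<ge> 0" by (simp add: b_def)
 have main: "c * b ^ (n + 2) \<le> a\<^sup>2 * M ^ n"
 proof (cases "b = 0")
  case False
  hence bp: "b > 0" using b0 by simp
  \<comment> \<open>On this ball \<open>f\<close> varies by at most
    \<open>25 * M / r * \<rho> = b / 2\<close>.\<close>
  define \<rho> where "\<rho> = r * b / (50 * M)"
  have \<rho>: "\<rho> > 0" "\<rho> \<le> r" using bp r M bM by (auto simp: \<rho>_def field_simps)
  have low: "\<bar>f x\<bar> \<ge> b / 2" if x: "norm (x - y) \<le> \<rho>" for x
  proof -
   have "\<bar>f x - f y\<bar> \<le> 25 * sqrt (M * M) / r * norm (x - y)"
    by (rule line_analytic_step(2)[OF f yB r]) (use M x \<rho> r line_analytic_bound[OF f yB] in auto)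
   also have "\<dots> \<le> 25 * M / r * \<rho>" using x M r by (simp add: mult_left_mono divide_right_mono)
   also have "\<dots> = b / 2" using M r by (simp add: \<rho>_def)
   finally show ?thesis unfolding b_def by linarith
  qed
  have sub: "ball y \<rho> \<subseteq> \<omega>"
  proof
   fix x assume "x \<in> ball y \<rho>"
   hence "norm (x - x0) \<le> 2 * r"
    using norm_triangle_ineq[of "x - y" "y - x0"] y \<rho> by (simp add: dist_norm norm_minus_commute)
   thus "x \<in> \<omega>" using w(1) by (auto simp: dist_norm norm_minus_commute)
  qed
  have "(b / 2)\<^sup>2 * measure lborel (ball y \<rho>) = (LBINT x. (b / 2)\<^sup>2 * indicator (ball y \<rho>) x)"
   by (simp)
  also have "\<dots> \<le> (LBINT x. (indicator \<omega> x * f x)\<^sup>2)"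
  proof (rule integral_mono)
   have "emeasure lborel (ball y \<rho>) < \<infinity>" using emeasure_lborel_ball_finite[of y \<rho>] by (simp add: top.not_eq_extremum)
   thus "integrable lborel (\<lambda>x. (b / 2)\<^sup>2 * indicator (ball y \<rho>) x)" by (intro integrable_mult_right integrable_real_indicator) auto
   show "integrable lborel (\<lambda>x. (indicator \<omega> x * f x)\<^sup>2)" by (rule sqint_sq[OF fw])
   fix x
   show "(b / 2)\<^sup>2 * indicator (ball y \<rho>) x \<le> (indicator \<omega> x * f x)\<^sup>2"
   proof (cases "x \<in> ball y \<rho>")
    case True
    hence "b / 2 \<le> \<bar>f x\<bar>" by (intro low) (simp add: dist_norm norm_minus_commute)
    hence "(b / 2)\<^sup>2 \<le> (f x)\<^sup>2" using b0 abs_le_square_iff[of "b / 2" "f x"] by simp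
    thus ?thesis using True sub by (auto simp: indicator_def)
   qed simp
  qed
  also have "\<dots> = a\<^sup>2" unfolding a_def l2_sq ..
  finally have "(b / 2)\<^sup>2 * (\<rho> ^ n * measure lborel (ball (0::'a) 1)) \<le> a\<^sup>2"
   using content_ball_conv_unit_ball[of \<rho> y] \<rho> by (simp add: n_def)
  hence "(b / 2)\<^sup>2 * (\<rho> ^ n * measure lborel (ball (0::'a) 1)) * M ^ n \<le> a\<^sup>2 * M ^ n"
   using M by (intro mult_right_mono) auto
  moreover have "\<rho> ^ n * M ^ n = (r / 50) ^ n * b ^ n"
   unfolding \<rho>_def power_mult_distrib[symmetric] using M by simp
  hence "(b / 2)\<^sup>2 * (\<rho> ^ n * measure lborel (ball (0::'a) 1)) * M ^ n = c * b ^ (n + 2)"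
  proof -
   let ?v = "measure lborel (ball (0::'a) 1)"
   have "(b / 2)\<^sup>2 * (\<rho> ^ n * ?v) * M ^ n = (b / 2)\<^sup>2 * ?v * (\<rho> ^ n * M ^ n)" by (simp only: mult_ac)
   also have "\<dots> = (b / 2)\<^sup>2 * ?v * ((r / 50) ^ n * b ^ n)" by (simp only: \<open>\<rho> ^ n * M ^ n = (r / 50) ^ n * b ^ n\<close>)
   also have "\<dots> = c * b ^ (n + 2)" unfolding c_def power_add by (simp add: power2_eq_square)
   finally show ?thesis .
  qed
  ultimately show ?thesis by simp
 qed (use M in simp)
 let ?p = "1 / (real n + 2)"
 have "b \<le> (1 / c) powr ?p * a powr (2 / (real n + 2)) * M powr (1 - 2 / (real n + 2))"
 proof (cases "b = 0")
  case False
  hence bp: "b > 0" using b0 by simp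
  have "b ^ (n + 2) \<le> (1 / c) * (a\<^sup>2 * M ^ n)" using main c by (simp add: field_simps)
  hence "(b ^ (n + 2)) powr ?p \<le> ((1 / c) * (a\<^sup>2 * M ^ n)) powr ?p" using bp by (intro powr_mono2) auto
  moreover have "(b ^ (n + 2)) powr ?p = b"
  proof -
   have "b ^ (n + 2) = b powr (real n + 2)" using powr_realpow[OF bp, of "n + 2"] by (simp only: of_nat_add of_nat_numeral)
   thus ?thesis using bp by (simp add: powr_powr)
  qed
  moreover have "((1 / c) * (a\<^sup>2 * M ^ n)) powr ?p = (1 / c) powr ?p * a powr (2 / (real n + 2)) * M powr (1 - 2 / (real n + 2))"
  proof -
   have a0: "a \<ge> 0" unfolding a_def by (rule l2_nonneg)
   have "((1 / c) * (a\<^sup>2 * M ^ n)) powr ?p = (1 / c) powr ?p * ((a\<^sup>2) powr ?p * (M ^ n) powr ?p)"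
    using c a0 M by (simp only: powr_mult zero_le_power2 zero_le_power mult_nonneg_nonneg zero_le_divide_1_iff less_imp_le)
   moreover have "(a\<^sup>2) powr ?p = a powr (2 / (real n + 2))"
   proof (cases "a = 0")
    case False
    hence "a\<^sup>2 = a powr 2" using a0 by simp
    hence "(a\<^sup>2) powr ?p = (a powr 2) powr ?p" by (rule arg_cong)
    thus ?thesis unfolding powr_powr by simp
   qed simp
   moreover have "(M ^ n) powr ?p = M powr (1 - 2 / (real n + 2))"
   proof -
    have "1 - 2 / (real n + 2) = real n * ?p" by (simp add: field_simps)
    moreover have "(M ^ n) powr ?p = (M powr real n) powr ?p" using M by (simp add: powr_realpow)
    ultimately show ?thesis unfolding powr_powr by simp
   qed
   ultimately show ?thesis by (simp only: mult.assoc)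
  qed
  ultimately show ?thesis by simp
 qed simp
 moreover have "1 / c = 4 / (measure lborel (ball (0::'a) 1) * (r / 50) ^ n)" unfolding c_def by simp
 ultimately show ?thesis unfolding b_def a_def n_def by (simp add: add.commute)
qed

text \<open>The exponent is \<open>\<theta> * (\<kappa>1 / 2)\<close>: \<open>\<theta>\<close> from
  the passage from L2 to the supremum near \<open>x0\<close>, \<open>\<kappa>1\<close> from the
  chain, and the last halving from one more step at \<open>x\<close>, which supplies the value bound
  and the Lipschitz bound together.\<close>

lemma spatial_propagation:
 fixes B \<omega> :: "'a::euclidean_space set"
 assumes B: "open B" "connected B" "compact (closure B)" and w: "open \<omega>" "\<omega> \<noteq> {}" "\<omega> \<subseteq> B" and R: "R > 0"
 obtains C \<kappa> r where "C > 0" "0 < \<kappa>" "\<kappa> < 1" "r > 0"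
  "\<And>f M x y. line_analytic B R M f \<Longrightarrow> M > 0 \<Longrightarrow> sqint lborel (\<lambda>x. indicator \<omega> x * f x) \<Longrightarrow> x \<in> B \<Longrightarrow>
   norm (y - x) \<le> r \<Longrightarrow>
   \<bar>f y\<bar> \<le> C * l2 lborel (\<lambda>x. indicator \<omega> x * f x) powr \<kappa> * M powr (1 - \<kappa>) \<and>
   \<bar>f y - f x\<bar> \<le> C * l2 lborel (\<lambda>x. indicator \<omega> x * f x) powr \<kappa> * M powr (1 - \<kappa>) * norm (y - x)"
proof -
 obtain x0 where x0: "x0 \<in> \<omega>" using w by blast
 obtain d where d: "d > 0" "cball x0 d \<subseteq> \<omega>" using open_contains_cball w(1) x0 by blast
 \<comment> \<open>The first entry puts the ball of radius \<open>2 * r\<close> inside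
   \<open>\<omega>\<close>, the second is the radius condition of the two constants
   estimate.\<close>
 define r where "r = min (d / 2) (R / 16)"
 have r: "r > 0" "16 * r \<le> R" "2 * r \<le> d" using d R by (auto simp: r_def)
 have sub: "cball x0 (2 * r) \<subseteq> \<omega>" using d r by (meson cball_subset_cball_iff dual_order.trans subset_cball)
 obtain \<kappa>1 where k1: "0 < \<kappa>1" "\<kappa>1 < 1"
  "\<And>f M \<epsilon> x y. line_analytic B R M f \<Longrightarrow> M > 0 \<Longrightarrow> 0 \<le> \<epsilon> \<Longrightarrow> \<epsilon> \<le> M \<Longrightarrow>
   (\<And>y. norm (y - x0) \<le> r \<Longrightarrow> \<bar>f y\<bar> \<le> \<epsilon>) \<Longrightarrow> x \<in> B \<Longrightarrow> norm (y - x) \<le> r \<Longrightarrow>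
   \<bar>f y\<bar> \<le> 625 * \<epsilon> powr \<kappa>1 * M powr (1 - \<kappa>1)"
 proof (rule chain_of_balls[OF B _ r(1,2), of x0], goal_cases)
  case (2 \<kappa>)
  show ?case by (rule 2(1)[OF 2(2,3)]) (rule 2(4))
 qed (use x0 w in auto)
 define \<theta> where "\<theta> = 2 / (real DIM('a) + 2)"
 have \<theta>: "0 < \<theta>" "\<theta> < 1" unfolding \<theta>_def by auto
 define C0 where "C0 = (4 / (measure lborel (ball (0::'a) 1) * (r / 50) ^ DIM('a))) powr (1 / (DIM('a) + 2))"
 have C0: "C0 > 0" unfolding C0_def using content_ball_pos[of 1 "0::'a"] r by simp
 define \<kappa> where "\<kappa> = \<theta> * (\<kappa>1 / 2)"
 \<comment> \<open>\<open>C0\<close> enters to the power \<open>\<kappa>1 / 2\<close>, which is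
   bounded by \<open>max 1 C0\<close> whether or not \<open>C0\<close> exceeds 1.\<close>
 define C1 where "C1 = 625 * max 1 C0"
 define C where "C = max C1 (C1 / r)"
 show thesis
 proof (rule that[of C \<kappa> r])
  show "C > 0" unfolding C_def C1_def by (simp add: less_max_iff_disj)
  show "0 < \<kappa>" unfolding \<kappa>_def using \<theta> k1 by simp
  show "\<kappa> < 1" unfolding \<kappa>_def using \<theta> k1 mult_strict_mono[of \<theta> 1 "\<kappa>1 / 2" 1] by simp
  show "r > 0" by (rule r)
  fix f M x y
  assume f: "line_analytic B R M f" and M: "M > 0" and fw: "sqint lborel (\<lambda>x. indicator \<omega> x * f x)"
   and x: "x \<in> B" and y: "norm (y - x) \<le> r"
  define a where "a = l2 lborel (\<lambda>x. indicator \<omega> x * f x)"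
  have a0: "a \<ge> 0" unfolding a_def by (rule l2_nonneg)
  define e0 where "e0 = C0 * a powr \<theta> * M powr (1 - \<theta>)"
  have e0: "e0 \<ge> 0" unfolding e0_def using C0 by simp
  \<comment> \<open>The minimum ensures \<open>\<epsilon> \<le> M\<close>, as the chain
    demands.\<close>
  define \<epsilon> where "\<epsilon> = min M e0"
  have e: "0 \<le> \<epsilon>" "\<epsilon> \<le> M" using M e0 by (auto simp: \<epsilon>_def)
  have small: "\<bar>f y\<bar> \<le> \<epsilon>" if "norm (y - x0) \<le> r" for y
  proof -
   have "\<bar>f y\<bar> \<le> e0"
    unfolding e0_def C0_def a_def \<theta>_def
    using l2_to_sup[OF f M r(1,2) sub w(3) fw that] by (simp add: add.commute)
   moreover have "\<bar>f y\<bar> \<le> M"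
    by (rule line_analytic_bound[OF f, of x0]) (use that r x0 w in auto)
   ultimately show ?thesis by (simp add: \<epsilon>_def)
  qed
  define e1 where "e1 = 625 * \<epsilon> powr \<kappa>1 * M powr (1 - \<kappa>1)"
  have e1: "\<bar>f y\<bar> \<le> e1" if "norm (y - x) \<le> r" for y
   unfolding e1_def by (rule k1(3)[OF f M e small x that])
  have e10: "e1 \<ge> 0" unfolding e1_def by simp
  have e2: "25 * sqrt (e1 * M) \<le> C1 * a powr \<kappa> * M powr (1 - \<kappa>)"
  proof -
   have "25 * sqrt (e1 * M) = 625 * \<epsilon> powr (\<kappa>1 / 2) * M powr (1 - \<kappa>1 / 2)"
    unfolding e1_def by (rule sqrt_powr_step[OF e(1) M])
   also have "\<dots> \<le> 625 * (max 1 C0 * (a powr \<kappa> * M powr ((1 - \<theta>) * (\<kappa>1 / 2)))) * M powr (1 - \<kappa>1 / 2)"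
   proof (intro mult_right_mono mult_left_mono)
    have "\<epsilon> powr (\<kappa>1 / 2) \<le> e0 powr (\<kappa>1 / 2)" using e k1 by (intro powr_mono2) (auto simp: \<epsilon>_def)
    also have "\<dots> = C0 powr (\<kappa>1 / 2) * (a powr \<kappa> * M powr ((1 - \<theta>) * (\<kappa>1 / 2)))"
     unfolding e0_def \<kappa>_def using C0 by (simp add: powr_mult powr_powr mult.assoc)
    also have "C0 powr (\<kappa>1 / 2) \<le> max 1 C0"
    proof -
     have "C0 powr (\<kappa>1 / 2) \<le> (max 1 C0) powr (\<kappa>1 / 2)" using C0 k1 by (intro powr_mono2) auto
     also have "\<dots> \<le> (max 1 C0) powr 1" using k1 by (intro powr_mono) auto
     finally show ?thesis by simp
    qed
    finally show "\<epsilon> powr (\<kappa>1 / 2) \<le> max 1 C0 * (a powr \<kappa> * M powr ((1 - \<theta>) * (\<kappa>1 / 2)))"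
     by (simp add: mult_right_mono)
   qed auto
   also have "\<dots> = C1 * a powr \<kappa> * (M powr ((1 - \<theta>) * (\<kappa>1 / 2)) * M powr (1 - \<kappa>1 / 2))"
    unfolding C1_def by simp
   also have "M powr ((1 - \<theta>) * (\<kappa>1 / 2)) * M powr (1 - \<kappa>1 / 2) = M powr (1 - \<kappa>)"
        proof -
     have "(1 - \<theta>) * (\<kappa>1 / 2) + (1 - \<kappa>1 / 2) = 1 - \<kappa>" by (simp add: \<kappa>_def field_simps)
     thus ?thesis unfolding powr_add[symmetric] by (simp only:)
    qed
   finally show ?thesis .
  qed
  let ?X = "a powr \<kappa> * M powr (1 - \<kappa>)"
  have X0: "?X \<ge> 0" by simp
  have "\<bar>f y\<bar> \<le> C1 * ?X"
   using line_analytic_step(1)[OF f x r(1,2) e10 e1, of y] y r e2 by (simp add: mult.assoc)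
  also have "\<dots> \<le> C * ?X" using X0 by (intro mult_right_mono) (auto simp: C_def)
  finally have p1: "\<bar>f y\<bar> \<le> C * ?X" .
  have "\<bar>f y - f x\<bar> \<le> 25 * sqrt (e1 * M) / r * norm (y - x)"
   by (rule line_analytic_step(2)[OF f x r(1,2) e10 e1 y])
  also have "\<dots> \<le> (C1 * ?X) / r * norm (y - x)"
   using e2 r by (intro mult_right_mono divide_right_mono) (auto simp: mult.assoc)
  also have "\<dots> = (C1 / r) * ?X * norm (y - x)" by simp
  also have "\<dots> \<le> C * ?X * norm (y - x)" using X0 by (intro mult_right_mono) (auto simp: C_def)
  finally show "\<bar>f y\<bar> \<le> C * l2 lborel (\<lambda>x. indicator \<omega> x * f x) powr \<kappa> * M powr (1 - \<kappa>) \<and>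
   \<bar>f y - f x\<bar> \<le> C * l2 lborel (\<lambda>x. indicator \<omega> x * f x) powr \<kappa> * M powr (1 - \<kappa>) * norm (y - x)"
   using p1 unfolding a_def by (simp add: mult.assoc)
 qed
qed

section \<open>The estimate for scalar space-time functions\<close>

text \<open>An affine majorant of the concave power, one for each \<open>l\<close>. Integrated with
  a suitable \<open>l\<close> it replaces Jensen's inequality at the cost of a constant.\<close>

lemma powr_le_split:
 fixes x l \<kappa> :: real
 assumes "x \<ge> 0" "l > 0" "0 < \<kappa>" "\<kappa> < 1"
 shows "x powr \<kappa> \<le> l powr (\<kappa> - 1) * x + l powr \<kappa>"
proof (cases "x \<ge> l")
 case True
 hence "x powr \<kappa> = x powr (\<kappa> - 1) * x" using assms by (simp add: powr_diff)
 also have "\<dots> \<le> l powr (\<kappa> - 1) * x" using True assms by (intro mult_right_mono powr_mono2') auto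
 finally show ?thesis by (simp add: add_increasing2)
next
 case False
 hence "x powr \<kappa> \<le> l powr \<kappa>" using assms by (intro powr_mono2) auto
 thus ?thesis using assms by (simp add: add_increasing)
qed

text \<open>\<open>powr_le_split\<close> is applied to the square of \<open>a t\<close> with
  \<open>l\<close> the square of the norm \<open>A\<close>, which makes both terms multiples of
  \<open>A powr (2 * \<kappa>)\<close>. No positive \<open>l\<close> is available for
  \<open>A = 0\<close>, where \<open>a\<close> vanishes almost everywhere on the interval.\<close>

lemma l2_powr_le:
 assumes I: "T1 < T2" and a: "sqint lborel (\<lambda>t. indicator {T1<..<T2} t * a t)"
  and a0: "\<And>t. a t \<ge> 0" and \<kappa>: "0 < \<kappa>" "\<kappa> < 1" and [measurable]: "a \<in> borel_measurable borel"
 shows "sqint lborel (\<lambda>t. indicator {T1<..<T2} t * a t powr \<kappa>)"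
  and "l2 lborel (\<lambda>t. indicator {T1<..<T2} t * a t powr \<kappa>)
   \<le> sqrt (1 + (T2 - T1)) * l2 lborel (\<lambda>t. indicator {T1<..<T2} t * a t) powr \<kappa>"
proof -
 let ?J = "indicator {T1<..<T2} :: real \<Rightarrow> real"
 define A where "A = l2 lborel (\<lambda>t. ?J t * a t)"
 have A0: "A \<ge> 0" unfolding A_def by (rule l2_nonneg)
 have eqa: "(?J t * a t powr \<kappa>)\<^sup>2 = ?J t * ((a t)\<^sup>2) powr \<kappa>" for t
 proof -
  have "(a t powr \<kappa>)\<^sup>2 = ((a t)\<^sup>2) powr \<kappa>"
   unfolding power2_eq_square using a0[of t] by (simp add: powr_mult)
  thus ?thesis by (auto simp: indicator_def)
 qed
 have ai: "integrable lborel (\<lambda>t. (?J t * a t)\<^sup>2)" by (rule sqint_sq[OF a])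
 have Ji: "integrable lborel ?J" using I by (intro integrable_real_indicator) auto
 have bd: "?J t * ((a t)\<^sup>2) powr \<kappa> \<le> l powr (\<kappa> - 1) * (?J t * a t)\<^sup>2 + l powr \<kappa> * ?J t" if "l > 0" for l t
  using powr_le_split[of "(a t)\<^sup>2" l \<kappa>] that \<kappa> by (auto simp: indicator_def)
 have int: "integrable lborel (\<lambda>t. ?J t * ((a t)\<^sup>2) powr \<kappa>)"
 proof (rule integrable_bound)
  show "integrable lborel (\<lambda>t. 1 powr (\<kappa> - 1) * (?J t * a t)\<^sup>2 + 1 powr \<kappa> * ?J t)"
   using ai Ji by simp
  show "AE t in lborel. norm (?J t * ((a t)\<^sup>2) powr \<kappa>) \<le> norm (1 powr (\<kappa> - 1) * (?J t * a t)\<^sup>2 + 1 powr \<kappa> * ?J t)"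
   using bd[of 1] by (intro AE_I2) (simp add: abs_of_nonneg)
 qed simp
 show "sqint lborel (\<lambda>t. ?J t * a t powr \<kappa>)"
  unfolding sqint_def eqa using int by simp
 have "(l2 lborel (\<lambda>t. ?J t * a t powr \<kappa>))\<^sup>2 \<le> (1 + (T2 - T1)) * (A powr \<kappa>)\<^sup>2"
 proof (cases "A = 0")
  case True
  hence "(LBINT t. (?J t * a t)\<^sup>2) = 0" unfolding A_def by (simp add: l2_sq[symmetric])
  hence "AE t in lborel. (?J t * a t)\<^sup>2 = 0" using integral_nonneg_eq_0_iff_AE[OF ai] by auto
  hence "AE t in lborel. (?J t * a t powr \<kappa>)\<^sup>2 = 0" by eventually_elim auto
  hence "(LBINT t. (?J t * a t powr \<kappa>)\<^sup>2) = 0" by (rule integral_eq_zero_AE)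
  thus ?thesis unfolding l2_sq using I by simp
 next
  case False
  hence A: "A > 0" using A0 by simp
  have "(LBINT t. ?J t * ((a t)\<^sup>2) powr \<kappa>) \<le> (LBINT t. (A\<^sup>2) powr (\<kappa> - 1) * (?J t * a t)\<^sup>2 + (A\<^sup>2) powr \<kappa> * ?J t)"
   using ai Ji A by (intro integral_mono int bd) auto
  also have "\<dots> = (A\<^sup>2) powr (\<kappa> - 1) * A\<^sup>2 + (A\<^sup>2) powr \<kappa> * (T2 - T1)"
   using ai Ji I by (simp add: A_def l2_sq)
  also have "(A\<^sup>2) powr (\<kappa> - 1) * A\<^sup>2 = (A\<^sup>2) powr \<kappa>" using A by (simp add: powr_diff)
  also have "(A\<^sup>2) powr \<kappa> = (A powr \<kappa>)\<^sup>2" unfolding power2_eq_square using A by (simp add: powr_mult)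
  finally show ?thesis unfolding l2_sq eqa by (simp add: algebra_simps)
 qed
 also have "\<dots> = (sqrt (1 + (T2 - T1)) * A powr \<kappa>)\<^sup>2" using I by (simp add: power_mult_distrib)
 finally show "l2 lborel (\<lambda>t. ?J t * a t powr \<kappa>) \<le> sqrt (1 + (T2 - T1)) * l2 lborel (\<lambda>t. ?J t * a t) powr \<kappa>"
  unfolding A_def by (rule power2_le_imp_le) (use I in simp)
qed

lemma sqint_iterated:
 assumes "sqint lborel F"
 shows "AE t in lborel. sqint lborel (\<lambda>x. F (t, x))"
  and "sqint lborel (\<lambda>t. l2 lborel (\<lambda>x. F (t, x)))"
  and "l2 lborel (\<lambda>t. l2 lborel (\<lambda>x. F (t, x))) = l2 lborel F"
proof -
 have Fm: "F \<in> borel_measurable borel" using assms by (simp add: sqint_def)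
 hence Fm'[measurable]: "F \<in> borel_measurable (borel \<Otimes>\<^sub>M borel)" by (simp add: borel_prod)
 have F: "integrable lborel (\<lambda>p. (F p)\<^sup>2)" by (rule sqint_sq[OF assms])
 hence F': "integrable (lborel \<Otimes>\<^sub>M lborel) (\<lambda>p. (F p)\<^sup>2)" by (simp add: lborel_prod)
 show "AE t in lborel. sqint lborel (\<lambda>x. F (t, x))"
  using lborel_pair.AE_integrable_fst'[OF F'] by eventually_elim (simp add: sqint_def)
 have sq: "(l2 lborel (\<lambda>x. F (t, x)))\<^sup>2 = (LBINT x. (F (t, x))\<^sup>2)" for t by (rule l2_sq)
 show "sqint lborel (\<lambda>t. l2 lborel (\<lambda>x. F (t, x)))"
  unfolding sqint_def sq using lborel_integral_iterated(2)[OF F]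
  by (auto simp: l2_def)
 show "l2 lborel (\<lambda>t. l2 lborel (\<lambda>x. F (t, x))) = l2 lborel F"
  unfolding l2_def[of _ "\<lambda>t. l2 lborel (\<lambda>x. F (t, x))"] sq using lborel_integral_iterated(1)[OF F] by (simp add: l2_def)
qed

text \<open>A weak derivative is bounded through difference quotients: translation invariance moves
  them from \<open>\<phi>\<close> to \<open>v\<close>, where the Lipschitz hypothesis applies, and
  the step tends to 0 from the right. The Lipschitz constant \<open>D p\<close> may vary with the
  point, because the propagation bound varies with time and is only square integrable.\<close>

lemma pairing_partial_deriv_le:
 fixes v D :: "'a::euclidean_space \<Rightarrow> real"
 assumes Q: "open Q" "emeasure lborel Q < \<infinity>" and \<phi>: "\<phi> \<in> \<D> Q" and i: "i \<in> Basis"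
  and vm[measurable]: "v \<in> borel_measurable borel" and vM: "\<And>p. p \<in> Q \<Longrightarrow> \<bar>v p\<bar> \<le> M"
  and D: "sqint lborel D" and r: "r > 0"
  and lip: "\<And>p h. p \<in> Q \<Longrightarrow> 0 \<le> h \<Longrightarrow> h \<le> r \<Longrightarrow> \<bar>v (p - h *\<^sub>R i) - v p\<bar> \<le> D p * h"
 shows "\<bar>LBINT p. v p * pd i \<phi> p\<bar> \<le> l2 lborel D * l2 lborel \<phi>"
proof -
 have [measurable]: "Q \<in> sets borel" using Q by simp
 obtain K where K: "compact K" "K \<subseteq> Q" "\<And>x. x \<notin> K \<Longrightarrow> \<phi> x = 0" using test_functionsE[OF \<phi>] by blast
 \<comment> \<open>For steps below \<open>e\<close> the translate of a point of the support of
   \<open>\<phi>\<close> is still in \<open>Q\<close>, where the hypotheses on \<open>v\<close>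
   hold.\<close>
 obtain e where e: "e > 0" "(\<Union>x\<in>K. cball x e) \<subseteq> Q"
  using compact_subset_open_imp_cball_epsilon_subset[OF K(1) Q(1) K(2)] by metis
 define g where "g p = indicator Q p * v p" for p
 have "\<bar>g p\<bar> \<le> \<bar>M\<bar>" for p using vM[of p] by (auto simp: g_def indicator_def)
 hence gi: "integrable lborel g"
  by (intro bounded_support_integrable(1)[OF _ Q(2)]) (auto simp: g_def[abs_def])
 have id: "(\<lambda>q. q) \<in> borel_measurable lborel" by simp
 note A = average_translates[OF gi id test_mono[OF \<phi> subset_UNIV]]
 let ?F = "\<lambda>p. (LBINT q. g q * \<phi> (p + q))" and ?C = "l2 lborel D * l2 lborel \<phi>"
 have d: "((\<lambda>s. ?F (s *\<^sub>R i)) has_real_derivative (LBINT q. g q * pd i \<phi> q)) (at 0)"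
  using has_partial_deriv[OF A(1) i, of 0 0] A(2)[OF i] by simp
 have Dp: "integrable lborel (\<lambda>p. \<bar>D p\<bar> * \<bar>\<phi> p\<bar>)" "(LBINT p. \<bar>D p\<bar> * \<bar>\<phi> p\<bar>) \<le> ?C"
 proof -
  have "sqint lborel (\<lambda>p. \<bar>D p\<bar>)" "sqint lborel (\<lambda>p. \<bar>\<phi> p\<bar>)"
   using D test_sqint[OF \<phi>] by (auto simp: sqint_def)
  from sqint_mult[OF this] Cauchy_Schwarz_l2[OF this]
  show "integrable lborel (\<lambda>p. \<bar>D p\<bar> * \<bar>\<phi> p\<bar>)" "(LBINT p. \<bar>D p\<bar> * \<bar>\<phi> p\<bar>) \<le> ?C" by (auto simp: l2_def)
 qed
 have bd: "\<bar>(?F (h *\<^sub>R i) - ?F (0 *\<^sub>R i)) / (h - 0)\<bar> \<le> ?C" if h: "h > 0" "h < min e r" for h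
 proof -
  have [measurable]: "\<phi> \<in> borel_measurable borel" "g \<in> borel_measurable borel"
   using test_borel[OF \<phi>] gi by auto
  have tr: "?F (h *\<^sub>R i) = (LBINT p. g (p - h *\<^sub>R i) * \<phi> p)"
   using lborel_integral_translate(1)[of "\<lambda>p. g (p - h *\<^sub>R i) * \<phi> p" "h *\<^sub>R i"] by (simp add: add.commute)
  have i1: "integrable lborel (\<lambda>p. g (p - h *\<^sub>R i) * \<phi> p)"
   using lborel_integral_translate(2)[of "\<lambda>p. g p * \<phi> (h *\<^sub>R i + p)" "- h *\<^sub>R i"] A(3)[of "h *\<^sub>R i"] by (simp add: add.commute)
  have i2: "integrable lborel (\<lambda>p. g p * \<phi> p)" using A(3)[of 0] by simp
  have "\<bar>?F (h *\<^sub>R i) - ?F (0 *\<^sub>R i)\<bar> = \<bar>LBINT p. g (p - h *\<^sub>R i) * \<phi> p - g p * \<phi> p\<bar>"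
   unfolding tr using i1 i2 by simp
  also have "\<dots> \<le> (LBINT p. h * (\<bar>D p\<bar> * \<bar>\<phi> p\<bar>))"
  proof (rule integral_abs_bound_integral)
   show "\<bar>g (p - h *\<^sub>R i) * \<phi> p - g p * \<phi> p\<bar> \<le> h * (\<bar>D p\<bar> * \<bar>\<phi> p\<bar>)" for p
   proof (cases "p \<in> K")
    case True
    have "p - h *\<^sub>R i \<in> cball p e" using h i by (simp add: dist_norm)
    hence Qs: "p \<in> Q" "p - h *\<^sub>R i \<in> Q" using True K(2) e(2) by blast+
    have "\<bar>v (p - h *\<^sub>R i) - v p\<bar> \<le> \<bar>D p\<bar> * h"
     by (rule order_trans[OF lip]) (use Qs h in \<open>auto intro: mult_right_mono\<close>)
    hence "\<bar>v (p - h *\<^sub>R i) - v p\<bar> * \<bar>\<phi> p\<bar> \<le> (\<bar>D p\<bar> * h) * \<bar>\<phi> p\<bar>" by (intro mult_right_mono) auto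
    thus ?thesis using Qs by (simp add: g_def algebra_simps flip: abs_mult)
   qed (use K(3) in simp)
  qed (use i1 i2 Dp in auto)
  also have "\<dots> \<le> h * ?C" using Dp h by (simp add: mult_left_mono)
  finally show ?thesis using h by (simp add: pos_divide_le_eq mult.commute)
 qed
 have "((\<lambda>h. (?F (h *\<^sub>R i) - ?F (0 *\<^sub>R i)) / (h - 0)) \<longlongrightarrow> (LBINT q. g q * pd i \<phi> q)) (at_right 0)"
  using d unfolding has_field_derivative_iff by (rule tendsto_mono[OF at_le[OF subset_UNIV]])
 moreover have "\<forall>\<^sub>F h in at_right 0. \<bar>(?F (h *\<^sub>R i) - ?F (0 *\<^sub>R i)) / (h - 0)\<bar> \<le> ?C"
  by (rule eventually_at_rightI[of 0 "min e r"]) (use bd e r in auto)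
 ultimately have "\<bar>LBINT q. g q * pd i \<phi> q\<bar> \<le> ?C"
  using tendsto_upperbound[OF tendsto_rabs] trivial_limit_at_right_real by blast
 moreover have "g q * pd i \<phi> q = v q * pd i \<phi> q" for q
  using test_zero_outside[OF test_partial_deriv[OF \<phi> i], of q] by (auto simp: g_def indicator_def)
 ultimately show ?thesis by simp
qed

text \<open>\<open>W i\<close> plays the weak spatial derivative of \<open>U\<close>, and
  \<open>N\<close> any bound for \<open>Lu\<close> in the dual of \<open>parabolic_norm\<close>.
  Only integrals against test functions occur, and the constants are fixed before \<open>U\<close>,
  \<open>W\<close> and \<open>N\<close>.\<close>

theorem scalar_three_sets_estimate:
 fixes \<Omega> \<omega> B :: "'a::euclidean_space set"
 assumes \<Omega>: "open \<Omega>" and w: "open \<omega>" "\<omega> \<noteq> {}" "\<omega> \<subseteq> B" and T: "0 < T1" "T1 < T2" "T2 < T"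
  and B: "open B" "connected B" "compact (closure B)" "closure B \<subseteq> \<Omega>"
 obtains C \<kappa> where "C > 0" "0 < \<kappa>" "\<kappa> < 1"
  "\<And>U W N. sqint lborel U \<Longrightarrow> (\<And>i. i \<in> Basis \<Longrightarrow> sqint lborel (W i)) \<Longrightarrow> N \<ge> 0 \<Longrightarrow>
   (\<And>\<psi>. \<psi> \<in> \<D> ({0<..<T} \<times> \<Omega>) \<Longrightarrow> \<bar>LBINT p. U p * heat_dual \<psi> p\<bar> \<le> N * parabolic_norm \<psi>) \<Longrightarrow>
   (\<And>\<psi> i. \<psi> \<in> \<D> ({0<..<T} \<times> \<Omega>) \<Longrightarrow> i \<in> Basis \<Longrightarrow>
    (LBINT p. U p * pd (0, i) \<psi> p) = - (LBINT p. W i p * \<psi> p)) \<Longrightarrow>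
   l2 lborel (\<lambda>p. indicator ({T1<..<T2} \<times> B) p * U p)
    + (\<Sum>i\<in>Basis. l2 lborel (\<lambda>p. indicator ({T1<..<T2} \<times> B) p * W i p))
   \<le> C * (l2 lborel (\<lambda>p. indicator ({0<..<T} \<times> \<omega>) p * U p) + N) powr \<kappa> * (l2 lborel U + N) powr (1 - \<kappa>)"
proof -
 let ?O = "{0<..<T} \<times> \<Omega>" and ?Q = "{T1<..<T2} \<times> B" and ?J = "{T1<..<T2}"
 have T0: "T > 0" using T by simp
 have oQ: "open ?Q" using B by (intro open_Times) auto
 have oO: "open ?O" using \<Omega> by (intro open_Times) auto
 \<comment> \<open>Compact in the open cylinder because of \<open>0 < T1\<close>,
   \<open>T2 < T\<close> and \<open>closure B \<subseteq> \<Omega>\<close>; so the cutoff can be 1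
   around it.\<close>
 define K where "K = {T1..T2} \<times> closure B"
 have K: "compact K" "K \<subseteq> ?O" unfolding K_def using B T by (auto intro!: compact_Times)
 have QK: "?Q \<subseteq> K" unfolding K_def using closure_subset by auto
 have BO: "B \<subseteq> \<Omega>" using B(4) closure_subset by blast
 have QO: "?Q \<subseteq> ?O" using BO T by auto
 obtain \<eta> d where \<eta>: "\<eta> \<in> \<D> ?O" "d > 0" "\<And>x y. x \<in> K \<Longrightarrow> dist x y \<le> d \<Longrightarrow> \<eta> y = 1"
  using smooth_cutoff[OF K(1) oO K(2)] by metis
 have \<eta>': "\<eta> \<in> \<D> ({0<..} \<times> UNIV)" by (rule test_mono[OF \<eta>(1)]) auto
 obtain R Ca where R: "R > 0" and Ca: "Ca \<ge> 0"
  "\<And>U t x e. sqint lborel U \<Longrightarrow> (t, x) \<in> K \<Longrightarrow> norm e = 1 \<Longrightarrow>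
   extends_holomorphically R (Ca * l2 lborel U) (\<lambda>s. caloric_part \<eta> T U (t, x + s *\<^sub>R e))"
 proof (rule caloric_part_analytic[OF \<eta>(1,2) compact_imp_bounded[OF K(1)], where T=T], goal_cases)
  case (1 p q)
  from 1(2,3) show ?case by (rule \<eta>(3))
 next
  case (2 R C)
  show ?case by (rule 2(1)[OF 2(2,3)]) (rule 2(4))
 qed
 obtain Ce where Ce: "Ce \<ge> 0"
  "\<And>f. f \<in> \<D> ({..<T} \<times> UNIV) \<Longrightarrow>
   parabolic_norm (\<lambda>p. \<eta> p * heat_pot T f p) \<le> Ce * l2 lborel f"
  "\<And>h i. h \<in> \<D> ({..<T} \<times> UNIV) \<Longrightarrow> i \<in> Basis \<Longrightarrow>
   parabolic_norm (\<lambda>p. \<eta> p * heat_pot T (pd (0, i) h) p) \<le> Ce * l2 lborel h"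
  by (rule heat_pot_energy[OF \<eta>' T0]) blast
 obtain Cp \<kappa> r where Cp: "Cp > 0" and \<kappa>: "0 < \<kappa>" "\<kappa> < 1" and r: "r > 0" and spread:
  "\<And>f M x y. line_analytic B R M f \<Longrightarrow> M > 0 \<Longrightarrow> sqint lborel (\<lambda>x. indicator \<omega> x * f x) \<Longrightarrow> x \<in> B \<Longrightarrow>
   norm (y - x) \<le> r \<Longrightarrow>
   \<bar>f y\<bar> \<le> Cp * l2 lborel (\<lambda>x. indicator \<omega> x * f x) powr \<kappa> * M powr (1 - \<kappa>) \<and>
   \<bar>f y - f x\<bar> \<le> Cp * l2 lborel (\<lambda>x. indicator \<omega> x * f x) powr \<kappa> * M powr (1 - \<kappa>) * norm (y - x)"
  using spatial_propagation[OF B(1-3) w R] by blast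
 have Bfin: "emeasure lborel B < \<infinity>"
  using emeasure_mono[OF closure_subset[of B], of lborel] emeasure_compact_finite[OF B(3)] by (auto intro: le_less_trans)
 have [measurable]: "B \<in> sets borel" "\<omega> \<in> sets borel" "\<Omega> \<in> sets borel" using B w \<Omega> by auto
 define mB where "mB = l2 lborel (indicator B :: 'a \<Rightarrow> real)"
 have sqB: "sqint lborel (indicator B :: 'a \<Rightarrow> real)" using Bfin by (intro sqint_indicator) auto
 have mB0: "mB \<ge> 0" unfolding mB_def by (rule l2_nonneg)
 \<comment> \<open>The factors are the square root of the volume of \<open>B\<close>, the
   propagation constant, the loss in Jensen's inequality, and the constants that bound the
   observation of \<open>v\<close> by \<open>E\<close> and its supremum by \<open>F\<close>.\<close>
 define C5 where "C5 = mB * Cp * sqrt (1 + (T2 - T1)) * (1 + Ce) powr \<kappa> * (Ca + 1) powr (1 - \<kappa>)"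
 have C50: "C5 \<ge> 0" unfolding C5_def using mB0 Cp T by simp
 define n where "n = real DIM('a)"
 define C where "C = (n + 1) * (Ce + C5) + 1"
 show thesis
 proof (rule that[of C \<kappa>])
  show "C > 0" unfolding C_def n_def using Ce(1) C50 by (simp add: add_nonneg_pos)
  show "0 < \<kappa>" "\<kappa> < 1" by (rule \<kappa>)+
  fix U :: "real \<times> 'a \<Rightarrow> real" and W :: "'a \<Rightarrow> real \<times> 'a \<Rightarrow> real" and N :: real
  assume U: "sqint lborel U" and W: "\<And>i. i \<in> Basis \<Longrightarrow> sqint lborel (W i)" and N: "N \<ge> 0"
   and H1: "\<And>\<psi>. \<psi> \<in> \<D> ?O \<Longrightarrow> \<bar>LBINT p. U p * heat_dual \<psi> p\<bar> \<le> N * parabolic_norm \<psi>"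
   and H2: "\<And>\<psi> i. \<psi> \<in> \<D> ?O \<Longrightarrow> i \<in> Basis \<Longrightarrow>
    (LBINT p. U p * pd (0, i) \<psi> p) = - (LBINT p. W i p * \<psi> p)"
  have Um[measurable]: "U \<in> borel_measurable borel" using U by (simp add: sqint_def)
  let ?v = "caloric_part \<eta> T U"
  have vm[measurable]: "?v \<in> borel_measurable borel" by (rule caloric_part_borel[OF Um \<eta>(1) T0])
  \<comment> \<open>\<open>E\<close> is the observed and \<open>F\<close> the global quantity;
    \<open>N \<le> E \<le> F\<close> is used throughout.\<close>
  define E where "E = l2 lborel (\<lambda>p. indicator ({0<..<T} \<times> \<omega>) p * U p) + N"
  define F where "F = l2 lborel U + N"
  have QB[measurable]: "?Q \<in> sets borel" using oQ by simp
  have wT[measurable]: "{0<..<T} \<times> \<omega> \<in> sets borel" using open_Times[OF open_greaterThanLessThan w(1)] by (rule borel_open)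
  have Jw[measurable]: "?J \<times> \<omega> \<in> sets borel" using open_Times[OF open_greaterThanLessThan w(1)] by (rule borel_open)
  have sqi: "sqint lborel (\<lambda>p. indicator A p * f p)" "l2 lborel (\<lambda>p. indicator A p * f p) \<le> l2 lborel f"
   if "sqint lborel f" "A \<in> sets borel" for A and f :: "real \<times> 'a \<Rightarrow> real"
  proof -
   have m: "(\<lambda>p. indicator A p * f p) \<in> borel_measurable lborel"
    using that by (intro borel_measurable_times borel_measurable_indicator) (auto simp: sqint_def)
   have le: "AE p in lborel. \<bar>indicator A p * f p\<bar> \<le> \<bar>f p\<bar>" by (intro AE_I2) (auto simp: indicator_def)
   show "sqint lborel (\<lambda>p. indicator A p * f p)" "l2 lborel (\<lambda>p. indicator A p * f p) \<le> l2 lborel f"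
    using l2_mono[OF that(1) m le] by auto
  qed
  have EF: "E \<le> F" unfolding E_def F_def using sqi(2)[OF U wT] by simp
  have E0: "E \<ge> 0" unfolding E_def using N by (simp add: l2_nonneg)
  have NE: "N \<le> E" unfolding E_def by (simp add: l2_nonneg)
  have tQ: "\<phi> \<in> \<D> ({..<T} \<times> UNIV)" if "\<phi> \<in> \<D> ?Q" for \<phi>
   by (rule test_mono[OF that]) (use T in auto)
  have tO: "(\<lambda>p. \<eta> p * heat_pot T f p) \<in> \<D> ?O" if "f \<in> \<D> ?Q" for f
   by (rule test_mult[OF \<eta>(1) smooth_heat_pot(1)]) (rule test_mono[OF that], simp)
  have pair: "(LBINT p. U p * f p) - (LBINT p. ?v p * f p) = - (LBINT p. U p * heat_dual (\<lambda>p. \<eta> p * heat_pot T f p) p)"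
   if f: "f \<in> \<D> ?Q" for f
  proof -
   have "\<eta> p * f p = f p" for p
   proof (cases "p \<in> ?Q")
    case True
    hence "\<eta> p = 1" using \<eta>(3)[of p p] QK \<eta>(2) by auto
    thus ?thesis by simp
   qed (use test_zero_outside[OF f] in simp)
   from caloric_part_pairing(1)[OF \<eta>' T0 U tQ[OF f] this] show ?thesis by simp
  qed
  \<comment> \<open>The weak derivative is reached only through \<open>H2\<close>: it suffices to
    bound \<open>U\<close> paired with derivatives of test functions.\<close>
  have l2W: "l2 lborel (\<lambda>p. indicator ?Q p * W i p) \<le> X" if i: "i \<in> Basis" and X: "X \<ge> 0"
   "\<And>\<phi>. \<phi> \<in> \<D> ?Q \<Longrightarrow> \<bar>LBINT p. U p * pd (0, i) \<phi> p\<bar> \<le> X * l2 lborel \<phi>" for i X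
  proof (rule l2_le_by_duality[OF oQ sqi(1)[OF W[OF i] QB] _ X(1)])
   fix \<phi> assume \<phi>: "\<phi> \<in> \<D> ?Q"
   have "(LBINT p. indicator ?Q p * W i p * \<phi> p) = (LBINT p. W i p * \<phi> p)"
    by (rule integral_cong[OF refl]) (use test_zero_outside[OF \<phi>] in \<open>auto simp: indicator_def\<close>)
   also have "\<dots> = - (LBINT p. U p * pd (0, i) \<phi> p)"
    using H2[OF test_mono[OF \<phi> QO] i] by simp
   finally show "\<bar>LBINT p. indicator ?Q p * W i p * \<phi> p\<bar> \<le> X * l2 lborel \<phi>" using X(2)[OF \<phi>] by simp
  qed simp
  show "l2 lborel (\<lambda>p. indicator ?Q p * U p) + (\<Sum>i\<in>Basis. l2 lborel (\<lambda>p. indicator ?Q p * W i p))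
   \<le> C * (l2 lborel (\<lambda>p. indicator ({0<..<T} \<times> \<omega>) p * U p) + N) powr \<kappa> * (l2 lborel U + N) powr (1 - \<kappa>)"
  \<comment> \<open>The propagation lemma needs a positive bound. If \<open>F = 0\<close> then
    \<open>U\<close> vanishes, and so do the \<open>W i\<close> on \<open>?Q\<close>, by
    duality.\<close>
  proof (cases "F = 0")
   case True
   hence U0: "l2 lborel U = 0" unfolding F_def using N l2_nonneg[of lborel U] by linarith
   have "l2 lborel (\<lambda>p. indicator ?Q p * W i p) \<le> 0" if i: "i \<in> Basis" for i
   proof (rule l2W[OF i])
    fix \<phi> assume \<phi>: "\<phi> \<in> \<D> ?Q"
    have "sqint lborel (pd (0, i) \<phi>)" by (rule test_sqint[OF test_partial_deriv[OF \<phi>]]) (use i in simp)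
    thus "\<bar>LBINT p. U p * pd (0, i) \<phi> p\<bar> \<le> 0 * l2 lborel \<phi>"
     using Cauchy_Schwarz_l2[OF U] U0 by fastforce
   qed simp
   hence "(\<Sum>i\<in>Basis. l2 lborel (\<lambda>p. indicator ?Q p * W i p)) \<le> 0" by (intro sum_nonpos)
   moreover have "l2 lborel (\<lambda>p. indicator ?Q p * U p) \<le> 0" using sqi(2)[OF U QB] U0 by simp
   moreover have "0 \<le> C * (l2 lborel (\<lambda>p. indicator ({0<..<T} \<times> \<omega>) p * U p) + N) powr \<kappa> * (l2 lborel U + N) powr (1 - \<kappa>)"
    using \<open>C > 0\<close> by simp
   ultimately show ?thesis by linarith
  next
   case False
   hence F: "F > 0" using EF E0 by linarith
   \<comment> \<open>The \<open>+ 1\<close> keeps \<open>M\<close> positive when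
     \<open>Ca = 0\<close>.\<close>
   define M where "M = (Ca + 1) * F"
   have M: "M > 0" unfolding M_def using Ca F by simp
   have CaM: "Ca * l2 lborel U \<le> M" unfolding M_def F_def using Ca(1) N by (intro mult_mono) (auto simp: l2_nonneg)
   have ext_mono: "extends_holomorphically R M f" if "extends_holomorphically R (Ca * l2 lborel U) f" for f
    using that CaM unfolding extends_holomorphically_def by (meson order_trans)
   have la: "line_analytic B R M (\<lambda>x. ?v (t, x))" if t: "t \<in> {T1..T2}" for t
    unfolding line_analytic_def
   proof (intro ballI allI impI ext_mono)
    fix x and e :: 'a assume "x \<in> B" "norm e = 1"
    thus "extends_holomorphically R (Ca * l2 lborel U) (\<lambda>s. ?v (t, x + s *\<^sub>R e))"
     by (intro Ca(2)[OF U]) (use t closure_subset in \<open>auto simp: K_def\<close>)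
   qed
   have vM: "\<bar>?v p\<bar> \<le> M" if pQ: "p \<in> ?Q" for p
   proof -
    obtain t x where p: "p = (t, x)" "t \<in> ?J" "x \<in> B" using pQ by (cases p) auto
    show ?thesis unfolding p(1) by (rule line_analytic_bound[OF la p(3)]) (use p R in auto)
   qed
   have Qi: "integrable lborel (indicator ?Q :: real \<times> 'a \<Rightarrow> real)"
   proof -
    have "integrable lborel (\<lambda>p. (indicator ?J (fst p) :: real) * indicator B (snd p :: 'a))"
     using Bfin T by (intro integrable_lborel_prod_mult integrable_real_indicator) auto
    moreover have "(\<lambda>p. (indicator ?J (fst p) :: real) * indicator B (snd p :: 'a)) = indicator ?Q"
     by (auto simp: indicator_def)
    ultimately show ?thesis by simp
   qed
   have Qf: "emeasure lborel ?Q < \<infinity>" using Qi by (simp add: integrable_indicator_iff)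
   have sqv: "sqint lborel (\<lambda>p. indicator ?Q p * ?v p)"
    by (rule bounded_support_integrable(2)[OF _ Qf, where B=M]) (use vM M in \<open>auto simp: indicator_def\<close>)
   have energy: "\<bar>(LBINT p. U p * f p) - (LBINT p. ?v p * f p)\<bar> \<le> N * parabolic_norm (\<lambda>p. \<eta> p * heat_pot T f p)"
    if "f \<in> \<D> ?Q" for f
    unfolding pair[OF that] using H1[OF tO[OF that]] by simp
   \<comment> \<open>The remainder \<open>U - v\<close>: its pairing with \<open>\<phi>\<close> is
     minus the pairing of \<open>U\<close> with \<open>heat_dual\<close> of an admissible test
     function, whose parabolic norm the energy estimate bounds.\<close>
   have l2w: "l2 lborel (\<lambda>p. indicator ?Q p * U p - indicator ?Q p * ?v p) \<le> N * Ce"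
   proof (rule l2_le_by_duality[OF oQ sqint_diff[OF sqi(1)[OF U QB] sqv]])
    fix \<phi> assume \<phi>: "\<phi> \<in> \<D> ?Q"
    note sq\<phi> = test_sqint[OF \<phi>]
    have "(LBINT p. (indicator ?Q p * U p - indicator ?Q p * ?v p) * \<phi> p)
      = (LBINT p. (indicator ?Q p * U p) * \<phi> p - (indicator ?Q p * ?v p) * \<phi> p)"
     by (simp add: left_diff_distrib)
    also have "\<dots> = (LBINT p. (indicator ?Q p * U p) * \<phi> p) - (LBINT p. (indicator ?Q p * ?v p) * \<phi> p)"
     by (intro integral_diff sqint_mult sqi(1)[OF U QB] sqv sq\<phi>)
    also have "(LBINT p. (indicator ?Q p * U p) * \<phi> p) = (LBINT p. U p * \<phi> p)"
     by (rule integral_cong[OF refl]) (use test_zero_outside[OF \<phi>] in \<open>auto simp: indicator_def\<close>)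
    also have "(LBINT p. (indicator ?Q p * ?v p) * \<phi> p) = (LBINT p. ?v p * \<phi> p)"
     by (rule integral_cong[OF refl]) (use test_zero_outside[OF \<phi>] in \<open>auto simp: indicator_def\<close>)
    finally have "\<bar>LBINT p. (indicator ?Q p * U p - indicator ?Q p * ?v p) * \<phi> p\<bar>
      \<le> N * parabolic_norm (\<lambda>p. \<eta> p * heat_pot T \<phi> p)" using energy[OF \<phi>] by simp
    also have "\<dots> \<le> N * (Ce * l2 lborel \<phi>)" by (intro mult_left_mono N Ce(2) tQ \<phi>)
    finally show "\<bar>LBINT p. (indicator ?Q p * U p - indicator ?Q p * ?v p) * \<phi> p\<bar> \<le> N * Ce * l2 lborel \<phi>"
     by (simp add: mult.assoc)
   qed (use N Ce in auto)
   define a where "a t = l2 lborel (\<lambda>x. indicator \<omega> x * ?v (t, x))" for t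
   have sqvw: "sqint lborel (\<lambda>p. indicator (?J \<times> \<omega>) p * ?v p)"
    by (rule l2_mono(2)[OF sqv]) (use w in \<open>auto simp: indicator_def\<close>)
   have Ja: "l2 lborel (\<lambda>x. indicator (?J \<times> \<omega>) (t, x) * ?v (t, x)) = indicator ?J t * a t" for t
    unfolding a_def by (auto simp: indicator_def l2_def)
   have am[measurable]: "a \<in> borel_measurable borel"
   proof -
    have [measurable]: "?v \<in> borel_measurable (borel \<Otimes>\<^sub>M borel)" using vm by (simp add: borel_prod)
    show ?thesis unfolding a_def[abs_def] l2_def by measurable
   qed
   have sqa: "sqint lborel (\<lambda>t. indicator ?J t * a t)"
    using sqint_iterated(2)[OF sqvw] unfolding Ja .
   have l2a: "l2 lborel (\<lambda>t. indicator ?J t * a t) \<le> (1 + Ce) * E"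
   proof -
    have "l2 lborel (\<lambda>t. indicator ?J t * a t) = l2 lborel (\<lambda>p. indicator (?J \<times> \<omega>) p * ?v p)"
     using sqint_iterated(3)[OF sqvw] unfolding Ja .
    \<comment> \<open>On \<open>\<omega>\<close>, a subset of \<open>B\<close>, the caloric part is
      \<open>U\<close> minus the remainder, so its observation costs at most that of
      \<open>U\<close> plus \<open>N * Ce\<close>.\<close>
    also have "\<dots> = l2 lborel (\<lambda>p. indicator (?J \<times> \<omega>) p * U p - indicator (?J \<times> \<omega>) p * (indicator ?Q p * U p - indicator ?Q p * ?v p))"
     by (rule arg_cong[where f="l2 lborel"]) (use w in \<open>auto simp: indicator_def fun_eq_iff\<close>)
    also have "\<dots> \<le> l2 lborel (\<lambda>p. indicator (?J \<times> \<omega>) p * U p) + l2 lborel (\<lambda>p. indicator (?J \<times> \<omega>) p * (indicator ?Q p * U p - indicator ?Q p * ?v p))"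
     by (intro l2_triangle_diff sqi(1) U Jw sqint_diff QB sqv)
    also have "l2 lborel (\<lambda>p. indicator (?J \<times> \<omega>) p * (indicator ?Q p * U p - indicator ?Q p * ?v p)) \<le> N * Ce"
     using sqi(2)[OF sqint_diff[OF sqi(1)[OF U QB] sqv] Jw] l2w by linarith
    also have "l2 lborel (\<lambda>p. indicator (?J \<times> \<omega>) p * U p) \<le> l2 lborel (\<lambda>p. indicator ({0<..<T} \<times> \<omega>) p * U p)"
     by (rule l2_mono(1)[OF sqi(1)[OF U wT]]) (use T in \<open>auto simp: indicator_def\<close>)
    finally have "l2 lborel (\<lambda>t. indicator ?J t * a t) \<le> l2 lborel (\<lambda>p. indicator ({0<..<T} \<times> \<omega>) p * U p) + N * Ce" by simp
    also have "\<dots> \<le> E + E * Ce" using NE Ce(1) N by (intro add_mono mult_right_mono) (auto simp: E_def)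
    finally show ?thesis by (simp add: algebra_simps)
   qed
   have a0: "a t \<ge> 0" for t unfolding a_def by (rule l2_nonneg)
   note ak = l2_powr_le[OF T(2) sqa a0 \<kappa> am]
   \<comment> \<open>The right-hand side of the propagation bound at time \<open>fst p\<close>. It
     serves both as a majorant of \<open>v\<close> and as its Lipschitz constant in space.\<close>
   define D where "D p = (indicator ?J (fst p) * a (fst p) powr \<kappa> * (Cp * M powr (1 - \<kappa>))) * indicator B (snd p)" for p :: "real \<times> 'a"
   have D2: "(D p)\<^sup>2 = (indicator ?J (fst p) * a (fst p) powr \<kappa> * (Cp * M powr (1 - \<kappa>)))\<^sup>2 * (indicator B (snd p))\<^sup>2" for p
    unfolding D_def by (simp only: power_mult_distrib)
   have Di: "integrable lborel (\<lambda>p. (D p)\<^sup>2)"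
    unfolding D2 using sqint_sq[OF sqint_cmult[OF ak(1), of "Cp * M powr (1 - \<kappa>)"]] sqint_sq[OF sqB]
    by (intro integrable_lborel_prod_mult) (simp_all only: mult.commute)
   have sqD: "sqint lborel D"
    unfolding sqint_def
   proof
    have "D \<in> borel_measurable (borel \<Otimes>\<^sub>M borel)" unfolding D_def by measurable
    thus "D \<in> borel_measurable lborel" by (simp add: borel_prod)
   qed (rule Di)
   have l2D: "l2 lborel D \<le> C5 * (E powr \<kappa> * F powr (1 - \<kappa>))"
   proof -
    have Dt: "l2 lborel (\<lambda>x. D (t, x)) = mB * (Cp * M powr (1 - \<kappa>)) * (indicator ?J t * a t powr \<kappa>)" for t
    proof -
     have "l2 lborel (\<lambda>x. D (t, x)) = \<bar>indicator ?J t * a t powr \<kappa> * (Cp * M powr (1 - \<kappa>))\<bar> * mB"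
      unfolding D_def fst_conv snd_conv l2_cmult mB_def ..
     also have "\<bar>indicator ?J t * a t powr \<kappa> * (Cp * M powr (1 - \<kappa>))\<bar> = indicator ?J t * a t powr \<kappa> * (Cp * M powr (1 - \<kappa>))"
      using Cp by (simp add: abs_mult)
     finally show ?thesis by (simp only: mult_ac)
    qed
    have "l2 lborel D = l2 lborel (\<lambda>t. mB * (Cp * M powr (1 - \<kappa>)) * (indicator ?J t * a t powr \<kappa>))"
     using sqint_iterated(3)[OF sqD] unfolding Dt by simp
    also have "\<dots> = mB * (Cp * M powr (1 - \<kappa>)) * l2 lborel (\<lambda>t. indicator ?J t * a t powr \<kappa>)"
     unfolding l2_cmult using mB0 Cp by (simp add: abs_mult)
    also have "\<dots> \<le> mB * (Cp * M powr (1 - \<kappa>)) * (sqrt (1 + (T2 - T1)) * ((1 + Ce) * E) powr \<kappa>)"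
    proof (rule mult_left_mono)
     have "l2 lborel (\<lambda>t. indicator ?J t * a t powr \<kappa>) \<le> sqrt (1 + (T2 - T1)) * l2 lborel (\<lambda>t. indicator ?J t * a t) powr \<kappa>"
      by (rule ak(2))
     also have "\<dots> \<le> sqrt (1 + (T2 - T1)) * ((1 + Ce) * E) powr \<kappa>"
      using l2a \<kappa> T by (intro mult_left_mono powr_mono2) (auto simp: l2_nonneg)
     finally show "l2 lborel (\<lambda>t. indicator ?J t * a t powr \<kappa>) \<le> sqrt (1 + (T2 - T1)) * ((1 + Ce) * E) powr \<kappa>" .
    qed (use mB0 Cp in simp)
    also have "\<dots> = C5 * (E powr \<kappa> * F powr (1 - \<kappa>))"
     unfolding C5_def M_def using Ca Ce E0 F by (simp add: powr_mult)
    finally show ?thesis .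
   qed
   have sqw: "sqint lborel (\<lambda>x. indicator \<omega> x * ?v (t, x))" if t: "t \<in> ?J" for t
   proof (rule bounded_support_integrable(2)[OF _ Bfin, where B=M])
    have [measurable]: "?v \<in> borel_measurable (borel \<Otimes>\<^sub>M borel)" using vm by (simp add: borel_prod)
    show "(\<lambda>x. indicator \<omega> x * ?v (t, x)) \<in> borel_measurable lborel" by measurable
    show "\<bar>indicator \<omega> x * ?v (t, x)\<bar> \<le> M" for x using vM[of "(t, x)"] t w M by (auto simp: indicator_def)
   qed (use w in \<open>auto simp: indicator_def\<close>)
   have vD: "\<bar>?v p\<bar> \<le> D p" and lipD: "0 \<le> h \<Longrightarrow> h \<le> r \<Longrightarrow> i \<in> Basis \<Longrightarrow> \<bar>?v (p - h *\<^sub>R (0, i)) - ?v p\<bar> \<le> D p * h"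
    if pQ: "p \<in> ?Q" for p h i
   proof -
    obtain t x where p: "p = (t, x)" "t \<in> ?J" "x \<in> B" using pQ by (cases p) auto
    have t': "t \<in> {T1..T2}" using p by auto
    have Dp: "D p = Cp * a t powr \<kappa> * M powr (1 - \<kappa>)" using p by (simp add: D_def)
    show "\<bar>?v p\<bar> \<le> D p"
     using spread[OF la[OF t'] M sqw[OF p(2)] p(3), of x] r unfolding Dp unfolding a_def p(1) by simp
    show "\<bar>?v (p - h *\<^sub>R (0, i)) - ?v p\<bar> \<le> D p * h" if "0 \<le> h" "h \<le> r" "i \<in> Basis"
     using spread[OF la[OF t'] M sqw[OF p(2)] p(3), of "x - h *\<^sub>R i"] that unfolding Dp unfolding a_def p(1) by simp
   qed
   let ?X = "E powr \<kappa> * F powr (1 - \<kappa>)"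
   \<comment> \<open>\<open>N\<close> splits as
     \<open>N powr \<kappa> * N powr (1 - \<kappa>)\<close>, and \<open>N\<close> is below both
     \<open>E\<close> and \<open>F\<close>; so the linear contribution of the remainder fits the
     interpolated form.\<close>
   have NX: "N \<le> ?X"
   proof (cases "N = 0")
    case False
    hence "N = N powr \<kappa> * N powr (1 - \<kappa>)" using N by (simp add: powr_add[symmetric])
    also have "\<dots> \<le> ?X" using NE EF N \<kappa> by (intro mult_mono powr_mono2) auto
    finally show ?thesis .
   qed simp
   have NCX: "N * Ce \<le> Ce * ?X" using NX Ce(1) by (simp add: mult.commute mult_left_mono)
   have b1: "l2 lborel (\<lambda>p. indicator ?Q p * U p) \<le> (Ce + C5) * ?X"
   proof -
    have "l2 lborel (\<lambda>p. indicator ?Q p * U p)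
      \<le> l2 lborel (\<lambda>p. indicator ?Q p * U p - indicator ?Q p * ?v p) + l2 lborel (\<lambda>p. indicator ?Q p * ?v p)"
     using l2_triangle[OF sqint_diff[OF sqi(1)[OF U QB] sqv] sqv] by simp
    also have "l2 lborel (\<lambda>p. indicator ?Q p * ?v p) \<le> l2 lborel D"
    proof (rule l2_mono(1)[OF sqD])
     show "AE p in lborel. \<bar>indicator ?Q p * ?v p\<bar> \<le> \<bar>D p\<bar>"
      using vD by (intro AE_I2) (auto simp: indicator_def intro: order_trans[OF _ abs_ge_self])
    qed simp
    finally show ?thesis using l2w l2D NCX by (simp add: distrib_right)
   qed
   \<comment> \<open>With \<open>pd (0, i) \<phi>\<close> as source, the remainder is handled by the
     second energy estimate and the caloric part by its Lipschitz bound.\<close>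
   have b2: "l2 lborel (\<lambda>p. indicator ?Q p * W i p) \<le> (Ce + C5) * ?X" if i: "i \<in> Basis" for i
   proof (rule l2W[OF i])
    fix \<phi> assume \<phi>: "\<phi> \<in> \<D> ?Q"
    have dt: "pd (0, i) \<phi> \<in> \<D> ?Q" using test_partial_deriv[OF \<phi>] i by simp
    have "\<bar>(LBINT p. U p * pd (0, i) \<phi> p) - (LBINT p. ?v p * pd (0, i) \<phi> p)\<bar>
      \<le> N * parabolic_norm (\<lambda>p. \<eta> p * heat_pot T (pd (0, i) \<phi>) p)" by (rule energy[OF dt])
    also have "\<dots> \<le> N * (Ce * l2 lborel \<phi>)" by (intro mult_left_mono N Ce(3) tQ \<phi> i)
    also have "\<dots> = (N * Ce) * l2 lborel \<phi>" by simp
    also have "\<dots> \<le> (Ce * ?X) * l2 lborel \<phi>" by (intro mult_right_mono NCX l2_nonneg)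
    finally have e1: "\<bar>(LBINT p. U p * pd (0, i) \<phi> p) - (LBINT p. ?v p * pd (0, i) \<phi> p)\<bar>
      \<le> (Ce * ?X) * l2 lborel \<phi>" .
    have "\<bar>LBINT p. ?v p * pd (0, i) \<phi> p\<bar> \<le> l2 lborel D * l2 lborel \<phi>"
     by (rule pairing_partial_deriv_le[OF oQ Qf \<phi> Basis_real_prod(2)[OF i] vm vM sqD r lipD]) (use i in auto)
    also have "\<dots> \<le> (C5 * ?X) * l2 lborel \<phi>" by (intro mult_right_mono l2D l2_nonneg)
    finally show "\<bar>LBINT p. U p * pd (0, i) \<phi> p\<bar> \<le> (Ce + C5) * ?X * l2 lborel \<phi>"
     using e1 by (simp add: distrib_right)
   qed (use Ce C50 in simp)
   have "(\<Sum>i\<in>Basis. l2 lborel (\<lambda>p. indicator ?Q p * W i p)) \<le> n * ((Ce + C5) * ?X)"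
    using sum_mono[OF b2, of Basis "\<lambda>i. i"] by (simp add: n_def)
   hence "l2 lborel (\<lambda>p. indicator ?Q p * U p) + (\<Sum>i\<in>Basis. l2 lborel (\<lambda>p. indicator ?Q p * W i p))
     \<le> (n + 1) * (Ce + C5) * ?X" using b1 by (simp add: algebra_simps)
   also have "\<dots> \<le> C * ?X" unfolding C_def by (intro mult_right_mono) auto
   finally show ?thesis unfolding E_def F_def by (simp add: mult.assoc)
  qed
 qed
qed

section \<open>The spaces \<open>L\<^sup>2\<close>, \<open>H\<^sup>1\<close> and \<open>H\<^sup>-\<^sup>1\<close>\<close>

lemma AE_lebesgue_on_iff:
 "S \<in> sets borel \<Longrightarrow> (AE x in lebesgue_on S. P x) \<longleftrightarrow> (AE x in lborel. x \<in> S \<longrightarrow> P x)"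
 by (subst AE_restrict_space_iff) (auto simp: AE_completion_iff)

lemma lebesgue_on_borel:
 fixes g :: "'a::euclidean_space \<Rightarrow> real"
 assumes S: "S \<in> sets borel" and g[measurable]: "g \<in> borel_measurable borel"
 shows "g \<in> borel_measurable (lebesgue_on S)"
  and "integrable (lebesgue_on S) g \<longleftrightarrow> integrable lborel (\<lambda>x. indicator S x * g x)"
  and "(\<integral>x. g x \<partial>lebesgue_on S) = (LBINT x. indicator S x * g x)"
proof -
 have S': "S \<inter> space lebesgue \<in> sets lebesgue" using S by simp
 have [measurable]: "S \<in> sets borel" by fact
 have gl: "g \<in> borel_measurable lebesgue" by (rule measurable_completion) simp
 show "g \<in> borel_measurable (lebesgue_on S)" by (rule measurable_restrict_space1[OF gl])
 have m: "(\<lambda>x. indicator S x * g x) \<in> borel_measurable lborel" by simp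
 show "integrable (lebesgue_on S) g \<longleftrightarrow> integrable lborel (\<lambda>x. indicator S x * g x)"
  using integrable_restrict_space[OF S', of g] integrable_completion[OF m] by simp
 show "(\<integral>x. g x \<partial>lebesgue_on S) = (LBINT x. indicator S x * g x)"
  using integral_restrict_space[OF S', of g] integral_completion[OF m] by simp
qed

lemma integral_lebesgue_on_supported:
 fixes g :: "'a::euclidean_space \<Rightarrow> real"
 assumes "S \<in> sets borel" "g \<in> borel_measurable borel" "\<And>x. x \<notin> S \<Longrightarrow> g x = 0"
 shows "(\<integral>x. g x \<partial>lebesgue_on S) = (LBINT x. g x)"
  and "integrable (lebesgue_on S) g \<longleftrightarrow> integrable lborel g"
proof -
 have "(\<lambda>x. indicator S x * g x) = g" using assms(3) by (auto simp: indicator_def fun_eq_iff)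
 thus "(\<integral>x. g x \<partial>lebesgue_on S) = (LBINT x. g x)"
  "integrable (lebesgue_on S) g \<longleftrightarrow> integrable lborel g"
  using lebesgue_on_borel(2,3)[OF assms(1,2)] by simp_all
qed

text \<open>The spaces consist of functions that are Lebesgue measurable on \<open>S\<close>,
  whereas the scalar theory works with Borel functions and \<open>lborel\<close>. Vanishing outside
  \<open>S\<close> makes the integrals over \<open>S\<close> and over the whole space agree.\<close>

lemma borel_representative:
 fixes f :: "'a::euclidean_space \<Rightarrow> real"
 assumes S: "S \<in> sets borel" and f: "f \<in> borel_measurable (lebesgue_on S)"
 obtains g where "g \<in> borel_measurable borel" "\<And>x. x \<notin> S \<Longrightarrow> g x = 0" "AE x in lebesgue_on S. f x = g x"
proof -
 have S': "S \<inter> space lebesgue \<in> sets lebesgue" using S by simp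
 have "(\<lambda>x. indicator S x *\<^sub>R f x) \<in> borel_measurable lebesgue"
  using f borel_measurable_restrict_space_iff[OF S', of f] by simp
 then obtain g' where g': "g' \<in> borel_measurable lborel" "AE x in lborel. indicator S x *\<^sub>R f x = g' x"
  using completion_ex_borel_measurable_real by blast
 show ?thesis
 proof (rule that[of "\<lambda>x. indicator S x * g' x"])
  show "(\<lambda>x. indicator S x * g' x) \<in> borel_measurable borel" using g'(1) S by simp
  show "AE x in lebesgue_on S. f x = indicator S x * g' x"
   unfolding AE_lebesgue_on_iff[OF S] using g'(2) by eventually_elim (auto simp: indicator_def)
 qed simp
qed

lemma l2_cong_AE:
 assumes "AE x in M. f x = g x" "f \<in> borel_measurable M" "g \<in> borel_measurable M"
 shows "l2 M f = l2 M g" "sqint M f \<longleftrightarrow> sqint M g"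
proof -
 have ae: "AE x in M. (f x)\<^sup>2 = (g x)\<^sup>2" using assms(1) by eventually_elim simp
 show "l2 M f = l2 M g" unfolding l2_def
  by (rule arg_cong[where f=sqrt], rule integral_cong_AE) (use assms ae in auto)
 show "sqint M f \<longleftrightarrow> sqint M g" unfolding sqint_def
  using assms integrable_cong_AE[OF _ _ ae] by auto
qed

lemma l2_lebesgue_on:
 assumes S: "S \<in> sets borel" and g[measurable]: "g \<in> borel_measurable borel" and z: "\<And>x. x \<notin> S \<Longrightarrow> g x = 0"
 shows "l2 (lebesgue_on S) g = l2 lborel g" "sqint (lebesgue_on S) g \<longleftrightarrow> sqint lborel g"
proof -
 have m: "(\<lambda>x. (g x)\<^sup>2) \<in> borel_measurable borel" by measurable
 show "l2 (lebesgue_on S) g = l2 lborel g"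
  unfolding l2_def by (subst integral_lebesgue_on_supported(1)[OF S m]) (use z in auto)
 show "sqint (lebesgue_on S) g \<longleftrightarrow> sqint lborel g"
  unfolding sqint_def using integral_lebesgue_on_supported(2)[OF S m] z lebesgue_on_borel(1)[OF S g] by auto
qed

lemma sqint_representative:
 assumes S: "S \<in> sets borel" and f: "sqint (lebesgue_on S) f"
 obtains g where "sqint lborel g" "\<And>x. x \<notin> S \<Longrightarrow> g x = 0" "AE x in lebesgue_on S. f x = g x"
  "l2 (lebesgue_on S) f = l2 lborel g"
proof -
 have fm: "f \<in> borel_measurable (lebesgue_on S)" by (rule sqint_measurable[OF f])
 obtain g where g: "g \<in> borel_measurable borel" "\<And>x. x \<notin> S \<Longrightarrow> g x = 0" "AE x in lebesgue_on S. f x = g x"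
  using borel_representative[OF S fm] by blast
 note gm = lebesgue_on_borel(1)[OF S g(1)]
 show ?thesis
  by (rule that[of g]) (use l2_cong_AE[OF g(3) fm gm] l2_lebesgue_on[OF S g(1,2)] g f in auto)
qed

text \<open>The fundamental lemma of the calculus of variations, as the case \<open>C = 0\<close> of
  \<open>l2_le_by_duality\<close>.\<close>

lemma AE_eq_by_duality:
 assumes S: "open S" and f: "sqint (lebesgue_on S) f"
  and z: "\<And>\<phi>. \<phi> \<in> \<D> S \<Longrightarrow> (\<integral>x. f x * \<phi> x \<partial>lebesgue_on S) = 0"
 shows "AE x in lebesgue_on S. f x = 0"
proof -
 have Sb: "S \<in> sets borel" using S by simp
 obtain g where g: "sqint lborel g" "\<And>x. x \<notin> S \<Longrightarrow> g x = 0" "AE x in lebesgue_on S. f x = g x"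
  "l2 (lebesgue_on S) f = l2 lborel g"
  using sqint_representative[OF Sb f] by blast
 have gm[measurable]: "g \<in> borel_measurable borel" using g(1) by (simp add: sqint_def)
 have "l2 lborel g \<le> 0"
 proof (rule l2_le_by_duality[OF S g(1,2)])
  fix \<phi> assume \<phi>: "\<phi> \<in> \<D> S"
  note [measurable] = test_borel[OF \<phi>]
  have "(LBINT x. g x * \<phi> x) = (\<integral>x. g x * \<phi> x \<partial>lebesgue_on S)"
   by (rule integral_lebesgue_on_supported(1)[OF Sb, symmetric]) (use g(2) in auto)
  also have "\<dots> = (\<integral>x. f x * \<phi> x \<partial>lebesgue_on S)"
  proof (rule integral_cong_AE)
   show "AE x in lebesgue_on S. g x * \<phi> x = f x * \<phi> x" using g(3) by eventually_elim simp
   show "(\<lambda>x. g x * \<phi> x) \<in> borel_measurable (lebesgue_on S)" by (rule lebesgue_on_borel(1)[OF Sb]) measurable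
   show "(\<lambda>x. f x * \<phi> x) \<in> borel_measurable (lebesgue_on S)"
    by (intro borel_measurable_times sqint_measurable[OF f] lebesgue_on_borel(1)[OF Sb test_borel[OF \<phi>]])
  qed
  finally show "\<bar>LBINT x. g x * \<phi> x\<bar> \<le> 0 * l2 lborel \<phi>" using z[OF \<phi>] by simp
 qed simp_all
 hence "l2 lborel g = 0" using l2_nonneg[of lborel g] by linarith
 hence "(LBINT x. (g x)\<^sup>2) = 0" by (simp add: l2_sq[symmetric])
 hence "AE x in lborel. (g x)\<^sup>2 = 0"
  using integral_nonneg_eq_0_iff_AE[OF sqint_sq[OF g(1)]] by auto
 hence "AE x in lebesgue_on S. g x = 0" unfolding AE_lebesgue_on_iff[OF Sb] by eventually_elim simp
 thus ?thesis using g(3) by eventually_elim simp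
qed

section \<open>Weak gradients and the norm of \<open>H1\<close>\<close>

lemma L2_real_iff: "f \<in> L2 S \<longleftrightarrow> sqint (lebesgue_on S) f" for f :: "'a::euclidean_space \<Rightarrow> real"
 unfolding L2_def sqint_def by simp

lemma L2_norm_real: "L2_norm S f = l2 (lebesgue_on S) f" for f :: "'a::euclidean_space \<Rightarrow> real"
 unfolding L2_norm_def l2_def by simp

lemma norm_sq_sum: "(norm x)\<^sup>2 = (\<Sum>i\<in>Basis. (x \<bullet> i)\<^sup>2)" for x :: "'b::euclidean_space"
 unfolding power2_norm_eq_inner by (subst euclidean_inner) (simp add: power2_eq_square)

lemma L2_vector_iff:
 fixes g :: "'a::euclidean_space \<Rightarrow> 'b::euclidean_space"
 shows "g \<in> L2 S \<longleftrightarrow> (\<forall>i\<in>Basis. sqint (lebesgue_on S) (\<lambda>x. g x \<bullet> i))"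
proof
 assume g: "g \<in> L2 S"
 show "\<forall>i\<in>Basis. sqint (lebesgue_on S) (\<lambda>x. g x \<bullet> i)"
 proof
  fix i :: 'b assume i: "i \<in> Basis"
  have gm: "g \<in> borel_measurable (lebesgue_on S)" using g by (simp add: L2_def)
  have m: "(\<lambda>x. g x \<bullet> i) \<in> borel_measurable (lebesgue_on S)" using gm by simp
  have "integrable (lebesgue_on S) (\<lambda>x. (g x \<bullet> i)\<^sup>2)"
  proof (rule integrable_bound)
   show "integrable (lebesgue_on S) (\<lambda>x. (norm (g x))\<^sup>2)" using g by (simp add: L2_def)
   show "AE x in lebesgue_on S. norm ((g x \<bullet> i)\<^sup>2) \<le> norm ((norm (g x))\<^sup>2)"
    using Basis_le_norm[OF i] by (intro AE_I2) (simp add: abs_le_square_iff[symmetric])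
  qed (use m in simp)
  thus "sqint (lebesgue_on S) (\<lambda>x. g x \<bullet> i)" using m by (simp add: sqint_def)
 qed
next
 assume a: "\<forall>i\<in>Basis. sqint (lebesgue_on S) (\<lambda>x. g x \<bullet> i)"
 hence "g \<in> borel_measurable (lebesgue_on S)"
  by (subst borel_measurable_euclidean_space) (auto simp: sqint_def)
 thus "g \<in> L2 S"
  unfolding L2_def norm_sq_sum using a by (auto simp: sqint_def)
qed

lemma L2_norm_vector:
 assumes "g \<in> L2 S"
 shows "(L2_norm S g)\<^sup>2 = (\<Sum>i\<in>Basis. (l2 (lebesgue_on S) (\<lambda>x. g x \<bullet> i))\<^sup>2)"
proof -
 have "(L2_norm S g)\<^sup>2 = (\<integral>x. (norm (g x))\<^sup>2 \<partial>lebesgue_on S)"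
  unfolding L2_norm_def by (simp add: integral_nonneg)
 also have "\<dots> = (\<Sum>i\<in>Basis. (\<integral>x. (g x \<bullet> i)\<^sup>2 \<partial>lebesgue_on S))"
  unfolding norm_sq_sum by (rule integral_sum)
   (use assms in \<open>auto simp: L2_vector_iff sqint_def\<close>)
 finally show ?thesis by (simp add: l2_sq)
qed

lemma test_lebesgue_on:
 assumes S: "open S" and \<phi>: "\<phi> \<in> \<D> S"
 shows "sqint (lebesgue_on S) \<phi>" "l2 (lebesgue_on S) \<phi> = l2 lborel \<phi>"
 using l2_lebesgue_on[OF borel_open[OF S] test_borel[OF \<phi>] test_zero_outside[OF \<phi>]] test_sqint[OF \<phi>] by auto

lemma weak_grad_unique:
 assumes S: "open S" and g: "g \<in> L2 S" "is_weak_grad S f g" and h: "h \<in> L2 S" "is_weak_grad S f h"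
 shows "AE x in lebesgue_on S. g x = h x"
proof -
 have "AE x in lebesgue_on S. g x \<bullet> i - h x \<bullet> i = 0" if i: "i \<in> Basis" for i
 proof (rule AE_eq_by_duality[OF S])
  have gi: "sqint (lebesgue_on S) (\<lambda>x. g x \<bullet> i)" and hi: "sqint (lebesgue_on S) (\<lambda>x. h x \<bullet> i)"
   using g(1) h(1) i by (auto simp: L2_vector_iff)
  show "sqint (lebesgue_on S) (\<lambda>x. g x \<bullet> i - h x \<bullet> i)" by (rule sqint_diff[OF gi hi])
  fix \<phi> assume \<phi>: "\<phi> \<in> \<D> S"
  have "(\<integral>x. (g x \<bullet> i - h x \<bullet> i) * \<phi> x \<partial>lebesgue_on S) = (\<integral>x. (g x \<bullet> i) * \<phi> x - (h x \<bullet> i) * \<phi> x \<partial>lebesgue_on S)"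
   by (simp add: left_diff_distrib)
  also have "\<dots> = (\<integral>x. (g x \<bullet> i) * \<phi> x \<partial>lebesgue_on S) - (\<integral>x. (h x \<bullet> i) * \<phi> x \<partial>lebesgue_on S)"
   by (intro integral_diff sqint_mult gi hi test_lebesgue_on(1)[OF S \<phi>])
  also have "\<dots> = 0" using g(2) h(2) \<phi> i unfolding is_weak_grad_def by (metis add.inverse_inverse diff_self)
  finally show "(\<integral>x. (g x \<bullet> i - h x \<bullet> i) * \<phi> x \<partial>lebesgue_on S) = 0" .
 qed
 hence "AE x in lebesgue_on S. \<forall>i\<in>Basis. g x \<bullet> i - h x \<bullet> i = 0" by (subst AE_finite_all) auto
 thus ?thesis by eventually_elim (auto intro: euclidean_eqI)
qed

lemma H1_weak_grad:
 assumes "f \<in> H1 S"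
 shows "weak_grad S f \<in> L2 S" "is_weak_grad S f (weak_grad S f)"
proof -
 have "\<exists>g. g \<in> L2 S \<and> is_weak_grad S f g" using assms by (auto simp: H1_def)
 from someI_ex[OF this] show "weak_grad S f \<in> L2 S" "is_weak_grad S f (weak_grad S f)"
  unfolding weak_grad_def by auto
qed

lemma H1_sqint:
 assumes "f \<in> H1 S"
 shows "sqint (lebesgue_on S) f" "i \<in> Basis \<Longrightarrow> sqint (lebesgue_on S) (\<lambda>x. weak_grad S f x \<bullet> i)"
 using assms H1_weak_grad(1)[OF assms] by (auto simp: H1_def L2_real_iff L2_vector_iff)

lemma H1_norm_sq:
 assumes "f \<in> H1 S"
 shows "(H1_norm S f)\<^sup>2 = (l2 (lebesgue_on S) f)\<^sup>2 + (\<Sum>i\<in>Basis. (l2 (lebesgue_on S) (\<lambda>x. weak_grad S f x \<bullet> i))\<^sup>2)"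
 unfolding H1_norm_def L2_norm_vector[OF H1_weak_grad(1)[OF assms], symmetric] L2_norm_real by simp

lemma H1_norm_nonneg: "H1_norm S f \<ge> 0"
 unfolding H1_norm_def by simp

lemma H1_norm_ge:
 assumes "f \<in> H1 S"
 shows "l2 (lebesgue_on S) f \<le> H1_norm S f"
  and "i \<in> Basis \<Longrightarrow> l2 (lebesgue_on S) (\<lambda>x. weak_grad S f x \<bullet> i) \<le> H1_norm S f"
proof -
 show "l2 (lebesgue_on S) f \<le> H1_norm S f"
  by (rule power2_le_imp_le[OF _ H1_norm_nonneg]) (simp add: H1_norm_sq[OF assms] sum_nonneg)
 show "l2 (lebesgue_on S) (\<lambda>x. weak_grad S f x \<bullet> i) \<le> H1_norm S f" if i: "i \<in> Basis"
 proof (rule power2_le_imp_le[OF _ H1_norm_nonneg])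
  have "(l2 (lebesgue_on S) (\<lambda>x. weak_grad S f x \<bullet> i))\<^sup>2 \<le> (\<Sum>i\<in>Basis. (l2 (lebesgue_on S) (\<lambda>x. weak_grad S f x \<bullet> i))\<^sup>2)"
   by (rule member_le_sum[OF i]) auto
  thus "(l2 (lebesgue_on S) (\<lambda>x. weak_grad S f x \<bullet> i))\<^sup>2 \<le> (H1_norm S f)\<^sup>2"
   by (simp add: H1_norm_sq[OF assms] add_increasing)
 qed
qed

text \<open>Any square integrable weak gradient at hand may replace the chosen one: by uniqueness
  they agree almost everywhere, and the norm is an integral.\<close>

lemma H1_I:
 assumes S: "open S" and f: "sqint (lebesgue_on S) f" and g: "g \<in> L2 S" "is_weak_grad S f g"
 shows "f \<in> H1 S" "AE x in lebesgue_on S. weak_grad S f x = g x"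
  and "(H1_norm S f)\<^sup>2 = (l2 (lebesgue_on S) f)\<^sup>2 + (\<Sum>i\<in>Basis. (l2 (lebesgue_on S) (\<lambda>x. g x \<bullet> i))\<^sup>2)"
proof -
 show H: "f \<in> H1 S" using f g by (auto simp: H1_def L2_real_iff)
 show ae: "AE x in lebesgue_on S. weak_grad S f x = g x"
  by (rule weak_grad_unique[OF S H1_weak_grad[OF H] g])
 have "l2 (lebesgue_on S) (\<lambda>x. weak_grad S f x \<bullet> i) = l2 (lebesgue_on S) (\<lambda>x. g x \<bullet> i)" if i: "i \<in> Basis" for i
 proof (rule l2_cong_AE(1))
  show "AE x in lebesgue_on S. weak_grad S f x \<bullet> i = g x \<bullet> i" using ae by eventually_elim simp
  show "(\<lambda>x. weak_grad S f x \<bullet> i) \<in> borel_measurable (lebesgue_on S)"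
   by (rule sqint_measurable[OF H1_sqint(2)[OF H i]])
  show "(\<lambda>x. g x \<bullet> i) \<in> borel_measurable (lebesgue_on S)"
   using g(1) i by (auto simp: L2_vector_iff sqint_def)
 qed
 thus "(H1_norm S f)\<^sup>2 = (l2 (lebesgue_on S) f)\<^sup>2 + (\<Sum>i\<in>Basis. (l2 (lebesgue_on S) (\<lambda>x. g x \<bullet> i))\<^sup>2)"
  unfolding H1_norm_sq[OF H] by simp
qed

lemma H1_linear:
 fixes f h :: "'a::euclidean_space \<Rightarrow> real"
 assumes S: "open S" and f: "f \<in> H1 S" and h: "h \<in> H1 S"
 shows "(\<lambda>x. f x + c * h x) \<in> H1 S"
  and "AE x in lebesgue_on S. weak_grad S (\<lambda>x. f x + c * h x) x = weak_grad S f x + c *\<^sub>R weak_grad S h x"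
proof -
 note fi = H1_sqint[OF f] and hi = H1_sqint[OF h]
 have sq: "sqint (lebesgue_on S) (\<lambda>x. f x + c * h x)"
  by (intro sqint_add sqint_cmult fi hi)
 have g: "(\<lambda>x. weak_grad S f x + c *\<^sub>R weak_grad S h x) \<in> L2 S"
  unfolding L2_vector_iff using fi(2) hi(2) by (auto simp: inner_add_left intro!: sqint_add sqint_cmult)
 have wg: "is_weak_grad S (\<lambda>x. f x + c * h x) (\<lambda>x. weak_grad S f x + c *\<^sub>R weak_grad S h x)"
  unfolding is_weak_grad_def
 proof (intro ballI)
  fix \<phi> :: "'a \<Rightarrow> real" and i :: 'a assume \<phi>: "\<phi> \<in> \<D> S" and i: "i \<in> Basis"
  note t = test_lebesgue_on(1)[OF S \<phi>] test_lebesgue_on(1)[OF S test_partial_deriv[OF \<phi> i]]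
  have "(\<integral>x. (f x + c * h x) * pd i \<phi> x \<partial>lebesgue_on S)
    = (\<integral>x. f x * pd i \<phi> x + c * (h x * pd i \<phi> x) \<partial>lebesgue_on S)"
   by (simp add: algebra_simps)
  also have "\<dots> = (\<integral>x. f x * pd i \<phi> x \<partial>lebesgue_on S) + c * (\<integral>x. h x * pd i \<phi> x \<partial>lebesgue_on S)"
   using sqint_mult[OF fi(1) t(2)] sqint_mult[OF hi(1) t(2)] by simp
  also have "\<dots> = - ((\<integral>x. (weak_grad S f x \<bullet> i) * \<phi> x \<partial>lebesgue_on S) + c * (\<integral>x. (weak_grad S h x \<bullet> i) * \<phi> x \<partial>lebesgue_on S))"
   using H1_weak_grad(2)[OF f] H1_weak_grad(2)[OF h] \<phi> i unfolding is_weak_grad_def by simp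
  also have "(\<integral>x. (weak_grad S f x \<bullet> i) * \<phi> x \<partial>lebesgue_on S) + c * (\<integral>x. (weak_grad S h x \<bullet> i) * \<phi> x \<partial>lebesgue_on S)
    = (\<integral>x. (weak_grad S f x \<bullet> i) * \<phi> x + c * ((weak_grad S h x \<bullet> i) * \<phi> x) \<partial>lebesgue_on S)"
   using sqint_mult[OF fi(2)[OF i] t(1)] sqint_mult[OF hi(2)[OF i] t(1)] by simp
  also have "\<dots> = (\<integral>x. ((weak_grad S f x + c *\<^sub>R weak_grad S h x) \<bullet> i) * \<phi> x \<partial>lebesgue_on S)"
   by (simp add: inner_add_left algebra_simps)
  finally show "(\<integral>x. (f x + c * h x) * pd i \<phi> x \<partial>lebesgue_on S)
    = - (\<integral>x. ((weak_grad S f x + c *\<^sub>R weak_grad S h x) \<bullet> i) * \<phi> x \<partial>lebesgue_on S)" .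
 qed
 show "(\<lambda>x. f x + c * h x) \<in> H1 S"
  "AE x in lebesgue_on S. weak_grad S (\<lambda>x. f x + c * h x) x = weak_grad S f x + c *\<^sub>R weak_grad S h x"
  using H1_I[OF S sq g wg] by auto
qed

lemma H1_diff:
 assumes "open S" "f \<in> H1 S" "h \<in> H1 S"
 shows "(\<lambda>x. f x - h x) \<in> H1 S"
  and "AE x in lebesgue_on S. weak_grad S (\<lambda>x. f x - h x) x = weak_grad S f x - weak_grad S h x"
 using H1_linear[OF assms, of "-1"] by simp_all

lemma test_H1:
 fixes \<phi> :: "'a::euclidean_space \<Rightarrow> real"
 assumes S: "open S" and \<phi>: "\<phi> \<in> \<D> S"
 shows "\<phi> \<in> H1 S" "AE x in lebesgue_on S. weak_grad S \<phi> x = (\<Sum>i\<in>Basis. pd i \<phi> x *\<^sub>R i)"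
  and "(H1_norm S \<phi>)\<^sup>2 = (l2 lborel \<phi>)\<^sup>2 + (\<Sum>i\<in>Basis. (l2 lborel (pd i \<phi>))\<^sup>2)"
proof -
 let ?g = "\<lambda>x. \<Sum>i\<in>Basis. pd i \<phi> x *\<^sub>R i"
 have gi: "?g x \<bullet> i = pd i \<phi> x" if "i \<in> Basis" for x i
  using that by (rule inner_sum_left_Basis)
 have g: "?g \<in> L2 S"
  unfolding L2_vector_iff using gi test_lebesgue_on(1)[OF S test_partial_deriv[OF \<phi>]] by simp
 have Sb: "S \<in> sets borel" using S by simp
 have wg: "is_weak_grad S \<phi> ?g"
  unfolding is_weak_grad_def
 proof (intro ballI)
  fix \<psi> :: "'a \<Rightarrow> real" and i :: 'a assume \<psi>: "\<psi> \<in> \<D> S" and i: "i \<in> Basis"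
  note [measurable] = test_borel[OF \<phi>] test_borel[OF \<psi>] test_borel[OF test_partial_deriv[OF \<phi> i]] test_borel[OF test_partial_deriv[OF \<psi> i]]
  have "(\<integral>x. \<phi> x * pd i \<psi> x \<partial>lebesgue_on S) = (LBINT x. \<phi> x * pd i \<psi> x)"
   by (rule integral_lebesgue_on_supported(1)[OF Sb]) (use test_zero_outside[OF \<phi>] in auto)
  also have "\<dots> = - (LBINT x. pd i \<phi> x * \<psi> x)"
   using test_integral_by_parts[OF \<phi> test_smooth[OF \<psi>] i] by simp
  also have "(LBINT x. pd i \<phi> x * \<psi> x) = (\<integral>x. pd i \<phi> x * \<psi> x \<partial>lebesgue_on S)"
   by (rule integral_lebesgue_on_supported(1)[OF Sb, symmetric]) (use test_zero_outside[OF \<psi>] in auto)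
  finally show "(\<integral>x. \<phi> x * pd i \<psi> x \<partial>lebesgue_on S) = - (\<integral>x. (?g x \<bullet> i) * \<psi> x \<partial>lebesgue_on S)"
   by (simp add: gi[OF i])
 qed
 note H = H1_I[OF S test_lebesgue_on(1)[OF S \<phi>] g wg]
 show "\<phi> \<in> H1 S" "AE x in lebesgue_on S. weak_grad S \<phi> x = ?g x" by (rule H)+
 show "(H1_norm S \<phi>)\<^sup>2 = (l2 lborel \<phi>)\<^sup>2 + (\<Sum>i\<in>Basis. (l2 lborel (pd i \<phi>))\<^sup>2)"
  unfolding H(3) test_lebesgue_on(2)[OF S \<phi>]
  using gi test_lebesgue_on(2)[OF S test_partial_deriv[OF \<phi>]] by simp
qed

lemma H1_norm_scale:
 assumes S: "open S" and f: "f \<in> H1 S"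
 shows "(\<lambda>x. c * f x) \<in> H1 S" "H1_norm S (\<lambda>x. c * f x) = \<bar>c\<bar> * H1_norm S f"
proof -
 have z: "(\<lambda>x. 0) \<in> H1 S" by (rule test_H1(1)[OF S test_zero])
 show H: "(\<lambda>x. c * f x) \<in> H1 S" using H1_linear(1)[OF S z f, of c] by simp
 have wz: "AE x in lebesgue_on S. weak_grad S (\<lambda>x. 0) x = 0"
  using test_H1(2)[OF S test_zero[of S]] by (simp add: partial_deriv_const)
 have ae: "AE x in lebesgue_on S. weak_grad S (\<lambda>x. c * f x) x = c *\<^sub>R weak_grad S f x"
  using H1_linear(2)[OF S z f, of c] wz by eventually_elim simp
 have "l2 (lebesgue_on S) (\<lambda>x. weak_grad S (\<lambda>x. c * f x) x \<bullet> i) = \<bar>c\<bar> * l2 (lebesgue_on S) (\<lambda>x. weak_grad S f x \<bullet> i)"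
  if i: "i \<in> Basis" for i
 proof -
  have "l2 (lebesgue_on S) (\<lambda>x. weak_grad S (\<lambda>x. c * f x) x \<bullet> i) = l2 (lebesgue_on S) (\<lambda>x. c * (weak_grad S f x \<bullet> i))"
  proof (rule l2_cong_AE(1))
   show "AE x in lebesgue_on S. weak_grad S (\<lambda>x. c * f x) x \<bullet> i = c * (weak_grad S f x \<bullet> i)"
    using ae by eventually_elim simp
  qed (use H1_sqint(2)[OF H i] H1_sqint(2)[OF f i] in \<open>auto simp: sqint_def\<close>)
  thus ?thesis by (simp add: l2_cmult)
 qed
 hence "(H1_norm S (\<lambda>x. c * f x))\<^sup>2 = (\<bar>c\<bar> * H1_norm S f)\<^sup>2"
  unfolding H1_norm_sq[OF H] power_mult_distrib H1_norm_sq[OF f] l2_cmult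
  by (simp add: power_mult_distrib sum_distrib_left distrib_left)
 thus "H1_norm S (\<lambda>x. c * f x) = \<bar>c\<bar> * H1_norm S f"
  by (rule power2_eq_imp_eq) (auto simp: H1_norm_nonneg)
qed

section \<open>The space \<open>H10\<close> and bounded functionals on it\<close>

lemma H10_H1: "f \<in> H10 S \<Longrightarrow> f \<in> H1 S"
 unfolding H10_def by simp

lemma test_H10:
 assumes S: "open S" and \<phi>: "\<phi> \<in> \<D> S"
 shows "\<phi> \<in> H10 S"
proof -
 have "H1_norm S (\<lambda>x. \<phi> x - \<phi> x) = 0"
  using H1_norm_scale(2)[OF S test_H1(1)[OF S \<phi>], of 0] by simp
 thus ?thesis unfolding H10_def using test_H1(1)[OF S \<phi>] \<phi> by (auto intro!: exI[of _ "\<lambda>_. \<phi>"])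
qed

lemma H10_scale:
 assumes S: "open S" and f: "f \<in> H10 S"
 shows "(\<lambda>x. c * f x) \<in> H10 S"
proof -
 obtain \<phi> where \<phi>: "\<And>k. \<phi> k \<in> \<D> S" "(\<lambda>k::nat. H1_norm S (\<lambda>x. \<phi> k x - f x)) \<longlonglongrightarrow> 0"
  using f unfolding H10_def by blast
 have "H1_norm S (\<lambda>x. c * \<phi> k x - c * f x) = \<bar>c\<bar> * H1_norm S (\<lambda>x. \<phi> k x - f x)" for k
  using H1_norm_scale(2)[OF S H1_diff(1)[OF S test_H1(1)[OF S \<phi>(1)] H10_H1[OF f]], of c k]
  by (simp add: right_diff_distrib)
 hence "(\<lambda>k::nat. H1_norm S (\<lambda>x. c * \<phi> k x - c * f x)) \<longlonglongrightarrow> 0"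
  using tendsto_mult_right_zero[OF \<phi>(2), of "\<bar>c\<bar>"] by simp
 thus ?thesis
  unfolding H10_def using H1_norm_scale(1)[OF S H10_H1[OF f]] test_mult2[OF \<phi>(1) smooth_const]
  by (auto intro!: exI[of _ "\<lambda>k x. c * \<phi> k x"])
qed

text \<open>\<open>Hm1_norm\<close> is a supremum of reals, which can be used only for a nonempty
  bounded set; this lemma and \<open>H10_unit_nonempty\<close> provide the two conditions.\<close>

lemma Hm1_bdd:
 assumes "F \<in> Hm1 S"
 shows "bdd_above ((\<lambda>f. \<bar>F f\<bar>) ` {f \<in> H10 S. H1_norm S f \<le> 1})"
proof -
 obtain K where K: "\<And>f. f \<in> H10 S \<Longrightarrow> \<bar>F f\<bar> \<le> K * H1_norm S f" using assms unfolding Hm1_def by blast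
 have "\<bar>F f\<bar> \<le> \<bar>K\<bar>" if "f \<in> H10 S" "H1_norm S f \<le> 1" for f
 proof -
  have "\<bar>F f\<bar> \<le> \<bar>K\<bar> * H1_norm S f"
   using K[OF that(1)] H1_norm_nonneg[of S f] by (meson abs_ge_self mult_right_mono order_trans)
  also have "\<dots> \<le> \<bar>K\<bar> * 1" using that by (intro mult_left_mono) auto
  finally show ?thesis by simp
 qed
 thus ?thesis by (intro bdd_aboveI[of _ "\<bar>K\<bar>"]) auto
qed

lemma H10_unit_nonempty:
 assumes S: "open S"
 shows "(\<lambda>x. 0) \<in> {f \<in> H10 S. H1_norm S f \<le> 1}"
 using test_H10[OF S test_zero] H1_norm_scale(2)[OF S test_H1(1)[OF S test_zero], of 0] by simp

lemma Hm1_norm_le: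
 assumes S: "open S" and K: "\<And>f. f \<in> H10 S \<Longrightarrow> H1_norm S f \<le> 1 \<Longrightarrow> \<bar>F f\<bar> \<le> K"
 shows "Hm1_norm S F \<le> K"
 unfolding Hm1_norm_def by (rule cSUP_least) (use H10_unit_nonempty[OF S] K in auto)

lemma Hm1_norm_nonneg:
 assumes S: "open S" and F: "F \<in> Hm1 S"
 shows "Hm1_norm S F \<ge> 0"
 unfolding Hm1_norm_def by (rule cSUP_upper2[OF _ H10_unit_nonempty[OF S]]) (use Hm1_bdd[OF F] in auto)

lemma Hm1_le:
 assumes S: "open S" and F: "F \<in> Hm1 S" and f: "f \<in> H10 S"
 shows "\<bar>F f\<bar> \<le> Hm1_norm S F * H1_norm S f"
proof (cases "H1_norm S f = 0")
 \<comment> \<open>Nothing can be scaled to norm 1 here, but boundedness of the functional already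
   forces the value 0.\<close>
 case True
 obtain K where "\<bar>F f\<bar> \<le> K * H1_norm S f" using F f unfolding Hm1_def by blast
 thus ?thesis using True by simp
next
 case False
 define c where "c = 1 / H1_norm S f"
 have c: "c > 0" unfolding c_def using False H1_norm_nonneg[of S f] by simp
 have "(\<lambda>x. c * f x) \<in> H10 S" by (rule H10_scale[OF S f])
 moreover have "H1_norm S (\<lambda>x. c * f x) = 1"
  using H1_norm_scale(2)[OF S H10_H1[OF f], of c] c False by (simp add: c_def H1_norm_nonneg)
 ultimately have "\<bar>F (\<lambda>x. c * f x)\<bar> \<le> Hm1_norm S F"
  unfolding Hm1_norm_def by (intro cSUP_upper Hm1_bdd[OF F]) auto
 moreover have "F (\<lambda>x. c * f x) = c * F f" using F f unfolding Hm1_def by blast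
 ultimately have "c * \<bar>F f\<bar> \<le> Hm1_norm S F" using c by (simp add: abs_mult)
 thus ?thesis using False H1_norm_nonneg[of S f] by (simp add: c_def field_simps)
qed

lemma Hm1_linear:
 assumes F: "F \<in> Hm1 S" and G: "G \<in> Hm1 S"
 shows "(\<lambda>v. F v + c * G v) \<in> Hm1 S"
proof -
 obtain K where K: "\<And>f. f \<in> H10 S \<Longrightarrow> \<bar>F f\<bar> \<le> K * H1_norm S f" using F unfolding Hm1_def by blast
 obtain L where L: "\<And>f. f \<in> H10 S \<Longrightarrow> \<bar>G f\<bar> \<le> L * H1_norm S f" using G unfolding Hm1_def by blast
 have "\<bar>F f + c * G f\<bar> \<le> (K + \<bar>c\<bar> * L) * H1_norm S f" if f: "f \<in> H10 S" for f
 proof -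
  have "\<bar>F f + c * G f\<bar> \<le> \<bar>F f\<bar> + \<bar>c\<bar> * \<bar>G f\<bar>" by (metis abs_mult abs_triangle_ineq)
  also have "\<dots> \<le> K * H1_norm S f + \<bar>c\<bar> * (L * H1_norm S f)" by (intro add_mono mult_left_mono K L f) auto
  finally show ?thesis by (simp add: algebra_simps)
 qed
 hence "\<exists>K. \<forall>f\<in>H10 S. \<bar>F f + c * G f\<bar> \<le> K * H1_norm S f" by blast
 thus ?thesis using F G unfolding Hm1_def by (auto simp: algebra_simps)
qed

lemma Hm1_diff: "F \<in> Hm1 S \<Longrightarrow> G \<in> Hm1 S \<Longrightarrow> (\<lambda>v. F v - G v) \<in> Hm1 S"
 using Hm1_linear[of F S G "-1"] by simp

lemma Hm1_norm_triangle:
 assumes S: "open S" and F: "F \<in> Hm1 S" and G: "G \<in> Hm1 S"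
 shows "Hm1_norm S (\<lambda>v. F v - G v) \<le> Hm1_norm S F + Hm1_norm S G"
proof (rule Hm1_norm_le[OF S])
 fix f assume f: "f \<in> H10 S" "H1_norm S f \<le> 1"
 have "\<bar>F f\<bar> \<le> Hm1_norm S F * 1" "\<bar>G f\<bar> \<le> Hm1_norm S G * 1"
  using Hm1_le[OF S F f(1)] Hm1_le[OF S G f(1)] f(2) Hm1_norm_nonneg[OF S F] Hm1_norm_nonneg[OF S G]
  by (meson mult_left_mono order_trans)+
 thus "\<bar>F f - G f\<bar> \<le> Hm1_norm S F + Hm1_norm S G" by linarith
qed

lemma weak_grad_inner:
 assumes w: "w \<in> H1 S" and f: "f \<in> H1 S"
 shows "integrable (lebesgue_on S) (\<lambda>x. weak_grad S w x \<bullet> weak_grad S f x)"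
  and "\<bar>\<integral>x. weak_grad S w x \<bullet> weak_grad S f x \<partial>lebesgue_on S\<bar> \<le> H1_norm S w * H1_norm S f"
proof -
 have L: "weak_grad S w \<in> L2 S" "weak_grad S f \<in> L2 S" by (rule H1_weak_grad(1)[OF w] H1_weak_grad(1)[OF f])+
 hence sq: "sqint (lebesgue_on S) (\<lambda>x. norm (weak_grad S w x))" "sqint (lebesgue_on S) (\<lambda>x. norm (weak_grad S f x))"
  by (auto simp: L2_def sqint_def)
 show i: "integrable (lebesgue_on S) (\<lambda>x. weak_grad S w x \<bullet> weak_grad S f x)"
  by (rule integrable_bound[OF sqint_mult[OF sq]]) (use L in \<open>auto simp: L2_def Cauchy_Schwarz_ineq2\<close>)
 have "\<bar>\<integral>x. weak_grad S w x \<bullet> weak_grad S f x \<partial>lebesgue_on S\<bar> \<le> (\<integral>x. norm (weak_grad S w x) * norm (weak_grad S f x) \<partial>lebesgue_on S)"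
  by (rule integral_abs_bound_integral[OF i sqint_mult[OF sq] Cauchy_Schwarz_ineq2])
 also have "\<dots> \<le> L2_norm S (weak_grad S w) * L2_norm S (weak_grad S f)"
  using Cauchy_Schwarz_l2[OF sq] by (simp add: l2_def L2_norm_def)
 also have "\<dots> \<le> H1_norm S w * H1_norm S f"
  by (rule mult_mono) (simp_all add: H1_norm_def L2_norm_def integral_nonneg real_le_rsqrt)
 finally show "\<bar>\<integral>x. weak_grad S w x \<bullet> weak_grad S f x \<partial>lebesgue_on S\<bar> \<le> H1_norm S w * H1_norm S f" .
qed

lemma weak_laplacian_linear:
 assumes S: "open S" and w: "w \<in> H1 S" and f: "f \<in> H1 S" and h: "h \<in> H1 S"
 shows "weak_laplacian S w (\<lambda>x. f x + c * h x) = weak_laplacian S w f + c * weak_laplacian S w h"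
  and "weak_laplacian S (\<lambda>x. f x - h x) w = weak_laplacian S f w - weak_laplacian S h w"
proof -
 note i = weak_grad_inner(1)
 have "(\<integral>x. weak_grad S w x \<bullet> weak_grad S (\<lambda>x. f x + c * h x) x \<partial>lebesgue_on S)
   = (\<integral>x. weak_grad S w x \<bullet> weak_grad S f x + c * (weak_grad S w x \<bullet> weak_grad S h x) \<partial>lebesgue_on S)"
 proof (rule integral_cong_AE)
  show "AE x in lebesgue_on S. weak_grad S w x \<bullet> weak_grad S (\<lambda>x. f x + c * h x) x
    = weak_grad S w x \<bullet> weak_grad S f x + c * (weak_grad S w x \<bullet> weak_grad S h x)"
   using H1_linear(2)[OF S f h, of c] by eventually_elim (simp add: inner_add_right)
 qed (use i[OF w f] i[OF w h] i[OF w H1_linear(1)[OF S f h]] in auto)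
 thus "weak_laplacian S w (\<lambda>x. f x + c * h x) = weak_laplacian S w f + c * weak_laplacian S w h"
  using i[OF w f] i[OF w h] by (simp add: weak_laplacian_def)
 have "(\<integral>x. weak_grad S (\<lambda>x. f x - h x) x \<bullet> weak_grad S w x \<partial>lebesgue_on S)
   = (\<integral>x. weak_grad S f x \<bullet> weak_grad S w x - weak_grad S h x \<bullet> weak_grad S w x \<partial>lebesgue_on S)"
 proof (rule integral_cong_AE)
  show "AE x in lebesgue_on S. weak_grad S (\<lambda>x. f x - h x) x \<bullet> weak_grad S w x
   = weak_grad S f x \<bullet> weak_grad S w x - weak_grad S h x \<bullet> weak_grad S w x"
   using H1_diff(2)[OF S f h] by eventually_elim (simp add: inner_diff_left)
 qed (use i[OF f w] i[OF h w] i[OF H1_diff(1)[OF S f h] w] in auto)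
 thus "weak_laplacian S (\<lambda>x. f x - h x) w = weak_laplacian S f w - weak_laplacian S h w"
  using i[OF f w] i[OF h w] by (simp add: weak_laplacian_def)
qed

lemma weak_laplacian_Hm1:
 assumes S: "open S" and w: "w \<in> H1 S"
 shows "weak_laplacian S w \<in> Hm1 S" "Hm1_norm S (weak_laplacian S w) \<le> H1_norm S w"
proof -
 have bd: "\<bar>weak_laplacian S w f\<bar> \<le> H1_norm S w * H1_norm S f" if "f \<in> H1 S" for f
  using weak_grad_inner(2)[OF w that] by (simp add: weak_laplacian_def)
 have z: "(\<lambda>x. 0) \<in> H1 S" by (rule test_H1(1)[OF S test_zero])
 have z0: "weak_laplacian S w (\<lambda>x. 0) = 0" using bd[OF z] H1_norm_scale(2)[OF S z, of 0] by simp
 note lin = weak_laplacian_linear(1)[OF S w]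
 show "weak_laplacian S w \<in> Hm1 S"
  unfolding Hm1_def
 proof (intro CollectI conjI ballI allI)
  show "weak_laplacian S w (\<lambda>x. f x + g x) = weak_laplacian S w f + weak_laplacian S w g" if "f \<in> H10 S" "g \<in> H10 S" for f g
   using lin[of f g 1] that[THEN H10_H1] by simp
  show "weak_laplacian S w (\<lambda>x. c * f x) = c * weak_laplacian S w f" if "f \<in> H10 S" for f c
   using lin[of "\<lambda>x. 0" f c] z z0 H10_H1[OF that] by simp
  show "\<exists>K. \<forall>f\<in>H10 S. \<bar>weak_laplacian S w f\<bar> \<le> K * H1_norm S f"
   using bd H10_H1 by blast
 qed
 show "Hm1_norm S (weak_laplacian S w) \<le> H1_norm S w"
 proof (rule Hm1_norm_le[OF S])
  fix f assume f: "f \<in> H10 S" "H1_norm S f \<le> 1"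
  show "\<bar>weak_laplacian S w f\<bar> \<le> H1_norm S w"
   using bd[OF H10_H1[OF f(1)]] mult_left_mono[OF f(2) H1_norm_nonneg[of S w]] by simp
 qed
qed

section \<open>Jointly measurable representatives\<close>

text \<open>Removes the completion: an equivalent simple function for \<open>lborel\<close> is
  needed before a Borel function of two variables can be built from it.\<close>

lemma simple_function_representative:
 assumes J: "J \<in> sets borel" and s: "simple_function (lebesgue_on J) s"
 obtains s' where "simple_function (lborel :: real measure) s'" "AE t in lborel. t \<in> J \<longrightarrow> s t = s' t"
proof -
 \<comment> \<open>The value type carries no structure, so \<open>undefined\<close> serves as the
   one additional value outside \<open>J\<close>; the range stays finite.\<close>
 define s0 where "s0 t = (if t \<in> J then s t else undefined)" for t
 have "simple_function lebesgue s0"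
  unfolding simple_function_def
 proof (intro conjI ballI)
  have "finite (s ` J)" using s by (simp add: simple_function_def)
  moreover have "s0 ` space lebesgue \<subseteq> s ` J \<union> {undefined}" by (auto simp: s0_def)
  ultimately show "finite (s0 ` space lebesgue)" by (meson finite.simps finite_UnI finite_subset)
  fix y
  have 1: "s -` {y} \<inter> J \<in> sets lebesgue"
  proof (cases "y \<in> s ` J")
   case True
   hence "s -` {y} \<inter> J \<in> sets (lebesgue_on J)" using s by (auto simp: simple_function_def)
   then obtain x where "x \<in> sets lebesgue" "s -` {y} \<inter> J = J \<inter> x" by (auto simp: sets_restrict_space)
   moreover have "J \<in> sets lebesgue" using J by simp
   ultimately show ?thesis by (metis sets.Int)
  next
   case False
   hence "s -` {y} \<inter> J = {}" by auto
   thus ?thesis by simp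
  qed
  have "s0 -` {y} \<inter> space lebesgue = (s -` {y} \<inter> J) \<union> (if y = undefined then - J else {})"
   by (auto simp: s0_def split: if_splits)
  moreover have "- J \<in> sets lebesgue" using J by simp
  ultimately show "s0 -` {y} \<inter> space lebesgue \<in> sets lebesgue" using 1 by auto
 qed
 then obtain s' where s': "simple_function lborel s'" "AE t in lborel. s0 t = s' t"
  using completion_ex_simple_function by blast
 from s'(2) have "AE t in lborel. t \<in> J \<longrightarrow> s t = s' t" by eventually_elim (auto simp: s0_def)
 thus ?thesis using that s'(1) by blast
qed

lemma simple_function_case_borel:
 fixes G :: "'b \<Rightarrow> 'a::euclidean_space \<Rightarrow> real"
 assumes s: "simple_function lborel (s :: real \<Rightarrow> 'b)" and G[measurable]: "\<And>f. G f \<in> borel_measurable borel"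
 shows "(\<lambda>p. G (s (fst p)) (snd p)) \<in> borel_measurable (borel \<Otimes>\<^sub>M borel)"
proof -
 have fin: "finite (range s)" using s by (simp add: simple_function_def)
 have [measurable]: "s -` {f} \<in> sets borel" for f
 proof (cases "f \<in> range s")
  case True
  thus ?thesis using s by (auto simp: simple_function_def)
 next
  case False
  hence "s -` {f} = {}" by auto
  thus ?thesis by simp
 qed
 have "G (s (fst p)) (snd p) = (\<Sum>f\<in>range s. indicator (s -` {f}) (fst p) * G f (snd p))" for p
 proof -
  have "(\<Sum>f\<in>range s. indicator (s -` {f}) (fst p) * G f (snd p)) = (\<Sum>f\<in>range s. if f = s (fst p) then G f (snd p) else 0)"
   by (rule sum.cong) (auto simp: indicator_def)
  thus ?thesis using fin by simp
 qed
 hence "(\<lambda>p. G (s (fst p)) (snd p)) = (\<lambda>p. \<Sum>f\<in>range s. indicator (s -` {f}) (fst p) * G f (snd p))" by blast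
 thus ?thesis by simp
qed

lemma l2_diff_triangle:
 assumes "sqint M f" "sqint M g" "sqint M h"
 shows "\<bar>l2 M (\<lambda>x. f x - g x) - l2 M (\<lambda>x. f x - h x)\<bar> \<le> l2 M (\<lambda>x. g x - h x)"
proof -
 have "l2 M (\<lambda>x. f x - g x) \<le> l2 M (\<lambda>x. f x - h x) + l2 M (\<lambda>x. g x - h x)"
  using l2_triangle_diff[OF sqint_diff[OF assms(1,3)] sqint_diff[OF assms(2,3)]] by simp
 moreover have "l2 M (\<lambda>x. f x - h x) \<le> l2 M (\<lambda>x. f x - g x) + l2 M (\<lambda>x. g x - h x)"
  using l2_triangle[OF sqint_diff[OF assms(1,2)] sqint_diff[OF assms(2,3)]] by simp
 ultimately show ?thesis by linarith
qed

text \<open>A curve of classes of functions carries no joint measurability; it comes from the simple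
  approximations, whose representatives are finite sums of products. They converge in L2 of space
  for almost every time, but a pointwise limit needs one subsequence valid for almost all times. It
  is chosen so that the time integrals of the truncated distances are summable: then the distances
  are summable for almost every \<open>t\<close>, and the approximations converge for almost every
  \<open>x\<close>.\<close>

lemma joint_representative:
 fixes \<Phi> :: "'b \<Rightarrow> 'a::euclidean_space \<Rightarrow> real" and y :: "real \<Rightarrow> 'a \<Rightarrow> real"
 assumes S: "S \<in> sets borel" and J: "J \<in> sets borel" "emeasure lborel J < \<infinity>"
  and s: "\<And>k::nat. simple_function (lebesgue_on J) (s k)"
  and sq: "\<And>k t. t \<in> J \<Longrightarrow> sqint (lebesgue_on S) (\<Phi> (s k t))"
  and y: "AE t in lebesgue_on J. sqint (lebesgue_on S) (y t)"
  and lim: "AE t in lebesgue_on J. (\<lambda>k. l2 (lebesgue_on S) (\<lambda>x. \<Phi> (s k t) x - y t x)) \<longlonglongrightarrow> 0"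
 obtains Y where "Y \<in> borel_measurable borel" "\<And>p. p \<notin> J \<times> S \<Longrightarrow> Y p = 0"
  "AE t in lborel. t \<in> J \<longrightarrow> (AE x in lebesgue_on S. y t x = Y (t, x))"
proof -
 note [measurable] = S J(1)
 have "\<forall>k. \<exists>s'. simple_function lborel s' \<and> (AE t in lborel. t \<in> J \<longrightarrow> s k t = s' t)"
  using simple_function_representative[OF J(1) s] by metis
 then obtain s' where s': "\<And>k. simple_function lborel (s' k)" "\<And>k. AE t in lborel. t \<in> J \<longrightarrow> s k t = s' k t" by metis
 define good where "good f g \<longleftrightarrow> sqint lborel g \<and> (\<forall>x. x \<notin> S \<longrightarrow> g x = 0) \<and> (AE x in lebesgue_on S. \<Phi> f x = g x)" for f g
 \<comment> \<open>Values of the modified simple functions at exceptional times need not be square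
   integrable on \<open>S\<close>; these get the default 0.\<close>
 define G where "G f = (if \<exists>g. good f g then SOME g. good f g else (\<lambda>_. 0))" for f
 have Ggood: "good f (G f)" if "sqint (lebesgue_on S) (\<Phi> f)" for f
 proof -
  have "\<exists>g. good f g" unfolding good_def using sqint_representative[OF S that] by metis
  thus ?thesis unfolding G_def by (simp add: someI_ex)
 qed
 have Gsq: "sqint lborel (G f)" for f
 proof (cases "\<exists>g. good f g")
  case True
  hence "good f (G f)" unfolding G_def by (simp add: someI_ex)
  thus ?thesis by (simp add: good_def)
 next
  case False
  hence "G f = (\<lambda>_. 0)" unfolding G_def by (simp only: if_False)
  thus ?thesis by (simp add: sqint_zero)
 qed
 have Gm[measurable]: "G f \<in> borel_measurable borel" for f using Gsq[of f] by (simp add: sqint_def)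
 define Yk where "Yk k p = G (s' k (fst p)) (snd p)" for k and p :: "real \<times> 'a"
 have Ykm': "Yk k \<in> borel_measurable (borel \<Otimes>\<^sub>M borel)" for k
  unfolding Yk_def[abs_def] by (rule simple_function_case_borel[OF s'(1) Gm])
 note [measurable] = Ykm'
 have Ysq: "sqint lborel (\<lambda>x. Yk k (t, x))" for k t unfolding Yk_def using Gsq by simp
 define D where "D k m t = l2 lborel (\<lambda>x. Yk k (t, x) - Yk m (t, x))" for k m t
 have [measurable]: "D k m \<in> borel_measurable borel" for k m unfolding D_def[abs_def] l2_def by measurable
 \<comment> \<open>The distance of \<open>\<Phi> (s k t)\<close> to \<open>y t\<close> is not known
   to be measurable in \<open>t\<close>. It is recovered as the limit over \<open>m\<close> of the
   measurable mutual distances \<open>D k m t\<close>; truncation at 1 makes it integrable over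
   \<open>J\<close>.\<close>
 define d where "d k t = indicator J t * min 1 \<bar>lim (\<lambda>m. D k m t)\<bar>" for k t
 have dm[measurable]: "d k \<in> borel_measurable borel" for k unfolding d_def[abs_def] by measurable
 have d0: "d k t \<ge> 0" "d k t \<le> indicator J t" for k t by (auto simp: d_def indicator_def)
 define \<delta> where "\<delta> k t = l2 (lebesgue_on S) (\<lambda>x. \<Phi> (s k t) x - y t x)" for k t
 define ok where "ok t \<longleftrightarrow> (\<forall>k. s k t = s' k t) \<and> sqint (lebesgue_on S) (y t) \<and> (\<lambda>k. \<delta> k t) \<longlonglongrightarrow> 0" for t
 have okAE: "AE t in lborel. t \<in> J \<longrightarrow> ok t"
 proof -
  have "AE t in lborel. \<forall>k. t \<in> J \<longrightarrow> s k t = s' k t" unfolding AE_all_countable using s'(2) by blast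
  moreover have "AE t in lborel. t \<in> J \<longrightarrow> sqint (lebesgue_on S) (y t)" using y unfolding AE_lebesgue_on_iff[OF J(1)] .
  moreover have "AE t in lborel. t \<in> J \<longrightarrow> (\<lambda>k. \<delta> k t) \<longlonglongrightarrow> 0" using lim unfolding AE_lebesgue_on_iff[OF J(1)] \<delta>_def .
  ultimately show ?thesis by eventually_elim (auto simp: ok_def)
 qed
 have rep: "\<exists>g. sqint lborel g \<and> (AE x in lebesgue_on S. y t x = g x) \<and> (\<forall>k. l2 lborel (\<lambda>x. Yk k (t, x) - g x) = \<delta> k t)"
  if t: "t \<in> J" "ok t" for t
 proof -
  have yt: "sqint (lebesgue_on S) (y t)" using t by (simp add: ok_def)
  obtain g where g: "sqint lborel g" "\<And>x. x \<notin> S \<Longrightarrow> g x = 0" "AE x in lebesgue_on S. y t x = g x"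
   using sqint_representative[OF S yt] by metis
  have gm[measurable]: "g \<in> borel_measurable borel" using g(1) by (simp add: sqint_def)
  have "l2 lborel (\<lambda>x. Yk k (t, x) - g x) = \<delta> k t" for k
  proof -
   have eq: "s' k t = s k t" using t by (simp add: ok_def)
   have gd: "good (s k t) (G (s k t))" by (rule Ggood[OF sq[OF t(1)]])
   have "l2 lborel (\<lambda>x. Yk k (t, x) - g x) = l2 lborel (\<lambda>x. G (s k t) x - g x)" by (simp add: Yk_def eq)
   also have "\<dots> = l2 (lebesgue_on S) (\<lambda>x. G (s k t) x - g x)"
    by (rule l2_lebesgue_on(1)[OF S, symmetric]) (use gd g(2) in \<open>auto simp: good_def\<close>)
   also have "\<dots> = \<delta> k t"
    unfolding \<delta>_def
   proof (rule l2_cong_AE(1))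
    have "AE x in lebesgue_on S. \<Phi> (s k t) x = G (s k t) x" using gd by (simp add: good_def)
    thus "AE x in lebesgue_on S. G (s k t) x - g x = \<Phi> (s k t) x - y t x" using g(3) by eventually_elim simp
    show "(\<lambda>x. G (s k t) x - g x) \<in> borel_measurable (lebesgue_on S)" by (rule lebesgue_on_borel(1)[OF S]) measurable
    show "(\<lambda>x. \<Phi> (s k t) x - y t x) \<in> borel_measurable (lebesgue_on S)"
     by (intro borel_measurable_diff sqint_measurable sq t(1) yt)
   qed
   finally show ?thesis .
  qed
  thus ?thesis using g by blast
 qed
 have dok: "d k t = min 1 (\<delta> k t)" if t: "t \<in> J" "ok t" for k t
 proof -
  obtain g where g: "sqint lborel g" "\<And>k. l2 lborel (\<lambda>x. Yk k (t, x) - g x) = \<delta> k t"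
   using rep[OF t] by blast
  have le: "norm (D k m t - \<delta> k t) \<le> \<delta> m t" for m
   unfolding D_def g(2)[symmetric] real_norm_def by (rule l2_diff_triangle[OF Ysq Ysq g(1)])
  have "(\<lambda>m. \<delta> m t) \<longlonglongrightarrow> 0" using t by (simp only: ok_def)
  hence "(\<lambda>m. D k m t - \<delta> k t) \<longlonglongrightarrow> 0"
   by (rule Lim_null_comparison[rotated]) (rule always_eventually, rule allI, rule le)
  hence "(\<lambda>m. D k m t) \<longlonglongrightarrow> \<delta> k t" by (simp add: LIM_zero_iff)
  hence "lim (\<lambda>m. D k m t) = \<delta> k t" by (rule limI)
  moreover have "\<delta> k t \<ge> 0" unfolding \<delta>_def by (rule l2_nonneg)
  ultimately show ?thesis using t by (simp add: d_def)
 qed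
 have Ji: "integrable lborel (indicator J :: real \<Rightarrow> real)" using J by (intro integrable_real_indicator) auto
 have di: "integrable lborel (d k)" for k
  by (rule integrable_bound[OF Ji]) (use d0 in auto)
 have "(\<lambda>k. (LBINT t. d k t)) \<longlonglongrightarrow> (\<integral>t. (0::real) \<partial>(lborel :: real measure))"
 proof (rule integral_dominated_convergence[OF _ _ Ji])
  show "AE t in lborel. (\<lambda>k. d k t) \<longlonglongrightarrow> 0"
   using okAE
  proof eventually_elim
   case (elim t)
   show ?case
   proof (cases "t \<in> J")
    case True
    hence "(\<lambda>k. \<delta> k t) \<longlonglongrightarrow> 0" "\<And>k. d k t = min 1 (\<delta> k t)" using elim dok by (auto simp: ok_def)
    thus ?thesis using tendsto_min[OF tendsto_const[of 1], of "\<lambda>k. \<delta> k t" 0 sequentially] by simp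
   qed (simp add: d_def)
  qed
  show "AE t in lborel. norm (d k t) \<le> indicator J t" for k using d0 by simp
 qed auto
 hence lim0: "(\<lambda>k. (LBINT t. d k t)) \<longlonglongrightarrow> 0" by simp
 have "\<forall>j. \<exists>k. (LBINT t. d k t) < (1 / 2) ^ j"
 proof
  fix j :: nat
  have "\<forall>\<^sub>F k in sequentially. (LBINT t. d k t) < (1 / 2) ^ j"
   by (rule order_tendstoD(2)[OF lim0]) simp
  from eventually_happens[OF this] show "\<exists>k. (LBINT t. d k t) < (1 / 2) ^ j" by simp
 qed
 \<comment> \<open>The rapidly converging subsequence; it depends on no particular time.\<close>
 then obtain \<kappa> where \<kappa>: "\<And>j. (LBINT t. d (\<kappa> j) t) < (1 / 2) ^ j" unfolding choice_iff by blast
 have sumAE: "AE t in lborel. summable (\<lambda>j. d (\<kappa> j) t)"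
 proof -
  have "(\<integral>\<^sup>+t. (\<Sum>j. ennreal (d (\<kappa> j) t)) \<partial>lborel) = (\<Sum>j. \<integral>\<^sup>+t. ennreal (d (\<kappa> j) t) \<partial>lborel)"
   by (rule nn_integral_suminf) measurable
  also have "\<dots> \<le> (\<Sum>j. ennreal ((1 / 2) ^ j))"
  proof (rule suminf_le)
   fix j
   show "(\<integral>\<^sup>+t. ennreal (d (\<kappa> j) t) \<partial>lborel) \<le> ennreal ((1 / 2) ^ j)"
    using nn_integral_eq_integral[OF di] d0 \<kappa>[of j] by (simp add: ennreal_leI less_imp_le)
  qed auto
  also have "\<dots> < \<infinity>"
  proof -
   have "(\<Sum>j. ennreal ((1 / 2) ^ j)) = ennreal (\<Sum>j. (1 / 2) ^ j)"
    by (rule suminf_ennreal2) (auto intro: summable_geometric)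
   thus ?thesis by simp
  qed
  finally have "(\<integral>\<^sup>+t. (\<Sum>j. ennreal (d (\<kappa> j) t)) \<partial>lborel) \<noteq> \<infinity>" by simp
  hence "AE t in lborel. (\<Sum>j. ennreal (d (\<kappa> j) t)) \<noteq> \<infinity>"
   by (intro nn_integral_PInf_AE) measurable
  thus ?thesis by eventually_elim (auto intro!: summable_suminf_not_top d0)
 qed
 define Y where "Y p = indicator (J \<times> S) p * lim (\<lambda>j. Yk (\<kappa> j) p)" for p
 show ?thesis
 proof (rule that[of Y])
  have "Y \<in> borel_measurable (borel \<Otimes>\<^sub>M borel)" unfolding Y_def[abs_def] by measurable
  thus "Y \<in> borel_measurable borel" by (simp add: borel_prod)
  show "Y p = 0" if "p \<notin> J \<times> S" for p using that by (simp add: Y_def)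
  show "AE t in lborel. t \<in> J \<longrightarrow> (AE x in lebesgue_on S. y t x = Y (t, x))"
   using okAE sumAE
  proof eventually_elim
   case (elim t)
   show ?case
   proof
    assume t: "t \<in> J"
    hence ok: "ok t" using elim by simp
    obtain g where g: "sqint lborel g" "AE x in lebesgue_on S. y t x = g x"
     "\<And>k. l2 lborel (\<lambda>x. Yk k (t, x) - g x) = \<delta> k t"
     using rep[OF t ok] by blast
    have gm[measurable]: "g \<in> borel_measurable borel" using g(1) by (simp add: sqint_def)
    have \<delta>0: "\<delta> k t \<ge> 0" for k unfolding \<delta>_def by (rule l2_nonneg)
    have sm: "summable (\<lambda>j. min 1 (\<delta> (\<kappa> j) t))" using elim(2) dok[OF t ok] by simp
    have "\<forall>\<^sub>F j in sequentially. min 1 (\<delta> (\<kappa> j) t) < 1"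
     using order_tendstoD(2)[OF summable_LIMSEQ_zero[OF sm], of 1] by simp
    \<comment> \<open>Eventually the distance is below 1, hence equal to its truncation and not
      smaller than its square; so the squares are summable as well.\<close>
    hence "\<forall>\<^sub>F j in sequentially. norm ((\<delta> (\<kappa> j) t)\<^sup>2) \<le> min 1 (\<delta> (\<kappa> j) t)"
    proof eventually_elim
     case (elim j)
     hence "\<delta> (\<kappa> j) t < 1" by (simp add: min_def split: if_splits)
     moreover have "\<delta> (\<kappa> j) t * \<delta> (\<kappa> j) t \<le> \<delta> (\<kappa> j) t * 1" using calculation \<delta>0 by (intro mult_left_mono) auto
     ultimately show ?case by (simp add: power2_eq_square min_def abs_of_nonneg[OF mult_nonneg_nonneg[OF \<delta>0 \<delta>0]])
    qed
    hence s2: "summable (\<lambda>j. (\<delta> (\<kappa> j) t)\<^sup>2)" by (rule summable_comparison_test_ev[OF _ sm])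
    have Ym2: "(\<lambda>x. ((Yk (\<kappa> j) (t, x) - g x)\<^sup>2)) \<in> borel_measurable borel" for j by measurable
    have "(\<integral>\<^sup>+x. (\<Sum>j. ennreal ((Yk (\<kappa> j) (t, x) - g x)\<^sup>2)) \<partial>lborel)
      = (\<Sum>j. \<integral>\<^sup>+x. ennreal ((Yk (\<kappa> j) (t, x) - g x)\<^sup>2) \<partial>lborel)"
     by (rule nn_integral_suminf) (use Ym2 in simp)
    also have "\<dots> = (\<Sum>j. ennreal ((\<delta> (\<kappa> j) t)\<^sup>2))"
     unfolding g(3)[symmetric] l2_sq
     by (intro suminf_cong nn_integral_eq_integral sqint_sq sqint_diff Ysq g(1)) simp
    also have "\<dots> = ennreal (\<Sum>j. (\<delta> (\<kappa> j) t)\<^sup>2)" by (rule suminf_ennreal2[OF _ s2]) simp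
    finally have "(\<integral>\<^sup>+x. (\<Sum>j. ennreal ((Yk (\<kappa> j) (t, x) - g x)\<^sup>2)) \<partial>lborel) \<noteq> \<infinity>" by simp
    hence "AE x in lborel. (\<Sum>j. ennreal ((Yk (\<kappa> j) (t, x) - g x)\<^sup>2)) \<noteq> \<infinity>"
     by (rule nn_integral_PInf_AE[rotated]) (intro borel_measurable_suminf_order measurable_compose[OF _ measurable_ennreal], use Ym2 in simp)
    hence "AE x in lborel. x \<in> S \<longrightarrow> g x = Y (t, x)"
    proof eventually_elim
     case (elim x)
     have "summable (\<lambda>j. (Yk (\<kappa> j) (t, x) - g x)\<^sup>2)" by (rule summable_suminf_not_top) (use elim in auto)
     hence "(\<lambda>j. (Yk (\<kappa> j) (t, x) - g x)\<^sup>2) \<longlonglongrightarrow> 0" by (rule summable_LIMSEQ_zero)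
     hence "(\<lambda>j. sqrt ((Yk (\<kappa> j) (t, x) - g x)\<^sup>2)) \<longlonglongrightarrow> sqrt 0" by (rule tendsto_real_sqrt)
     hence "(\<lambda>j. Yk (\<kappa> j) (t, x) - g x) \<longlonglongrightarrow> 0" by (simp only: real_sqrt_abs real_sqrt_zero tendsto_rabs_zero_iff)
     hence "(\<lambda>j. Yk (\<kappa> j) (t, x)) \<longlonglongrightarrow> g x" by (simp add: LIM_zero_iff)
     thus ?case using t by (simp add: Y_def limI[of "\<lambda>j. Yk (\<kappa> j) (t, x)"])
    qed
    hence "AE x in lebesgue_on S. g x = Y (t, x)" unfolding AE_lebesgue_on_iff[OF S] .
    thus "AE x in lebesgue_on S. y t x = Y (t, x)" using g(2) by eventually_elim simp
   qed
  qed
 qed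
qed

section \<open>Functions of time with values in \<open>H\<^sup>1\<close>\<close>

lemma lebesgue_on_measurable_AE:
 fixes f g :: "'a::euclidean_space \<Rightarrow> real"
 assumes S: "S \<in> sets borel" and g: "g \<in> borel_measurable (lebesgue_on S)"
  and eq: "AE x in lebesgue_on S. f x = g x"
 shows "f \<in> borel_measurable (lebesgue_on S)"
proof -
 have S': "S \<inter> space lebesgue \<in> sets lebesgue" using S by simp
 have "AE x in lborel. x \<in> S \<longrightarrow> f x = g x" using eq unfolding AE_lebesgue_on_iff[OF S] .
 hence "AE x in lborel. indicator S x *\<^sub>R g x = indicator S x *\<^sub>R f x"
  by eventually_elim (auto simp: indicator_def)
 hence "AE x in lebesgue. indicator S x *\<^sub>R g x = indicator S x *\<^sub>R f x" by (simp add: AE_completion_iff)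
 moreover have "(\<lambda>x. indicator S x *\<^sub>R g x) \<in> borel_measurable lebesgue"
  using g borel_measurable_restrict_space_iff[OF S', of g] by simp
 ultimately have "(\<lambda>x. indicator S x *\<^sub>R f x) \<in> borel_measurable lebesgue" by (rule borel_measurable_AE[rotated])
 thus ?thesis using borel_measurable_restrict_space_iff[OF S', of f] by simp
qed

lemma lebesgue_on_AE_eq:
 fixes f g :: "'a::euclidean_space \<Rightarrow> real"
 assumes S: "S \<in> sets borel" and g: "g \<in> borel_measurable borel"
  and eq: "AE x in lebesgue_on S. f x = g x"
 shows "f \<in> borel_measurable (lebesgue_on S)"
  and "integrable (lebesgue_on S) f \<longleftrightarrow> integrable lborel (\<lambda>x. indicator S x * g x)"
  and "(\<integral>x. f x \<partial>lebesgue_on S) = (LBINT x. indicator S x * g x)"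
proof -
 note gm = lebesgue_on_borel(1)[OF S g]
 show fm: "f \<in> borel_measurable (lebesgue_on S)" by (rule lebesgue_on_measurable_AE[OF S gm eq])
 show "integrable (lebesgue_on S) f \<longleftrightarrow> integrable lborel (\<lambda>x. indicator S x * g x)"
  using integrable_cong_AE[OF fm gm eq] lebesgue_on_borel(2)[OF S g] by simp
 show "(\<integral>x. f x \<partial>lebesgue_on S) = (LBINT x. indicator S x * g x)"
  using integral_cong_AE[OF fm gm eq] lebesgue_on_borel(3)[OF S g] by simp
qed

lemma lebesgue_on_pairing:
 fixes f g \<phi> :: "'a::euclidean_space \<Rightarrow> real"
 assumes S: "S \<in> sets borel" and g[measurable]: "g \<in> borel_measurable borel" and z: "\<And>x. x \<notin> S \<Longrightarrow> g x = 0"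
  and eq: "AE x in lebesgue_on S. f x = g x" and \<phi>[measurable]: "\<phi> \<in> borel_measurable borel"
 shows "(\<integral>x. f x * \<phi> x \<partial>lebesgue_on S) = (LBINT x. g x * \<phi> x)"
proof -
 have "AE x in lebesgue_on S. f x * \<phi> x = g x * \<phi> x" using eq by eventually_elim simp
 hence "(\<integral>x. f x * \<phi> x \<partial>lebesgue_on S) = (LBINT x. indicator S x * (g x * \<phi> x))"
  by (rule lebesgue_on_AE_eq(3)[OF S, rotated]) measurable
 also have "(\<lambda>x. indicator S x * (g x * \<phi> x)) = (\<lambda>x. g x * \<phi> x)" using z by (auto simp: indicator_def fun_eq_iff)
 finally show ?thesis .
qed

lemma AE_lebesgue_on_subset:
 assumes "S \<in> sets borel" "A \<in> sets borel" "A \<subseteq> S" "AE x in lebesgue_on S. P x"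
 shows "AE x in lebesgue_on A. P x"
 using assms(4) unfolding AE_lebesgue_on_iff[OF assms(1)] AE_lebesgue_on_iff[OF assms(2)]
 by eventually_elim (use assms(3) in auto)

lemma l2_lebesgue_on_restrict:
 assumes S: "S \<in> sets borel" and A[measurable]: "A \<in> sets borel" and AS: "A \<subseteq> S" and g[measurable]: "g \<in> borel_measurable borel"
  and eq: "AE x in lebesgue_on S. f x = g x"
 shows "l2 (lebesgue_on A) f = l2 lborel (\<lambda>x. indicator A x * g x)"
  and "sqint (lebesgue_on A) f \<longleftrightarrow> sqint lborel (\<lambda>x. indicator A x * g x)"
proof -
 let ?g = "\<lambda>x. indicator A x * g x"
 have gm: "?g \<in> borel_measurable borel" by measurable
 have "AE x in lebesgue_on A. f x = g x" by (rule AE_lebesgue_on_subset[OF S A AS eq])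
 hence ae: "AE x in lebesgue_on A. f x = ?g x"
  unfolding AE_lebesgue_on_iff[OF A] by eventually_elim auto
 note fm = lebesgue_on_AE_eq(1)[OF A gm ae]
 note c = l2_cong_AE[OF ae fm lebesgue_on_borel(1)[OF A gm]] and d = l2_lebesgue_on[OF A gm]
 show "l2 (lebesgue_on A) f = l2 lborel ?g" using c(1) d(1) by simp
 show "sqint (lebesgue_on A) f \<longleftrightarrow> sqint lborel ?g" using c(2) d(2) by simp
qed

text \<open>The bridge between the two halves of the proof: one Borel, square integrable function of
  space-time whose slices agree almost everywhere with the given curve, and which vanishes off the
  cylinder so that integrals extend to the whole space.\<close>

definition represents :: "real set \<Rightarrow> 'a::euclidean_space set \<Rightarrow> (real \<Rightarrow> 'a \<Rightarrow> real) \<Rightarrow> (real \<times> 'a \<Rightarrow> real) \<Rightarrow> bool" where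
 "represents J S y Y \<longleftrightarrow> sqint lborel Y \<and> (\<forall>p. p \<notin> J \<times> S \<longrightarrow> Y p = 0) \<and>
   (AE t in lborel. t \<in> J \<longrightarrow> (AE x in lebesgue_on S. y t x = Y (t, x)))"

lemma borel_slice:
 assumes "Y \<in> borel_measurable (borel :: (real \<times> 'a::euclidean_space) measure)"
 shows "(\<lambda>x. Y (t, x)) \<in> borel_measurable borel"
proof -
 have [measurable]: "Y \<in> borel_measurable (borel \<Otimes>\<^sub>M borel)" using assms by (simp add: borel_prod)
 show ?thesis by measurable
qed

lemma representsD:
 assumes "represents J S y Y"
 shows "sqint lborel Y" "\<And>p. p \<notin> J \<times> S \<Longrightarrow> Y p = 0" "(\<lambda>x. Y (t, x)) \<in> borel_measurable borel"
  "AE t in lborel. t \<in> J \<longrightarrow> (AE x in lebesgue_on S. y t x = Y (t, x))"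
 using assms borel_slice[of Y] unfolding represents_def sqint_def by auto

text \<open>Tonelli: for almost every time the slice norm of \<open>Y\<close> is that of
  \<open>y t\<close>, hence at most \<open>m t\<close>, whose square is integrable.\<close>

lemma representsI:
 assumes S: "S \<in> sets borel" and J: "J \<in> sets borel"
  and Y[measurable]: "Y \<in> borel_measurable borel" and z: "\<And>p. p \<notin> J \<times> S \<Longrightarrow> Y p = 0"
  and ae: "AE t in lborel. t \<in> J \<longrightarrow> (AE x in lebesgue_on S. y t x = Y (t, x))"
  and y: "AE t in lebesgue_on J. sqint (lebesgue_on S) (y t) \<and> l2 (lebesgue_on S) (y t) \<le> m t"
  and m: "integrable (lebesgue_on J) (\<lambda>t. (m t)\<^sup>2)"
 shows "represents J S y Y"
proof -
 have [measurable]: "Y \<in> borel_measurable (borel \<Otimes>\<^sub>M borel)" using Y by (simp add: borel_prod)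
 have J': "J \<inter> space lebesgue \<in> sets lebesgue" using J by simp
 define F where "F t = (\<integral>\<^sup>+x. ennreal ((Y (t, x))\<^sup>2) \<partial>lborel)" for t
 have Fm: "F \<in> borel_measurable lborel" unfolding F_def[abs_def] by measurable
 have "(\<integral>\<^sup>+p. ennreal ((Y p)\<^sup>2) \<partial>lborel) = (\<integral>\<^sup>+p. ennreal ((Y p)\<^sup>2) \<partial>(lborel \<Otimes>\<^sub>M lborel))" by (simp add: lborel_prod)
 also have "\<dots> = (\<integral>\<^sup>+t. F t \<partial>lborel)" unfolding F_def by (subst lborel.nn_integral_fst[symmetric]) measurable
 also have "\<dots> = (\<integral>\<^sup>+t. F t \<partial>lebesgue)" by (rule nn_integral_completion[symmetric])
 also have "\<dots> = (\<integral>\<^sup>+t. F t * indicator J t \<partial>lebesgue)"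
  by (rule nn_integral_cong) (use z in \<open>auto simp: F_def indicator_def\<close>)
 also have "\<dots> = (\<integral>\<^sup>+t. F t \<partial>lebesgue_on J)" by (rule nn_integral_restrict_space[OF J', symmetric])
 also have "\<dots> \<le> (\<integral>\<^sup>+t. ennreal ((m t)\<^sup>2) \<partial>lebesgue_on J)"
 proof (rule nn_integral_mono_AE)
  have "AE t in lebesgue_on J. AE x in lebesgue_on S. y t x = Y (t, x)" using ae unfolding AE_lebesgue_on_iff[OF J] .
  with y show "AE t in lebesgue_on J. F t \<le> ennreal ((m t)\<^sup>2)"
  proof eventually_elim
   case (elim t)
   note r = l2_lebesgue_on_restrict[OF S S subset_refl borel_slice[OF Y] elim(2)]
   have e: "(\<lambda>x. indicator S x * Y (t, x)) = (\<lambda>x. Y (t, x))" using z by (auto simp: indicator_def fun_eq_iff)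
   have "sqint lborel (\<lambda>x. Y (t, x))" "l2 lborel (\<lambda>x. Y (t, x)) \<le> m t" using elim(1) r unfolding e by auto
   hence "F t = ennreal ((l2 lborel (\<lambda>x. Y (t, x)))\<^sup>2)"
    unfolding F_def l2_sq by (intro nn_integral_eq_integral) (auto simp: sqint_def)
   also have "\<dots> \<le> ennreal ((m t)\<^sup>2)" using \<open>l2 lborel (\<lambda>x. Y (t, x)) \<le> m t\<close> by (intro ennreal_leI power_mono l2_nonneg)
   finally show ?case .
  qed
 qed
 also have "\<dots> < \<infinity>" using nn_integral_eq_integral[OF m] by simp
 finally have "integrable lborel (\<lambda>p. (Y p)\<^sup>2)" by (intro integrableI_bounded) auto
 thus ?thesis unfolding represents_def sqint_def using z ae by simp
qed

text \<open>One argument covers \<open>u\<close> and the components of its weak gradient. Both are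
  maps \<open>\<Phi>\<close> on \<open>H1\<close> that respect differences almost everywhere and are
  bounded by the norm, so they carry the simple approximations of \<open>u\<close> to approximations
  in L2.\<close>

lemma H1_representatives:
 fixes \<Omega> :: "'a::euclidean_space set" and u :: "real \<Rightarrow> 'a \<Rightarrow> real"
 assumes \<Omega>: "open \<Omega>" and J: "open J" "emeasure lborel J < \<infinity>" and u: "u \<in> time_L2 J (H1 \<Omega>) (H1_norm \<Omega>)"
 obtains U W where "represents J \<Omega> u U" "\<And>i. i \<in> Basis \<Longrightarrow> represents J \<Omega> (\<lambda>t x. weak_grad \<Omega> (u t) x \<bullet> i) (W i)"
proof -
 have Jb: "J \<in> sets borel" and S: "\<Omega> \<in> sets borel" using J \<Omega> by auto
 obtain s where s: "\<And>k::nat. simple_function (lebesgue_on J) (s k)" "\<And>k t. t \<in> J \<Longrightarrow> s k t \<in> H1 \<Omega>"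
  and lim: "AE t in lebesgue_on J. (\<lambda>k. H1_norm \<Omega> (\<lambda>x. s k t x - u t x)) \<longlonglongrightarrow> 0"
  using u unfolding time_L2_def strongly_measurable_def by blast
 have uH: "AE t in lebesgue_on J. u t \<in> H1 \<Omega>" and m: "integrable (lebesgue_on J) (\<lambda>t. (H1_norm \<Omega> (u t))\<^sup>2)"
  using u by (auto simp: time_L2_def)
 have Jae: "AE t in lebesgue_on J. t \<in> J" using AE_space[of "lebesgue_on J"] by simp
 have rep: "\<exists>Y. represents J \<Omega> (\<lambda>t. \<Phi> (u t)) Y"
  if sq: "\<And>f. f \<in> H1 \<Omega> \<Longrightarrow> sqint (lebesgue_on \<Omega>) (\<Phi> f)"
   and le: "\<And>f. f \<in> H1 \<Omega> \<Longrightarrow> l2 (lebesgue_on \<Omega>) (\<Phi> f) \<le> H1_norm \<Omega> f"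
   and diff: "\<And>f g. f \<in> H1 \<Omega> \<Longrightarrow> g \<in> H1 \<Omega> \<Longrightarrow>
    AE x in lebesgue_on \<Omega>. \<Phi> (\<lambda>x. f x - g x) x = \<Phi> f x - \<Phi> g x" for \<Phi>
 proof -
  have y: "AE t in lebesgue_on J. sqint (lebesgue_on \<Omega>) (\<Phi> (u t))" using uH by eventually_elim (rule sq)
  have l: "AE t in lebesgue_on J. (\<lambda>k. l2 (lebesgue_on \<Omega>) (\<lambda>x. \<Phi> (s k t) x - \<Phi> (u t) x)) \<longlonglongrightarrow> 0"
   using Jae uH lim
  proof eventually_elim
   case (elim t)
   have "l2 (lebesgue_on \<Omega>) (\<lambda>x. \<Phi> (s k t) x - \<Phi> (u t) x) \<le> H1_norm \<Omega> (\<lambda>x. s k t x - u t x)" for k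
   proof -
    note H = s(2)[OF elim(1), of k] elim(2)
    have "l2 (lebesgue_on \<Omega>) (\<lambda>x. \<Phi> (s k t) x - \<Phi> (u t) x) = l2 (lebesgue_on \<Omega>) (\<Phi> (\<lambda>x. s k t x - u t x))"
     by (rule l2_cong_AE(1)[symmetric, OF diff[OF H]])
      (intro sqint_measurable sqint_diff sq H1_diff(1)[OF \<Omega>] H)+
    also have "\<dots> \<le> H1_norm \<Omega> (\<lambda>x. s k t x - u t x)" by (rule le[OF H1_diff(1)[OF \<Omega> H]])
    finally show ?thesis .
   qed
   thus ?case
    by (intro tendsto_sandwich[OF _ _ tendsto_const elim(3)]) (auto simp: l2_nonneg)
  qed
  obtain Y where Y: "Y \<in> borel_measurable borel" "\<And>p. p \<notin> J \<times> \<Omega> \<Longrightarrow> Y p = 0"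
   "AE t in lborel. t \<in> J \<longrightarrow> (AE x in lebesgue_on \<Omega>. \<Phi> (u t) x = Y (t, x))"
   using joint_representative[where \<Phi> = \<Phi> and y = "\<lambda>t. \<Phi> (u t)", OF S Jb J(2) s(1) sq[OF s(2)] y l] by blast
  have "represents J \<Omega> (\<lambda>t. \<Phi> (u t)) Y"
  proof (rule representsI[OF S Jb Y _ m])
   show "AE t in lebesgue_on J. sqint (lebesgue_on \<Omega>) (\<Phi> (u t)) \<and> l2 (lebesgue_on \<Omega>) (\<Phi> (u t)) \<le> H1_norm \<Omega> (u t)"
    using uH by eventually_elim (simp add: sq le)
  qed
  thus ?thesis by blast
 qed
 have "\<exists>U. represents J \<Omega> u U" by (rule rep[of "\<lambda>f. f"]) (auto intro: H1_sqint H1_norm_ge)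
 moreover have "\<forall>i\<in>Basis. \<exists>W. represents J \<Omega> (\<lambda>t x. weak_grad \<Omega> (u t) x \<bullet> i) W"
 proof
  fix i :: 'a assume i: "i \<in> Basis"
  have "AE x in lebesgue_on \<Omega>. weak_grad \<Omega> (\<lambda>x. f x - g x) x \<bullet> i = weak_grad \<Omega> f x \<bullet> i - weak_grad \<Omega> g x \<bullet> i"
   if "f \<in> H1 \<Omega>" "g \<in> H1 \<Omega>" for f g
   using H1_diff(2)[OF \<Omega> that] by eventually_elim (simp add: inner_diff_left)
  thus "\<exists>W. represents J \<Omega> (\<lambda>t x. weak_grad \<Omega> (u t) x \<bullet> i) W"
   by (intro rep[of "\<lambda>f x. weak_grad \<Omega> f x \<bullet> i"]) (auto intro: H1_sqint H1_norm_ge i)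
 qed
 ultimately show ?thesis using that unfolding bchoice_iff by blast
qed

lemma represents_l2:
 assumes r: "represents J S y Y" and J: "J \<in> sets borel" and S: "S \<in> sets borel"
  and J': "J' \<in> sets borel" "J' \<subseteq> J" and A: "A \<in> sets borel" "A \<subseteq> S"
 defines "Z \<equiv> \<lambda>p. indicator (J' \<times> A) p * Y p"
 shows "sqint lborel Z"
  and "(\<integral>t. (l2 (lebesgue_on A) (y t))\<^sup>2 \<partial>lebesgue_on J') = (l2 lborel Z)\<^sup>2"
  and "integrable (lebesgue_on J') (\<lambda>t. (l2 (lebesgue_on A) (y t))\<^sup>2)"
  and "AE t in lebesgue_on J'. sqint (lebesgue_on A) (y t)"
proof -
 note [measurable] = J J' S A(1)
 have Y: "sqint lborel Y" by (rule representsD[OF r])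
 have [measurable]: "J' \<times> A \<in> sets borel" by (rule borel_Times[OF J'(1) A(1)])
 show Z: "sqint lborel Z"
  unfolding Z_def by (rule sqint_bounded_mult[OF Y, where B=1]) (auto simp: indicator_def)
 define n where "n t = l2 lborel (\<lambda>x. Z (t, x))" for t
 note it = sqint_iterated[OF Z, folded n_def]
 have nm[measurable]: "n \<in> borel_measurable borel" using it(2) by (simp add: sqint_def)
 have ae: "AE t in lborel. t \<in> J' \<longrightarrow> l2 (lebesgue_on A) (y t) = n t \<and> sqint (lebesgue_on A) (y t)"
  using representsD(4)[OF r] it(1)
 proof eventually_elim
  case (elim t)
  show ?case
  proof
   assume t: "t \<in> J'"
   hence e: "AE x in lebesgue_on S. y t x = Y (t, x)" using elim J' by auto
   have z: "(\<lambda>x. Z (t, x)) = (\<lambda>x. indicator A x * Y (t, x))" using t by (auto simp: Z_def indicator_def fun_eq_iff)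
   show "l2 (lebesgue_on A) (y t) = n t \<and> sqint (lebesgue_on A) (y t)"
    using l2_lebesgue_on_restrict[OF S A representsD(3)[OF r] e] elim(2) unfolding n_def z by simp
  qed
 qed
 thus "AE t in lebesgue_on J'. sqint (lebesgue_on A) (y t)"
  unfolding AE_lebesgue_on_iff[OF J'(1)] by eventually_elim simp
 have ae': "AE t in lebesgue_on J'. (l2 (lebesgue_on A) (y t))\<^sup>2 = (n t)\<^sup>2"
  unfolding AE_lebesgue_on_iff[OF J'(1)] using ae by eventually_elim simp
 have n0: "n t = 0" if "t \<notin> J'" for t
 proof -
  have "(\<lambda>x. Z (t, x)) = (\<lambda>x. 0)" using that by (auto simp: Z_def)
  thus ?thesis by (simp add: n_def l2_def)
 qed
 have e: "(\<lambda>t. indicator J' t * (n t)\<^sup>2) = (\<lambda>t. (n t)\<^sup>2)" using n0 by (auto simp: indicator_def fun_eq_iff)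
 have m2: "(\<lambda>t. (n t)\<^sup>2) \<in> borel_measurable borel" by measurable
 note L = lebesgue_on_AE_eq[OF J'(1) m2 ae', unfolded e]
 show "(\<integral>t. (l2 (lebesgue_on A) (y t))\<^sup>2 \<partial>lebesgue_on J') = (l2 lborel Z)\<^sup>2"
  using L(3) l2_sq[of lborel n] it(3) by simp
 show "integrable (lebesgue_on J') (\<lambda>t. (l2 (lebesgue_on A) (y t))\<^sup>2)"
  unfolding L(2) by (rule sqint_sq[OF it(2)])
qed

lemma represents_time_L2_norm:
 assumes "represents J S y Y" "J \<in> sets borel" "S \<in> sets borel" "J' \<in> sets borel" "J' \<subseteq> J" "A \<in> sets borel" "A \<subseteq> S"
 shows "time_L2_norm J' (L2_norm A) y = l2 lborel (\<lambda>p. indicator (J' \<times> A) p * Y p)"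
 unfolding time_L2_norm_def L2_norm_real represents_l2(2)[OF assms] by (simp add: l2_nonneg)

text \<open>Test functions on \<open>A\<close> are test functions on \<open>S\<close>, so the weak
  gradient on \<open>S\<close> is also one on \<open>A\<close>.\<close>

lemma H1_subset:
 fixes f :: "'a::euclidean_space \<Rightarrow> real"
 assumes S: "open S" and A: "open A" "A \<subseteq> S" and f: "f \<in> H1 S"
 shows "f \<in> H1 A"
  and "(H1_norm A f)\<^sup>2 = (l2 (lebesgue_on A) f)\<^sup>2 + (\<Sum>i\<in>Basis. (l2 (lebesgue_on A) (\<lambda>x. weak_grad S f x \<bullet> i))\<^sup>2)"
proof -
 have Sb: "S \<in> sets borel" and Ab: "A \<in> sets borel" using S A by auto
 have sub: "sqint (lebesgue_on A) h" if h: "sqint (lebesgue_on S) h" for h :: "'a \<Rightarrow> real"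
 proof -
  obtain g where g: "sqint lborel g" "AE x in lebesgue_on S. h x = g x"
   using sqint_representative[OF Sb h] by metis
  have gm: "g \<in> borel_measurable borel" using g by (simp add: sqint_def)
  have "sqint lborel (\<lambda>x. indicator A x * g x)"
   by (rule sqint_bounded_mult[OF g(1), where B=1]) (use Ab in \<open>auto simp: indicator_def\<close>)
  thus ?thesis using l2_lebesgue_on_restrict(2)[OF Sb Ab A(2) gm g(2)] by simp
 qed
 have ext: "(\<integral>x. h x \<partial>lebesgue_on A) = (\<integral>x. h x \<partial>lebesgue_on S)" if "\<And>x. x \<notin> A \<Longrightarrow> h x = 0" for h :: "'a \<Rightarrow> real"
 proof -
  have "(\<lambda>x. indicator A x *\<^sub>R h x) = (\<lambda>x. indicator S x *\<^sub>R h x)" using that A(2) by (auto simp: indicator_def fun_eq_iff)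
  thus ?thesis using integral_restrict_space[of A lebesgue h] integral_restrict_space[of S lebesgue h] Ab Sb by simp
 qed
 let ?g = "weak_grad S f"
 have g: "?g \<in> L2 A" unfolding L2_vector_iff using sub H1_sqint(2)[OF f] by auto
 have wg: "is_weak_grad A f ?g"
  unfolding is_weak_grad_def
 proof (intro ballI)
  fix \<phi> :: "'a \<Rightarrow> real" and i :: 'a assume \<phi>: "\<phi> \<in> \<D> A" and i: "i \<in> Basis"
  have \<phi>S: "\<phi> \<in> \<D> S" using test_mono \<phi> A(2) by blast
  have "(\<integral>x. f x * pd i \<phi> x \<partial>lebesgue_on A) = (\<integral>x. f x * pd i \<phi> x \<partial>lebesgue_on S)"
   by (rule ext) (simp add: test_zero_outside[OF test_partial_deriv[OF \<phi> i]])
  also have "\<dots> = - (\<integral>x. (?g x \<bullet> i) * \<phi> x \<partial>lebesgue_on S)"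
   using H1_weak_grad(2)[OF f] \<phi>S i unfolding is_weak_grad_def by blast
  also have "(\<integral>x. (?g x \<bullet> i) * \<phi> x \<partial>lebesgue_on S) = (\<integral>x. (?g x \<bullet> i) * \<phi> x \<partial>lebesgue_on A)"
   by (rule ext[symmetric]) (simp add: test_zero_outside[OF \<phi>])
  finally show "(\<integral>x. f x * pd i \<phi> x \<partial>lebesgue_on A) = - (\<integral>x. (?g x \<bullet> i) * \<phi> x \<partial>lebesgue_on A)" .
 qed
 note H = H1_I[OF A(1) sub[OF H1_sqint(1)[OF f]] g wg]
 show "f \<in> H1 A" by (rule H)
 show "(H1_norm A f)\<^sup>2 = (l2 (lebesgue_on A) f)\<^sup>2 + (\<Sum>i\<in>Basis. (l2 (lebesgue_on A) (\<lambda>x. ?g x \<bullet> i))\<^sup>2)" by (rule H)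
qed

lemma sum_of_squares_le:
 fixes a :: real and b :: "'i \<Rightarrow> real"
 assumes "finite I" "a \<ge> 0" "\<And>i. i \<in> I \<Longrightarrow> b i \<ge> 0"
 shows "a\<^sup>2 + (\<Sum>i\<in>I. (b i)\<^sup>2) \<le> (a + (\<Sum>i\<in>I. b i))\<^sup>2"
proof -
 have "(\<Sum>i\<in>I. (b i)\<^sup>2) \<le> (\<Sum>i\<in>I. b i * (\<Sum>i\<in>I. b i))"
  unfolding power2_eq_square by (intro sum_mono mult_left_mono member_le_sum assms) auto
 also have "\<dots> = (\<Sum>i\<in>I. b i)\<^sup>2" by (simp add: sum_distrib_right power2_eq_square)
 moreover have "0 \<le> a * (\<Sum>i\<in>I. b i)" by (intro mult_nonneg_nonneg sum_nonneg assms)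
 ultimately show ?thesis by (simp add: power2_sum)
qed

lemma time_L2_norm_H1_le:
 assumes U: "represents J S u U" and W: "\<And>i. i \<in> Basis \<Longrightarrow> represents J S (\<lambda>t x. weak_grad S (u t) x \<bullet> i) (W i)"
  and u: "AE t in lebesgue_on J. u t \<in> H1 S"
  and o: "open J" "open S" "open J'" "J' \<subseteq> J" "open A" "A \<subseteq> S"
 shows "time_L2_norm J' (H1_norm A) u \<le> l2 lborel (\<lambda>p. indicator (J' \<times> A) p * U p)
   + (\<Sum>i\<in>Basis. l2 lborel (\<lambda>p. indicator (J' \<times> A) p * W i p))"
proof -
 have b: "J \<in> sets borel" "S \<in> sets borel" "J' \<in> sets borel" "J' \<subseteq> J" "A \<in> sets borel" "A \<subseteq> S" using o by auto
 let ?a = "l2 lborel (\<lambda>p. indicator (J' \<times> A) p * U p)" and ?b = "\<lambda>i. l2 lborel (\<lambda>p. indicator (J' \<times> A) p * W i p)"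
 let ?f = "\<lambda>t. (l2 (lebesgue_on A) (u t))\<^sup>2 + (\<Sum>i\<in>Basis. (l2 (lebesgue_on A) (\<lambda>x. weak_grad S (u t) x \<bullet> i))\<^sup>2)"
 note rU = represents_l2[OF U b] and rW = represents_l2[OF W b]
 have fi: "integrable (lebesgue_on J') ?f" by (intro integrable_add integrable_sum rU rW)
 have "AE t in lebesgue_on J'. u t \<in> H1 S" by (rule AE_lebesgue_on_subset[OF b(1,3,4) u])
 hence ae: "AE t in lebesgue_on J'. (H1_norm A (u t))\<^sup>2 = ?f t"
  by eventually_elim (rule H1_subset(2)[OF o(2,5,6)])
 have "(\<integral>t. (H1_norm A (u t))\<^sup>2 \<partial>lebesgue_on J') = (\<integral>t. ?f t \<partial>lebesgue_on J')"
  by (rule integral_cong_AE[OF lebesgue_on_measurable_AE[OF b(3) borel_measurable_integrable[OF fi] ae] borel_measurable_integrable[OF fi] ae])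
 also have "\<dots> = ?a\<^sup>2 + (\<Sum>i\<in>Basis. (?b i)\<^sup>2)"
  using rU(2,3) rW(2,3) by (simp add: integral_sum integral_add integrable_sum)
 also have "\<dots> \<le> (?a + (\<Sum>i\<in>Basis. ?b i))\<^sup>2" by (intro sum_of_squares_le l2_nonneg finite_Basis)
 finally have "(\<integral>t. (H1_norm A (u t))\<^sup>2 \<partial>lebesgue_on J') \<le> (?a + (\<Sum>i\<in>Basis. ?b i))\<^sup>2" .
 hence "time_L2_norm J' (H1_norm A) u \<le> sqrt ((?a + (\<Sum>i\<in>Basis. ?b i))\<^sup>2)"
  unfolding time_L2_norm_def by (rule real_sqrt_le_mono)
 also have "\<dots> = ?a + (\<Sum>i\<in>Basis. ?b i)" by (simp add: l2_nonneg sum_nonneg)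
 finally show ?thesis .
qed

text \<open>The definition of the weak gradient is applied in almost every time slice, with the
  slice of \<open>\<psi>\<close> as test function, and integrated by Fubini.\<close>

lemma represents_weak_deriv:
 assumes U: "represents J S u U" and W: "represents J S (\<lambda>t x. weak_grad S (u t) x \<bullet> i) Wi"
  and u: "AE t in lebesgue_on J. u t \<in> H1 S" and o: "open J" "open S"
  and \<psi>: "\<psi> \<in> \<D> (J \<times> S)" and i: "i \<in> Basis"
 shows "(LBINT p. U p * pd (0, i) \<psi> p) = - (LBINT p. Wi p * \<psi> p)"
proof -
 have b: "J \<in> sets borel" "S \<in> sets borel" using o by auto
 have \<psi>i: "pd (0, i) \<psi> \<in> \<D> (J \<times> S)" using \<psi> i by (intro test_partial_deriv) auto
 have i1: "integrable lborel (\<lambda>p. U p * pd (0, i) \<psi> p)" and i2: "integrable lborel (\<lambda>p. Wi p * \<psi> p)"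
  using test_sqint[OF \<psi>] test_sqint[OF \<psi>i] representsD(1)[OF U] representsD(1)[OF W] by (auto intro: sqint_mult)
 note j1 = lborel_integral_iterated[OF i1] and j2 = lborel_integral_iterated[OF i2]
 have "AE t in lborel. t \<in> J \<longrightarrow> u t \<in> H1 S" using u unfolding AE_lebesgue_on_iff[OF b(1)] .
 hence "AE t in lborel. (LBINT x. U (t, x) * pd (0, i) \<psi> (t, x)) = - (LBINT x. Wi (t, x) * \<psi> (t, x))"
  using representsD(4)[OF U] representsD(4)[OF W]
 proof eventually_elim
  case (elim t)
  show ?case
  proof (cases "t \<in> J")
   case False
   thus ?thesis using representsD(2)[OF U] representsD(2)[OF W] by simp
  next
   case True
   let ?\<phi> = "\<lambda>x. \<psi> (t, x)"
   have \<phi>: "?\<phi> \<in> \<D> S" by (rule test_slice[OF \<psi>])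
   have pd: "pd i ?\<phi> = (\<lambda>x. pd (0, i) \<psi> (t, x))" using smooth_slice(2)[OF test_smooth[OF \<psi>] i] by blast
   have "(LBINT x. U (t, x) * pd i ?\<phi> x) = (\<integral>x. u t x * pd i ?\<phi> x \<partial>lebesgue_on S)"
    by (rule lebesgue_on_pairing[OF b(2), symmetric])
     (use True elim representsD(2,3)[OF U] test_borel[OF test_partial_deriv[OF \<phi> i]] in auto)
   also have "\<dots> = - (\<integral>x. (weak_grad S (u t) x \<bullet> i) * ?\<phi> x \<partial>lebesgue_on S)"
    using H1_weak_grad(2) elim True \<phi> i unfolding is_weak_grad_def by blast
   also have "(\<integral>x. (weak_grad S (u t) x \<bullet> i) * ?\<phi> x \<partial>lebesgue_on S) = (LBINT x. Wi (t, x) * ?\<phi> x)"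
    by (rule lebesgue_on_pairing[OF b(2)])
     (use True elim representsD(2,3)[OF W] test_borel[OF \<phi>] in auto)
   finally show ?thesis unfolding pd .
  qed
 qed
 hence "(LBINT t. (LBINT x. U (t, x) * pd (0, i) \<psi> (t, x))) = (LBINT t. - (LBINT x. Wi (t, x) * \<psi> (t, x)))"
  by (rule integral_cong_AE[rotated 2]) (use j1(2) j2(2) in auto)
 thus ?thesis unfolding j1(1) j2(1) by simp
qed

section \<open>The weak time derivative\<close>

lemma H1_norm_test_le:
 assumes "open S" "\<phi> \<in> \<D> S"
 shows "H1_norm S \<phi> \<le> l2 lborel \<phi> + (\<Sum>i\<in>Basis. l2 lborel (pd i \<phi>))"
proof (rule power2_le_imp_le)
 show "(H1_norm S \<phi>)\<^sup>2 \<le> (l2 lborel \<phi> + (\<Sum>i\<in>Basis. l2 lborel (pd i \<phi>)))\<^sup>2"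
  unfolding test_H1(3)[OF assms] by (intro sum_of_squares_le l2_nonneg finite_Basis)
qed (intro add_nonneg_nonneg sum_nonneg l2_nonneg)

lemma test_diff: "f \<in> \<D> S \<Longrightarrow> g \<in> \<D> S \<Longrightarrow> (\<lambda>x. f x - g x) \<in> \<D> S"
 using test_add[of f S "\<lambda>x. (-1) * g x"] test_mult2[OF _ smooth_const, of g S "-1"] by simp

lemma partial_deriv_diff_smooth:
 assumes "smooth f" "smooth g"
 shows "pd i (\<lambda>x. f x - g x) = (\<lambda>x. pd i f x - pd i g x)"
proof
 fix x
 have "((\<lambda>x. f x - g x) has_derivative (\<lambda>h. frechet_derivative f (at x) h - frechet_derivative g (at x) h)) (at x)"
  using assms[THEN smooth_differentiable, of x] unfolding frechet_derivative_works by (rule has_derivative_diff)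
 from partial_deriv_eqI[OF this] show "pd i (\<lambda>x. f x - g x) x = pd i f x - pd i g x"
  by (simp add: partial_deriv_def)
qed

text \<open>All slices are supported in the projection of one compact set, so uniform and Lipschitz
  bounds pass to L2 with the square root of its measure as factor.\<close>

lemma test_slice_l2:
 fixes \<chi>' :: "real \<times> 'a::euclidean_space \<Rightarrow> real"
 assumes "\<chi>' \<in> \<D> (A \<times> S)"
 obtains C where "C \<ge> 0" "\<And>s. l2 lborel (\<lambda>x. \<chi>' (s, x)) \<le> C"
  "\<And>s s'. l2 lborel (\<lambda>x. \<chi>' (s, x) - \<chi>' (s', x)) \<le> C * \<bar>s - s'\<bar>"
proof -
 obtain K where K: "compact K" "K \<subseteq> A \<times> S" "\<And>p. p \<notin> K \<Longrightarrow> \<chi>' p = 0" using test_functionsE[OF assms] by blast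
 obtain M where M: "M > 0" "\<And>p. \<bar>\<chi>' p\<bar> \<le> M" using test_bounded[OF assms] by blast
 obtain L where L: "L > 0" "\<And>p q. \<bar>\<chi>' p - \<chi>' q\<bar> \<le> L * norm (p - q)" using test_lipschitz[OF assms] by blast
 define X where "X = snd ` K"
 have Xc: "compact X" unfolding X_def using K(1) by (intro compact_continuous_image continuous_intros)
 have Xb[measurable]: "X \<in> sets borel" using Xc by (simp add: borel_compact)
 have z: "\<chi>' (s, x) = 0" if "x \<notin> X" for s x using K(3) that unfolding X_def by force
 have Xsq: "sqint lborel (indicator X :: 'a \<Rightarrow> real)"
  using emeasure_compact_finite[OF Xc] by (intro sqint_indicator) auto
 define w where "w = l2 lborel (indicator X :: 'a \<Rightarrow> real)"
 have w0: "w \<ge> 0" unfolding w_def by (rule l2_nonneg)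
 have cb[measurable]: "(\<lambda>x. \<chi>' (s, x)) \<in> borel_measurable borel" for s by (rule borel_slice[OF test_borel[OF assms]])
 have le: "l2 lborel f \<le> c * w" if f: "f \<in> borel_measurable borel" "\<And>x. x \<notin> X \<Longrightarrow> f x = 0" "\<And>x. \<bar>f x\<bar> \<le> c" and c: "c \<ge> 0" for f c
 proof -
  have "l2 lborel f \<le> l2 lborel (\<lambda>x. c * indicator X x)"
   by (rule l2_mono(1)[OF sqint_cmult[OF Xsq]]) (use f c in \<open>auto simp: indicator_def\<close>)
  thus ?thesis using c by (simp add: l2_cmult w_def)
 qed
 show ?thesis
 proof (rule that[of "(M + L) * w"])
  show "(M + L) * w \<ge> 0" using M(1) L(1) w0 by simp
  fix s
  have "l2 lborel (\<lambda>x. \<chi>' (s, x)) \<le> M * w" by (rule le) (use M z in auto)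
  also have "\<dots> \<le> (M + L) * w" using L(1) w0 by (intro mult_right_mono) auto
  finally show "l2 lborel (\<lambda>x. \<chi>' (s, x)) \<le> (M + L) * w" .
  fix s'
  have "\<bar>\<chi>' (s, x) - \<chi>' (s', x)\<bar> \<le> L * \<bar>s - s'\<bar>" for x
   using L(2)[of "(s, x)" "(s', x)"] by (simp add: norm_prod_def)
  hence "l2 lborel (\<lambda>x. \<chi>' (s, x) - \<chi>' (s', x)) \<le> L * \<bar>s - s'\<bar> * w"
   by (intro le) (use L z in auto)
  also have "\<dots> \<le> (M + L) * w * \<bar>s - s'\<bar>" using M(1) w0 by (simp add: algebra_simps)
  finally show "l2 lborel (\<lambda>x. \<chi>' (s, x) - \<chi>' (s', x)) \<le> (M + L) * w * \<bar>s - s'\<bar>" .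
 qed
qed

lemma test_slice_H1:
 fixes \<psi> :: "real \<times> 'a::euclidean_space \<Rightarrow> real"
 assumes \<psi>: "\<psi> \<in> \<D> (A \<times> S)" and S: "open S"
 obtains C where "C \<ge> 0" "\<And>s. H1_norm S (\<lambda>x. \<psi> (s, x)) \<le> C"
  "\<And>s s'. H1_norm S (\<lambda>x. \<psi> (s, x) - \<psi> (s', x)) \<le> C * \<bar>s - s'\<bar>"
proof -
 define Q where "Q f C \<longleftrightarrow> C \<ge> 0 \<and> (\<forall>s. l2 lborel (\<lambda>x. f (s, x)) \<le> C) \<and> (\<forall>s s'. l2 lborel (\<lambda>x. f (s, x) - f (s', x)) \<le> C * \<bar>s - s'\<bar>)"
  for f :: "real \<times> 'a \<Rightarrow> real" and C
 have ex: "\<exists>C. Q f C" if "f \<in> \<D> (A \<times> S)" for f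
  by (rule test_slice_l2[OF that]) (use Q_def in blast)
 obtain C0 where C0: "Q \<psi> C0" using ex[OF \<psi>] by blast
 have "\<exists>C. Q (pd (0, i) \<psi>) C" if "i \<in> Basis" for i by (intro ex test_partial_deriv \<psi> Basis_real_prod that)
 hence "\<forall>i\<in>Basis. \<exists>C. Q (pd (0, i) \<psi>) C" by blast
 then obtain C1 where C1: "\<And>i. i \<in> Basis \<Longrightarrow> Q (pd (0, i) \<psi>) (C1 i)" unfolding bchoice_iff by blast
 note sm = smooth_slice(1)[OF test_smooth[OF \<psi>]]
 have pd: "pd i (\<lambda>x. \<psi> (s, x)) = (\<lambda>x. pd (0, i) \<psi> (s, x))" if "i \<in> Basis" for i s
  using smooth_slice(2)[OF test_smooth[OF \<psi>] that] by blast
 show ?thesis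
 proof (rule that[of "C0 + (\<Sum>i\<in>Basis. C1 i)"])
  show "0 \<le> C0 + (\<Sum>i\<in>Basis. C1 i)" using C0 C1 by (intro add_nonneg_nonneg sum_nonneg) (auto simp: Q_def)
  fix s
  have "H1_norm S (\<lambda>x. \<psi> (s, x)) \<le> l2 lborel (\<lambda>x. \<psi> (s, x)) + (\<Sum>i\<in>Basis. l2 lborel (\<lambda>x. pd (0, i) \<psi> (s, x)))"
   using H1_norm_test_le[OF S test_slice[OF \<psi>], of s] by (simp add: pd cong: sum.cong)
  also have "\<dots> \<le> C0 + (\<Sum>i\<in>Basis. C1 i)" using C0 C1 by (intro add_mono sum_mono) (auto simp: Q_def)
  finally show "H1_norm S (\<lambda>x. \<psi> (s, x)) \<le> C0 + (\<Sum>i\<in>Basis. C1 i)" .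
  fix s'
  have "H1_norm S (\<lambda>x. \<psi> (s, x) - \<psi> (s', x)) \<le> l2 lborel (\<lambda>x. \<psi> (s, x) - \<psi> (s', x))
    + (\<Sum>i\<in>Basis. l2 lborel (\<lambda>x. pd (0, i) \<psi> (s, x) - pd (0, i) \<psi> (s', x)))"
   using H1_norm_test_le[OF S test_diff[OF test_slice[OF \<psi>] test_slice[OF \<psi>]], of s s']
   by (simp add: pd partial_deriv_diff_smooth[OF sm sm] cong: sum.cong)
  also have "\<dots> \<le> C0 * \<bar>s - s'\<bar> + (\<Sum>i\<in>Basis. C1 i * \<bar>s - s'\<bar>)" using C0 C1 by (intro add_mono sum_mono) (auto simp: Q_def)
  also have "\<dots> = (C0 + (\<Sum>i\<in>Basis. C1 i)) * \<bar>s - s'\<bar>" by (simp add: distrib_right sum_distrib_right)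
  finally show "H1_norm S (\<lambda>x. \<psi> (s, x) - \<psi> (s', x)) \<le> (C0 + (\<Sum>i\<in>Basis. C1 i)) * \<bar>s - s'\<bar>" .
 qed
qed

lemma Hm1_apply_diff:
 assumes S: "open S" and F: "F \<in> Hm1 S" and f: "f \<in> H10 S" and g: "g \<in> H10 S"
 shows "F (\<lambda>x. f x - g x) = F f - F g"
proof -
 have a: "\<forall>f\<in>H10 S. \<forall>g\<in>H10 S. F (\<lambda>x. f x + g x) = F f + F g" and c: "\<forall>c. \<forall>f\<in>H10 S. F (\<lambda>x. c * f x) = c * F f"
  using F by (simp_all add: Hm1_def)
 have "F (\<lambda>x. f x + (-1) * g x) = F f + F (\<lambda>x. (-1) * g x)" by (rule bspec[OF bspec[OF a f] H10_scale[OF S g]])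
 also have "F (\<lambda>x. (-1) * g x) = (-1) * F g" by (rule bspec[OF spec[OF c] g])
 finally show ?thesis by simp
qed

lemma Hm1_test_slice_lipschitz:
 assumes S: "open S" and F: "F \<in> Hm1 S" and \<psi>: "\<psi> \<in> \<D> (A \<times> S)"
  and C: "\<And>s s'. H1_norm S (\<lambda>x. \<psi> (s, x) - \<psi> (s', x)) \<le> C * \<bar>s - s'\<bar>"
 shows "\<bar>F (\<lambda>x. \<psi> (s, x)) - F (\<lambda>x. \<psi> (s', x))\<bar> \<le> Hm1_norm S F * (C * \<bar>s - s'\<bar>)"
proof -
 note t = test_slice[OF \<psi>]
 have "F (\<lambda>x. \<psi> (s, x)) - F (\<lambda>x. \<psi> (s', x)) = F (\<lambda>x. \<psi> (s, x) - \<psi> (s', x))"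
  by (rule Hm1_apply_diff[OF S F test_H10[OF S t] test_H10[OF S t], symmetric])
 hence "\<bar>F (\<lambda>x. \<psi> (s, x)) - F (\<lambda>x. \<psi> (s', x))\<bar> \<le> Hm1_norm S F * H1_norm S (\<lambda>x. \<psi> (s, x) - \<psi> (s', x))"
  by (simp only:) (rule Hm1_le[OF S F test_H10[OF S test_diff[OF t t]]])
 also have "\<dots> \<le> Hm1_norm S F * (C * \<bar>s - s'\<bar>)" by (rule mult_left_mono[OF C Hm1_norm_nonneg[OF S F]])
 finally show ?thesis .
qed

text \<open>The variant for functionals evaluated along a curve of test functions. Convergence in
  the dual norm gives convergence at every \<open>r\<close>, so the limit can be taken pointwise
  along the whole sequence.\<close>

lemma joint_representative_pointwise:
 fixes \<Phi> :: "'b \<Rightarrow> real \<Rightarrow> real" and y :: "real \<Rightarrow> real \<Rightarrow> real"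
 assumes J: "J \<in> sets borel" and s: "\<And>k::nat. simple_function (lebesgue_on J) (s k)"
  and m: "\<And>k t. t \<in> J \<Longrightarrow> \<Phi> (s k t) \<in> borel_measurable borel"
  and lim: "AE t in lebesgue_on J. \<forall>r. (\<lambda>k. \<Phi> (s k t) r) \<longlonglongrightarrow> y t r"
 obtains Y where "Y \<in> borel_measurable (borel \<Otimes>\<^sub>M borel)" "AE t in lborel. t \<in> J \<longrightarrow> (\<forall>r. y t r = Y (t, r))"
proof -
 have "\<forall>k. \<exists>s'. simple_function lborel s' \<and> (AE t in lborel. t \<in> J \<longrightarrow> s k t = s' t)"
  using simple_function_representative[OF J s] by metis
 then obtain s' where s': "\<And>k. simple_function lborel (s' k)" "\<And>k. AE t in lborel. t \<in> J \<longrightarrow> s k t = s' k t" by metis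
 define G where "G f = (if \<Phi> f \<in> borel_measurable borel then \<Phi> f else (\<lambda>_. 0))" for f
 have Gm[measurable]: "G f \<in> borel_measurable borel" for f by (simp add: G_def)
 define Yk where "Yk k p = G (s' k (fst p)) (snd p)" for k and p :: "real \<times> real"
 have Ykm[measurable]: "Yk k \<in> borel_measurable (borel \<Otimes>\<^sub>M borel)" for k
  unfolding Yk_def[abs_def] by (rule simple_function_case_borel[OF s'(1) Gm])
 show ?thesis
 proof (rule that[of "\<lambda>p. lim (\<lambda>k. Yk k p)"])
  show "(\<lambda>p. lim (\<lambda>k. Yk k p)) \<in> borel_measurable (borel \<Otimes>\<^sub>M borel)" by measurable
  have "AE t in lborel. \<forall>k. t \<in> J \<longrightarrow> s k t = s' k t" unfolding AE_all_countable using s'(2) by blast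
  moreover have "AE t in lborel. t \<in> J \<longrightarrow> (\<forall>r. (\<lambda>k. \<Phi> (s k t) r) \<longlonglongrightarrow> y t r)"
   using lim unfolding AE_lebesgue_on_iff[OF J] .
  ultimately show "AE t in lborel. t \<in> J \<longrightarrow> (\<forall>r. y t r = lim (\<lambda>k. Yk k (t, r)))"
  proof eventually_elim
   case (elim t)
   show ?case
   proof (intro impI allI)
    fix r assume t: "t \<in> J"
    have "Yk k (t, r) = \<Phi> (s k t) r" for k using elim(1) m[OF t, of k] t by (simp add: Yk_def G_def)
    hence "(\<lambda>k. Yk k (t, r)) \<longlonglongrightarrow> y t r" using elim(2) t by simp
    thus "y t r = lim (\<lambda>k. Yk k (t, r))" by (rule limI[symmetric])
   qed
  qed
 qed
qed

lemma integrable_lborel_iterated_bound: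
 fixes F :: "real \<times> 'a::euclidean_space \<Rightarrow> real"
 assumes F[measurable]: "F \<in> borel_measurable (borel \<Otimes>\<^sub>M borel)" and E: "integrable lborel E"
  and k: "integrable lborel k" "\<And>s. k s \<ge> 0"
  and le: "AE t in lborel. 0 \<le> E t \<and> (\<forall>s. \<bar>F (t, s)\<bar> \<le> E t * k s)"
 shows "integrable lborel F"
proof -
 have [measurable]: "E \<in> borel_measurable borel" "k \<in> borel_measurable borel" using E k by auto
 have "(\<integral>\<^sup>+p. ennreal \<bar>F p\<bar> \<partial>lborel) = (\<integral>\<^sup>+p. ennreal \<bar>F p\<bar> \<partial>(lborel \<Otimes>\<^sub>M lborel))" by (simp add: lborel_prod)
 also have "\<dots> = (\<integral>\<^sup>+t. (\<integral>\<^sup>+s. ennreal \<bar>F (t, s)\<bar> \<partial>lborel) \<partial>lborel)" by (subst lborel.nn_integral_fst[symmetric]) measurable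
 also have "\<dots> \<le> (\<integral>\<^sup>+t. ennreal (E t * (LBINT s. k s)) \<partial>lborel)"
 proof (rule nn_integral_mono_AE)
  show "AE t in lborel. (\<integral>\<^sup>+s. ennreal \<bar>F (t, s)\<bar> \<partial>lborel) \<le> ennreal (E t * (LBINT s. k s))"
   using le
  proof eventually_elim
   case (elim t)
   have "(\<integral>\<^sup>+s. ennreal \<bar>F (t, s)\<bar> \<partial>lborel) \<le> (\<integral>\<^sup>+s. ennreal (E t * k s) \<partial>lborel)"
    using elim by (intro nn_integral_mono ennreal_leI) simp
   also have "\<dots> = ennreal (LBINT s. E t * k s)"
    by (rule nn_integral_eq_integral) (use elim k in auto)
   finally show ?case by simp
  qed
 qed
 also have "\<dots> < \<infinity>"
 proof -
  have "(\<integral>\<^sup>+t. ennreal (E t * (LBINT s. k s)) \<partial>lborel) = ennreal (LBINT t. E t * (LBINT s. k s))"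
  proof (rule nn_integral_eq_integral)
   show "AE t in lborel. 0 \<le> E t * (LBINT s. k s)" using le by eventually_elim (simp add: k)
  qed (use E in simp)
  thus ?thesis by simp
 qed
 finally have fin: "(\<integral>\<^sup>+p. ennreal \<bar>F p\<bar> \<partial>lborel) < \<infinity>" .
 have "F \<in> borel_measurable lborel" using F by (simp add: borel_prod)
 thus ?thesis using fin by (intro integrableI_bounded) auto
qed

text \<open>Removes a doubling of variables. Within the width \<open>\<delta>\<close> of the
  mollifier, \<open>q (t, s)\<close> differs from \<open>q (t, t)\<close> by at most
  \<open>\<delta> * E t\<close>, so the integral over the diagonal is bounded by every small
  multiple of the integral of \<open>E\<close>.\<close>

lemma mollified_diagonal:
 fixes q :: "real \<times> real \<Rightarrow> real"
 assumes q[measurable]: "q \<in> borel_measurable (borel \<Otimes>\<^sub>M borel)" and E: "integrable lborel E"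
  and le: "AE t in lborel. 0 \<le> E t \<and> (\<forall>s. \<bar>q (t, s)\<bar> \<le> E t) \<and> (\<forall>s s'. \<bar>q (t, s) - q (t, s')\<bar> \<le> E t * \<bar>s - s'\<bar>)"
  and \<delta>0: "\<delta>0 > 0"
  and z: "\<And>\<delta>. 0 < \<delta> \<Longrightarrow> \<delta> < \<delta>0 \<Longrightarrow> (LBINT t. (LBINT s. q (t, s) * mollifier \<delta> (t - s))) = 0"
 shows "integrable lborel (\<lambda>t. q (t, t))" "(LBINT t. q (t, t)) = 0"
proof -
 have qt: "(\<lambda>t. q (t, t)) \<in> borel_measurable borel" by measurable
 show qi: "integrable lborel (\<lambda>t. q (t, t))"
 proof (rule integrable_bound[OF E])
  show "AE t in lborel. norm (q (t, t)) \<le> norm (E t)" using le by eventually_elim auto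
 qed (use qt in simp)
 have bd: "\<bar>LBINT t. q (t, t)\<bar> \<le> \<delta> * (LBINT t. E t)" if d: "0 < \<delta>" "\<delta> < \<delta>0" for \<delta>
 proof -
  let ?\<mu> = "mollifier \<delta> :: real \<Rightarrow> real"
  note t\<mu> = test_mollifier[OF d(1), where 'a=real]
  have [measurable]: "?\<mu> \<in> borel_measurable borel" by (rule test_borel[OF t\<mu>])
  have \<mu>i: "integrable lborel (\<lambda>s. ?\<mu> (t - s))" and \<mu>1: "(LBINT s. ?\<mu> (t - s)) = 1" for t
  proof -
   have e: "(\<lambda>s. ?\<mu> (t - s)) = (\<lambda>s. ?\<mu> (s + (- t)))"
    using mollifier_uminus[OF d(1), of "s - t" for s] by (simp add: fun_eq_iff)
   show "integrable lborel (\<lambda>s. ?\<mu> (t - s))" "(LBINT s. ?\<mu> (t - s)) = 1"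
    unfolding e using lborel_integral_translate[of ?\<mu> "- t"] test_integrable[OF t\<mu>] mollifier_integral[OF d(1), where 'a=real] by auto
  qed
  obtain M where M: "M > 0" "\<And>x. \<bar>?\<mu> x\<bar> \<le> M" using test_bounded[OF t\<mu>] by blast
  define A where "A t = (LBINT s. q (t, s) * ?\<mu> (t - s))" for t
  have [measurable]: "A \<in> borel_measurable borel" unfolding A_def[abs_def] by measurable
  have AE: "AE t in lborel. \<bar>A t - q (t, t)\<bar> \<le> \<delta> * E t"
   using le
  proof eventually_elim
   case (elim t)
   have i1: "integrable lborel (\<lambda>s. q (t, s) * ?\<mu> (t - s))"
   proof (rule integrable_bound[OF integrable_mult_right[OF \<mu>i[of t], of "E t"]])
    show "AE s in lborel. norm (q (t, s) * ?\<mu> (t - s)) \<le> norm (E t * ?\<mu> (t - s))"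
     using elim by (intro AE_I2) (auto simp: abs_mult intro!: mult_right_mono)
   qed measurable
   have i2: "integrable lborel (\<lambda>s. q (t, t) * ?\<mu> (t - s))" by (intro integrable_mult_right \<mu>i)
   have "A t - q (t, t) = (LBINT s. q (t, s) * ?\<mu> (t - s)) - (LBINT s. q (t, t) * ?\<mu> (t - s))"
    by (simp add: A_def \<mu>1)
   also have "\<dots> = (LBINT s. q (t, s) * ?\<mu> (t - s) - q (t, t) * ?\<mu> (t - s))"
    using i1 i2 by simp
   finally have "\<bar>A t - q (t, t)\<bar> \<le> (LBINT s. \<bar>q (t, s) * ?\<mu> (t - s) - q (t, t) * ?\<mu> (t - s)\<bar>)"
    using integral_abs_bound by simp
   also have "\<dots> \<le> (LBINT s. \<delta> * E t * ?\<mu> (t - s))"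
   proof (rule integral_mono)
    show "integrable lborel (\<lambda>s. \<bar>q (t, s) * ?\<mu> (t - s) - q (t, t) * ?\<mu> (t - s)\<bar>)"
     using i1 i2 by (intro integrable_abs integrable_diff)
    show "integrable lborel (\<lambda>s. \<delta> * E t * ?\<mu> (t - s))" by (intro integrable_mult_right \<mu>i)
    fix s
    have "\<bar>q (t, s) - q (t, t)\<bar> * ?\<mu> (t - s) \<le> \<delta> * E t * ?\<mu> (t - s)"
    proof (cases "\<bar>t - s\<bar> \<ge> \<delta>")
     case True
     thus ?thesis using mollifier_eq_0[OF d(1), of "t - s"] by simp
    next
     case False
     have "\<bar>q (t, s) - q (t, t)\<bar> \<le> E t * \<bar>s - t\<bar>" using elim by blast
     also have "\<dots> \<le> E t * \<delta>" using False elim by (intro mult_left_mono) auto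
     finally show ?thesis using mollifier_nonneg[OF d(1), of "t - s"] by (intro mult_right_mono) (auto simp: mult.commute)
    qed
    thus "\<bar>q (t, s) * ?\<mu> (t - s) - q (t, t) * ?\<mu> (t - s)\<bar> \<le> \<delta> * E t * ?\<mu> (t - s)"
     using mollifier_nonneg[OF d(1), of "t - s"] by (simp add: left_diff_distrib[symmetric] abs_mult)
   qed
   also have "\<dots> = \<delta> * E t" by (simp add: \<mu>1)
   finally show ?case .
  qed
  have Di: "integrable lborel (\<lambda>t. A t - q (t, t))"
   by (rule integrable_bound[OF integrable_mult_right[OF E, of \<delta>]])
    (measurable, use AE in eventually_elim, simp)
  hence Ai: "integrable lborel A" using integrable_add[OF Di qi] by simp
  have "(LBINT t. A t) = 0" unfolding A_def by (rule z[OF d])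
  hence "\<bar>LBINT t. q (t, t)\<bar> = \<bar>LBINT t. A t - q (t, t)\<bar>" using Ai qi by simp
  also have "\<dots> \<le> (LBINT t. \<bar>A t - q (t, t)\<bar>)" by (rule integral_abs_bound)
  also have "\<dots> \<le> (LBINT t. \<delta> * E t)" using Di E AE by (intro integral_mono_AE) auto
  finally show ?thesis by simp
 qed
 have "\<bar>LBINT t. q (t, t)\<bar> \<le> 0"
 proof (rule tendsto_lowerbound)
  show "((\<lambda>\<delta>. \<delta> * (LBINT t. E t)) \<longlongrightarrow> 0) (at_right 0)" by (auto intro!: tendsto_eq_intros)
  show "\<forall>\<^sub>F \<delta> in at_right 0. \<bar>LBINT t. q (t, t)\<bar> \<le> \<delta> * (LBINT t. E t)"
   using eventually_at_right_less[of "0::real"] eventually_at_right_real[OF \<delta>0]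
   by eventually_elim (use bd in auto)
 qed simp
 thus "(LBINT t. q (t, t)) = 0" by simp
qed

text \<open>The product rule in \<open>s\<close> for the pairing of the fixed slice \<open>f\<close>
  with \<open>\<psi> (s, x)\<close>, times \<open>m s\<close>. Compact support comes from
  \<open>\<psi>\<close>; the factor \<open>m\<close> will be a translated mollifier.\<close>

lemma slice_integral_by_parts:
 fixes f :: "'a::euclidean_space \<Rightarrow> real" and \<psi> :: "real \<times> 'a \<Rightarrow> real"
 assumes f: "sqint lborel f" and \<psi>: "\<psi> \<in> \<D> S"
  and m: "\<And>s. (m has_real_derivative m' s) (at s)" and M: "\<And>s. \<bar>m s\<bar> \<le> M" "\<And>s. \<bar>m' s\<bar> \<le> M"
 shows "(LBINT s. (LBINT x. f x * pd (1, 0) \<psi> (s, x)) * m s + (LBINT x. f x * \<psi> (s, x)) * m' s) = 0"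
proof -
 let ?\<psi>t = "pd (1, 0) \<psi>"
 note \<psi>t = test_partial_deriv[OF \<psi> Basis_real_prod(1)]
 obtain K where K: "compact K" "\<And>p. p \<notin> K \<Longrightarrow> \<psi> p = 0" using test_functionsE[OF \<psi>] by metis
 obtain K' where K': "compact K'" "\<And>p. p \<notin> K' \<Longrightarrow> ?\<psi>t p = 0" using test_functionsE[OF \<psi>t] by metis
 define X where "X = snd ` (K \<union> K')"
 have X: "compact X" unfolding X_def using K(1) K'(1) by (intro compact_continuous_image continuous_intros compact_Un)
 have z: "\<psi> (s, x) = 0" "?\<psi>t (s, x) = 0" if "x \<notin> X" for s x using that K(2)[of "(s, x)"] K'(2)[of "(s, x)"] unfolding X_def by force+
 define w where "w x = f x * indicator X x" for x
 have w: "integrable lborel w" unfolding w_def[abs_def]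
  using X emeasure_compact_finite[OF X] by (intro sqint_mult[OF f] sqint_indicator) (auto simp: borel_compact)
 have Y: "(\<lambda>x::'a. (0::real, x)) \<in> borel_measurable lborel" by simp
 define \<Phi> where "\<Phi> g p = (LBINT x. w x * g (p + (0, x)))" for g and p :: "real \<times> 'a"
 have c: "(LBINT x. f x * \<psi> (s, x)) = \<Phi> \<psi> (s, 0)" "(LBINT x. f x * ?\<psi>t (s, x)) = \<Phi> ?\<psi>t (s, 0)" for s
  unfolding \<Phi>_def w_def by (rule integral_cong[OF refl]; use z in \<open>auto simp: indicator_def\<close>)+
 note A = average_translates[OF w Y test_mono[OF \<psi> subset_UNIV], folded \<Phi>_def]
 have dm: "((\<lambda>s. \<Phi> \<psi> (s, 0) * m s) has_real_derivative \<Phi> ?\<psi>t (s, 0) * m s + \<Phi> \<psi> (s, 0) * m' s) (at s)" for s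
 proof -
  have "((\<lambda>s. \<Phi> \<psi> (0 + s *\<^sub>R (1, 0))) has_real_derivative \<Phi> ?\<psi>t (0 + s *\<^sub>R (1, 0))) (at s)"
   using has_partial_deriv[OF A(1) Basis_real_prod(1), of 0 s] unfolding A(2)[OF Basis_real_prod(1)] .
  from DERIV_mult[OF this m] show ?thesis by (simp add: algebra_simps)
 qed
 have bd: "\<exists>C\<ge>0. \<forall>p. \<bar>\<Phi> g p\<bar> \<le> C" if g: "g \<in> \<D> S" for g
 proof -
  obtain B where B: "B > 0" "\<And>x. \<bar>g x\<bar> \<le> B" using test_bounded[OF g] by metis
  have "\<bar>\<Phi> g p\<bar> \<le> (LBINT x. \<bar>w x\<bar> * B)" for p
   unfolding \<Phi>_def
   by (rule integral_abs_bound_integral[OF average_translates_integrable[OF w Y test_mono[OF g subset_UNIV]]])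
    (use w B(1) in \<open>auto simp: abs_mult intro!: mult_left_mono B(2)\<close>)
  thus ?thesis using B by (intro exI[of _ "LBINT x. \<bar>w x\<bar> * B"]) auto
 qed
 obtain B B' where B: "B \<ge> 0" "\<And>p. \<bar>\<Phi> \<psi> p\<bar> \<le> B" "B' \<ge> 0" "\<And>p. \<bar>\<Phi> ?\<psi>t p\<bar> \<le> B'" using bd[OF \<psi>] bd[OF \<psi>t] by metis
 have mul: "\<bar>a * b\<bar> \<le> C * M" if "\<bar>a\<bar> \<le> C" "\<bar>b\<bar> \<le> M" for a b C :: real
  unfolding abs_mult using that by (intro mult_mono) auto
 obtain R where R: "\<And>p. p \<in> K \<Longrightarrow> norm p \<le> R" using compact_imp_bounded[OF K(1)] unfolding bounded_iff by blast
 have \<Phi>z: "\<Phi> \<psi> (s, 0) = 0" if "\<bar>s\<bar> > \<bar>R\<bar>" for s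
 proof -
  have "\<psi> (s, x) = 0" for x
   using that R[of "(s, x)"] K(2)[of "(s, x)"] norm_fst_le[of s x] by fastforce
  thus ?thesis by (simp add: \<Phi>_def)
 qed
 have cont: "continuous_on UNIV (\<lambda>s. \<Phi> \<psi> (s, 0) * m s)"
  by (rule DERIV_continuous_on) (use dm has_field_derivative_at_within in blast)
 show ?thesis unfolding c
 proof (rule integral_directional_deriv_eq_0(1)[where f = "\<lambda>s. \<Phi> \<psi> (s, 0) * m s" and v = 1 and R = "\<bar>R\<bar>"])
  show "integrable lborel (\<lambda>s. \<Phi> \<psi> (s, 0) * m s)"
   by (rule bounded_support_integrable(1)[of "{-\<bar>R\<bar>..\<bar>R\<bar>}", OF _ _ _ mul[OF B(2) M(1)]])
    (use \<Phi>z borel_measurable_continuous_onI[OF cont] in auto)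
  show "((\<lambda>r. \<Phi> \<psi> (s + r *\<^sub>R 1, 0) * m (s + r *\<^sub>R 1)) has_real_derivative \<Phi> ?\<psi>t (s, 0) * m s + \<Phi> \<psi> (s, 0) * m' s) (at 0)" for s
   using DERIV_shift[of "\<lambda>s. \<Phi> \<psi> (s, 0) * m s" _ 0 s] dm[of s] by (simp add: add.commute)
  show "\<bar>\<Phi> ?\<psi>t (s, 0) * m s + \<Phi> \<psi> (s, 0) * m' s\<bar> \<le> B' * M + B * M" for s
   by (rule order_trans[OF abs_triangle_ineq]) (intro add_mono mul B M)
 qed (use \<Phi>z in auto)
qed

text \<open>\<open>is_time_deriv\<close> admits only products of a function of time and a function
  of space, but a general \<open>\<psi>\<close> is needed. The time argument is doubled: for frozen
  \<open>s\<close> the identity is used with \<open>\<psi> (s, x)\<close> in space and a mollifier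
  centred at \<open>s\<close> in time, then integrated over \<open>s\<close>; as the width tends to
  0 the diagonal remains.\<close>

lemma time_deriv_pairing:
 fixes \<Omega> :: "'a::euclidean_space set"
 assumes o: "open J" "open \<Omega>" and Jf: "emeasure lborel J < \<infinity>"
  and U: "represents J \<Omega> u U"
  and G: "G \<in> time_L2 J (Hm1 \<Omega>) (Hm1_norm \<Omega>)"
  and td: "is_time_deriv J \<Omega> (\<lambda>t. to_Hm1 \<Omega> (u t)) G"
  and \<psi>: "\<psi> \<in> \<D> (J \<times> \<Omega>)"
 shows "integrable (lebesgue_on J) (\<lambda>t. G t (\<lambda>x. \<psi> (t, x)))"
  and "(LBINT p. U p * pd (1, 0) \<psi> p) = - (\<integral>t. G t (\<lambda>x. \<psi> (t, x)) \<partial>lebesgue_on J)"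
proof -
 have J[measurable]: "J \<in> sets borel" and \<Omega>[measurable]: "\<Omega> \<in> sets borel" using o by auto
 let ?\<psi>t = "pd (1, 0) \<psi>" and ?v = "\<lambda>s x. \<psi> (s, x)"
 note \<psi>t = test_partial_deriv[OF \<psi> Basis_real_prod(1)]
 have v: "?v s \<in> \<D> \<Omega>" for s by (rule test_slice[OF \<psi>])
 have v10: "?v s \<in> H10 \<Omega>" for s by (rule test_H10[OF o(2) v])
 obtain C where C: "C \<ge> 0" "\<And>s. H1_norm \<Omega> (?v s) \<le> C" "\<And>s s'. H1_norm \<Omega> (\<lambda>x. \<psi> (s, x) - \<psi> (s', x)) \<le> C * \<bar>s - s'\<bar>"
  by (rule test_slice_H1[OF \<psi> o(2)]) blast
 obtain C0 where C0: "C0 \<ge> 0" "\<And>s. l2 lborel (?v s) \<le> C0" by (rule test_slice_l2[OF \<psi>]) blast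
 obtain C1 where C1: "C1 \<ge> 0" "\<And>s. l2 lborel (\<lambda>x. ?\<psi>t (s, x)) \<le> C1"
  "\<And>s s'. l2 lborel (\<lambda>x. ?\<psi>t (s, x) - ?\<psi>t (s', x)) \<le> C1 * \<bar>s - s'\<bar>" by (rule test_slice_l2[OF \<psi>t]) blast
 obtain K where K: "compact K" "K \<subseteq> J \<times> \<Omega>" "\<And>p. p \<notin> K \<Longrightarrow> \<psi> p = 0" using test_functionsE[OF \<psi>] by blast
 define K1 where "K1 = fst ` K"
 have K1: "compact K1" "K1 \<subseteq> J" unfolding K1_def using K(1,2) by (auto intro!: compact_continuous_image continuous_intros)
 have [measurable]: "K1 \<in> sets borel" using K1 by (simp add: borel_compact)
 have vz: "\<psi> (s, x) = 0" if "s \<notin> K1" for s x using that K(3)[of "(s, x)"] unfolding K1_def by force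
 \<comment> \<open>A mollifier of smaller width centred in the time projection \<open>K1\<close> of
   the support is a test function on \<open>J\<close>.\<close>
 obtain \<delta>0 where \<delta>0: "\<delta>0 > 0" "(\<Union>x\<in>K1. ball x \<delta>0) \<subseteq> J"
  using compact_subset_open_imp_ball_epsilon_subset[OF K1(1) o(1) K1(2)] by blast
 have Jae: "AE t in lebesgue_on J. t \<in> J" using AE_space[of "lebesgue_on J"] by simp
 obtain s where s: "\<And>k::nat. simple_function (lebesgue_on J) (s k)" "\<And>k t. t \<in> J \<Longrightarrow> s k t \<in> Hm1 \<Omega>"
  and lim: "AE t in lebesgue_on J. (\<lambda>k. Hm1_norm \<Omega> (\<lambda>v. s k t v - G t v)) \<longlonglongrightarrow> 0"
  using G unfolding time_L2_def strongly_measurable_def by blast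
 have GH: "AE t in lebesgue_on J. G t \<in> Hm1 \<Omega>" and Gi: "integrable (lebesgue_on J) (\<lambda>t. (Hm1_norm \<Omega> (G t))\<^sup>2)"
  using G by (auto simp: time_L2_def)
 have bm: "(\<lambda>r. s k t (?v r)) \<in> borel_measurable borel" if t: "t \<in> J" for k t
 proof (rule borel_measurable_continuous_onI)
  have "(Hm1_norm \<Omega> (s k t) * C)-lipschitz_on UNIV (\<lambda>r. s k t (?v r))"
   using Hm1_test_slice_lipschitz[OF o(2) s(2)[OF t] \<psi> C(3)] C(1) Hm1_norm_nonneg[OF o(2) s(2)[OF t]]
   by (intro lipschitz_onI) (auto simp: dist_real_def mult.assoc)
  thus "continuous_on UNIV (\<lambda>r. s k t (?v r))" by (rule lipschitz_on_continuous_on)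
 qed
 have limv: "AE t in lebesgue_on J. \<forall>r. (\<lambda>k. s k t (?v r)) \<longlonglongrightarrow> G t (?v r)"
  using Jae GH lim
 proof eventually_elim
  case (elim t)
  show ?case
  proof
   fix r
   have le: "norm (s k t (?v r) - G t (?v r)) \<le> Hm1_norm \<Omega> (\<lambda>v. s k t v - G t v) * C" for k
   proof -
    have H: "(\<lambda>v. s k t v - G t v) \<in> Hm1 \<Omega>" by (rule Hm1_diff[OF s(2)[OF elim(1)] elim(2)])
    have "\<bar>s k t (?v r) - G t (?v r)\<bar> \<le> Hm1_norm \<Omega> (\<lambda>v. s k t v - G t v) * H1_norm \<Omega> (?v r)"
     by (rule Hm1_le[OF o(2) H v10])
    also have "\<dots> \<le> Hm1_norm \<Omega> (\<lambda>v. s k t v - G t v) * C" by (intro mult_left_mono C Hm1_norm_nonneg o H)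
    finally show ?thesis by simp
   qed
   have "(\<lambda>k. Hm1_norm \<Omega> (\<lambda>v. s k t v - G t v) * C) \<longlonglongrightarrow> 0" using tendsto_mult_left_zero[OF elim(3)] .
   hence "(\<lambda>k. s k t (?v r) - G t (?v r)) \<longlonglongrightarrow> 0"
    by (rule Lim_null_comparison[rotated]) (rule always_eventually, rule allI, rule le)
   thus "(\<lambda>k. s k t (?v r)) \<longlonglongrightarrow> G t (?v r)" by (simp only: LIM_zero_iff)
  qed
 qed
 obtain Y where Y[measurable]: "Y \<in> borel_measurable (borel \<Otimes>\<^sub>M borel)"
  and YG: "AE t in lborel. t \<in> J \<longrightarrow> (\<forall>r. G t (?v r) = Y (t, r))"
  by (rule joint_representative_pointwise[where \<Phi> = "\<lambda>F r. F (?v r)" and y = "\<lambda>t r. G t (?v r)", OF J s(1) bm limv])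
 \<comment> \<open>Membership in \<open>time_L2\<close> gives measurability of the squared norm
   only; the square root recovers it for the norm.\<close>
 have nsq: "sqint (lebesgue_on J) (\<lambda>t. sqrt ((Hm1_norm \<Omega> (G t))\<^sup>2))"
  unfolding sqint_def using measurable_compose[OF borel_measurable_integrable[OF Gi] borel_measurable_sqrt] Gi
  by (simp del: real_sqrt_abs)
 obtain e where e: "sqint lborel e" "\<And>t. t \<notin> J \<Longrightarrow> e t = 0"
  "AE t in lebesgue_on J. sqrt ((Hm1_norm \<Omega> (G t))\<^sup>2) = e t"
  "l2 (lebesgue_on J) (\<lambda>t. sqrt ((Hm1_norm \<Omega> (G t))\<^sup>2)) = l2 lborel e"
 proof (rule sqint_representative[OF J nsq], goal_cases)
  case (1 g)
  show ?case by (rule 1(1)[OF 1(2) _ 1(4,5)]) (rule 1(3))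
 qed
 have Usq: "sqint lborel U" by (rule representsD[OF U])
 define a where "a t = l2 lborel (\<lambda>x. U (t, x))" for t
 have a: "sqint lborel a" unfolding a_def[abs_def] by (rule sqint_iterated(2)[OF Usq])
 have a0: "a t \<ge> 0" for t by (simp add: a_def l2_nonneg)
 have Uz: "U (t, x) = 0" if "t \<notin> J" for t x by (rule representsD(2)[OF U]) (use that in auto)
 have az: "a t = 0" if "t \<notin> J" for t using Uz[OF that] by (simp add: a_def l2_def)
 have [measurable]: "U \<in> borel_measurable (borel \<Otimes>\<^sub>M borel)" using Usq by (simp add: sqint_def borel_prod)
 have [measurable]: "\<psi> \<in> borel_measurable (borel \<Otimes>\<^sub>M borel)" "?\<psi>t \<in> borel_measurable (borel \<Otimes>\<^sub>M borel)"
  using test_borel[OF \<psi>] test_borel[OF \<psi>t] by (simp_all add: borel_prod)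
 have Jsq: "sqint lborel (indicator J :: real \<Rightarrow> real)" using Jf by (intro sqint_indicator) auto
 have fin: "integrable lborel (\<lambda>t. \<bar>f t\<bar>)" if "sqint lborel f" "\<And>t. t \<notin> J \<Longrightarrow> f t = 0" for f :: "real \<Rightarrow> real"
 proof -
  have "(\<lambda>t. \<bar>f t\<bar>) = (\<lambda>t. \<bar>f t * indicator J t\<bar>)" using that(2) by (auto simp: indicator_def fun_eq_iff)
  thus ?thesis using sqint_mult[OF that(1) Jsq] by simp
 qed
 define D where "D = C + C0 + C1"
 have D: "D \<ge> 0" "C \<le> D" "C0 \<le> D" "C1 \<le> D" using C(1) C0(1) C1(1) by (auto simp: D_def)
 \<comment> \<open>Common integrable majorant: \<open>a\<close> is the norm of the slice of
   \<open>U\<close>, \<open>e\<close> a Borel version of the dual norm of \<open>G t\<close>, and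
   \<open>D\<close> bounds the slices of \<open>\<psi>\<close> and their Lipschitz
   constants.\<close>
 define E where "E t = D * (a t + \<bar>e t\<bar>)" for t
 have Ei: "integrable lborel E" unfolding E_def[abs_def]
  using fin[OF a az] fin[OF e(1,2)] a0 by simp
 \<comment> \<open>The slice of \<open>U\<close> at the first time is paired with
   \<open>\<psi>\<close> in \<open>c\<close>, and with its time derivative in \<open>c1\<close>, at
   the second time; \<open>h\<close> is \<open>G\<close> at the first time applied to
   \<open>\<psi>\<close> at the second. The claim is that \<open>c1 + h\<close> integrates to 0 over
   the diagonal.\<close>
 define c where "c p = (LBINT x. U (fst p, x) * \<psi> (snd p, x))" for p
 define c1 where "c1 p = (LBINT x. U (fst p, x) * ?\<psi>t (snd p, x))" for p
 define h where "h p = indicator J (fst p) * Y p" for p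
 have [measurable]: "c \<in> borel_measurable (borel \<Otimes>\<^sub>M borel)" "c1 \<in> borel_measurable (borel \<Otimes>\<^sub>M borel)" "h \<in> borel_measurable (borel \<Otimes>\<^sub>M borel)"
  unfolding c_def[abs_def] c1_def[abs_def] h_def[abs_def] by measurable
 define dom where "dom t \<longleftrightarrow> 0 \<le> E t \<and> sqint lborel (\<lambda>x. U (t, x)) \<and>
   (\<forall>s. \<bar>h (t, s)\<bar> \<le> D * \<bar>e t\<bar> \<and> \<bar>c (t, s)\<bar> \<le> D * a t \<and> \<bar>c1 (t, s)\<bar> \<le> D * a t \<and> (s \<notin> K1 \<longrightarrow> h (t, s) = 0 \<and> c (t, s) = 0)) \<and>
   (\<forall>s s'. \<bar>h (t, s) - h (t, s')\<bar> \<le> D * \<bar>e t\<bar> * \<bar>s - s'\<bar> \<and> \<bar>c1 (t, s) - c1 (t, s')\<bar> \<le> D * a t * \<bar>s - s'\<bar>)" for t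
 have domAE: "AE t in lborel. dom t"
 proof -
  have GH': "AE t in lborel. t \<in> J \<longrightarrow> G t \<in> Hm1 \<Omega>" using GH unfolding AE_lebesgue_on_iff[OF J] .
  have e': "AE t in lborel. t \<in> J \<longrightarrow> sqrt ((Hm1_norm \<Omega> (G t))\<^sup>2) = e t" using e(3) unfolding AE_lebesgue_on_iff[OF J] .
  show ?thesis
   using GH' e' YG sqint_iterated(1)[OF Usq]
  proof eventually_elim
   case (elim t)
   have sl: "sqint lborel (\<lambda>x. g (s, x))" if "g \<in> \<D> (J \<times> \<Omega>)" for g s
    by (rule test_sqint[OF test_slice[OF that]])
   have cs: "\<bar>LBINT x. U (t, x) * g x\<bar> \<le> D * B * a t" if "sqint lborel g" "l2 lborel g \<le> D * B" for g B
   proof -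
    have "\<bar>LBINT x. U (t, x) * g x\<bar> \<le> a t * l2 lborel g" unfolding a_def by (rule Cauchy_Schwarz_l2[OF elim(4) that(1)])
    also have "\<dots> \<le> a t * (D * B)" using that(2) a0 by (rule mult_left_mono)
    finally show ?thesis by (simp add: mult.commute)
   qed
   have 1: "\<bar>c (t, s)\<bar> \<le> D * a t" "\<bar>c1 (t, s)\<bar> \<le> D * a t" for s
    using cs[OF sl[OF \<psi>], of s 1] cs[OF sl[OF \<psi>t], of s 1] C0(2)[of s] C1(2)[of s] D by (auto simp: c_def c1_def)
   have 2: "\<bar>c1 (t, s) - c1 (t, s')\<bar> \<le> D * a t * \<bar>s - s'\<bar>" for s s'
   proof -
    have "c1 (t, s) - c1 (t, s') = (LBINT x. U (t, x) * (?\<psi>t (s, x) - ?\<psi>t (s', x)))"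
     using sqint_mult[OF elim(4) sl[OF \<psi>t]] by (simp add: c1_def right_diff_distrib)
    moreover have "l2 lborel (\<lambda>x. ?\<psi>t (s, x) - ?\<psi>t (s', x)) \<le> D * \<bar>s - s'\<bar>"
     using C1(3)[of s s'] mult_right_mono[OF D(4), of "\<bar>s - s'\<bar>"] by linarith
    ultimately show ?thesis
     using cs[OF sqint_diff[OF sl[OF \<psi>t] sl[OF \<psi>t]], of s s' "\<bar>s - s'\<bar>"] by (simp add: mult_ac)
   qed
   have 3: "c (t, s) = 0" if "s \<notin> K1" for s using vz[OF that] by (simp add: c_def)
   have 4: "\<bar>h (t, s)\<bar> \<le> D * \<bar>e t\<bar>" "\<bar>h (t, s) - h (t, s')\<bar> \<le> D * \<bar>e t\<bar> * \<bar>s - s'\<bar>" "s \<notin> K1 \<Longrightarrow> h (t, s) = 0" for s s'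
   proof -
    have "\<bar>h (t, s)\<bar> \<le> D * \<bar>e t\<bar> \<and> \<bar>h (t, s) - h (t, s')\<bar> \<le> D * \<bar>e t\<bar> * \<bar>s - s'\<bar> \<and> (s \<notin> K1 \<longrightarrow> h (t, s) = 0)"
    proof (cases "t \<in> J")
     case False
     thus ?thesis using D by (simp add: h_def)
    next
     case True
     hence F: "G t \<in> Hm1 \<Omega>" and et: "\<bar>e t\<bar> = Hm1_norm \<Omega> (G t)" and hY: "h (t, s) = G t (?v s)" for s
      using elim Hm1_norm_nonneg[OF o(2), of "G t"] by (auto simp: h_def)
     have "\<bar>G t (?v s)\<bar> \<le> \<bar>e t\<bar> * H1_norm \<Omega> (?v s)" unfolding et by (rule Hm1_le[OF o(2) F v10])
     also have "\<dots> \<le> \<bar>e t\<bar> * D" using C(2)[of s] D by (intro mult_left_mono) auto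
     finally have b: "\<bar>G t (?v s)\<bar> \<le> D * \<bar>e t\<bar>" by (simp add: mult.commute)
     have "\<bar>G t (?v s) - G t (?v s')\<bar> \<le> \<bar>e t\<bar> * (C * \<bar>s - s'\<bar>)"
      unfolding et by (rule Hm1_test_slice_lipschitz[OF o(2) F \<psi> C(3)])
     also have "\<dots> \<le> \<bar>e t\<bar> * (D * \<bar>s - s'\<bar>)" by (intro mult_left_mono mult_right_mono D) auto
     finally have l: "\<bar>G t (?v s) - G t (?v s')\<bar> \<le> D * \<bar>e t\<bar> * \<bar>s - s'\<bar>" by (simp add: mult_ac)
     have "G t (?v s) = 0" if "s \<notin> K1"
     proof -
      have "\<bar>G t (\<lambda>x. 0)\<bar> \<le> Hm1_norm \<Omega> (G t) * H1_norm \<Omega> (\<lambda>x. 0)"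
       by (rule Hm1_le[OF o(2) F test_H10[OF o(2) test_zero]])
      thus ?thesis using vz[OF that] H1_norm_scale(2)[OF o(2) test_H1(1)[OF o(2) test_zero], of 0] by simp
     qed
     thus ?thesis using b l unfolding hY by blast
    qed
    thus "\<bar>h (t, s)\<bar> \<le> D * \<bar>e t\<bar>" "\<bar>h (t, s) - h (t, s')\<bar> \<le> D * \<bar>e t\<bar> * \<bar>s - s'\<bar>" "s \<notin> K1 \<Longrightarrow> h (t, s) = 0" by auto
   qed
   have "0 \<le> E t" using D(1) a0 by (simp add: E_def)
   thus "dom t" unfolding dom_def using elim(4) 1 2 3 4 by blast
  qed
 qed
 define q where "q p = c1 p + h p" for p
 have qm[measurable]: "q \<in> borel_measurable (borel \<Otimes>\<^sub>M borel)" unfolding q_def[abs_def] by measurable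
 have hE: "\<bar>h (t, s)\<bar> \<le> E t" "\<bar>c (t, s)\<bar> \<le> E t" "\<bar>c1 (t, s)\<bar> \<le> E t" if "dom t" for t s
 proof -
  have "D * \<bar>e t\<bar> \<le> E t" "D * a t \<le> E t" using D(1) a0 by (auto simp: E_def distrib_left)
  thus "\<bar>h (t, s)\<bar> \<le> E t" "\<bar>c (t, s)\<bar> \<le> E t" "\<bar>c1 (t, s)\<bar> \<le> E t"
   using that unfolding dom_def by (meson order_trans)+
 qed
 have qle: "AE t in lborel. 0 \<le> E t \<and> (\<forall>s. \<bar>q (t, s)\<bar> \<le> E t) \<and> (\<forall>s s'. \<bar>q (t, s) - q (t, s')\<bar> \<le> E t * \<bar>s - s'\<bar>)"
  using domAE
 proof eventually_elim
  case (elim t)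
  have "\<bar>q (t, s)\<bar> \<le> E t" for s
  proof -
   have "\<bar>h (t, s)\<bar> \<le> D * \<bar>e t\<bar>" "\<bar>c1 (t, s)\<bar> \<le> D * a t" using elim unfolding dom_def by blast+
   thus ?thesis by (simp add: q_def E_def distrib_left)
  qed
  moreover have "\<bar>q (t, s) - q (t, s')\<bar> \<le> E t * \<bar>s - s'\<bar>" for s s'
  proof -
   have "\<bar>h (t, s) - h (t, s')\<bar> \<le> D * \<bar>e t\<bar> * \<bar>s - s'\<bar>" "\<bar>c1 (t, s) - c1 (t, s')\<bar> \<le> D * a t * \<bar>s - s'\<bar>"
    using elim unfolding dom_def by blast+
   moreover have "E t * \<bar>s - s'\<bar> = D * a t * \<bar>s - s'\<bar> + D * \<bar>e t\<bar> * \<bar>s - s'\<bar>" by (simp add: E_def algebra_simps)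
   moreover have "\<bar>q (t, s) - q (t, s')\<bar> \<le> \<bar>c1 (t, s) - c1 (t, s')\<bar> + \<bar>h (t, s) - h (t, s')\<bar>"
    unfolding q_def by arith
   ultimately show ?thesis by linarith
  qed
  ultimately show ?case using elim unfolding dom_def by blast
 qed
 have z: "(LBINT t. (LBINT s. q (t, s) * mollifier \<delta> (t - s))) = 0" if d: "0 < \<delta>" "\<delta> < \<delta>0" for \<delta>
 proof -
  let ?\<mu> = "mollifier \<delta> :: real \<Rightarrow> real" and ?\<mu>' = "pd 1 (mollifier \<delta> :: real \<Rightarrow> real)"
  note t\<mu> = test_mollifier[OF d(1), where 'a=real]
  have t\<mu>': "?\<mu>' \<in> \<D> UNIV" by (rule test_partial_deriv[OF t\<mu>]) simp
  have [measurable]: "?\<mu> \<in> borel_measurable borel" "?\<mu>' \<in> borel_measurable borel" by (rule test_borel[OF t\<mu>] test_borel[OF t\<mu>'])+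
  obtain M1 where M1: "M1 > 0" "\<And>x. \<bar>?\<mu> x\<bar> \<le> M1" using test_bounded[OF t\<mu>] by blast
  obtain M2 where M2: "M2 > 0" "\<And>x. \<bar>?\<mu>' x\<bar> \<le> M2" using test_bounded[OF t\<mu>'] by blast
  define M where "M = M1 + M2"
  have M: "M > 0" "\<And>x. \<bar>?\<mu> x\<bar> \<le> M" "\<And>x. \<bar>?\<mu>' x\<bar> \<le> M"
   using M1 M2 by (auto simp: M_def intro: order_trans[OF M1(2)] order_trans[OF M2(2)])
  have d\<mu>: "(?\<mu> has_real_derivative ?\<mu>' x) (at x)" for x
   using has_partial_deriv[OF test_smooth[OF t\<mu>], of 1 0 x] by simp
  \<comment> \<open>For fixed \<open>s\<close> its integral over \<open>t\<close> vanishes by the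
    definition of the weak time derivative. For fixed \<open>t\<close> its integral over
    \<open>s\<close> equals that of \<open>q\<close> times the mollifier, by parts in
    \<open>s\<close>. Fubini joins the two.\<close>
  define P where "P p = h p * ?\<mu> (fst p - snd p) + c p * ?\<mu>' (fst p - snd p)" for p
  have Pm[measurable]: "P \<in> borel_measurable (borel \<Otimes>\<^sub>M borel)" unfolding P_def[abs_def] by measurable
  have bdE: "\<bar>g * m\<bar> \<le> B * M" if "\<bar>g\<bar> \<le> B" "\<bar>m\<bar> \<le> M" for g m B :: real
   using mult_mono[OF that] that by (auto simp: abs_mult)
  have B: "(LBINT t. P (t, s)) = 0" for s
  proof (cases "s \<in> K1")
   case False
   have "AE t in lborel. P (t, s) = 0" using domAE
    by eventually_elim (use False in \<open>auto simp: dom_def P_def\<close>)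
   thus ?thesis by (rule integral_eq_zero_AE)
  next
   case True
   let ?\<phi> = "\<lambda>t. ?\<mu> (t - s)"
   have dphi: "(?\<phi> has_real_derivative ?\<mu>' (t - s)) (at t)" for t
    using DERIV_shift[of ?\<mu> "?\<mu>' (t - s)" t "- s"] d\<mu>[of "t - s"] by (simp add: add.commute)
   have \<phi>: "?\<phi> \<in> \<D> J"
   proof (rule test_functionsI[of _ "cball s \<delta>"])
    show "smooth ?\<phi>" using test_smooth[OF test_translate[OF t\<mu>, of "- s"]] by (simp add: add.commute)
    show "cball s \<delta> \<subseteq> J" using \<delta>0(2) True d by (force simp: subset_iff)
    show "?\<phi> x = 0" if "x \<notin> cball s \<delta>" for x
     by (rule mollifier_eq_0[OF d(1)]) (use that in \<open>auto simp: dist_real_def\<close>)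
   qed simp
   have i1: "integrable lborel (\<lambda>t. h (t, s) * ?\<mu> (t - s))" and i2: "integrable lborel (\<lambda>t. c (t, s) * ?\<mu>' (t - s))"
    by (rule integrable_bound[OF integrable_mult_left[OF Ei, of M]],
      measurable, use domAE in eventually_elim, use bdE hE M in \<open>force simp: dom_def\<close>)+
   have "(\<integral>t. to_Hm1 \<Omega> (u t) (?v s) * deriv ?\<phi> t \<partial>lebesgue_on J) = - (\<integral>t. G t (?v s) * ?\<phi> t \<partial>lebesgue_on J)"
    using td \<phi> v10[of s] unfolding is_time_deriv_def by blast
   moreover have "(\<integral>t. to_Hm1 \<Omega> (u t) (?v s) * deriv ?\<phi> t \<partial>lebesgue_on J) = (LBINT t. c (t, s) * ?\<mu>' (t - s))"
   proof -
    have "AE t in lebesgue_on J. to_Hm1 \<Omega> (u t) (?v s) * deriv ?\<phi> t = c (t, s) * ?\<mu>' (t - s)"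
     unfolding AE_lebesgue_on_iff[OF J] using representsD(4)[OF U]
    proof eventually_elim
     case (elim t)
     show ?case
     proof
      assume t: "t \<in> J"
      have "to_Hm1 \<Omega> (u t) (?v s) = c (t, s)" unfolding to_Hm1_def c_def fst_conv snd_conv
       by (rule lebesgue_on_pairing[OF \<Omega>]) (use elim t representsD(2,3)[OF U] test_borel[OF v] in auto)
      thus "to_Hm1 \<Omega> (u t) (?v s) * deriv ?\<phi> t = c (t, s) * ?\<mu>' (t - s)" using DERIV_imp_deriv[OF dphi] by simp
     qed
    qed
    hence "(\<integral>t. to_Hm1 \<Omega> (u t) (?v s) * deriv ?\<phi> t \<partial>lebesgue_on J) = (LBINT t. indicator J t * (c (t, s) * ?\<mu>' (t - s)))"
     by (rule lebesgue_on_AE_eq(3)[OF J, rotated]) measurable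
    also have "(\<lambda>t. indicator J t * (c (t, s) * ?\<mu>' (t - s))) = (\<lambda>t. c (t, s) * ?\<mu>' (t - s))"
     using Uz by (auto simp: indicator_def c_def fun_eq_iff)
    finally show ?thesis .
   qed
   moreover have "(\<integral>t. G t (?v s) * ?\<phi> t \<partial>lebesgue_on J) = (LBINT t. h (t, s) * ?\<mu> (t - s))"
   proof -
    have "AE t in lebesgue_on J. G t (?v s) * ?\<phi> t = Y (t, s) * ?\<mu> (t - s)"
     unfolding AE_lebesgue_on_iff[OF J] using YG by eventually_elim simp
    hence "(\<integral>t. G t (?v s) * ?\<phi> t \<partial>lebesgue_on J) = (LBINT t. indicator J t * (Y (t, s) * ?\<mu> (t - s)))"
     by (rule lebesgue_on_AE_eq(3)[OF J, rotated]) measurable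
    thus ?thesis by (simp add: h_def mult.assoc)
   qed
   ultimately show ?thesis unfolding P_def fst_conv snd_conv using i1 i2 by simp
  qed
  have Pi: "integrable lborel P"
  proof (rule integrable_lborel_iterated_bound)
   show "integrable lborel (\<lambda>t. 2 * M * E t)" using Ei by simp
   show "integrable lborel (indicator K1 :: real \<Rightarrow> real)"
    using emeasure_compact_finite[OF K1(1)] by (intro integrable_real_indicator) auto
   show "AE t in lborel. 0 \<le> 2 * M * E t \<and> (\<forall>s. \<bar>P (t, s)\<bar> \<le> 2 * M * E t * indicator K1 s)"
    using domAE
   proof eventually_elim
    case (elim t)
    have "\<bar>P (t, s)\<bar> \<le> 2 * M * E t * indicator K1 s" for s
    proof (cases "s \<in> K1")
     case False
     thus ?thesis using elim by (simp add: P_def dom_def)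
    next
     case True
     have "\<bar>P (t, s)\<bar> \<le> \<bar>h (t, s) * ?\<mu> (t - s)\<bar> + \<bar>c (t, s) * ?\<mu>' (t - s)\<bar>" unfolding P_def fst_conv snd_conv by (rule abs_triangle_ineq)
     also have "\<dots> \<le> E t * M + E t * M" by (intro add_mono bdE hE elim M)
     finally show ?thesis using True by simp
    qed
    thus ?case using elim M by (simp add: dom_def)
   qed
  qed (use Pm in auto)
  have "(LBINT t. (LBINT s. q (t, s) * ?\<mu> (t - s))) = (LBINT t. (LBINT s. P (t, s)))"
  proof (rule integral_cong_AE)
   show "AE t in lborel. (LBINT s. q (t, s) * ?\<mu> (t - s)) = (LBINT s. P (t, s))"
    using domAE
   proof eventually_elim
    case (elim t)
    have shift: "integrable lborel (\<lambda>s. f (t - s))" if f: "f \<in> \<D> UNIV" for f :: "real \<Rightarrow> real"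
     using lborel_integrable_real_affine[OF test_integrable[OF f], of "-1" t] by simp
    have bi: "integrable lborel (\<lambda>s. g s * f (t - s))"
     if f: "f \<in> \<D> UNIV" and g[measurable]: "g \<in> borel_measurable borel" and le: "\<And>s. \<bar>g s\<bar> \<le> E t" for f g :: "real \<Rightarrow> real"
    proof (rule integrable_bound[OF integrable_mult_right[OF shift[OF f], of "E t"]])
     have [measurable]: "f \<in> borel_measurable borel" by (rule test_borel[OF f])
     show "(\<lambda>s. g s * f (t - s)) \<in> borel_measurable lborel" by measurable
     show "AE s in lborel. norm (g s * f (t - s)) \<le> norm (E t * f (t - s))"
      using le by (intro AE_I2) (auto simp: abs_mult intro!: mult_right_mono order_trans[OF le])
    qed
    have i: "integrable lborel (\<lambda>s. h (t, s) * ?\<mu> (t - s))" "integrable lborel (\<lambda>s. c (t, s) * ?\<mu>' (t - s))"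
     "integrable lborel (\<lambda>s. c1 (t, s) * ?\<mu> (t - s))"
     by (rule bi[OF t\<mu> _ hE(1)[OF elim]] bi[OF t\<mu>' _ hE(2)[OF elim]] bi[OF t\<mu> _ hE(3)[OF elim]], measurable)+
    have "(LBINT s. c1 (t, s) * ?\<mu> (t - s) + c (t, s) * (- ?\<mu>' (t - s))) = 0"
     unfolding c_def c1_def fst_conv snd_conv
    proof (rule slice_integral_by_parts[OF _ \<psi>])
     show "sqint lborel (\<lambda>x. U (t, x))" using elim by (simp add: dom_def)
     show "((\<lambda>s. ?\<mu> (t - s)) has_real_derivative - ?\<mu>' (t - s)) (at s)" for s
     proof -
      have "((\<lambda>s. t - s) has_real_derivative - 1) (at s)" by (auto intro!: derivative_eq_intros)
      from DERIV_chain2[OF d\<mu> this] show ?thesis by simp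
     qed
     show "\<bar>?\<mu> (t - s)\<bar> \<le> M" "\<bar>- ?\<mu>' (t - s)\<bar> \<le> M" for s using M by auto
    qed measurable
    hence A: "(LBINT s. c1 (t, s) * ?\<mu> (t - s)) = (LBINT s. c (t, s) * ?\<mu>' (t - s))" using i by simp
    show ?case unfolding P_def q_def fst_conv snd_conv distrib_right using i A by simp
   qed
  qed measurable
  also have "\<dots> = (LBINT s. (LBINT t. P (t, s)))"
   using lborel_pair.Fubini_integral[of "\<lambda>t s. P (t, s)"] Pi by (simp add: lborel_prod)
  finally show ?thesis by (simp add: B)
 qed
 note diag = mollified_diagonal[OF qm Ei qle \<delta>0(1) z]
 have U\<psi>: "integrable lborel (\<lambda>p. U p * ?\<psi>t p)" by (rule sqint_mult[OF Usq test_sqint[OF \<psi>t]])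
 have ci: "integrable lborel (\<lambda>t. c1 (t, t))" "(LBINT p. U p * ?\<psi>t p) = (LBINT t. c1 (t, t))"
  unfolding c1_def fst_conv snd_conv by (rule lborel_integral_iterated[OF U\<psi>])+
 have hi: "integrable lborel (\<lambda>t. h (t, t))" using integrable_diff[OF diag(1) ci(1)] by (simp add: q_def)
 have h0: "(LBINT t. c1 (t, t)) + (LBINT t. h (t, t)) = 0" using diag(2) ci(1) hi by (simp add: q_def)
 have ae: "AE t in lebesgue_on J. G t (?v t) = Y (t, t)" unfolding AE_lebesgue_on_iff[OF J] using YG by eventually_elim simp
 have Ym: "(\<lambda>t. Y (t, t)) \<in> borel_measurable borel" by measurable
 note L = lebesgue_on_AE_eq[OF J Ym ae]
 show "integrable (lebesgue_on J) (\<lambda>t. G t (?v t))" unfolding L(2) using hi by (simp add: h_def)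
 show "(LBINT p. U p * ?\<psi>t p) = - (\<integral>t. G t (?v t) \<partial>lebesgue_on J)"
  unfolding L(3) ci(2) using h0 by (simp add: h_def)
qed

section \<open>The heat operator\<close>

lemma Hm1_norm_dist_le:
 assumes S: "open S" and F: "F \<in> Hm1 S" and H: "H \<in> Hm1 S"
  and K: "\<And>f. f \<in> H10 S \<Longrightarrow> H1_norm S f \<le> 1 \<Longrightarrow> \<bar>F f - H f\<bar> \<le> K"
 shows "\<bar>Hm1_norm S F - Hm1_norm S H\<bar> \<le> K"
proof -
 have "Hm1_norm S F' \<le> Hm1_norm S H' + K"
  if H': "H' \<in> Hm1 S" and K: "\<And>f. f \<in> H10 S \<Longrightarrow> H1_norm S f \<le> 1 \<Longrightarrow> \<bar>F' f - H' f\<bar> \<le> K" for F' H'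
 proof (rule Hm1_norm_le[OF S])
  fix f assume f: "f \<in> H10 S" "H1_norm S f \<le> 1"
  have "\<bar>H' f\<bar> \<le> Hm1_norm S H' * H1_norm S f" by (rule Hm1_le[OF S H' f(1)])
  also have "\<dots> \<le> Hm1_norm S H' * 1" by (rule mult_left_mono[OF f(2) Hm1_norm_nonneg[OF S H']])
  finally show "\<bar>F' f\<bar> \<le> Hm1_norm S H' + K" using K[OF f] by linarith
 qed
 from this[OF H K] this[OF F, of H] K show ?thesis by (smt (verit) abs_minus_commute)
qed

text \<open>Only the square of the norm is integrable by definition; nonnegativity makes the norm
  the square root of it, hence measurable.\<close>

lemma time_L2_sqint:
 assumes J: "J \<in> sets borel" and n: "integrable (lebesgue_on J) (\<lambda>t. (n t)\<^sup>2)" "AE t in lebesgue_on J. n t \<ge> 0"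
 shows "sqint (lebesgue_on J) n"
proof -
 have m: "(\<lambda>t. sqrt ((n t)\<^sup>2)) \<in> borel_measurable (lebesgue_on J)"
  by (rule measurable_compose[OF borel_measurable_integrable[OF n(1)] borel_measurable_sqrt])
 have "AE t in lebesgue_on J. n t = sqrt ((n t)\<^sup>2)" using n(2) by eventually_elim simp
 hence "n \<in> borel_measurable (lebesgue_on J)" by (rule lebesgue_on_measurable_AE[OF J m])
 thus ?thesis using n(1) by (simp add: sqint_def)
qed

lemma time_deriv_time_H1_Hm1:
 assumes "u \<in> time_H1_Hm1 J S"
 shows "time_deriv J S (\<lambda>t. to_Hm1 S (u t)) \<in> time_L2 J (Hm1 S) (Hm1_norm S)"
  and "is_time_deriv J S (\<lambda>t. to_Hm1 S (u t)) (time_deriv J S (\<lambda>t. to_Hm1 S (u t)))"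
proof -
 have "\<exists>G. G \<in> time_L2 J (Hm1 S) (Hm1_norm S) \<and> is_time_deriv J S (\<lambda>t. to_Hm1 S (u t)) G"
  using assms unfolding time_H1_Hm1_def by blast
 from someI_ex[OF this] show "time_deriv J S (\<lambda>t. to_Hm1 S (u t)) \<in> time_L2 J (Hm1 S) (Hm1_norm S)"
  "is_time_deriv J S (\<lambda>t. to_Hm1 S (u t)) (time_deriv J S (\<lambda>t. to_Hm1 S (u t)))"
  unfolding time_deriv_def by auto
qed

text \<open>The integral of a nonintegrable function is 0 by convention, so the norm of
  \<open>Lu\<close> carries information only once its square is known to be integrable.
  Measurability comes from simple approximations of the time derivative in \<open>Hm1\<close> and of
  \<open>u\<close> in \<open>H1\<close>, since the Laplacian is bounded between these
  spaces.\<close>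

lemma heat_op_Hm1:
 assumes o: "open J" "open \<Omega>" and u: "u \<in> time_H1_Hm1 J \<Omega>" "u \<in> time_L2 J (H1 \<Omega>) (H1_norm \<Omega>)"
 shows "AE t in lebesgue_on J. heat_op J \<Omega> u t \<in> Hm1 \<Omega>"
  and "sqint (lebesgue_on J) (\<lambda>t. Hm1_norm \<Omega> (heat_op J \<Omega> u t))"
proof -
 have J: "J \<in> sets borel" using o by auto
 let ?G = "time_deriv J \<Omega> (\<lambda>t. to_Hm1 \<Omega> (u t))" and ?n = "\<lambda>t. Hm1_norm \<Omega> (heat_op J \<Omega> u t)"
 note G = time_deriv_time_H1_Hm1(1)[OF u(1)]
 have heq: "heat_op J \<Omega> u t = (\<lambda>v. ?G t v - weak_laplacian \<Omega> (u t) v)" for t by (rule ext) (simp add: heat_op_def)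
 obtain s where s: "\<And>k::nat. simple_function (lebesgue_on J) (s k)" "\<And>k t. t \<in> J \<Longrightarrow> s k t \<in> Hm1 \<Omega>"
  and slim: "AE t in lebesgue_on J. (\<lambda>k. Hm1_norm \<Omega> (\<lambda>v. s k t v - ?G t v)) \<longlonglongrightarrow> 0"
  using G unfolding time_L2_def strongly_measurable_def by blast
 obtain r where r: "\<And>k::nat. simple_function (lebesgue_on J) (r k)" "\<And>k t. t \<in> J \<Longrightarrow> r k t \<in> H1 \<Omega>"
  and rlim: "AE t in lebesgue_on J. (\<lambda>k. H1_norm \<Omega> (\<lambda>x. r k t x - u t x)) \<longlonglongrightarrow> 0"
  using u(2) unfolding time_L2_def strongly_measurable_def by blast
 have GH: "AE t in lebesgue_on J. ?G t \<in> Hm1 \<Omega>" and Gi: "integrable (lebesgue_on J) (\<lambda>t. (Hm1_norm \<Omega> (?G t))\<^sup>2)"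
  using G by (auto simp: time_L2_def)
 have uH: "AE t in lebesgue_on J. u t \<in> H1 \<Omega>" and ui: "integrable (lebesgue_on J) (\<lambda>t. (H1_norm \<Omega> (u t))\<^sup>2)"
  using u(2) by (auto simp: time_L2_def)
 have Jae: "AE t in lebesgue_on J. t \<in> J" using AE_space[of "lebesgue_on J"] by simp
 show H: "AE t in lebesgue_on J. heat_op J \<Omega> u t \<in> Hm1 \<Omega>"
  using GH uH unfolding heq by eventually_elim (intro Hm1_diff weak_laplacian_Hm1 o)
 \<comment> \<open>The norm is not evaluated on a limit but on a function of two simple functions,
   which is simple and hence measurable.\<close>
 define nk where "nk k t = Hm1_norm \<Omega> (\<lambda>v. s k t v - weak_laplacian \<Omega> (r k t) v)" for k t
 have nkm: "nk k \<in> borel_measurable (lebesgue_on J)" for k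
  unfolding nk_def[abs_def]
  by (rule borel_measurable_simple_function[OF simple_function_compose2[OF s(1) r(1)]])
 have nklim: "AE t in lebesgue_on J. (\<lambda>k. nk k t) \<longlonglongrightarrow> ?n t"
  using Jae GH uH slim rlim H
 proof eventually_elim
  case (elim t)
  let ?e = "\<lambda>k. Hm1_norm \<Omega> (\<lambda>v. s k t v - ?G t v) + H1_norm \<Omega> (\<lambda>x. r k t x - u t x)"
  have le: "norm (nk k t - ?n t) \<le> ?e k" for k
   unfolding nk_def real_norm_def
  proof (rule Hm1_norm_dist_le[OF o(2)])
   show "(\<lambda>v. s k t v - weak_laplacian \<Omega> (r k t) v) \<in> Hm1 \<Omega>"
    by (intro Hm1_diff s(2) weak_laplacian_Hm1 o r(2) elim)
   show "heat_op J \<Omega> u t \<in> Hm1 \<Omega>" by (rule elim)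
   fix f assume f: "f \<in> H10 \<Omega>" "H1_norm \<Omega> f \<le> 1"
   have 1: "(\<lambda>v. s k t v - ?G t v) \<in> Hm1 \<Omega>" by (rule Hm1_diff[OF s(2)[OF elim(1)] elim(2)])
   note 2 = weak_laplacian_Hm1[OF o(2) H1_diff(1)[OF o(2) r(2)[OF elim(1)] elim(3)], of k]
   have "\<bar>s k t f - ?G t f\<bar> \<le> Hm1_norm \<Omega> (\<lambda>v. s k t v - ?G t v) * H1_norm \<Omega> f" by (rule Hm1_le[OF o(2) 1 f(1)])
   also have "\<dots> \<le> Hm1_norm \<Omega> (\<lambda>v. s k t v - ?G t v) * 1" by (rule mult_left_mono[OF f(2) Hm1_norm_nonneg[OF o(2) 1]])
   finally have a: "\<bar>s k t f - ?G t f\<bar> \<le> Hm1_norm \<Omega> (\<lambda>v. s k t v - ?G t v)" by simp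
   have "\<bar>weak_laplacian \<Omega> (\<lambda>x. r k t x - u t x) f\<bar> \<le> Hm1_norm \<Omega> (weak_laplacian \<Omega> (\<lambda>x. r k t x - u t x)) * H1_norm \<Omega> f"
    by (rule Hm1_le[OF o(2) 2(1) f(1)])
   also have "\<dots> \<le> Hm1_norm \<Omega> (weak_laplacian \<Omega> (\<lambda>x. r k t x - u t x)) * 1"
    by (rule mult_left_mono[OF f(2) Hm1_norm_nonneg[OF o(2) 2(1)]])
   also have "\<dots> \<le> H1_norm \<Omega> (\<lambda>x. r k t x - u t x)" using 2(2) by simp
   finally have b: "\<bar>weak_laplacian \<Omega> (r k t) f - weak_laplacian \<Omega> (u t) f\<bar> \<le> H1_norm \<Omega> (\<lambda>x. r k t x - u t x)"
    using weak_laplacian_linear(2)[OF o(2) H10_H1[OF f(1)] r(2)[OF elim(1)] elim(3), of k] by simp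
   show "\<bar>s k t f - weak_laplacian \<Omega> (r k t) f - heat_op J \<Omega> u t f\<bar> \<le> ?e k"
    using a b unfolding heq by linarith
  qed
  have "?e \<longlonglongrightarrow> 0 + 0" by (intro tendsto_add elim)
  hence e0: "?e \<longlonglongrightarrow> 0" by simp
  have "(\<lambda>k. nk k t - ?n t) \<longlonglongrightarrow> 0"
   by (rule Lim_null_comparison[OF always_eventually e0]) (rule allI, rule le)
  thus ?case by (simp only: LIM_zero_iff)
 qed
 have nm: "?n \<in> borel_measurable (lebesgue_on J)"
 proof (rule lebesgue_on_measurable_AE[OF J borel_measurable_lim_metric[OF nkm]])
  show "AE t in lebesgue_on J. ?n t = lim (\<lambda>k. nk k t)" using nklim by eventually_elim (rule limI[symmetric])
 qed
 have "AE t in lebesgue_on J. 0 \<le> Hm1_norm \<Omega> (?G t)" using GH by eventually_elim (rule Hm1_norm_nonneg[OF o(2)])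
 note Gsq = time_L2_sqint[OF J Gi this]
 have usq: "sqint (lebesgue_on J) (\<lambda>t. H1_norm \<Omega> (u t))"
  by (rule time_L2_sqint[OF J ui]) (simp add: H1_norm_nonneg)
 show "sqint (lebesgue_on J) ?n"
 proof (rule l2_mono(2)[OF sqint_add[OF Gsq usq] nm])
  show "AE t in lebesgue_on J. \<bar>?n t\<bar> \<le> \<bar>Hm1_norm \<Omega> (?G t) + H1_norm \<Omega> (u t)\<bar>"
   using GH uH H
  proof eventually_elim
   case (elim t)
   note w = weak_laplacian_Hm1[OF o(2) elim(2)]
   have "?n t \<le> Hm1_norm \<Omega> (?G t) + Hm1_norm \<Omega> (weak_laplacian \<Omega> (u t))"
    unfolding heq by (rule Hm1_norm_triangle[OF o(2) elim(1) w(1)])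
   moreover have "?n t \<ge> 0" by (rule Hm1_norm_nonneg[OF o(2) elim(3)])
   ultimately show ?case using w(2) by linarith
  qed
 qed
qed

text \<open>Identifies \<open>parabolic_norm\<close> with the norm in which the duality with
  \<open>Hm1\<close> in space and Cauchy-Schwarz in time can be applied.\<close>

lemma l2_H1_norm_slices:
 assumes o: "open J" "open \<Omega>" and \<psi>: "\<psi> \<in> \<D> (J \<times> \<Omega>)"
 shows "sqint (lebesgue_on J) (\<lambda>t. H1_norm \<Omega> (\<lambda>x. \<psi> (t, x)))"
  and "l2 (lebesgue_on J) (\<lambda>t. H1_norm \<Omega> (\<lambda>x. \<psi> (t, x))) = parabolic_norm \<psi>"
proof -
 have J: "J \<in> sets borel" using o by auto
 let ?l = "\<lambda>f t. l2 lborel (\<lambda>x. f (t, x) :: real)" and ?p = "\<lambda>t. H1_norm \<Omega> (\<lambda>x. \<psi> (t, x))"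
 have \<psi>i: "pd (0, i) \<psi> \<in> \<D> (J \<times> \<Omega>)" if "i \<in> Basis" for i by (intro test_partial_deriv \<psi> Basis_real_prod that)
 note I = sqint_iterated[OF test_sqint[OF \<psi>]] and Ii = sqint_iterated[OF test_sqint[OF \<psi>i]]
 have pd: "pd i (\<lambda>x. \<psi> (s, x)) = (\<lambda>x. pd (0, i) \<psi> (s, x))" if "i \<in> Basis" for i s
  using smooth_slice(2)[OF test_smooth[OF \<psi>] that] by blast
 have psq: "(?p t)\<^sup>2 = (?l \<psi> t)\<^sup>2 + (\<Sum>i\<in>Basis. (?l (pd (0, i) \<psi>) t)\<^sup>2)" for t
  unfolding test_H1(3)[OF o(2) test_slice[OF \<psi>]] by (simp add: pd cong: sum.cong)
 have i2: "integrable lborel (\<lambda>t. (?p t)\<^sup>2)"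
  unfolding psq by (intro integrable_add integrable_sum sqint_sq I Ii)
 have pe: "?p = (\<lambda>t. sqrt ((?p t)\<^sup>2))" by (simp add: H1_norm_nonneg)
 have pm: "?p \<in> borel_measurable borel"
  by (subst pe) (use measurable_compose[OF borel_measurable_integrable[OF i2] borel_measurable_sqrt] in simp)
 have pz: "?p t = 0" if "t \<notin> J" for t
 proof -
  have "(\<lambda>x. \<psi> (t, x)) = (\<lambda>x. 0)" using test_zero_outside[OF \<psi>, of "(t, x)" for x] that by auto
  thus ?thesis using H1_norm_scale(2)[OF o(2) test_H1(1)[OF o(2) test_zero], of 0] by simp
 qed
 note L = l2_lebesgue_on[of J ?p, OF J pm pz]
 show "sqint (lebesgue_on J) ?p" using L(2) pm i2 by (simp add: sqint_def)
 have "(l2 lborel ?p)\<^sup>2 = (LBINT t. (?l \<psi> t)\<^sup>2 + (\<Sum>i\<in>Basis. (?l (pd (0, i) \<psi>) t)\<^sup>2))" unfolding l2_sq psq ..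
 also have "\<dots> = (LBINT t. (?l \<psi> t)\<^sup>2) + (\<Sum>i\<in>Basis. (LBINT t. (?l (pd (0, i) \<psi>) t)\<^sup>2))"
  by (intro integral_add_sum sqint_sq I Ii) auto
 also have "\<dots> = (l2 lborel \<psi>)\<^sup>2 + (\<Sum>i\<in>Basis. (l2 lborel (pd (0, i) \<psi>))\<^sup>2)"
  unfolding l2_sq[symmetric] I(3) using Ii(3) by simp
 finally show "l2 (lebesgue_on J) ?p = parabolic_norm \<psi>"
  using L(1) real_sqrt_unique[of "l2 lborel ?p"] by (simp add: parabolic_norm_def l2_nonneg)
qed

text \<open>The left integral is, up to sign, \<open>Lu\<close> at time \<open>t\<close> applied to
  the slice of \<open>\<psi>\<close>, integrated over time: the time derivative is moved by
  \<open>time_deriv_pairing\<close>, one spatial derivative by the weak gradient. The dual norm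
  bounds each slice, Cauchy-Schwarz the time integral.\<close>

lemma heat_op_pairing_le:
 assumes o: "open J" "open \<Omega>" and Jf: "emeasure lborel J < \<infinity>"
  and u: "u \<in> time_H1_Hm1 J \<Omega>" "u \<in> time_L2 J (H1 \<Omega>) (H1_norm \<Omega>)"
  and U: "represents J \<Omega> u U" and W: "\<And>i. i \<in> Basis \<Longrightarrow> represents J \<Omega> (\<lambda>t x. weak_grad \<Omega> (u t) x \<bullet> i) (W i)"
  and \<psi>: "\<psi> \<in> \<D> (J \<times> \<Omega>)"
 shows "\<bar>LBINT p. U p * heat_dual \<psi> p\<bar> \<le> time_L2_norm J (Hm1_norm \<Omega>) (heat_op J \<Omega> u) * parabolic_norm \<psi>"
proof -
 have J: "J \<in> sets borel" and \<Omega>: "\<Omega> \<in> sets borel" using o by auto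
 let ?G = "time_deriv J \<Omega> (\<lambda>t. to_Hm1 \<Omega> (u t))" and ?v = "\<lambda>t x. \<psi> (t, x)" and ?\<psi>i = "\<lambda>i. pd (0, i) \<psi>"
 note G = time_deriv_pairing[OF o Jf U time_deriv_time_H1_Hm1[OF u(1)] \<psi>]
 have \<psi>i: "?\<psi>i i \<in> \<D> (J \<times> \<Omega>)" if "i \<in> Basis" for i by (intro test_partial_deriv \<psi> Basis_real_prod that)
 have uH: "AE t in lebesgue_on J. u t \<in> H1 \<Omega>" using u(2) by (auto simp: time_L2_def)
 have Usq: "sqint lborel U" by (rule representsD[OF U])
 have Wsq: "sqint lborel (W i)" if "i \<in> Basis" for i by (rule representsD[OF W[OF that]])
 have Wi: "integrable lborel (\<lambda>p. W i p * ?\<psi>i i p)" if "i \<in> Basis" for i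
  by (rule sqint_mult[OF Wsq[OF that] test_sqint[OF \<psi>i[OF that]]])
 define b where "b i t = (LBINT x. W i (t, x) * ?\<psi>i i (t, x))" for i t
 have b: "(LBINT p. W i p * ?\<psi>i i p) = (LBINT t. b i t)" "integrable lborel (b i)" if "i \<in> Basis" for i
  unfolding b_def[abs_def] by (rule lborel_integral_iterated[OF Wi[OF that]])+
 have bz: "b i t = 0" if "t \<notin> J" "i \<in> Basis" for i t
  using representsD(2)[OF W[OF that(2)]] that(1) by (simp add: b_def)
 have bJ: "integrable (lebesgue_on J) (b i)" "(\<integral>t. b i t \<partial>lebesgue_on J) = (LBINT t. b i t)" if "i \<in> Basis" for i
  using integral_lebesgue_on_supported[OF J, of "b i"] b(2)[OF that] bz that by auto
 let ?f = "\<lambda>t. heat_op J \<Omega> u t (?v t)" and ?g = "\<lambda>t. ?G t (?v t) + (\<Sum>i\<in>Basis. b i t)"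
 have gi: "integrable (lebesgue_on J) ?g" by (intro integrable_add integrable_sum G(1) bJ)
 have W4: "AE t in lborel. \<forall>i\<in>Basis. t \<in> J \<longrightarrow> (AE x in lebesgue_on \<Omega>. weak_grad \<Omega> (u t) x \<bullet> i = W i (t, x))"
  by (subst AE_finite_all) (use representsD(4)[OF W] in auto)
 have WS: "AE t in lborel. \<forall>i\<in>Basis. sqint lborel (\<lambda>x. W i (t, x))"
  by (subst AE_finite_all) (use sqint_iterated(1)[OF Wsq] in auto)
 have fg: "AE t in lebesgue_on J. ?f t = ?g t"
  unfolding AE_lebesgue_on_iff[OF J] using W4 WS
 proof eventually_elim
  case (elim t)
  show ?case
  proof
   assume t: "t \<in> J"
   have "AE x in lebesgue_on \<Omega>. \<forall>i\<in>Basis. weak_grad \<Omega> (u t) x \<bullet> i = W i (t, x)"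
    by (subst AE_finite_all) (use elim(1) t in auto)
   hence "AE x in lebesgue_on \<Omega>. weak_grad \<Omega> (u t) x \<bullet> weak_grad \<Omega> (?v t) x = (\<Sum>i\<in>Basis. W i (t, x) * ?\<psi>i i (t, x))"
    using test_H1(2)[OF o(2) test_slice[OF \<psi>], of t]
   proof eventually_elim
    case (elim x)
    have "weak_grad \<Omega> (u t) x \<bullet> weak_grad \<Omega> (?v t) x = (\<Sum>i\<in>Basis. (weak_grad \<Omega> (u t) x \<bullet> i) * pd i (?v t) x)"
     unfolding elim(2) by (simp add: inner_sum_right mult.commute)
    also have "\<dots> = (\<Sum>i\<in>Basis. W i (t, x) * ?\<psi>i i (t, x))"
     by (rule sum.cong) (use elim(1) smooth_slice(2)[OF test_smooth[OF \<psi>]] in auto)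
    finally show ?case .
   qed
   hence "(\<integral>x. weak_grad \<Omega> (u t) x \<bullet> weak_grad \<Omega> (?v t) x \<partial>lebesgue_on \<Omega>)
     = (LBINT x. indicator \<Omega> x * (\<Sum>i\<in>Basis. W i (t, x) * ?\<psi>i i (t, x)))"
    by (rule lebesgue_on_AE_eq(3)[OF \<Omega>, rotated])
     (intro borel_measurable_sum borel_measurable_times representsD(3)[OF W] borel_slice test_borel[OF \<psi>i])
   also have "\<dots> = (LBINT x. (\<Sum>i\<in>Basis. W i (t, x) * ?\<psi>i i (t, x)))"
    by (rule integral_cong) (use representsD(2)[OF W] in \<open>auto simp: indicator_def intro!: sum.neutral\<close>)
   also have "\<dots> = (\<Sum>i\<in>Basis. b i t)" unfolding b_def
    by (rule integral_sum)
     (use elim(2) in \<open>auto intro!: sqint_mult test_sqint[OF test_slice[OF \<psi>i]]\<close>)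
   finally have "weak_laplacian \<Omega> (u t) (?v t) = - (\<Sum>i\<in>Basis. b i t)" by (simp add: weak_laplacian_def)
   thus "?f t = ?g t" by (simp add: heat_op_def)
  qed
 qed
 note fm = lebesgue_on_measurable_AE[OF J borel_measurable_integrable[OF gi] fg]
 have fi: "integrable (lebesgue_on J) ?f" using integrable_cong_AE[OF fm borel_measurable_integrable[OF gi] fg] gi by simp
 have U1: "integrable lborel (\<lambda>p. U p * pd (1, 0) \<psi> p)"
  by (rule sqint_mult[OF Usq test_sqint[OF test_partial_deriv[OF \<psi> Basis_real_prod(1)]]])
 have U2: "integrable lborel (\<lambda>p. U p * pd (0, i) (?\<psi>i i) p)" if "i \<in> Basis" for i
  by (rule sqint_mult[OF Usq test_sqint[OF test_partial_deriv[OF \<psi>i]]]) (use that in auto)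
 have "(LBINT p. U p * heat_dual \<psi> p)
   = (LBINT p. U p * pd (1, 0) \<psi> p + (\<Sum>i\<in>Basis. U p * pd (0, i) (?\<psi>i i) p))"
  by (simp add: heat_dual_def distrib_left sum_distrib_left)
 also have "\<dots> = (LBINT p. U p * pd (1, 0) \<psi> p) + (\<Sum>i\<in>Basis. (LBINT p. U p * pd (0, i) (?\<psi>i i) p))"
  by (intro integral_add_sum U1 U2) auto
 also have "\<dots> = - (\<integral>t. ?G t (?v t) \<partial>lebesgue_on J) + (\<Sum>i\<in>Basis. - (\<integral>t. b i t \<partial>lebesgue_on J))"
  unfolding G(2) using represents_weak_deriv[OF U W uH o \<psi>i] b bJ by (intro arg_cong2[where f="(+)"] sum.cong) auto
 also have "\<dots> = - ((\<integral>t. ?G t (?v t) \<partial>lebesgue_on J) + (\<Sum>i\<in>Basis. (\<integral>t. b i t \<partial>lebesgue_on J)))" by (simp add: sum_negf)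
 also have "(\<integral>t. ?G t (?v t) \<partial>lebesgue_on J) + (\<Sum>i\<in>Basis. (\<integral>t. b i t \<partial>lebesgue_on J)) = (\<integral>t. ?g t \<partial>lebesgue_on J)"
  by (intro integral_add_sum[symmetric] G(1) bJ) auto
 also have "\<dots> = (\<integral>t. ?f t \<partial>lebesgue_on J)"
  by (rule integral_cong_AE[OF fm borel_measurable_integrable[OF gi] fg, symmetric])
 finally have eq: "\<bar>LBINT p. U p * heat_dual \<psi> p\<bar> = \<bar>\<integral>t. ?f t \<partial>lebesgue_on J\<bar>" by simp
 let ?n = "\<lambda>t. Hm1_norm \<Omega> (heat_op J \<Omega> u t)" and ?p = "\<lambda>t. H1_norm \<Omega> (?v t)"
 note n = heat_op_Hm1[OF o u] and p = l2_H1_norm_slices[OF o \<psi>]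
 have "\<bar>\<integral>t. ?f t \<partial>lebesgue_on J\<bar> \<le> (\<integral>t. \<bar>?f t\<bar> \<partial>lebesgue_on J)" by (rule integral_abs_bound)
 also have "\<dots> \<le> (\<integral>t. ?n t * ?p t \<partial>lebesgue_on J)"
 proof (rule integral_mono_AE)
  show "AE t in lebesgue_on J. \<bar>?f t\<bar> \<le> ?n t * ?p t"
   using n(1) by eventually_elim (rule Hm1_le[OF o(2) _ test_H10[OF o(2) test_slice[OF \<psi>]]])
 qed (use fi sqint_mult[OF n(2) p(1)] in auto)
 also have "\<dots> \<le> l2 (lebesgue_on J) ?n * l2 (lebesgue_on J) ?p"
  using Cauchy_Schwarz_l2[OF n(2) p(1)] by linarith
 also have "l2 (lebesgue_on J) ?n = time_L2_norm J (Hm1_norm \<Omega>) (heat_op J \<Omega> u)" by (simp add: l2_def time_L2_norm_def)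
 finally show ?thesis unfolding eq p(2) .
qed

theorem theorem1:
  fixes T T1 T2 :: real and \<Omega> \<omega> B :: "(real ^ 'n) set"
  assumes "T > 0"
    and "open \<Omega>"
    and "open \<omega>" and "\<omega> \<noteq> {}" and "\<omega> \<subseteq> \<Omega>"
    and "0 < T1" and "T1 < T2" and "T2 < T"
    and "open B" and "connected B" and "B \<subseteq> \<Omega>" and "\<omega> \<subseteq> B"
    and "compact (closure B)" and "closure B \<subseteq> \<Omega>"
  shows "\<exists>C>0. \<exists>\<kappa>\<in>{0<..<1}.
    \<forall>u \<in> time_H1_Hm1 {0<..<T} \<Omega> \<inter> time_L2 {0<..<T} (H1 \<Omega>) (H1_norm \<Omega>).
      time_L2_norm {T1<..<T2} (H1_norm B) u
        \<le> C * (time_L2_norm {0<..<T} (L2_norm \<omega>) u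
               + time_L2_norm {0<..<T} (Hm1_norm \<Omega>) (heat_op {0<..<T} \<Omega> u)) powr \<kappa>
            * (time_L2_norm {0<..<T} (L2_norm \<Omega>) u
               + time_L2_norm {0<..<T} (Hm1_norm \<Omega>) (heat_op {0<..<T} \<Omega> u)) powr (1 - \<kappa>)"
proof -
 let ?J = "{0<..<T}" and ?J' = "{T1<..<T2}"
 \<comment> \<open>The scalar estimate as a single formula, so that it can be obtained together with
   its constants and then applied to every \<open>u\<close>.\<close>
 define good where "good C \<kappa> \<longleftrightarrow> (\<forall>(U :: real \<times> (real ^ 'n) \<Rightarrow> real) W N. sqint lborel U \<longrightarrow>
   (\<forall>i\<in>Basis. sqint lborel (W i)) \<longrightarrow> N \<ge> 0 \<longrightarrow>
   (\<forall>\<psi>\<in>\<D> (?J \<times> \<Omega>). \<bar>LBINT p. U p * heat_dual \<psi> p\<bar> \<le> N * parabolic_norm \<psi>) \<longrightarrow>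
   (\<forall>\<psi>\<in>\<D> (?J \<times> \<Omega>). \<forall>i\<in>Basis.
    (LBINT p. U p * pd (0, i) \<psi> p) = - (LBINT p. W i p * \<psi> p)) \<longrightarrow>
   l2 lborel (\<lambda>p. indicator (?J' \<times> B) p * U p) + (\<Sum>i\<in>Basis. l2 lborel (\<lambda>p. indicator (?J' \<times> B) p * W i p))
    \<le> C * (l2 lborel (\<lambda>p. indicator (?J \<times> \<omega>) p * U p) + N) powr \<kappa> * (l2 lborel U + N) powr (1 - \<kappa>))" for C \<kappa> :: real
 obtain C \<kappa> where C: "C > 0" "0 < \<kappa>" "\<kappa> < 1" "good C \<kappa>"
 proof (rule scalar_three_sets_estimate[OF assms(2,3,4,12,6,7,8,9,10,13,14)], goal_cases)
  case (1 C \<kappa>)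
  have "good C \<kappa>" unfolding good_def by (intro allI impI, rule 1(5)) auto
  with 1(1-4) show ?case by blast
 qed
 have o: "open ?J" "open ?J'" "?J' \<subseteq> ?J" and Jf: "emeasure lborel ?J < \<infinity>" using assms by auto
 have main: "time_L2_norm ?J' (H1_norm B) u
    \<le> C * (time_L2_norm ?J (L2_norm \<omega>) u + time_L2_norm ?J (Hm1_norm \<Omega>) (heat_op ?J \<Omega> u)) powr \<kappa>
      * (time_L2_norm ?J (L2_norm \<Omega>) u + time_L2_norm ?J (Hm1_norm \<Omega>) (heat_op ?J \<Omega> u)) powr (1 - \<kappa>)"
  if u: "u \<in> time_H1_Hm1 ?J \<Omega>" "u \<in> time_L2 ?J (H1 \<Omega>) (H1_norm \<Omega>)" for u
 proof -
  obtain U W where U: "represents ?J \<Omega> u U"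
   and W: "\<And>i. i \<in> Basis \<Longrightarrow> represents ?J \<Omega> (\<lambda>t x. weak_grad \<Omega> (u t) x \<bullet> i) (W i)"
   by (rule H1_representatives[OF assms(2) o(1) Jf u(2)]) blast
  have uH: "AE t in lebesgue_on ?J. u t \<in> H1 \<Omega>" using u(2) by (auto simp: time_L2_def)
  let ?N = "time_L2_norm ?J (Hm1_norm \<Omega>) (heat_op ?J \<Omega> u)"
  have N: "?N \<ge> 0" by (simp add: time_L2_norm_def integral_nonneg)
  have "time_L2_norm ?J' (H1_norm B) u \<le> l2 lborel (\<lambda>p. indicator (?J' \<times> B) p * U p)
    + (\<Sum>i\<in>Basis. l2 lborel (\<lambda>p. indicator (?J' \<times> B) p * W i p))"
   by (rule time_L2_norm_H1_le[OF U W uH o(1) assms(2) o(2,3) assms(9,11)])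
  also have "\<dots> \<le> C * (l2 lborel (\<lambda>p. indicator (?J \<times> \<omega>) p * U p) + ?N) powr \<kappa> * (l2 lborel U + ?N) powr (1 - \<kappa>)"
   using C(4) representsD(1)[OF U] representsD(1)[OF W] N heat_op_pairing_le[OF o(1) assms(2) Jf u U W]
    represents_weak_deriv[OF U W uH o(1) assms(2)] unfolding good_def by blast
  also have "l2 lborel (\<lambda>p. indicator (?J \<times> \<omega>) p * U p) = time_L2_norm ?J (L2_norm \<omega>) u"
   by (rule represents_time_L2_norm[OF U, symmetric]) (use assms in auto)
  also have "l2 lborel U = time_L2_norm ?J (L2_norm \<Omega>) u"
  proof -
   have "(\<lambda>p. indicator (?J \<times> \<Omega>) p * U p) = U"
   proof
    show "indicator (?J \<times> \<Omega>) p * U p = U p" for p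
     using representsD(2)[OF U, of p] by (cases "p \<in> ?J \<times> \<Omega>") (simp_all del: mem_Sigma_iff)
   qed
   moreover have "time_L2_norm ?J (L2_norm \<Omega>) u = l2 lborel (\<lambda>p. indicator (?J \<times> \<Omega>) p * U p)"
    by (rule represents_time_L2_norm[OF U]) (use assms in auto)
   ultimately show ?thesis by simp
  qed
  finally show ?thesis .
 qed
 show ?thesis using C(1-3) main by (intro exI[of _ C] conjI bexI[of _ \<kappa>]) auto
qed

end
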